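(* Let $T>0$, let $n\ge2$ be an integer, $d\ge1$, $\alpha\in\mathbb{R}$, and let $D,A\in\mathbb{R}^{n\times n}$, $B\in\mathbb{R}^n$ be the matrices given in the context. Assume in addition that $n=2p+1$ for some $p\in\mathbb{N}^\star$ when $\alpha>0$. Fix $x_0\in(0,\pi)$ and consider the pointwise control system $$y_t-Dy_{xx}+Ay=B\,\delta_{x_0}u \text{ in }(0,T)\times(0,\pi),\qquad y(\cdot,0)=y(\cdot,\pi)=0\text{ in }(0,T),\qquad y(0,\cdot)=y^0\text{ in }(0,\pi),$$ with $y^0\in L^2(0,\pi;\mathbb{R}^n)$ and scalar control $u\in L^2(0,T)$. Then: 1. If $\alpha\ne0$, the system is approximately controllable at time $T$ if and only if both of the following hold: every eigenvalue of $L^\star=-D^\star\partial_{xx}+A^\star$ has geometric multiplicity equal to $1$; and $x_0\neq r\pi$ for every $r\in\mathbb{Q}\cap(0,1)$. 2. If $\alpha=0$, the system is approximately controllable at time $T$ if and only if $x_0\ne r\pi$ for every $r\in\mathbb{Q}\cap(0,1)$.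
   Context: $\mathbb{N}^\star=\{1,2,3,\dots\}$; $M^\star$ is the conjugate transpose of a matrix $M$; $\delta_{x_0}\in H^{-1}(0,\pi)$ is the Dirac distribution at $x_0$. Matrices: $D\in\mathbb{R}^{n\times n}$ is the single Jordan block with $D_{ii}=d$ for $1\le i\le n$, $D_{i,i+1}=1$ for $1\le i\le n-1$, and all other entries $0$. $A\in\mathbb{R}^{n\times n}$ has $A_{n,1}=\alpha$ and all other entries $0$. $B=e_n=(0,\dots,0,1)^\star\in\mathbb{R}^n$. Operator: $L^\star f=-D^\star\partial_{xx}f+A^\star f$ on $L^2(0,\pi;\mathbb{C}^n)$ with domain $H^2(0,\pi;\mathbb{C}^n)\cap H^1_0(0,\pi;\mathbb{C}^n)$. The geometric multiplicity of an eigenvalue $\lambda$ is $\dim\ker(L^\star-\lambda)$. For every $y^0\in L^2(0,\pi;\mathbb{R}^n)$ and $u\in L^2(0,T)$ the system has a unique weak solution $y\in L^2(0,T;H^1_0(0,\pi;\mathbb{R}^n))\cap C^0([0,T];L^2(0,\pi;\mathbb{R}^n))$. The system is approximately controllable at time $T$ if for all $y^0,y^T\in L^2(0,\pi;\mathbb{R}^n)$ and $\varepsilon>0$ there is $u\in L^2(0,T)$ such that the solution satisfies $\|y(T,\cdot)-y^T\|_{L^2(0,\pi;\mathbb{R}^n)}\le\varepsilon$. *)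

theory Defs
  imports "HOL-Analysis.Analysis"
begin

text \<open>
  The index type \<open>'n :: {finite, linorder}\<close> stands for \<open>{1,\<dots>,n}\<close> with \<open>n = CARD('n)\<close>;
  \<open>idx\<close> is the order isomorphism onto \<open>{1,\<dots>,n}\<close>. The numeral types \<open>2\<close>, \<open>3\<close>, ... are instances.
\<close>

definition idx :: "'n::{finite,linorder} \<Rightarrow> nat" where
  "idx i = card {..i}"

definition matD :: "real \<Rightarrow> real^('n::{finite,linorder})^('n::{finite,linorder})" where
  "matD d = (\<chi> i j. if j = i then d else if idx j = idx i + 1 then 1 else 0)"

definition matA :: "real \<Rightarrow> real^('n::{finite,linorder})^('n::{finite,linorder})" where
  "matA \<alpha> = (\<chi> i j. if idx i = CARD('n) \<and> idx j = 1 then \<alpha> else 0)"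

definition vecB :: "real^('n::{finite,linorder})" where
  "vecB = (\<chi> i. if idx i = CARD('n) then 1 else 0)"

definition conj_transpose :: "complex^'n^'m \<Rightarrow> complex^'m^'n" where
  "conj_transpose M = (\<chi> i j. cnj (M $ j $ i))"

definition of_real_matrix :: "real^'n^'m \<Rightarrow> complex^'n^'m" where
  "of_real_matrix = map_matrix complex_of_real"


section \<open>Lebesgue and Sobolev spaces\<close>

text \<open>
  Elements of \<open>L\<^sup>2\<close> and of the Sobolev spaces are represented by functions; equality in these spaces
  is equality almost everywhere.
\<close>

definition L2 :: "'x measure \<Rightarrow> ('x \<Rightarrow> 'a::euclidean_space) set" where
  "L2 M = {f \<in> borel_measurable M. integrable M (\<lambda>x. (norm (f x))\<^sup>2)}"

definition L2norm :: "'x measure \<Rightarrow> ('x \<Rightarrow> 'a::euclidean_space) \<Rightarrow> real" where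
  "L2norm M f = sqrt (LINT x|M. (norm (f x))\<^sup>2)"

abbreviation leb :: "real \<Rightarrow> real measure" where
  "leb b \<equiv> restrict_space lborel {0<..<b}"

abbreviation Om :: "real measure" where
  "Om \<equiv> leb pi"

text \<open>\<open>\<phi> \<in> C\<^sub>c\<^sup>1(0,\<pi>)\<close>, extended by zero to the real line, with derivative \<open>\<phi>'\<close>.\<close>

definition C1c :: "(real \<Rightarrow> 'a::euclidean_space) \<Rightarrow> (real \<Rightarrow> 'a) \<Rightarrow> bool" where
  "C1c \<phi> \<phi>' \<longleftrightarrow> (\<forall>x. (\<phi> has_vector_derivative \<phi>' x) (at x)) \<and> continuous_on UNIV \<phi>' \<and>
     (\<exists>a b. 0 < a \<and> b < pi \<and> (\<forall>x. x \<notin> {a..b} \<longrightarrow> \<phi> x = 0))"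

definition weak_deriv :: "(real \<Rightarrow> 'a::euclidean_space) \<Rightarrow> (real \<Rightarrow> 'a) \<Rightarrow> bool" where
  "weak_deriv f g \<longleftrightarrow> f \<in> L2 Om \<and> g \<in> L2 Om \<and>
     (\<forall>\<phi> \<phi>' :: real \<Rightarrow> real. C1c \<phi> \<phi>' \<longrightarrow>
        (LINT x|Om. \<phi>' x *\<^sub>R f x) = - (LINT x|Om. \<phi> x *\<^sub>R g x))"

definition H1 :: "(real \<Rightarrow> 'a::euclidean_space) set" where
  "H1 = {f. \<exists>g. weak_deriv f g}"

definition H2 :: "(real \<Rightarrow> 'a::euclidean_space) set" where
  "H2 = {f. \<exists>g \<in> H1. weak_deriv f g}"

text \<open>\<open>H\<^sub>0\<^sup>1(0,\<pi>)\<close> is the closure of \<open>C\<^sub>c\<^sup>1(0,\<pi>)\<close> in \<open>H\<^sup>1(0,\<pi>)\<close>.\<close>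

definition H10 :: "(real \<Rightarrow> 'a::euclidean_space) set" where
  "H10 = {f. \<exists>g. weak_deriv f g \<and>
     (\<forall>\<epsilon>>0. \<exists>\<phi> \<phi>'. C1c \<phi> \<phi>' \<and>
        L2norm Om (\<lambda>x. f x - \<phi> x) < \<epsilon> \<and> L2norm Om (\<lambda>x. g x - \<phi>' x) < \<epsilon>)}"


section \<open>The control system\<close>

text \<open>
  \<open>weak_solution T D A B x\<^sub>0 y\<^sub>0 u y\<close>: \<open>y\<close> belongs to
  \<open>L\<^sup>2(0,T;H\<^sub>0\<^sup>1) \<inter> C\<^sup>0([0,T];L\<^sup>2)\<close>, \<open>y(0) = y\<^sub>0\<close>, and for each \<open>v \<in> H\<^sub>0\<^sup>1\<close>
  \<open>d/dt (y,v) + (D y\<^sub>x, v\<^sub>x) + (A y, v) = u \<langle>B \<delta>\<^bsub>x0\<^esub>, v\<rangle>\<close>, integrated over \<open>(0,t)\<close>.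
  The function \<open>z\<close> is \<open>y\<^sub>x\<close>. The space \<open>L\<^sup>2(0,T;L\<^sup>2(0,\<pi>))\<close> is identified with
  \<open>L\<^sup>2((0,T) \<times> (0,\<pi>))\<close>. The value \<open>v(x\<^sub>0)\<close> refers to the continuous representative of \<open>v\<close>.
\<close>

definition weak_solution ::
  "real \<Rightarrow> real^'n^'n \<Rightarrow> real^'n^'n \<Rightarrow> real^'n \<Rightarrow> real \<Rightarrow> (real \<Rightarrow> real^'n) \<Rightarrow> (real \<Rightarrow> real)
     \<Rightarrow> (real \<Rightarrow> real \<Rightarrow> real^'n) \<Rightarrow> bool" where
  "weak_solution T D A B x0 y0 u y \<longleftrightarrow>
     (\<forall>t\<in>{0..T}. y t \<in> L2 Om) \<and>
     (\<forall>t\<in>{0..T}. ((\<lambda>s. L2norm Om (\<lambda>x. y s x - y t x)) \<longlongrightarrow> 0) (at t within {0..T})) \<and>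
     (AE x in Om. y 0 x = y0 x) \<and>
     (\<exists>z. case_prod y \<in> L2 (leb T \<Otimes>\<^sub>M Om) \<and> case_prod z \<in> L2 (leb T \<Otimes>\<^sub>M Om) \<and>
        (AE t in leb T. y t \<in> H10 \<and> weak_deriv (y t) (z t)) \<and>
        (\<forall>v v'. v \<in> H10 \<and> weak_deriv v v' \<and> continuous_on {0..pi} v \<longrightarrow>
           (\<forall>t\<in>{0..T}.
              (LINT x|Om. y t x \<bullet> v x) - (LINT x|Om. y0 x \<bullet> v x)
              + (LINT s|leb t. LINT x|Om. (D *v z s x) \<bullet> v' x + (A *v y s x) \<bullet> v x)
              = (LINT s|leb t. u s * (B \<bullet> v x0)))))"

definition approx_controllable ::
  "real \<Rightarrow> real^'n^'n \<Rightarrow> real^'n^'n \<Rightarrow> real^'n \<Rightarrow> real \<Rightarrow> bool" where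
  "approx_controllable T D A B x0 \<longleftrightarrow>
     (\<forall>y0 \<in> L2 Om. \<forall>yT \<in> L2 Om. \<forall>\<epsilon>>0. \<exists>u \<in> L2 (leb T). \<exists>y.
        weak_solution T D A B x0 y0 u y \<and> L2norm Om (\<lambda>x. y T x - yT x) \<le> \<epsilon>)"


section \<open>The adjoint operator\<close>

text \<open>The graph of \<open>L\<^sup>\<star> = - D\<^sup>\<star> \<partial>\<^sub>x\<^sub>x + A\<^sup>\<star>\<close> with domain \<open>H\<^sup>2 \<inter> H\<^sub>0\<^sup>1\<close>.\<close>

definition Lstar ::
  "real^'n^'n \<Rightarrow> real^'n^'n \<Rightarrow> (real \<Rightarrow> complex^'n) \<Rightarrow> (real \<Rightarrow> complex^'n) \<Rightarrow> bool" where
  "Lstar D A f g \<longleftrightarrow> f \<in> H2 \<inter> H10 \<and> g \<in> L2 Om \<and>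
     (\<exists>f1 f2. weak_deriv f f1 \<and> weak_deriv f1 f2 \<and>
        (AE x in Om. g x = - (conj_transpose (of_real_matrix D) *v f2 x)
                           + conj_transpose (of_real_matrix A) *v f x))"

definition ker_Lstar :: "real^'n^'n \<Rightarrow> real^'n^'n \<Rightarrow> complex \<Rightarrow> (real \<Rightarrow> complex^'n) set" where
  "ker_Lstar D A \<mu> = {f. Lstar D A f (\<lambda>x. \<mu> *s f x)}"

definition eigenvalue_Lstar :: "real^'n^'n \<Rightarrow> real^'n^'n \<Rightarrow> complex \<Rightarrow> bool" where
  "eigenvalue_Lstar D A \<mu> \<longleftrightarrow> (\<exists>f \<in> ker_Lstar D A \<mu>. \<not> (AE x in Om. f x = 0))"

text \<open>
  The complex dimension, modulo equality almost everywhere, of the space \<open>V\<close> is \<open>m\<close>: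
  \<open>b 0, \<dots>, b (m - 1)\<close> is a basis.
\<close>

definition has_complex_dim :: "(real \<Rightarrow> complex^'n) set \<Rightarrow> nat \<Rightarrow> bool" where
  "has_complex_dim V m \<longleftrightarrow> (\<exists>b :: nat \<Rightarrow> real \<Rightarrow> complex^'n.
     (\<forall>i<m. b i \<in> V) \<and>
     (\<forall>c :: nat \<Rightarrow> complex. (AE x in Om. (\<Sum>i<m. c i *s b i x) = 0) \<longrightarrow> (\<forall>i<m. c i = 0)) \<and>
     (\<forall>f\<in>V. \<exists>c :: nat \<Rightarrow> complex. AE x in Om. f x = (\<Sum>i<m. c i *s b i x)))"

definition has_geometric_multiplicity :: "real^'n^'n \<Rightarrow> real^'n^'n \<Rightarrow> complex \<Rightarrow> nat \<Rightarrow> bool" where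
  "has_geometric_multiplicity D A \<mu> m \<longleftrightarrow> has_complex_dim (ker_Lstar D A \<mu>) m"

end

theory Submission
  imports Defs "HOL-Complex_Analysis.Complex_Analysis"
begin

text \<open>
  The Fourier modes \<open>y\<^sub>k\<close> of a solution satisfy
  \<open>y\<^sub>k' = - (k\<^sup>2 D + A) y\<^sub>k + (2/\<pi>) sin(k x\<^sub>0) u B\<close>. The vector \<open>B\<close> is cyclic for each
  \<open>k\<^sup>2 D + A\<close>, so each of its eigenvalues is geometrically simple, and the eigenvalues of
  \<open>L\<^sup>\<star>\<close> are geometrically simple exactly when different modes share no eigenvalue. If
  \<open>sin(k x\<^sub>0) = 0\<close> or two modes share an eigenvalue, then an eigenfunction of \<open>L\<^sup>\<star>\<close>
  invisible from \<open>x\<^sub>0\<close> gives a functional that vanishes on all states reachable from zero.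

  Conversely, use the controls \<open>u(t) = \<Sum> \<beta>\<^sub>j exp(\<zeta>\<^sub>j t)\<close>, for which the modes are explicit.
  A bounded functional, with values \<open>v\<^sub>k\<close> on the modes, that annihilates the states
  reached makes the moments
  of \<open>F(t) = \<Sum> sin(k x\<^sub>0) \<langle>exp(- t (k\<^sup>2 D + A)) B, v\<^sub>k\<rangle>\<close> on \<open>(0,T)\<close> against exponentials vanish.
  Hence \<open>F = 0\<close> on \<open>(0,T)\<close> by Weierstrass, and on \<open>(0,\<infinity>)\<close> because \<open>F\<close> is holomorphic in a sector. Its
  Laplace transform is a series of rational functions with disjoint poles, which forces
  every \<open>v\<^sub>k\<close> to vanish.
\<close>

section \<open>The semi-inner product space \<open>L\<^sup>2\<close>\<close>

text \<open>Uniqueness of weak solutions plays no part in either direction: for sufficiency a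
  solution is assembled from its modes, and for necessity the weak identity is tested with
  \<open>sin (k x)\<close>, so the conclusion holds for whichever solution is given. The initial
  datum enters only through the free evolution, which leaves density of the states reached from
  zero. Exponential controls are chosen because the forced modes then reduce to resolvents: with r
  solving \<open>(k^2 D + A + \<zeta>) r = B\<close>, the mode is \<open>exp (\<zeta> t) r\<close>
  minus the free evolution of r, and no Duhamel integral has to be estimated. Separating the modes
  by the poles of the Laplace transform asks neither for a spectral gap nor for a basis of
  eigenvectors, which does not exist when \<alpha> = 0. All it asks is that no pole be shared,
  recorded as \<open>disjoint_spectra\<close>; this is also the algebraic form of geometric
  simplicity, so both sides of the equivalence meet there. The price is control of F at complex
  times, where the Jordan coupling of size k^2 competes with a decay of the same order k^2.\<close>

lemma L2_measurable: "f \<in> L2 M \<Longrightarrow> f \<in> borel_measurable M"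
  by (simp add: L2_def)

lemma L2_sq_integrable: "f \<in> L2 M \<Longrightarrow> integrable M (\<lambda>x. (norm (f x))\<^sup>2)"
  by (simp add: L2_def)

lemma L2_inner_integrable:
  fixes f g :: "'x \<Rightarrow> 'a::euclidean_space"
  assumes "f \<in> L2 M" "g \<in> L2 M"
  shows "integrable M (\<lambda>x. f x \<bullet> g x)"
proof (rule Bochner_Integration.integrable_bound)
  show "integrable M (\<lambda>x. (norm (f x))\<^sup>2 + (norm (g x))\<^sup>2)"
    using assms by (intro Bochner_Integration.integrable_add L2_sq_integrable)
  show "(\<lambda>x. f x \<bullet> g x) \<in> borel_measurable M"
    using assms[THEN L2_measurable] by measurable
  have "\<bar>f x \<bullet> g x\<bar> \<le> (norm (f x))\<^sup>2 + (norm (g x))\<^sup>2" for x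
  proof -
    have "\<bar>f x \<bullet> g x\<bar> \<le> norm (f x) * norm (g x)"
      by (rule Cauchy_Schwarz_ineq2)
    also have "\<dots> \<le> (norm (f x))\<^sup>2 + (norm (g x))\<^sup>2"
      using sum_squares_bound[of "norm (f x)" "norm (g x)"]
        mult_nonneg_nonneg[OF norm_ge_zero norm_ge_zero, of "f x" "g x"] by linarith
    finally show ?thesis .
  qed
  then show "AE x in M. norm (f x \<bullet> g x) \<le> norm ((norm (f x))\<^sup>2 + (norm (g x))\<^sup>2)"
    by auto
qed

lemma L2_scaleR_integrable:
  fixes \<phi> :: "'x \<Rightarrow> real" and f :: "'x \<Rightarrow> 'a::euclidean_space"
  assumes "\<phi> \<in> L2 M" "f \<in> L2 M"
  shows "integrable M (\<lambda>x. \<phi> x *\<^sub>R f x)"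
proof (rule Bochner_Integration.integrable_bound)
  show "integrable M (\<lambda>x. (norm (\<phi> x))\<^sup>2 + (norm (f x))\<^sup>2)"
    using assms by (intro Bochner_Integration.integrable_add L2_sq_integrable)
  show "(\<lambda>x. \<phi> x *\<^sub>R f x) \<in> borel_measurable M"
    using assms[THEN L2_measurable] by measurable
  have "norm (\<phi> x *\<^sub>R f x) \<le> (norm (\<phi> x))\<^sup>2 + (norm (f x))\<^sup>2" for x
    using sum_squares_bound[of "norm (\<phi> x)" "norm (f x)"]
      mult_nonneg_nonneg[OF norm_ge_zero norm_ge_zero, of "\<phi> x" "f x"]
    by (simp only: norm_scaleR real_norm_def)
  then show "AE x in M. norm (\<phi> x *\<^sub>R f x) \<le> norm ((norm (\<phi> x))\<^sup>2 + (norm (f x))\<^sup>2)"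
    by auto
qed

lemma L2I_bound:
  fixes f :: "'x \<Rightarrow> 'a::euclidean_space" and g :: "'x \<Rightarrow> 'b::euclidean_space"
  assumes "f \<in> borel_measurable M" "g \<in> L2 M" "AE x in M. norm (f x) \<le> C * norm (g x)"
  shows "f \<in> L2 M"
proof -
  have "integrable M (\<lambda>x. (norm (f x))\<^sup>2)"
  proof (rule Bochner_Integration.integrable_bound)
    show "integrable M (\<lambda>x. C\<^sup>2 * (norm (g x))\<^sup>2)"
      using L2_sq_integrable[OF assms(2)] by simp
    show "(\<lambda>x. (norm (f x))\<^sup>2) \<in> borel_measurable M"
      using assms(1) by measurable
    show "AE x in M. norm ((norm (f x))\<^sup>2) \<le> norm (C\<^sup>2 * (norm (g x))\<^sup>2)"
      using assms(3)
    proof eventually_elim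
      case (elim x)
      have "(norm (f x))\<^sup>2 \<le> (C * norm (g x))\<^sup>2"
        by (rule power_mono[OF elim]) simp
      then show ?case by (simp add: power_mult_distrib)
    qed
  qed
  with assms(1) show ?thesis by (simp add: L2_def)
qed

lemma L2_add:
  fixes f g :: "'x \<Rightarrow> 'a::euclidean_space"
  assumes "f \<in> L2 M" "g \<in> L2 M"
  shows "(\<lambda>x. f x + g x) \<in> L2 M"
proof -
  have "integrable M (\<lambda>x. (norm (f x))\<^sup>2 + 2 * (f x \<bullet> g x) + (norm (g x))\<^sup>2)"
    using assms by (intro Bochner_Integration.integrable_add L2_sq_integrable
        integrable_mult_right L2_inner_integrable)
  moreover have "(norm (f x + g x))\<^sup>2 = (norm (f x))\<^sup>2 + 2 * (f x \<bullet> g x) + (norm (g x))\<^sup>2" for x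
    by (simp add: power2_norm_eq_inner inner_simps inner_commute)
  ultimately show ?thesis
    using assms by (simp add: L2_def borel_measurable_add)
qed

lemma L2_linear:
  fixes f :: "'x \<Rightarrow> 'a::euclidean_space" and h :: "'a \<Rightarrow> 'b::euclidean_space"
  assumes "f \<in> L2 M" "linear h"
  shows "(\<lambda>x. h (f x)) \<in> L2 M"
proof -
  have bl: "bounded_linear h" using assms(2) by (simp add: linear_linear)
  obtain K where K: "\<And>v. norm (h v) \<le> K * norm v"
    using bounded_linear.bounded[OF bl] by (metis mult.commute)
  have [measurable]: "h \<in> borel_measurable borel"
    by (rule borel_measurable_continuous_onI) (simp add: bl linear_continuous_on)
  show ?thesis
    by (rule L2I_bound[OF _ assms(1)]) (use assms(1)[THEN L2_measurable] K in auto)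
qed

lemma L2_scaleR: "f \<in> L2 M \<Longrightarrow> (\<lambda>x. c *\<^sub>R f x) \<in> L2 M" for f :: "'x \<Rightarrow> 'a::euclidean_space"
  by (rule L2_linear) (auto intro: linear_scale_self linearI simp: algebra_simps)

lemma L2_scaleR_left: "\<phi> \<in> L2 M \<Longrightarrow> (\<lambda>x. \<phi> x *\<^sub>R a) \<in> L2 M"
  for \<phi> :: "'x \<Rightarrow> real" and a :: "'a::euclidean_space"
  by (rule L2_linear[where h = "\<lambda>t. t *\<^sub>R a"]) (auto intro: linearI simp: algebra_simps)

lemma L2_inner_left: "f \<in> L2 M \<Longrightarrow> (\<lambda>x. f x \<bullet> a) \<in> L2 M" for f :: "'x \<Rightarrow> 'a::euclidean_space"
  by (rule L2_linear[where h = "\<lambda>t. t \<bullet> a"]) (auto intro: linearI simp: algebra_simps inner_simps)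

lemma L2_diff:
  fixes f g :: "'x \<Rightarrow> 'a::euclidean_space"
  assumes "f \<in> L2 M" "g \<in> L2 M"
  shows "(\<lambda>x. f x - g x) \<in> L2 M"
  using L2_add[OF assms(1) L2_scaleR[OF assms(2), of "-1"]] by simp

lemma L2_zero: "(\<lambda>x. 0) \<in> L2 M" for M :: "'x measure"
  by (simp add: L2_def)

lemma L2_sum:
  fixes f :: "'i \<Rightarrow> 'x \<Rightarrow> 'a::euclidean_space"
  assumes "\<And>i. i \<in> I \<Longrightarrow> f i \<in> L2 M"
  shows "(\<lambda>x. \<Sum>i\<in>I. f i x) \<in> L2 M"
  using assms by (induction I rule: infinite_finite_induct) (auto simp: L2_zero intro: L2_add)

lemma L2_bounded:
  fixes f :: "'x \<Rightarrow> 'a::euclidean_space"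
  assumes "finite_measure M" "f \<in> borel_measurable M" "AE x in M. norm (f x) \<le> C"
  shows "f \<in> L2 M"
proof (rule L2I_bound[OF assms(2)])
  interpret finite_measure M by fact
  show "(\<lambda>x. 1::real) \<in> L2 M" by (simp add: L2_def)
  show "AE x in M. norm (f x) \<le> C * norm (1::real)" using assms(3) by simp
qed

lemma L2norm_nonneg: "0 \<le> L2norm M f"
  by (simp add: L2norm_def)

lemma L2norm_sq: "(L2norm M f)\<^sup>2 = (LINT x|M. f x \<bullet> f x)"
  by (simp add: L2norm_def power2_norm_eq_inner)

lemma L2norm_cong_AE:
  fixes f g :: "'x \<Rightarrow> 'a::euclidean_space"
  assumes "f \<in> borel_measurable M" "g \<in> borel_measurable M" "AE x in M. f x = g x"
  shows "L2norm M f = L2norm M g"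
  unfolding L2norm_def using assms by (intro arg_cong[of _ _ sqrt] integral_cong_AE) auto

lemma L2norm_scaleR: "L2norm M (\<lambda>x. c *\<^sub>R f x) = \<bar>c\<bar> * L2norm M f"
  for f :: "'x \<Rightarrow> 'a::euclidean_space"
  by (simp add: L2norm_def power_mult_distrib real_sqrt_mult)

lemma L2norm_minus_commute: "L2norm M (\<lambda>x. f x - g x) = L2norm M (\<lambda>x. g x - f x)"
  by (simp add: L2norm_def norm_minus_commute)

text \<open>The parameter t lets one identity serve several purposes: a quadratic that is
  nonnegative for all t gives Cauchy-Schwarz, t = 1 and t = -1 give the triangle inequality and
  polarisation, and near-minimality in t gives near-orthogonality in the separation
  argument.\<close>

lemma L2norm_add_sq:
  fixes f g :: "'x \<Rightarrow> 'a::euclidean_space"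
  assumes "f \<in> L2 M" "g \<in> L2 M"
  shows "(L2norm M (\<lambda>x. f x + t *\<^sub>R g x))\<^sup>2
    = (L2norm M f)\<^sup>2 + 2 * t * (LINT x|M. f x \<bullet> g x) + t\<^sup>2 * (L2norm M g)\<^sup>2"
proof -
  have "(f x + t *\<^sub>R g x) \<bullet> (f x + t *\<^sub>R g x)
      = f x \<bullet> f x + (2 * t) * (f x \<bullet> g x) + t\<^sup>2 * (g x \<bullet> g x)" for x
    by (simp add: inner_simps inner_commute power2_eq_square algebra_simps)
  then show ?thesis
    using L2_inner_integrable[OF assms] L2_inner_integrable[OF assms(1) assms(1)]
      L2_inner_integrable[OF assms(2) assms(2)]
    by (simp add: L2norm_sq)
qed

lemma L2_Cauchy_Schwarz:
  fixes f g :: "'x \<Rightarrow> 'a::euclidean_space"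
  assumes "f \<in> L2 M" "g \<in> L2 M"
  shows "\<bar>LINT x|M. f x \<bullet> g x\<bar> \<le> L2norm M f * L2norm M g"
proof -
  let ?i = "LINT x|M. f x \<bullet> g x"
  have q: "0 \<le> (L2norm M f)\<^sup>2 + 2 * t * ?i + t\<^sup>2 * (L2norm M g)\<^sup>2" for t
    using L2norm_add_sq[OF assms, of t] by (metis zero_le_power2)
  have "?i\<^sup>2 \<le> (L2norm M f * L2norm M g)\<^sup>2"
  proof (cases "L2norm M g = 0")
    case True
    have "?i = 0"
    proof (rule ccontr)
      assume "?i \<noteq> 0"
      \<comment> \<open>When the norm of g vanishes the quadratic is affine in t, and this t makes
        it equal to -1.\<close>
      then have "2 * (- ((L2norm M f)\<^sup>2 + 1) / (2 * ?i)) * ?i = - ((L2norm M f)\<^sup>2 + 1)"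
        by (simp add: field_simps)
      with q[of "- ((L2norm M f)\<^sup>2 + 1) / (2 * ?i)"] True show False
        by simp
    qed
    then show ?thesis by simp
  next
    case False
    \<comment> \<open>The minimiser of the quadratic.\<close>
    let ?t = "- ?i / (L2norm M g)\<^sup>2"
    have "2 * ?t * ?i + ?t\<^sup>2 * (L2norm M g)\<^sup>2 = - (?i\<^sup>2 / (L2norm M g)\<^sup>2)"
      using False by (simp add: field_simps power2_eq_square)
    with q[of ?t] have "?i\<^sup>2 / (L2norm M g)\<^sup>2 \<le> (L2norm M f)\<^sup>2" by linarith
    then show ?thesis
      using False by (simp add: divide_le_eq power_mult_distrib)
  qed
  then have "\<bar>?i\<bar> \<le> \<bar>L2norm M f * L2norm M g\<bar>"
    by (simp only: abs_le_square_iff)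
  then show ?thesis
    by (simp add: L2norm_nonneg)
qed

lemma L2norm_triangle:
  fixes f g :: "'x \<Rightarrow> 'a::euclidean_space"
  assumes "f \<in> L2 M" "g \<in> L2 M"
  shows "L2norm M (\<lambda>x. f x + g x) \<le> L2norm M f + L2norm M g"
proof (rule power2_le_imp_le)
  show "(L2norm M (\<lambda>x. f x + g x))\<^sup>2 \<le> (L2norm M f + L2norm M g)\<^sup>2"
  proof -
    have "(L2norm M (\<lambda>x. f x + g x))\<^sup>2
        = (L2norm M f)\<^sup>2 + 2 * (LINT x|M. f x \<bullet> g x) + (L2norm M g)\<^sup>2"
      using L2norm_add_sq[OF assms, of 1] by (simp only: scaleR_one mult_1 mult_1_right one_power2)
    also have "\<dots> \<le> (L2norm M f)\<^sup>2 + 2 * (L2norm M f * L2norm M g) + (L2norm M g)\<^sup>2"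
      using L2_Cauchy_Schwarz[OF assms] by linarith
    finally show ?thesis by (simp only: power2_sum mult.assoc)
  qed
qed (intro add_nonneg_nonneg L2norm_nonneg)

lemma L2norm_triangle_diff:
  fixes f g h :: "'x \<Rightarrow> 'a::euclidean_space"
  assumes "f \<in> L2 M" "g \<in> L2 M" "h \<in> L2 M"
  shows "L2norm M (\<lambda>x. f x - h x) \<le> L2norm M (\<lambda>x. f x - g x) + L2norm M (\<lambda>x. g x - h x)"
proof -
  have "(\<lambda>x. f x - h x) = (\<lambda>x. (f x - g x) + (g x - h x))"
    by (simp add: fun_eq_iff)
  with L2norm_triangle[OF L2_diff[OF assms(1,2)] L2_diff[OF assms(2,3)]] show ?thesis
    by (simp only:)
qed

text \<open>Pairing the vector integral with its own value \<open>?w\<close> reduces the claim to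
  the scalar inequality.\<close>

lemma L2_Cauchy_Schwarz_scaleR:
  fixes \<phi> :: "'x \<Rightarrow> real" and f :: "'x \<Rightarrow> 'a::euclidean_space"
  assumes "\<phi> \<in> L2 M" "f \<in> L2 M"
  shows "norm (LINT x|M. \<phi> x *\<^sub>R f x) \<le> L2norm M \<phi> * L2norm M f"
proof -
  let ?w = "LINT x|M. \<phi> x *\<^sub>R f x"
  have "(norm ?w)\<^sup>2 = ?w \<bullet> ?w" by (simp add: power2_norm_eq_inner)
  also have "\<dots> = (LINT x|M. (\<phi> x *\<^sub>R f x) \<bullet> ?w)"
    by (rule integral_inner_left[symmetric]) (rule L2_scaleR_integrable[OF assms])
  also have "\<dots> = (LINT x|M. (\<phi> x *\<^sub>R ?w) \<bullet> f x)"
    by (simp add: inner_commute)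
  also have "\<dots> \<le> L2norm M (\<lambda>x. \<phi> x *\<^sub>R ?w) * L2norm M f"
    using L2_Cauchy_Schwarz[OF L2_scaleR_left[OF assms(1)] assms(2), of ?w] by linarith
  also have "L2norm M (\<lambda>x. \<phi> x *\<^sub>R ?w) = L2norm M \<phi> * norm ?w"
    by (simp add: L2norm_def power_mult_distrib real_sqrt_mult)
  finally have "norm ?w * norm ?w \<le> norm ?w * (L2norm M \<phi> * L2norm M f)"
    by (simp add: power2_eq_square mult_ac)
  then show ?thesis
    by (cases "?w = 0") (auto simp: L2norm_nonneg)
qed

lemma L2norm_bounded:
  fixes f :: "'x \<Rightarrow> 'a::euclidean_space"
  assumes "finite_measure M" "f \<in> borel_measurable M" "AE x in M. norm (f x) \<le> C" "0 \<le> C"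
  shows "L2norm M f \<le> C * sqrt (measure M (space M))"
proof -
  interpret finite_measure M by fact
  have "(LINT x|M. (norm (f x))\<^sup>2) \<le> (LINT x|M. C\<^sup>2)"
    using L2_sq_integrable[OF L2_bounded[OF assms(1-3)]] assms(3)
    by (intro integral_mono_AE) (auto elim!: eventually_mono intro: power_mono)
  then have "L2norm M f \<le> sqrt (C\<^sup>2 * measure M (space M))"
    unfolding L2norm_def by (intro real_sqrt_le_mono) (simp add: mult.commute)
  then show ?thesis
    using assms(4) by (simp add: real_sqrt_mult)
qed

lemma L2norm_eq_0_imp_AE:
  fixes f :: "'x \<Rightarrow> 'a::euclidean_space"
  assumes "f \<in> L2 M" "L2norm M f = 0"
  shows "AE x in M. f x = 0"
proof -
  have "AE x in M. (norm (f x))\<^sup>2 = 0"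
    using integral_nonneg_eq_0_iff_AE[OF L2_sq_integrable[OF assms(1)]] assms(2)
    by (simp add: L2norm_def)
  then show ?thesis by simp
qed

lemma L2_tendsto_inner:
  fixes f :: "'x \<Rightarrow> 'a::euclidean_space"
  assumes "\<And>n. F n \<in> L2 M" "f \<in> L2 M" "g \<in> L2 M"
    and "(\<lambda>n. L2norm M (\<lambda>x. F n x - f x)) \<longlonglongrightarrow> 0"
  shows "(\<lambda>n. LINT x|M. F n x \<bullet> g x) \<longlonglongrightarrow> (LINT x|M. f x \<bullet> g x)"
proof (rule LIM_zero_cancel, rule Lim_null_comparison)
  have "(LINT x|M. F n x \<bullet> g x) - (LINT x|M. f x \<bullet> g x) = (LINT x|M. (F n x - f x) \<bullet> g x)" for n
    using L2_inner_integrable[OF assms(1)[of n] assms(3)] L2_inner_integrable[OF assms(2,3)]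
    by (simp add: inner_diff_left)
  then show "\<forall>\<^sub>F n in sequentially. norm ((LINT x|M. F n x \<bullet> g x) - (LINT x|M. f x \<bullet> g x))
      \<le> L2norm M (\<lambda>x. F n x - f x) * L2norm M g"
    using L2_Cauchy_Schwarz[OF L2_diff[OF assms(1,2)] assms(3)] by simp
  show "(\<lambda>n. L2norm M (\<lambda>x. F n x - f x) * L2norm M g) \<longlonglongrightarrow> 0"
    using tendsto_mult_left_zero[OF assms(4)] .
qed

lemma L2_tendsto_scaleR:
  fixes f :: "'x \<Rightarrow> 'a::euclidean_space" and g :: "'x \<Rightarrow> real"
  assumes "\<And>n. F n \<in> L2 M" "f \<in> L2 M" "g \<in> L2 M"
    and "(\<lambda>n. L2norm M (\<lambda>x. F n x - f x)) \<longlonglongrightarrow> 0"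
  shows "(\<lambda>n. LINT x|M. g x *\<^sub>R F n x) \<longlonglongrightarrow> (LINT x|M. g x *\<^sub>R f x)"
proof (rule LIM_zero_cancel, rule Lim_null_comparison)
  have "(LINT x|M. g x *\<^sub>R F n x) - (LINT x|M. g x *\<^sub>R f x) = (LINT x|M. g x *\<^sub>R (F n x - f x))" for n
    using L2_scaleR_integrable[OF assms(3) assms(1)[of n]] L2_scaleR_integrable[OF assms(3,2)]
    by (simp add: scaleR_diff_right)
  then show "\<forall>\<^sub>F n in sequentially. norm ((LINT x|M. g x *\<^sub>R F n x) - (LINT x|M. g x *\<^sub>R f x))
      \<le> L2norm M g * L2norm M (\<lambda>x. F n x - f x)"
    using L2_Cauchy_Schwarz_scaleR[OF assms(3) L2_diff[OF assms(1,2)]] by simp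
  show "(\<lambda>n. L2norm M g * L2norm M (\<lambda>x. F n x - f x)) \<longlonglongrightarrow> 0"
    using tendsto_mult_right_zero[OF assms(4)] .
qed

lemma L2_tendsto_scaleR_left:
  fixes f :: "'x \<Rightarrow> 'a::euclidean_space" and g :: "'x \<Rightarrow> real"
  assumes "\<And>n. G n \<in> L2 M" "g \<in> L2 M" "f \<in> L2 M"
    and "(\<lambda>n. L2norm M (\<lambda>x. G n x - g x)) \<longlonglongrightarrow> 0"
  shows "(\<lambda>n. LINT x|M. G n x *\<^sub>R f x) \<longlonglongrightarrow> (LINT x|M. g x *\<^sub>R f x)"
proof (rule LIM_zero_cancel, rule Lim_null_comparison)
  have "(LINT x|M. G n x *\<^sub>R f x) - (LINT x|M. g x *\<^sub>R f x) = (LINT x|M. (G n x - g x) *\<^sub>R f x)" for n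
    using L2_scaleR_integrable[OF assms(1)[of n] assms(3)] L2_scaleR_integrable[OF assms(2,3)]
    by (simp add: scaleR_diff_left)
  then show "\<forall>\<^sub>F n in sequentially. norm ((LINT x|M. G n x *\<^sub>R f x) - (LINT x|M. g x *\<^sub>R f x))
      \<le> L2norm M (\<lambda>x. G n x - g x) * L2norm M f"
    using L2_Cauchy_Schwarz_scaleR[OF L2_diff[OF assms(1,2)] assms(3)] by simp
  show "(\<lambda>n. L2norm M (\<lambda>x. G n x - g x) * L2norm M f) \<longlonglongrightarrow> 0"
    using tendsto_mult_left_zero[OF assms(4)] .
qed

lemma L2_integrable:
  fixes f :: "'x \<Rightarrow> 'a::euclidean_space"
  assumes "finite_measure M" "f \<in> L2 M"
  shows "integrable M f"
proof -
  interpret finite_measure M by fact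
  have "(\<lambda>x. 1::real) \<in> L2 M" by (simp add: L2_def)
  from L2_scaleR_integrable[OF this assms(2)] show ?thesis by simp
qed

section \<open>Completeness of L2\<close>

text \<open>Fatou's lemma for the squared norms. The bound is asked only from N on, so that the
  tails of a Cauchy sequence can be inserted directly.\<close>

lemma L2norm_lim_le:
  fixes F :: "nat \<Rightarrow> 'x \<Rightarrow> 'a::euclidean_space"
  assumes F: "\<And>j. F j \<in> L2 M" and f: "f \<in> borel_measurable M"
    and lim: "AE x in M. (\<lambda>j. F j x) \<longlonglongrightarrow> f x"
    and bd: "\<And>j. j \<ge> N \<Longrightarrow> L2norm M (F j) \<le> B" and "0 \<le> B"
  shows "f \<in> L2 M" "L2norm M f \<le> B"
proof -
  have nnF: "(\<integral>\<^sup>+x. ennreal ((norm (F j x))\<^sup>2) \<partial>M) = ennreal ((L2norm M (F j))\<^sup>2)" for j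
    using L2_sq_integrable[OF F] by (subst nn_integral_eq_integral) (auto simp: L2norm_def)
  have m[measurable]: "\<And>j. F j \<in> borel_measurable M" "f \<in> borel_measurable M"
    using F f by (auto dest: L2_measurable)
  have "(\<integral>\<^sup>+x. ennreal ((norm (f x))\<^sup>2) \<partial>M) = (\<integral>\<^sup>+x. liminf (\<lambda>j. ennreal ((norm (F j x))\<^sup>2)) \<partial>M)"
  proof (rule nn_integral_cong_AE)
    show "AE x in M. ennreal ((norm (f x))\<^sup>2) = liminf (\<lambda>j. ennreal ((norm (F j x))\<^sup>2))"
      using lim
    proof eventually_elim
      case (elim x)
      have "(\<lambda>j. ennreal ((norm (F j x))\<^sup>2)) \<longlonglongrightarrow> ennreal ((norm (f x))\<^sup>2)"
        by (intro tendsto_intros tendsto_ennrealI elim)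
      from lim_imp_Liminf[OF _ this] show ?case by simp
    qed
  qed
  also have "\<dots> \<le> liminf (\<lambda>j. \<integral>\<^sup>+x. ennreal ((norm (F j x))\<^sup>2) \<partial>M)"
    by (rule nn_integral_liminf) measurable
  also have "\<dots> \<le> ennreal (B\<^sup>2)"
  proof (rule Liminf_le)
    show "\<forall>\<^sub>F j in sequentially. (\<integral>\<^sup>+x. ennreal ((norm (F j x))\<^sup>2) \<partial>M) \<le> ennreal (B\<^sup>2)"
      unfolding eventually_sequentially nnF
      by (intro exI[of _ N] allI impI ennreal_leI power_mono bd) (auto simp: L2norm_nonneg)
  qed simp
  finally have le: "(\<integral>\<^sup>+x. ennreal ((norm (f x))\<^sup>2) \<partial>M) \<le> ennreal (B\<^sup>2)" .
  then have "integrable M (\<lambda>x. (norm (f x))\<^sup>2)"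
    by (intro integrableI_nonneg) (auto simp: le_less_trans[OF le])
  then show L: "f \<in> L2 M" using f by (simp add: L2_def)
  have "(L2norm M f)\<^sup>2 \<le> B\<^sup>2"
    using le L2_sq_integrable[OF L] \<open>0 \<le> B\<close>
    by (subst (asm) nn_integral_eq_integral) (auto simp: L2norm_def)
  then show "L2norm M f \<le> B" using \<open>0 \<le> B\<close> by (rule power2_le_imp_le)
qed

lemma Riesz_Fischer:
  fixes F :: "nat \<Rightarrow> 'x \<Rightarrow> 'a::euclidean_space"
  assumes fin: "finite_measure M" and F: "\<And>j. F j \<in> L2 M"
    and fast: "\<And>j. L2norm M (\<lambda>x. F (Suc j) x - F j x) \<le> C * (1/2) ^ j"
  defines "f \<equiv> \<lambda>x. lim (\<lambda>j. F j x)"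
  shows "f \<in> L2 M" "(\<lambda>j. L2norm M (\<lambda>x. F j x - f x)) \<longlonglongrightarrow> 0"
proof -
  interpret finite_measure M by fact
  have [measurable]: "\<And>j. F j \<in> borel_measurable M" using F by (auto dest: L2_measurable)
  have fm[measurable]: "f \<in> borel_measurable M"
    unfolding f_def by (rule borel_measurable_lim_metric) measurable
  have C: "0 \<le> C" using fast[of 0] L2norm_nonneg[of M "\<lambda>x. F (Suc 0) x - F 0 x"] by simp
  let ?K = "L2norm M (\<lambda>x. 1::real)"
  have one: "(\<lambda>x. 1::real) \<in> L2 M" by (simp add: L2_def)
  have normL2: "(\<lambda>x. norm (F (Suc j) x - F j x)) \<in> L2 M" for j
    by (rule L2I_bound[OF _ L2_diff[OF F F], where C=1]) auto
  have d1: "(LINT x|M. norm (F (Suc j) x - F j x)) \<le> ?K * (C * (1/2) ^ j)" for j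
  proof -
    have "(LINT x|M. norm (F (Suc j) x - F j x)) \<le> ?K * L2norm M (\<lambda>x. norm (F (Suc j) x - F j x))"
      using L2_Cauchy_Schwarz_scaleR[OF one normL2, of j] by simp
    also have "L2norm M (\<lambda>x. norm (F (Suc j) x - F j x)) = L2norm M (\<lambda>x. F (Suc j) x - F j x)"
      by (simp add: L2norm_def)
    also have "?K * \<dots> \<le> ?K * (C * (1/2) ^ j)"
      by (intro mult_left_mono fast L2norm_nonneg)
    finally show ?thesis .
  qed
  have "(\<integral>\<^sup>+x. (\<Sum>j. ennreal (norm (F (Suc j) x - F j x))) \<partial>M)
      = (\<Sum>j. \<integral>\<^sup>+x. ennreal (norm (F (Suc j) x - F j x)) \<partial>M)"
    by (intro nn_integral_suminf) measurable
  also have "\<dots> = (\<Sum>j. ennreal (LINT x|M. norm (F (Suc j) x - F j x)))"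
    by (intro suminf_cong nn_integral_eq_integral L2_integrable[OF fin normL2]) auto
  also have "\<dots> \<le> (\<Sum>j. ennreal (?K * (C * (1/2) ^ j)))"
    by (intro suminf_le ennreal_leI d1) auto
  also have "\<dots> = ennreal (\<Sum>j. ?K * (C * (1/2) ^ j))"
    using C by (intro suminf_ennreal2 summable_mult summable_geometric)
      (auto simp: L2norm_nonneg)
  also have "\<dots> < \<infinity>" by simp
  finally have "(\<integral>\<^sup>+x. (\<Sum>j. ennreal (norm (F (Suc j) x - F j x))) \<partial>M) \<noteq> \<infinity>" by simp
  from nn_integral_PInf_AE[OF _ this]
  have "AE x in M. (\<Sum>j. ennreal (norm (F (Suc j) x - F j x))) \<noteq> \<infinity>" by measurable
  then have conv: "AE x in M. (\<lambda>j. F j x) \<longlonglongrightarrow> f x"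
  proof eventually_elim
    case (elim x)
    have "summable (\<lambda>j. norm (F (Suc j) x - F j x))"
      by (rule summable_suminf_not_top) (use elim in auto)
    then have "summable (\<lambda>j. F (Suc j) x - F j x)" by (rule summable_norm_cancel)
    then have "convergent (\<lambda>m. \<Sum>j<m. (F (Suc j) x - F j x))" by (simp add: summable_iff_convergent)
    then have "convergent (\<lambda>m. F m x - F 0 x)" by (simp add: sum_lessThan_telescope[of "\<lambda>j. F j x"])
    then have "convergent (\<lambda>m. F m x)"
      using convergent_add[OF _ convergent_const[of "F 0 x"]] by fastforce
    then show ?case unfolding f_def by (simp add: convergent_LIMSEQ_iff)
  qed
  have tail: "L2norm M (\<lambda>x. F j x - F m x) \<le> 2 * C * (1/2) ^ m" if "m \<le> j" for m j
  proof -
    \<comment> \<open>The subtracted \<open>(1/2) ^ j\<close> is what lets the induction on j absorb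
      the next increment.\<close>
    have "L2norm M (\<lambda>x. F j x - F m x) \<le> 2 * C * ((1/2) ^ m - (1/2) ^ j)"
      using that
    proof (induction j rule: dec_induct)
      case base
      show ?case by (simp add: L2norm_def)
    next
      case (step j)
      have "L2norm M (\<lambda>x. F (Suc j) x - F m x)
          \<le> L2norm M (\<lambda>x. F (Suc j) x - F j x) + L2norm M (\<lambda>x. F j x - F m x)"
        by (rule L2norm_triangle_diff[OF F F F])
      with fast[of j] step.IH show ?case by (simp add: algebra_simps)
    qed
    also have "\<dots> \<le> 2 * C * (1/2) ^ m"
      using C by (intro mult_left_mono) auto
    finally show ?thesis .
  qed
  have key: "(\<lambda>x. f x - F m x) \<in> L2 M \<and> L2norm M (\<lambda>x. f x - F m x) \<le> 2 * C * (1/2) ^ m" for m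
  proof -
    have "AE x in M. (\<lambda>j. F j x - F m x) \<longlonglongrightarrow> f x - F m x"
      using conv by eventually_elim (intro tendsto_intros)
    from L2norm_lim_le[OF L2_diff[OF F F] _ this tail] show ?thesis
      using C by simp
  qed
  show "f \<in> L2 M" using L2_add[OF F[of 0] conjunct1[OF key[of 0]]] by simp
  show "(\<lambda>j. L2norm M (\<lambda>x. F j x - f x)) \<longlonglongrightarrow> 0"
  proof (rule Lim_null_comparison)
    show "\<forall>\<^sub>F j in sequentially. norm (L2norm M (\<lambda>x. F j x - f x)) \<le> 2 * C * (1/2) ^ j"
      using key by (simp add: L2norm_nonneg L2norm_minus_commute[of M "F _" f])
    show "(\<lambda>j. 2 * C * (1/2) ^ j) \<longlonglongrightarrow> 0"
      by (intro tendsto_mult_right_zero LIMSEQ_power_zero) simp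
  qed
qed

section \<open>Sine series\<close>

lemma finite_leb: "finite_measure (leb b)"
  proof (rule finite_measureI)
  have "emeasure lborel {0<..<b} < \<infinity>"
    using emeasure_lborel_box_finite[of 0 b] by (simp add: box_real)
  then show "emeasure (leb b) (space (leb b)) \<noteq> \<infinity>"
    by (simp add: emeasure_restrict_space space_restrict_space)
qed

lemma AE_leb_iff: "(AE x in leb b. P x) \<longleftrightarrow> (AE x in lborel. x \<in> {0<..<b} \<longrightarrow> P x)"
  by (rule AE_restrict_space_iff) simp

lemma space_leb [simp]: "space (leb b) = {0<..<b}"
  by (simp add: space_restrict_space)

text \<open>Bridge from the Lebesgue integral on the open interval to the gauge integral on the
  closed one, where the fundamental theorem of calculus is available; the end points form a null
  set.\<close>

lemma leb_continuous:
  fixes f :: "real \<Rightarrow> 'a::euclidean_space"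
  assumes "continuous_on {0..b} f"
  shows "integrable (leb b) f" "(LINT x|leb b. f x) = integral {0..b} f"
proof -
  have si: "set_integrable lborel {0..b} f"
    by (rule borel_integrable_atLeastAtMost'[OF assms])
  then have si': "set_integrable lborel {0<..<b} f"
    by (rule set_integrable_subset) auto
  then show "integrable (leb b) f"
    by (simp add: integrable_restrict_space set_integrable_def)
  have "(LINT x|leb b. f x) = (LINT x:{0<..<b}|lborel. f x)"
    by (simp add: integral_restrict_space set_lebesgue_integral_def)
  also have "\<dots> = (LINT x:{0..b}|lborel. f x)"
    unfolding set_lebesgue_integral_def
  proof (rule integral_cong_AE)
    show "(\<lambda>x. indicator {0<..<b} x *\<^sub>R f x) \<in> borel_measurable lborel"
      using si' unfolding set_integrable_def by (rule borel_measurable_integrable)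
    show "(\<lambda>x. indicator {0..b} x *\<^sub>R f x) \<in> borel_measurable lborel"
      using si unfolding set_integrable_def by (rule borel_measurable_integrable)
    show "AE x in lborel. indicator {0<..<b} x *\<^sub>R f x = indicator {0..b} x *\<^sub>R f x"
      using AE_lborel_singleton[of 0] AE_lborel_singleton[of b]
      by eventually_elim (auto simp: indicator_def)
  qed
  also have "\<dots> = integral {0..b} f"
    by (rule set_borel_integral_eq_integral[OF si])
  finally show "(LINT x|leb b. f x) = integral {0..b} f" .
qed

lemma leb_FTC:
  fixes f :: "real \<Rightarrow> 'a::euclidean_space"
  assumes "0 \<le> b" "\<And>x. x \<in> {0..b} \<Longrightarrow> (F has_vector_derivative f x) (at x within {0..b})"
    and "continuous_on {0..b} f"
  shows "(LINT x|leb b. f x) = F b - F 0"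
  using fundamental_theorem_of_calculus[OF assms(1,2)] leb_continuous(2)[OF assms(3)]
  by (simp add: integral_unique)

lemma L2_continuous:
  fixes f :: "real \<Rightarrow> 'a::euclidean_space"
  assumes "continuous_on {0..b} f"
  shows "f \<in> L2 (leb b)"
proof -
  have "continuous_on {0..b} (\<lambda>x. (norm (f x))\<^sup>2)"
    using assms by (intro continuous_intros)
  then show ?thesis
    using leb_continuous(1)[OF assms] leb_continuous(1)[of b "\<lambda>x. (norm (f x))\<^sup>2"]
    by (auto simp: L2_def)
qed

section \<open>Orthogonality and Bessel's inequality\<close>

lemma integral_cos_multiple:
  "(LINT x|Om. cos (of_int m * x)) = (if m = 0 then pi else 0)"
proof (cases "m = 0")
  case True
  then show ?thesis
    using leb_FTC[of pi "\<lambda>x. x" "\<lambda>x. 1"] by (simp add: has_vector_derivative_id)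
next
  case False
  have "(LINT x|Om. cos (of_int m * x)) = sin (of_int m * pi) / of_int m - sin (of_int m * 0) / of_int m"
  proof (rule leb_FTC)
    fix x :: real
    have "((\<lambda>x. sin (of_int m * x) / of_int m) has_real_derivative cos (of_int m * x)) (at x within {0..pi})"
      using False by (auto intro!: derivative_eq_intros)
    then show "((\<lambda>x. sin (of_int m * x) / of_int m) has_vector_derivative cos (of_int m * x)) (at x within {0..pi})"
      by (simp add: has_real_derivative_iff_has_vector_derivative)
  qed (auto intro!: continuous_intros)
  moreover have "sin (of_int m * pi) = 0"
    by (simp add: sin_zero_iff_int2)
  ultimately show ?thesis using False by simp
qed

lemma L2_sin [simp, intro]: "(\<lambda>x. sin (real k * x)) \<in> L2 (leb b)"
  by (intro L2_continuous continuous_intros)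

lemma L2_cos [simp, intro]: "(\<lambda>x. cos (real k * x)) \<in> L2 (leb b)"
  by (intro L2_continuous continuous_intros)

lemma trig_orthogonal:
  assumes "1 \<le> k" "1 \<le> l"
  shows "(LINT x|Om. sin (real k * x) * sin (real l * x)) = (if k = l then pi / 2 else 0)"
    and "(LINT x|Om. cos (real k * x) * cos (real l * x)) = (if k = l then pi / 2 else 0)"
proof -
  let ?c = "\<lambda>m x. cos (of_int m * x)"
  let ?p = "int k + int l" and ?m = "int k - int l"
  have i: "integrable Om (?c m)" for m :: int
    by (rule leb_continuous) (intro continuous_intros)
  have "sin (real k * x) * sin (real l * x) = (?c ?m x - ?c ?p x) / 2" for x
    by (simp add: sin_times_sin algebra_simps)
  then have "(LINT x|Om. sin (real k * x) * sin (real l * x)) = ((LINT x|Om. ?c ?m x) - (LINT x|Om. ?c ?p x)) / 2"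
    by (simp only: Bochner_Integration.integral_diff[OF i i] integral_divide_zero)
  then show "(LINT x|Om. sin (real k * x) * sin (real l * x)) = (if k = l then pi / 2 else 0)"
    using assms unfolding integral_cos_multiple by (auto split: if_splits)
  have "cos (real k * x) * cos (real l * x) = (?c ?m x + ?c ?p x) / 2" for x
    by (simp add: cos_times_cos algebra_simps)
  then have "(LINT x|Om. cos (real k * x) * cos (real l * x)) = ((LINT x|Om. ?c ?m x) + (LINT x|Om. ?c ?p x)) / 2"
    by (simp only: Bochner_Integration.integral_add[OF i i] integral_divide_zero)
  then show "(LINT x|Om. cos (real k * x) * cos (real l * x)) = (if k = l then pi / 2 else 0)"
    using assms unfolding integral_cos_multiple by (auto split: if_splits)
qed

text \<open>The coefficients a are arbitrary: at the Fourier coefficients the identity yields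
  Bessel's inequality, at other ones it compares an approximation with the Fourier projection. A
  common squared norm c covers sines and cosines alike.\<close>

lemma L2norm_orthogonal_expansion:
  fixes e :: "nat \<Rightarrow> 'x \<Rightarrow> real" and f :: "'x \<Rightarrow> 'a::euclidean_space"
  assumes "finite I" and e: "\<And>k. k \<in> I \<Longrightarrow> e k \<in> L2 M" and f: "f \<in> L2 M"
    and orth: "\<And>k l. k \<in> I \<Longrightarrow> l \<in> I \<Longrightarrow> (LINT x|M. e k x * e l x) = (if k = l then c else 0)"
  shows "(L2norm M (\<lambda>x. f x - (\<Sum>k\<in>I. e k x *\<^sub>R a k)))\<^sup>2
    = (L2norm M f)\<^sup>2 - 2 * (\<Sum>k\<in>I. (LINT x|M. e k x *\<^sub>R f x) \<bullet> a k) + c * (\<Sum>k\<in>I. (norm (a k))\<^sup>2)"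
proof -
  let ?S = "\<lambda>x. \<Sum>k\<in>I. e k x *\<^sub>R a k"
  have eL: "k \<in> I \<Longrightarrow> (\<lambda>x. e k x *\<^sub>R a k) \<in> L2 M" for k
    by (intro L2_scaleR_left e)
  have S: "?S \<in> L2 M" by (intro L2_sum eL)
  have ei: "integrable M (\<lambda>x. e k x * e l x)" if "k \<in> I" "l \<in> I" for k l
    using L2_inner_integrable[OF e[OF that(1)] e[OF that(2)]] by simp
  have "(LINT x|M. f x \<bullet> ?S x) = (LINT x|M. (\<Sum>k\<in>I. (e k x *\<^sub>R f x) \<bullet> a k))"
    by (simp add: inner_sum_right)
  also have "\<dots> = (\<Sum>k\<in>I. LINT x|M. (e k x *\<^sub>R f x) \<bullet> a k)"
    by (intro Bochner_Integration.integral_sum integrable_inner_left L2_scaleR_integrable e f)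
  also have "\<dots> = (\<Sum>k\<in>I. (LINT x|M. e k x *\<^sub>R f x) \<bullet> a k)"
    by (intro sum.cong refl integral_inner_left L2_scaleR_integrable e f)
  finally have 1: "(LINT x|M. f x \<bullet> ?S x) = (\<Sum>k\<in>I. (LINT x|M. e k x *\<^sub>R f x) \<bullet> a k)" .
  have "(LINT x|M. ?S x \<bullet> ?S x) = (LINT x|M. (\<Sum>k\<in>I. \<Sum>l\<in>I. (e k x * e l x) * (a k \<bullet> a l)))"
    by (simp add: inner_sum_left inner_sum_right sum_distrib_left mult_ac inner_commute)
  also have "\<dots> = (\<Sum>k\<in>I. \<Sum>l\<in>I. (LINT x|M. e k x * e l x) * (a k \<bullet> a l))"
    using ei by (subst Bochner_Integration.integral_sum; (intro Bochner_Integration.integrable_sum sum.cong refl)?)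
      (auto simp: Bochner_Integration.integral_sum)
  also have "\<dots> = (\<Sum>k\<in>I. \<Sum>l\<in>I. if l = k then c * (norm (a k))\<^sup>2 else 0)"
    by (intro sum.cong refl) (auto simp: orth power2_norm_eq_inner)
  also have "\<dots> = c * (\<Sum>k\<in>I. (norm (a k))\<^sup>2)"
    using \<open>finite I\<close> by (simp add: sum_distrib_left)
  finally have 2: "(L2norm M ?S)\<^sup>2 = c * (\<Sum>k\<in>I. (norm (a k))\<^sup>2)" by (simp add: L2norm_sq)
  show ?thesis
    using L2norm_add_sq[OF f S, of "-1"] unfolding 1 2 by simp
qed

text \<open>The k-th sine coefficient without normalisation, unrelated to sin(x)/x: f is recovered
  by summing \<open>(2 / pi) * sin (k x)\<close> times \<open>sinc k f\<close>. Its value at k = 0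
  is 0, so sums may run over all natural numbers.\<close>

definition sinc :: "nat \<Rightarrow> (real \<Rightarrow> 'a::euclidean_space) \<Rightarrow> 'a" where
  "sinc k f = (LINT x|Om. sin (real k * x) *\<^sub>R f x)"

definition cosc :: "nat \<Rightarrow> (real \<Rightarrow> 'a::euclidean_space) \<Rightarrow> 'a" where
  "cosc k f = (LINT x|Om. cos (real k * x) *\<^sub>R f x)"

lemma sinc_0 [simp]: "sinc 0 f = 0"
  by (simp add: sinc_def)

lemma L2norm_cosine_sum:
  fixes a :: "nat \<Rightarrow> 'a::euclidean_space"
  assumes "finite I" "0 \<notin> I"
  shows "(L2norm Om (\<lambda>x. \<Sum>k\<in>I. cos (real k * x) *\<^sub>R a k))\<^sup>2 = pi / 2 * (\<Sum>k\<in>I. (norm (a k))\<^sup>2)"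
proof -
  have orth: "(LINT x|Om. cos (real k * x) * cos (real l * x)) = (if k = l then pi / 2 else 0)"
    if "k \<in> I" "l \<in> I" for k l
    using that assms(2) by (intro trig_orthogonal) (auto simp: Suc_le_eq intro!: gr0I)
  have "(L2norm Om (\<lambda>x. 0 - (\<Sum>k\<in>I. cos (real k * x) *\<^sub>R a k)))\<^sup>2 = pi / 2 * (\<Sum>k\<in>I. (norm (a k))\<^sup>2)"
    using assms
    by (subst L2norm_orthogonal_expansion[where c = "pi / 2"])
      (auto simp: L2_zero L2norm_def orth)
  then show ?thesis by (simp add: L2norm_def)
qed

lemma projection_algebra:
  fixes a :: "'i \<Rightarrow> 'a::real_inner"
  shows "pi / 2 * (\<Sum>k\<in>I. (norm ((2 / pi) *\<^sub>R a k))\<^sup>2) - 2 * (\<Sum>k\<in>I. a k \<bullet> (2 / pi) *\<^sub>R a k)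
    = - (2 / pi * (\<Sum>k\<in>I. (norm (a k))\<^sup>2))"
proof -
  have "a k \<bullet> (2 / pi) *\<^sub>R a k = 2 / pi * (norm (a k))\<^sup>2"
    "(norm ((2 / pi) *\<^sub>R a k))\<^sup>2 = (2 / pi)\<^sup>2 * (norm (a k))\<^sup>2" for k
    by (simp_all add: dot_square_norm power2_eq_square)
  then have "pi / 2 * (\<Sum>k\<in>I. (norm ((2 / pi) *\<^sub>R a k))\<^sup>2) - 2 * (\<Sum>k\<in>I. a k \<bullet> (2 / pi) *\<^sub>R a k)
      = pi / 2 * ((2 / pi)\<^sup>2 * (\<Sum>k\<in>I. (norm (a k))\<^sup>2)) - 2 * (2 / pi * (\<Sum>k\<in>I. (norm (a k))\<^sup>2))"
    by (simp only: sum_distrib_left)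
  then show ?thesis by (simp add: field_simps power2_eq_square)
qed

lemma L2norm_sine_remainder:
  fixes f :: "real \<Rightarrow> 'a::euclidean_space"
  assumes f: "f \<in> L2 Om"
  shows "(L2norm Om (\<lambda>x. f x - (\<Sum>k<m. sin (real k * x) *\<^sub>R (2 / pi) *\<^sub>R sinc k f)))\<^sup>2
    = (L2norm Om f)\<^sup>2 - 2 / pi * (\<Sum>k<m. (norm (sinc k f))\<^sup>2)"
proof -
  \<comment> \<open>Orthogonality holds for frequencies from 1 on, whereas the sums are stated from
    0; the term at 0 vanishes.\<close>
  have s: "(\<Sum>k\<in>{1..<m}. g k) = (\<Sum>k<m. g k)" if "g 0 = 0" for g :: "nat \<Rightarrow> 'b::comm_monoid_add"
    using that by (intro sum.mono_neutral_left) (auto simp: Suc_le_eq intro!: gr0I)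
  have "(L2norm Om (\<lambda>x. f x - (\<Sum>k\<in>{1..<m}. sin (real k * x) *\<^sub>R (2 / pi) *\<^sub>R sinc k f)))\<^sup>2
    = (L2norm Om f)\<^sup>2 - 2 * (\<Sum>k\<in>{1..<m}. sinc k f \<bullet> (2 / pi) *\<^sub>R sinc k f)
      + pi / 2 * (\<Sum>k\<in>{1..<m}. (norm ((2 / pi) *\<^sub>R sinc k f))\<^sup>2)"
    unfolding sinc_def
    by (rule L2norm_orthogonal_expansion) (auto simp: trig_orthogonal f)
  also have "\<dots> = (L2norm Om f)\<^sup>2 - 2 / pi * (\<Sum>k\<in>{1..<m}. (norm (sinc k f))\<^sup>2)"
    using projection_algebra[where I = "{1..<m}" and a = "\<lambda>k. sinc k f"] by simp
  finally show ?thesis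
    by (simp only: s[of "\<lambda>k. (norm (sinc k f))\<^sup>2"] s[of "\<lambda>k. sin (real k * _) *\<^sub>R (2 / pi) *\<^sub>R sinc k f"]
        sinc_0 norm_zero power_zero_numeral scaleR_zero_right)
qed

lemma Bessel_sine:
  fixes f :: "real \<Rightarrow> 'a::euclidean_space"
  assumes f: "f \<in> L2 Om"
  shows "(\<Sum>k<m. (norm (sinc k f))\<^sup>2) \<le> pi / 2 * (L2norm Om f)\<^sup>2"
proof -
  have "0 \<le> (L2norm Om f)\<^sup>2 - 2 / pi * (\<Sum>k<m. (norm (sinc k f))\<^sup>2)"
    unfolding L2norm_sine_remainder[OF f, symmetric] by simp
  then show ?thesis by (simp add: field_simps)
qed

lemma summable_sinc:
  fixes f :: "real \<Rightarrow> 'a::euclidean_space"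
  assumes "f \<in> L2 Om"
  shows "summable (\<lambda>k. (norm (sinc k f))\<^sup>2)"
  by (rule summableI_nonneg_bounded) (auto intro: Bessel_sine[OF assms])

lemma Bessel_cosine:
  fixes f :: "real \<Rightarrow> 'a::euclidean_space"
  assumes f: "f \<in> L2 Om"
  shows "(\<Sum>k\<in>{1..<m}. (norm (cosc k f))\<^sup>2) \<le> pi / 2 * (L2norm Om f)\<^sup>2"
proof -
  have "(L2norm Om (\<lambda>x. f x - (\<Sum>k\<in>{1..<m}. cos (real k * x) *\<^sub>R (2 / pi) *\<^sub>R cosc k f)))\<^sup>2
    = (L2norm Om f)\<^sup>2 - 2 * (\<Sum>k\<in>{1..<m}. cosc k f \<bullet> (2 / pi) *\<^sub>R cosc k f)
      + pi / 2 * (\<Sum>k\<in>{1..<m}. (norm ((2 / pi) *\<^sub>R cosc k f))\<^sup>2)"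
    unfolding cosc_def
    by (rule L2norm_orthogonal_expansion) (auto simp: trig_orthogonal f)
  also have "\<dots> = (L2norm Om f)\<^sup>2 - 2 / pi * (\<Sum>k\<in>{1..<m}. (norm (cosc k f))\<^sup>2)"
    using projection_algebra[where I = "{1..<m}" and a = "\<lambda>k. cosc k f"] by simp
  finally have "0 \<le> (L2norm Om f)\<^sup>2 - 2 / pi * (\<Sum>k\<in>{1..<m}. (norm (cosc k f))\<^sup>2)"
    by (rule ord_le_eq_trans[OF zero_le_power2])
  then show ?thesis by (simp add: field_simps)
qed

section \<open>Density of the sine polynomials\<close>

lemma L2_dominated_convergence:
  fixes f :: "'x \<Rightarrow> 'a::euclidean_space" and g :: "'x \<Rightarrow> real"
  assumes [measurable]: "\<And>j. F j \<in> borel_measurable M" "f \<in> borel_measurable M" and g: "g \<in> L2 M"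
    and lim: "AE x in M. (\<lambda>j. F j x) \<longlonglongrightarrow> f x"
    and bd: "\<And>j. AE x in M. norm (F j x - f x) \<le> \<bar>g x\<bar>"
  shows "(\<lambda>j. L2norm M (\<lambda>x. F j x - f x)) \<longlonglongrightarrow> 0"
proof -
  have "(\<lambda>j. LINT x|M. (norm (F j x - f x))\<^sup>2) \<longlonglongrightarrow> (LINT x|M. 0)"
  proof (rule integral_dominated_convergence)
    show "integrable M (\<lambda>x. (norm (g x))\<^sup>2)" by (rule L2_sq_integrable[OF g])
    show "AE x in M. (\<lambda>j. (norm (F j x - f x))\<^sup>2) \<longlonglongrightarrow> 0"
      using lim
    proof eventually_elim
      case (elim x)
      have "(\<lambda>j. (norm (F j x - f x))\<^sup>2) \<longlonglongrightarrow> (norm (f x - f x))\<^sup>2"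
        by (intro tendsto_intros elim)
      then show ?case by simp
    qed
    show "AE x in M. norm ((norm (F j x - f x))\<^sup>2) \<le> (norm (g x))\<^sup>2" for j
      using bd[of j]
    proof eventually_elim
      case (elim x)
      then have "(norm (F j x - f x))\<^sup>2 \<le> \<bar>g x\<bar>\<^sup>2" by (intro power_mono) auto
      then show ?case by simp
    qed
  qed measurable
  from tendsto_real_sqrt[OF this] show ?thesis by (simp add: L2norm_def)
qed

definition sine_approx :: "(real \<Rightarrow> real) \<Rightarrow> bool" where
  "sine_approx f \<longleftrightarrow> f \<in> L2 Om \<and> (\<forall>e>0. \<exists>m a. L2norm Om (\<lambda>x. f x - (\<Sum>k<m. a k * sin (real k * x))) < e)"

lemma L2_sine_sum: "(\<lambda>x. \<Sum>k<m. a k * sin (real k * x)) \<in> L2 (leb b)"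
  by (intro L2_continuous continuous_intros)

lemma sine_approx_limit:
  assumes f: "f \<in> L2 Om" and F: "\<And>j. sine_approx (F j)"
    and lim: "(\<lambda>j. L2norm Om (\<lambda>x. F j x - f x)) \<longlonglongrightarrow> 0"
  shows "sine_approx f"
  unfolding sine_approx_def
proof (intro conjI allI impI f)
  fix e :: real assume "0 < e"
  then have "\<forall>\<^sub>F j in sequentially. L2norm Om (\<lambda>x. F j x - f x) < e / 2"
    using order_tendstoD(2)[OF lim, of "e / 2"] by simp
  then obtain j where j: "L2norm Om (\<lambda>x. F j x - f x) < e / 2"
    by (auto simp: eventually_sequentially)
  from F[of j] \<open>0 < e\<close> obtain m a where
    m: "L2norm Om (\<lambda>x. F j x - (\<Sum>k<m. a k * sin (real k * x))) < e / 2"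
    unfolding sine_approx_def by (meson half_gt_zero)
  have "L2norm Om (\<lambda>x. f x - (\<Sum>k<m. a k * sin (real k * x)))
      \<le> L2norm Om (\<lambda>x. f x - F j x) + L2norm Om (\<lambda>x. F j x - (\<Sum>k<m. a k * sin (real k * x)))"
    using F[of j] by (intro L2norm_triangle_diff f L2_sine_sum) (simp add: sine_approx_def)
  also have "\<dots> < e"
    using j m by (simp add: L2norm_minus_commute[of _ f])
  finally show "\<exists>m a. L2norm Om (\<lambda>x. f x - (\<Sum>k<m. a k * sin (real k * x))) < e" by blast
qed

text \<open>The real span of the sines, given inductively so that stability under multiplication by
  cos x follows by rule induction. That stability turns sin x times a polynomial in cos x into a
  sine polynomial.\<close>

inductive sine_sum :: "(real \<Rightarrow> real) \<Rightarrow> bool" where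
  single: "sine_sum (\<lambda>x. c * sin (real k * x))"
| add: "sine_sum f \<Longrightarrow> sine_sum g \<Longrightarrow> sine_sum (\<lambda>x. f x + g x)"

lemma sine_sum_scale: "sine_sum f \<Longrightarrow> sine_sum (\<lambda>x. c * f x)"
proof (induction rule: sine_sum.induct)
  case (single c' k)
  show ?case using sine_sum.single[of "c * c'" k] by (simp add: mult.assoc)
next
  case (add f g)
  then show ?case using sine_sum.add by (simp add: distrib_left)
qed

lemma sine_sum_cos: "sine_sum f \<Longrightarrow> sine_sum (\<lambda>x. f x * cos x)"
proof (induction rule: sine_sum.induct)
  case (single c k)
  show ?case
  proof (cases k)
    case 0
    then show ?thesis using sine_sum.single[of 0 0] by simp
  next
    case (Suc l)
    have "c * sin (real k * x) * cos x = c / 2 * sin (real (Suc k) * x) + c / 2 * sin (real l * x)" for x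
    proof -
      have "sin (real k * x) * cos x = (sin (real k * x + x) + sin (real k * x - x)) / 2"
        by (rule sin_times_cos)
      moreover have "real k * x + x = real (Suc k) * x" "real k * x - x = real l * x"
        using Suc by (simp_all add: algebra_simps)
      ultimately have "sin (real k * x) * cos x = (sin (real (Suc k) * x) + sin (real l * x)) / 2"
        by simp
      then show ?thesis by (simp add: distrib_left mult.assoc add_divide_distrib)
    qed
    then have "(\<lambda>x. c * sin (real k * x) * cos x)
        = (\<lambda>x. c / 2 * sin (real (Suc k) * x) + c / 2 * sin (real l * x))"
      by (rule ext)
    then show ?thesis using sine_sum.add[OF sine_sum.single sine_sum.single] by (simp only:)
  qed
next
  case (add f g)
  then show ?case using sine_sum.add by (simp add: distrib_right)
qed

lemma sine_sum_expand:
  "sine_sum f \<Longrightarrow> \<exists>m a. f = (\<lambda>x. \<Sum>k<m. a k * sin (real k * x))"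
proof (induction rule: sine_sum.induct)
  case (single c k)
  have "(\<Sum>j<Suc k. (if j = k then c else 0) * sin (real j * x)) = c * sin (real k * x)" for x
    by (subst sum.cong[OF refl, of _ _ "\<lambda>j. if j = k then c * sin (real k * x) else 0"]) auto
  then have "(\<lambda>x. c * sin (real k * x)) = (\<lambda>x. \<Sum>j<Suc k. (if j = k then c else 0) * sin (real j * x))"
    by (rule ext[OF sym])
  then have "\<exists>a. (\<lambda>x. c * sin (real k * x)) = (\<lambda>x. \<Sum>j<Suc k. a j * sin (real j * x))"
    by (rule exI[where x = "\<lambda>j. if j = k then c else 0"])
  then show ?case by (rule exI[where x = "Suc k"])
next
  case (add f g)
  then obtain m a n b where
    f: "f = (\<lambda>x. \<Sum>k<m. a k * sin (real k * x))" and g: "g = (\<lambda>x. \<Sum>k<n. b k * sin (real k * x))"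
    by blast
  define N where "N = max m n"
  define c where "c k = (if k < m then a k else 0) + (if k < n then b k else 0)" for k
  have "f x + g x = (\<Sum>k<N. c k * sin (real k * x))" for x
  proof -
    have "(\<Sum>k<N. (if k < m then a k else 0) * sin (real k * x)) = f x"
      unfolding f N_def by (rule sum.mono_neutral_cong_right) auto
    moreover have "(\<Sum>k<N. (if k < n then b k else 0) * sin (real k * x)) = g x"
      unfolding g N_def by (rule sum.mono_neutral_cong_right) auto
    ultimately show ?thesis
      by (simp only: c_def distrib_right sum.distrib)
  qed
  then have "(\<lambda>x. f x + g x) = (\<lambda>x. \<Sum>k<N. c k * sin (real k * x))" by (rule ext)
  then have "\<exists>a. (\<lambda>x. f x + g x) = (\<lambda>x. \<Sum>k<N. a k * sin (real k * x))" by (rule exI[where x = c])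
  then show ?case by (rule exI[where x = N])
qed

lemma sine_sum_sin_cos_power: "sine_sum (\<lambda>x. sin x * cos x ^ j)"
proof (induction j)
  case 0
  have "sine_sum (\<lambda>x. 1 * sin (real 1 * x))" by (rule sine_sum.single)
  then show ?case by (simp only: of_nat_1 mult_1 power_0 mult_1_right)
next
  case (Suc j)
  from sine_sum_cos[OF this] show ?case by (simp only: power_Suc2 mult.assoc)
qed

lemma sine_sum_sin_poly: "sine_sum (\<lambda>x. sin x * (\<Sum>i\<le>n. a i * cos x ^ i))"
proof (induction n)
  case 0
  have "sine_sum (\<lambda>x. a 0 * (sin x * cos x ^ 0))"
    by (intro sine_sum_scale sine_sum_sin_cos_power)
  then show ?case by (simp only: atMost_0 sum.insert_remove sum.empty finite.emptyI empty_Diff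
        add_0_right mult.left_commute)
next
  case (Suc n)
  from sine_sum.add[OF this sine_sum_scale[OF sine_sum_sin_cos_power, of "a (Suc n)" "Suc n"]]
  show ?case by (simp only: sum.atMost_Suc distrib_left mult.left_commute)
qed

text \<open>In the variable u = cos x the Weierstrass theorem gives a polynomial p with p(cos x)
  close to h, and sin x p(cos x) is a sine polynomial. The factor sin x supplies the oddness that
  polynomials in cos x lack.\<close>

lemma sine_approx_sin_times:
  assumes h: "continuous_on {0..pi} h"
  shows "sine_approx (\<lambda>x. sin x * h x)"
  unfolding sine_approx_def
proof (intro conjI allI impI)
  show L: "(\<lambda>x. sin x * h x) \<in> L2 Om" by (intro L2_continuous continuous_intros h)
  fix e :: real assume "0 < e"
  \<comment> \<open>A uniform error d on an interval of length pi costs d sqrt(pi) = e / 2 in the L2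
    norm.\<close>
  define d where "d = e / (2 * sqrt pi)"
  have "0 < d" using \<open>0 < e\<close> by (simp add: d_def)
  have "continuous_on {-1..1} (\<lambda>u. h (arccos u))"
    by (rule continuous_on_compose2[OF h])
      (auto intro!: continuous_on_arccos' arccos_lbound arccos_ubound)
  then obtain p where p: "real_polynomial_function p"
    "\<And>u. u \<in> {-1..1} \<Longrightarrow> \<bar>h (arccos u) - p u\<bar> < d"
    using Stone_Weierstrass_real_polynomial_function[of "{-1..1::real}" _ d] \<open>0 < d\<close> by auto
  obtain a n where pa: "p = (\<lambda>u. \<Sum>i\<le>n. a i * u ^ i)"
    using p(1) real_polynomial_function_iff_sum by blast
  obtain m b where mb: "(\<lambda>x. sin x * p (cos x)) = (\<lambda>x. \<Sum>k<m. b k * sin (real k * x))"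
    using sine_sum_expand[OF sine_sum_sin_poly[of a n]] unfolding pa by blast
  have pt: "norm (sin x * h x - sin x * p (cos x)) \<le> d" if "x \<in> {0<..<pi}" for x
  proof -
    have "\<bar>h x - p (cos x)\<bar> \<le> d"
      using p(2)[of "cos x"] that by (simp add: arccos_cos less_imp_le)
    then have "\<bar>sin x\<bar> * \<bar>h x - p (cos x)\<bar> \<le> 1 * d"
      by (intro mult_mono) auto
    then show ?thesis by (simp add: abs_mult[symmetric] algebra_simps)
  qed
  have "L2norm Om (\<lambda>x. sin x * h x - sin x * p (cos x)) \<le> d * sqrt (measure Om (space Om))"
  proof (rule L2norm_bounded[OF finite_leb])
    show "(\<lambda>x. sin x * h x - sin x * p (cos x)) \<in> borel_measurable Om"
      using L L2_sine_sum[of b m pi] unfolding mb[unfolded fun_eq_iff, rule_format]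
      by (intro borel_measurable_diff L2_measurable)
  qed (use pt \<open>0 < d\<close> in \<open>auto intro!: AE_I2 less_imp_le[of 0 d]\<close>)
  also have "\<dots> = e / 2"
    by (simp add: d_def measure_restrict_space)
  also have "\<dots> < e" using \<open>0 < e\<close> by simp
  finally show "\<exists>m a. L2norm Om (\<lambda>x. sin x * h x - (\<Sum>k<m. a k * sin (real k * x))) < e"
    unfolding mb[unfolded fun_eq_iff, rule_format] by blast
qed

text \<open>The quotient of f by sin x may be unbounded at the end points, so it is replaced by the
  regularised quotient \<open>h j\<close>. Then \<open>sin x * h j x\<close> is f times a factor in
  [0,1] that tends to 1 inside the interval, and dominated convergence applies.\<close>

lemma sine_approx_continuous:
  assumes f: "continuous_on {0..pi} f"
  shows "sine_approx f"
proof -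
  define h where "h j x = f x * sin x / ((sin x)\<^sup>2 + 1 / real (Suc j))" for j x
  have pos: "0 < (sin x)\<^sup>2 + 1 / real (Suc j)" for j x
    by (intro add_nonneg_pos) auto
  have hc: "continuous_on {0..pi} (h j)" for j
    unfolding h_def using pos[of _ j] by (intro continuous_intros f) (metis less_irrefl)
  show ?thesis
  proof (rule sine_approx_limit)
    show "f \<in> L2 Om" by (rule L2_continuous[OF f])
    show "sine_approx (\<lambda>x. sin x * h j x)" for j by (rule sine_approx_sin_times[OF hc])
    show "(\<lambda>j. L2norm Om (\<lambda>x. sin x * h j x - f x)) \<longlonglongrightarrow> 0"
    proof (rule L2_dominated_convergence)
      show "(\<lambda>x. sin x * h j x) \<in> borel_measurable Om" for j
        by (intro L2_measurable L2_continuous continuous_intros hc)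
      show "f \<in> borel_measurable Om" "f \<in> L2 Om" by (auto intro: L2_measurable L2_continuous[OF f])
      have "(\<lambda>j. sin x * h j x) \<longlonglongrightarrow> f x" if "x \<in> {0<..<pi}" for x
      proof -
        have s: "sin x \<noteq> 0" using sin_gt_zero[of x] that by simp
        have "(\<lambda>j. sin x * (f x * sin x / ((sin x)\<^sup>2 + 1 / real (Suc j))))
          \<longlonglongrightarrow> sin x * (f x * sin x / ((sin x)\<^sup>2 + 0))"
          using s by (intro tendsto_intros LIMSEQ_Suc[OF lim_1_over_n]) auto
        with s show ?thesis by (simp add: h_def power2_eq_square)
      qed
      then show "AE x in Om. (\<lambda>j. sin x * h j x) \<longlonglongrightarrow> f x" by (intro AE_I2) simp
      have "norm (sin x * h j x - f x) \<le> \<bar>f x\<bar>" for x j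
      proof -
        define q where "q = (sin x)\<^sup>2 / ((sin x)\<^sup>2 + 1 / real (Suc j))"
        have "0 \<le> q" unfolding q_def using less_imp_le[OF pos[of x j]] by (intro divide_nonneg_nonneg) simp_all
        moreover have "q \<le> 1" unfolding q_def using pos[of x j] by (subst divide_le_eq_1_pos) simp_all
        ultimately have "\<bar>q - 1\<bar> \<le> 1" by linarith
        moreover have "sin x * h j x - f x = f x * (q - 1)"
          by (simp add: h_def q_def power2_eq_square right_diff_distrib mult.left_commute)
        ultimately show ?thesis
          using mult_left_mono[of "\<bar>q - 1\<bar>" 1 "\<bar>f x\<bar>"] by (simp add: abs_mult)
      qed
      then show "AE x in Om. norm (sin x * h j x - f x) \<le> \<bar>f x\<bar>" for j by simp
    qed
  qed
qed

text \<open>Two truncations: f is cut off at height j to become bounded, and continuous functions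
  converging to f almost everywhere are cut off at the same height, which supplies the dominating
  constant.\<close>

lemma sine_approx_L2:
  assumes f: "f \<in> L2 Om"
  shows "sine_approx f"
proof -
  define clip where "clip B t = max (- B) (min B t)" for B t :: real
  have clipc: "continuous_on A g \<Longrightarrow> continuous_on A (\<lambda>x. clip B (g x))" for A and g :: "real \<Rightarrow> real" and B
    unfolding clip_def by (intro continuous_intros)
  have cb: "\<bar>clip (real j) t\<bar> \<le> real j" for j t by (auto simp: clip_def)
  have [measurable]: "f \<in> borel_measurable Om" by (rule L2_measurable[OF f])
  have clipm: "(\<lambda>x. clip B (g x)) \<in> borel_measurable M" if "g \<in> borel_measurable M"
    for B g and M :: "real measure"
    using that unfolding clip_def by measurable
  have bd: "sine_approx (\<lambda>x. clip (real j) (f x))" for j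
  proof -
    have "(\<lambda>x. indicator {0<..<pi} x *\<^sub>R f x) \<in> borel_measurable lebesgue"
      using L2_measurable[OF f] by (simp add: borel_measurable_restrict_space_iff measurable_completion)
    then have "(\<lambda>x. indicator {0<..<pi} x *\<^sub>R f x) measurable_on UNIV"
      by (intro lebesgue_measurable_imp_measurable_on) (auto simp: lebesgue_on_UNIV_eq)
    \<comment> \<open>Unfolding \<open>measurable_on\<close> exhibits a measurable function as a
      limit of continuous ones outside a negligible set.\<close>
    then obtain N g where N: "negligible N" and g: "\<And>n. continuous_on UNIV (g n)"
      and lim: "\<And>x. x \<notin> N \<Longrightarrow> (\<lambda>n. g n x) \<longlonglongrightarrow> indicator {0<..<pi} x *\<^sub>R f x"
      unfolding measurable_on_def if_P[OF UNIV_I] by blast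
    have "AE x in lebesgue. x \<notin> N"
      using N by (simp add: negligible_iff_null_sets AE_not_in)
    then have "AE x in lborel. x \<notin> N" by (simp only: AE_completion_iff)
    then have lim': "AE x in Om. (\<lambda>n. g n x) \<longlonglongrightarrow> f x"
      unfolding AE_leb_iff
    proof eventually_elim
      case (elim x)
      from lim[OF elim] show ?case by (cases "x \<in> {0<..<pi}") auto
    qed
    have cL: "(\<lambda>x. clip (real j) (h x)) \<in> L2 Om" if "h \<in> borel_measurable Om" for h
      by (rule L2_bounded[OF finite_leb clipm[OF that], where C = "real j"]) (use cb in auto)
    show ?thesis
    proof (rule sine_approx_limit)
      show "(\<lambda>x. clip (real j) (f x)) \<in> L2 Om" by (rule cL) measurable
      show "sine_approx (\<lambda>x. clip (real j) (g n x))" for n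
        by (intro sine_approx_continuous clipc continuous_on_subset[OF g]) auto
      show "(\<lambda>n. L2norm Om (\<lambda>x. clip (real j) (g n x) - clip (real j) (f x))) \<longlonglongrightarrow> 0"
      proof (rule L2_dominated_convergence)
        show "(\<lambda>x. clip (real j) (g n x)) \<in> borel_measurable Om" for n
          by (intro L2_measurable L2_continuous clipc continuous_on_subset[OF g]) auto
        show "(\<lambda>x. clip (real j) (f x)) \<in> borel_measurable Om" by (rule clipm) measurable
        show "(\<lambda>x. 2 * real j) \<in> L2 Om" by (intro L2_continuous continuous_intros)
        show "AE x in Om. (\<lambda>n. clip (real j) (g n x)) \<longlonglongrightarrow> clip (real j) (f x)"
          using lim' by eventually_elim (auto simp: clip_def intro!: tendsto_intros)
        have "\<bar>clip (real j) s - clip (real j) t\<bar> \<le> 2 * real j" for s t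
          using cb[of j s] cb[of j t] by linarith
        then show "AE x in Om. norm (clip (real j) (g n x) - clip (real j) (f x)) \<le> \<bar>2 * real j\<bar>" for n
          by simp
      qed
    qed
  qed
  show ?thesis
  proof (rule sine_approx_limit[OF f bd])
    show "(\<lambda>j. L2norm Om (\<lambda>x. clip (real j) (f x) - f x)) \<longlonglongrightarrow> 0"
    proof (rule L2_dominated_convergence[OF _ _ f])
      show "(\<lambda>x. clip (real j) (f x)) \<in> borel_measurable Om" for j by (rule clipm) measurable
      have "(\<lambda>j. clip (real j) t) \<longlonglongrightarrow> t" for t
      proof (rule tendsto_eventually)
        obtain n :: nat where "\<bar>t\<bar> \<le> real n" using real_arch_simple by blast
        then show "\<forall>\<^sub>F j in sequentially. clip (real j) t = t"
          unfolding eventually_sequentially clip_def by (intro exI[of _ n]) auto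
      qed
      then show "AE x in Om. (\<lambda>j. clip (real j) (f x)) \<longlonglongrightarrow> f x" by simp
      have "\<bar>clip (real j) t - t\<bar> \<le> \<bar>t\<bar>" for j t unfolding clip_def by auto
      then show "AE x in Om. norm (clip (real j) (f x) - f x) \<le> \<bar>f x\<bar>" for j by simp
    qed measurable
  qed
qed

section \<open>Parseval's identity and uniqueness of sine coefficients\<close>

lemma sinc_add: "f \<in> L2 Om \<Longrightarrow> g \<in> L2 Om \<Longrightarrow> sinc k (\<lambda>x. f x + g x) = sinc k f + sinc k g"
  unfolding sinc_def by (simp add: scaleR_add_right L2_scaleR_integrable)

lemma sinc_diff: "f \<in> L2 Om \<Longrightarrow> g \<in> L2 Om \<Longrightarrow> sinc k (\<lambda>x. f x - g x) = sinc k f - sinc k g"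
  unfolding sinc_def by (simp add: scaleR_diff_right L2_scaleR_integrable)

lemma sinc_linear:
  fixes h :: "'a::euclidean_space \<Rightarrow> 'b::euclidean_space"
  assumes "f \<in> L2 Om" "linear h"
  shows "sinc k (\<lambda>x. h (f x)) = h (sinc k f)"
proof -
  have "bounded_linear h" using assms(2) by (simp add: linear_linear)
  from integral_bounded_linear[OF this L2_scaleR_integrable[OF L2_sin assms(1)]]
  show ?thesis unfolding sinc_def by (simp add: linear_scale[OF assms(2)])
qed

lemma cosc_linear:
  fixes h :: "'a::euclidean_space \<Rightarrow> 'b::euclidean_space"
  assumes "f \<in> L2 Om" "linear h"
  shows "cosc k (\<lambda>x. h (f x)) = h (cosc k f)"
proof -
  have "bounded_linear h" using assms(2) by (simp add: linear_linear)
  from integral_bounded_linear[OF this L2_scaleR_integrable[OF L2_cos assms(1)]]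
  show ?thesis unfolding cosc_def by (simp add: linear_scale[OF assms(2)])
qed

lemma linear_inner_left: "linear (\<lambda>v. v \<bullet> (b::'a::euclidean_space))"
  by (rule linearI) (simp_all add: inner_add_left)

text \<open>Bessel gives one inequality. For the other, an approximating sine polynomial is at least
  as far from f as the Fourier partial sum of the same length, so density forces the defect to
  0.\<close>

lemma Parseval_real:
  fixes f :: "real \<Rightarrow> real"
  assumes f: "f \<in> L2 Om"
  shows "(\<lambda>k. (sinc k f)\<^sup>2) sums (pi / 2 * (L2norm Om f)\<^sup>2)"
proof -
  let ?S = "\<lambda>m. \<Sum>k<m. (sinc k f)\<^sup>2" and ?N = "(L2norm Om f)\<^sup>2"
  have up: "?S m \<le> pi / 2 * ?N" for m using Bessel_sine[OF f, of m] by simp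
  have mono: "?S m \<le> ?S n" if "m \<le> n" for m n using that by (intro sum_mono2) auto
  have low: "\<exists>m. pi / 2 * ?N - ?S m < e" if "0 < e" for e
  proof -
    have "0 < sqrt (2 / pi * e)" using that by simp
    then obtain m a where m: "L2norm Om (\<lambda>x. f x - (\<Sum>k<m. a k * sin (real k * x))) < sqrt (2 / pi * e)"
      using sine_approx_L2[OF f] unfolding sine_approx_def by blast
    have s: "(\<Sum>k\<in>{1..<m}. g k) = (\<Sum>k<m. g k)" if "g 0 = 0" for g :: "nat \<Rightarrow> real"
      using that by (intro sum.mono_neutral_left) (auto simp: Suc_le_eq intro!: gr0I)
    have "(L2norm Om (\<lambda>x. f x - (\<Sum>k\<in>{1..<m}. sin (real k * x) *\<^sub>R a k)))\<^sup>2
        = ?N - 2 * (\<Sum>k\<in>{1..<m}. sinc k f \<bullet> a k) + pi / 2 * (\<Sum>k\<in>{1..<m}. (norm (a k))\<^sup>2)"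
      unfolding sinc_def by (rule L2norm_orthogonal_expansion) (auto simp: trig_orthogonal f)
    moreover have "(\<Sum>k\<in>{1..<m}. sin (real k * x) *\<^sub>R a k) = (\<Sum>k<m. a k * sin (real k * x))" for x
      by (subst s[symmetric]) (simp_all add: mult.commute)
    ultimately have "?N - 2 * (\<Sum>k\<in>{1..<m}. sinc k f * a k) + pi / 2 * (\<Sum>k\<in>{1..<m}. (a k)\<^sup>2) < (sqrt (2 / pi * e))\<^sup>2"
      using power_strict_mono[OF m L2norm_nonneg, of 2] by simp
    moreover have "2 * (\<Sum>k\<in>{1..<m}. sinc k f * a k) - pi / 2 * (\<Sum>k\<in>{1..<m}. (a k)\<^sup>2)
        \<le> 2 / pi * (\<Sum>k\<in>{1..<m}. (sinc k f)\<^sup>2)"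
      unfolding sum_distrib_left sum_subtractf[symmetric]
    proof (rule sum_mono)
      fix k
      \<comment> \<open>Completing the square: the optimal coefficient is 2 / pi times
        \<open>sinc k f\<close>.\<close>
      have "0 \<le> (sqrt (2 / pi) * sinc k f - sqrt (pi / 2) * a k)\<^sup>2" by simp
      also have "\<dots> = 2 / pi * (sinc k f)\<^sup>2 + pi / 2 * (a k)\<^sup>2 - 2 * (sqrt (2 / pi) * sqrt (pi / 2)) * (sinc k f * a k)"
        by (simp add: power2_diff power_mult_distrib mult_ac)
      also have "sqrt (2 / pi) * sqrt (pi / 2) = 1"
        unfolding real_sqrt_mult[symmetric] by simp
      finally show "2 * (sinc k f * a k) - pi / 2 * (a k)\<^sup>2 \<le> 2 / pi * (sinc k f)\<^sup>2" by simp
    qed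
    moreover have "(\<Sum>k\<in>{1..<m}. (sinc k f)\<^sup>2) = ?S m" by (rule s) simp
    moreover have "(sqrt (2 / pi * e))\<^sup>2 = 2 / pi * e" using that by simp
    ultimately have "?N - 2 / pi * ?S m < 2 / pi * e" by simp
    then have "pi / 2 * (?N - 2 / pi * ?S m) < pi / 2 * (2 / pi * e)"
      by (rule mult_strict_left_mono) simp
    then have "pi / 2 * ?N - ?S m < e" by (simp add: right_diff_distrib)
    then show ?thesis ..
  qed
  show ?thesis
    unfolding sums_def
  proof (rule LIMSEQ_I)
    fix e :: real assume "0 < e"
    then obtain m where m: "pi / 2 * ?N - ?S m < e" using low by blast
    show "\<exists>no. \<forall>n\<ge>no. norm (?S n - pi / 2 * ?N) < e"
    proof (intro exI allI impI)
      fix n assume "m \<le> n"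
      with mono[OF this] m up[of n] show "norm (?S n - pi / 2 * ?N) < e"
        unfolding real_norm_def by linarith
    qed
  qed
qed

lemma Parseval:
  fixes f :: "real \<Rightarrow> 'a::euclidean_space"
  assumes f: "f \<in> L2 Om"
  shows "(\<lambda>k. (norm (sinc k f))\<^sup>2) sums (pi / 2 * (L2norm Om f)\<^sup>2)"
proof -
  have nb: "(norm v)\<^sup>2 = (\<Sum>b\<in>Basis. (v \<bullet> b)\<^sup>2)" for v :: 'a
    by (simp add: norm_eq_sqrt_inner euclidean_inner[of v v] power2_eq_square[symmetric] sum_nonneg)
  have "(\<lambda>k. \<Sum>b\<in>Basis. (sinc k (\<lambda>x. f x \<bullet> b))\<^sup>2) sums (\<Sum>b\<in>Basis. pi / 2 * (L2norm Om (\<lambda>x. f x \<bullet> b))\<^sup>2)"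
    by (intro sums_sum Parseval_real L2_inner_left f)
  moreover have "sinc k (\<lambda>x. f x \<bullet> b) = sinc k f \<bullet> b" for k and b :: 'a
    by (rule sinc_linear[OF f linear_inner_left])
  moreover have "(\<Sum>b\<in>Basis. pi / 2 * (L2norm Om (\<lambda>x. f x \<bullet> b))\<^sup>2) = pi / 2 * (L2norm Om f)\<^sup>2"
  proof -
    have "(L2norm Om f)\<^sup>2 = (LINT x|Om. (\<Sum>b\<in>Basis. (norm (f x \<bullet> b))\<^sup>2))"
      by (simp add: L2norm_sq dot_square_norm nb)
    also have "\<dots> = (\<Sum>b\<in>Basis. LINT x|Om. (norm (f x \<bullet> b))\<^sup>2)"
      by (intro Bochner_Integration.integral_sum L2_sq_integrable L2_inner_left f)
    also have "\<dots> = (\<Sum>b\<in>Basis. (L2norm Om (\<lambda>x. f x \<bullet> b))\<^sup>2)"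
      unfolding L2norm_sq by (simp add: power2_eq_square)
    finally show ?thesis by (simp add: sum_distrib_left)
  qed
  ultimately show ?thesis by (simp only: nb)
qed

lemma Parseval_inner:
  fixes f g :: "real \<Rightarrow> 'a::euclidean_space"
  assumes f: "f \<in> L2 Om" and g: "g \<in> L2 Om"
  shows "(\<lambda>k. sinc k f \<bullet> sinc k g) sums (pi / 2 * (LINT x|Om. f x \<bullet> g x))"
proof -
  have "(\<lambda>k. ((norm (sinc k (\<lambda>x. f x + g x)))\<^sup>2 - (norm (sinc k (\<lambda>x. f x - g x)))\<^sup>2) / 4)
      sums ((pi / 2 * (L2norm Om (\<lambda>x. f x + g x))\<^sup>2 - pi / 2 * (L2norm Om (\<lambda>x. f x - g x))\<^sup>2) / 4)"
    by (intro sums_divide sums_diff Parseval L2_add L2_diff f g)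
  moreover have "((norm (sinc k (\<lambda>x. f x + g x)))\<^sup>2 - (norm (sinc k (\<lambda>x. f x - g x)))\<^sup>2) / 4 = sinc k f \<bullet> sinc k g" for k
    by (simp add: sinc_add sinc_diff f g power2_norm_eq_inner inner_simps inner_commute)
  moreover have "(pi / 2 * (L2norm Om (\<lambda>x. f x + g x))\<^sup>2 - pi / 2 * (L2norm Om (\<lambda>x. f x - g x))\<^sup>2) / 4
      = pi / 2 * (LINT x|Om. f x \<bullet> g x)"
  proof -
    have "(L2norm Om (\<lambda>x. f x + g x))\<^sup>2 - (L2norm Om (\<lambda>x. f x - g x))\<^sup>2 = 4 * (LINT x|Om. f x \<bullet> g x)"
      using L2norm_add_sq[OF f g, of 1] L2norm_add_sq[OF f g, of "-1"] by simp
    then have "pi / 8 * ((L2norm Om (\<lambda>x. f x + g x))\<^sup>2 - (L2norm Om (\<lambda>x. f x - g x))\<^sup>2)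
        = pi / 8 * (4 * (LINT x|Om. f x \<bullet> g x))" by (rule arg_cong)
    then show ?thesis by (simp add: right_diff_distrib diff_divide_distrib)
  qed
  ultimately show ?thesis by (simp only:)
qed

lemma sine_coefficients_zero:
  fixes f :: "real \<Rightarrow> 'a::euclidean_space"
  assumes f: "f \<in> L2 Om" and "\<And>k. sinc k f = 0"
  shows "AE x in Om. f x = 0"
proof (rule L2norm_eq_0_imp_AE[OF f])
  have "(\<lambda>k. (norm (sinc k f))\<^sup>2) sums 0" using assms(2) by simp
  from sums_unique2[OF this Parseval[OF f]] show "L2norm Om f = 0" by simp
qed

lemma sine_coefficients_unique:
  fixes f g :: "real \<Rightarrow> 'a::euclidean_space"
  assumes "f \<in> L2 Om" "g \<in> L2 Om" and "\<And>k. sinc k f = sinc k g"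
  shows "AE x in Om. f x = g x"
proof -
  have "AE x in Om. f x - g x = 0"
    using assms by (intro sine_coefficients_zero L2_diff) (simp_all add: sinc_diff)
  then show ?thesis by simp
qed

lemma sine_partial_sums_tendsto:
  fixes f :: "real \<Rightarrow> 'a::euclidean_space"
  assumes f: "f \<in> L2 Om"
  shows "(\<lambda>m. L2norm Om (\<lambda>x. f x - (\<Sum>k<m. sin (real k * x) *\<^sub>R (2 / pi) *\<^sub>R sinc k f))) \<longlonglongrightarrow> 0"
proof -
  have "(\<lambda>m. (L2norm Om f)\<^sup>2 - 2 / pi * (\<Sum>k<m. (norm (sinc k f))\<^sup>2))
      \<longlonglongrightarrow> (L2norm Om f)\<^sup>2 - 2 / pi * (pi / 2 * (L2norm Om f)\<^sup>2)"
    using Parseval[OF f] unfolding sums_def by (intro tendsto_intros)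
  then have "(\<lambda>m. (L2norm Om (\<lambda>x. f x - (\<Sum>k<m. sin (real k * x) *\<^sub>R (2 / pi) *\<^sub>R sinc k f)))\<^sup>2) \<longlonglongrightarrow> 0"
    unfolding L2norm_sine_remainder[OF f] by simp
  from tendsto_real_sqrt[OF this] show ?thesis by (simp add: L2norm_nonneg)
qed

section \<open>Absolutely convergent sine series\<close>

definition sine_series :: "(nat \<Rightarrow> 'a::euclidean_space) \<Rightarrow> real \<Rightarrow> 'a" where
  "sine_series a x = (\<Sum>k. sin (real k * x) *\<^sub>R a k)"

lemma sine_series_summable:
  assumes "summable (\<lambda>k. norm (a k))"
  shows "summable (\<lambda>k. norm (sin (real k * x) *\<^sub>R a k))"
  by (rule summable_comparison_test'[OF assms, of 0]) (simp add: mult_left_le_one_le)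

lemma sine_series_continuous:
  fixes a :: "nat \<Rightarrow> 'a::euclidean_space"
  assumes "summable (\<lambda>k. norm (a k))"
  shows "continuous_on UNIV (sine_series a)"
proof -
  have "uniform_limit UNIV (\<lambda>n x. \<Sum>k<n. sin (real k * x) *\<^sub>R a k) (\<lambda>x. \<Sum>k. sin (real k * x) *\<^sub>R a k) sequentially"
    by (rule Weierstrass_m_test[OF _ assms]) (simp add: mult_left_le_one_le)
  then have "uniform_limit UNIV (\<lambda>n x. \<Sum>k<n. sin (real k * x) *\<^sub>R a k) (sine_series a) sequentially"
    by (simp add: sine_series_def[abs_def])
  then show ?thesis
    by (rule uniform_limit_theorem[rotated]) (auto intro!: always_eventually continuous_intros)
qed

lemma sine_series_L2:
  fixes a :: "nat \<Rightarrow> 'a::euclidean_space"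
  assumes "summable (\<lambda>k. norm (a k))"
  shows "sine_series a \<in> L2 (leb b)"
  by (intro L2_continuous continuous_on_subset[OF sine_series_continuous[OF assms]]) auto

lemma measure_leb_pi: "measure Om {0<..<pi} = pi"
  by (simp add: measure_restrict_space)

text \<open>Absolute summability justifies integrating term by term. The index l = 0 is excluded
  because \<open>a 0\<close> is multiplied by sin 0 and leaves no trace in the function.\<close>

lemma sinc_sine_series:
  fixes a :: "nat \<Rightarrow> 'a::euclidean_space"
  assumes a: "summable (\<lambda>k. norm (a k))" and l: "1 \<le> l"
  shows "sinc l (sine_series a) = (pi / 2) *\<^sub>R a l"
proof -
  let ?f = "\<lambda>k x. (sin (real l * x) * sin (real k * x)) *\<^sub>R a k"
  have nb: "norm (?f k x) \<le> norm (a k)" for k x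
  proof -
    have "\<bar>sin (real l * x)\<bar> * \<bar>sin (real k * x)\<bar> \<le> 1 * 1" by (intro mult_mono) auto
    then show ?thesis by (simp add: abs_mult mult_left_le_one_le)
  qed
  have fi: "integrable Om (?f k)" for k
    by (intro leb_continuous continuous_intros)
  have "sinc l (sine_series a) = (LINT x|Om. (\<Sum>k. ?f k x))"
    unfolding sinc_def
  proof (intro Bochner_Integration.integral_cong refl)
    fix x
    have "sin (real l * x) *\<^sub>R sine_series a x = (\<Sum>k. sin (real l * x) *\<^sub>R sin (real k * x) *\<^sub>R a k)"
      unfolding sine_series_def
      by (intro suminf_scaleR_right summable_norm_cancel[OF sine_series_summable[OF a]])
    then show "sin (real l * x) *\<^sub>R sine_series a x = (\<Sum>k. ?f k x)" by simp
  qed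
  also have "\<dots> = (\<Sum>k. LINT x|Om. ?f k x)"
  proof (rule integral_suminf[OF fi])
    show "AE x in Om. summable (\<lambda>k. norm (?f k x))"
      by (intro AE_I2 summable_comparison_test'[OF a, of 0]) (use nb in simp)
    show "summable (\<lambda>k. LINT x|Om. norm (?f k x))"
    proof (rule summable_comparison_test'[of "\<lambda>k. pi * norm (a k)" 0])
      show "summable (\<lambda>k. pi * norm (a k))" by (intro summable_mult a)
      fix k :: nat
      interpret finite_measure Om by (rule finite_leb)
      have "(LINT x|Om. norm (?f k x)) \<le> (LINT x|Om. norm (a k))"
        by (intro integral_mono integrable_norm fi nb) simp
      then show "norm (LINT x|Om. norm (?f k x)) \<le> pi * norm (a k)"
        by (simp add: measure_leb_pi)
    qed
  qed
  also have "\<dots> = (\<Sum>k. if k = l then (pi / 2) *\<^sub>R a l else 0)"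
  proof (intro suminf_cong)
    fix k
    have "(LINT x|Om. ?f k x) = (LINT x|Om. sin (real l * x) * sin (real k * x)) *\<^sub>R a k"
      by (rule integral_scaleR_left) (intro leb_continuous continuous_intros)
    also have "\<dots> = (if k = l then (pi / 2) *\<^sub>R a l else 0)"
      using l by (cases "k = 0") (auto simp: trig_orthogonal Suc_le_eq)
    finally show "(LINT x|Om. ?f k x) = (if k = l then (pi / 2) *\<^sub>R a l else 0)" .
  qed
  also have "\<dots> = (pi / 2) *\<^sub>R a l"
    using suminf_finite[of "{l}" "\<lambda>k. if k = l then (pi / 2) *\<^sub>R a l else 0"] by simp
  finally show ?thesis .
qed

lemma L2norm_sine_series:
  fixes a :: "nat \<Rightarrow> 'a::euclidean_space"
  assumes a: "summable (\<lambda>k. norm (a k))" and "a 0 = 0"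
  shows "(\<lambda>k. pi / 2 * (norm (a k))\<^sup>2) sums (L2norm Om (sine_series a))\<^sup>2"
proof -
  have "sinc k (sine_series a) = (pi / 2) *\<^sub>R a k" for k
    by (cases "k = 0") (use assms sinc_sine_series[OF a, of k] in auto)
  with sums_mult[OF Parseval[OF sine_series_L2[OF a]], of "2 / pi"]
  show ?thesis by (simp add: power_mult_distrib power2_eq_square mult_ac)
qed

section \<open>Separation from a subspace of \<open>L\<^sup>2\<close>\<close>

text \<open>The orthogonal projection of g, expressed through functionals. A minimising sequence
  \<open>r m\<close> leaves residuals \<open>e m\<close> that are orthogonal to V up to
  \<open>q m\<close>, hence form a Cauchy sequence; l is the limit of the pairings with
  \<open>e m\<close>. The residuals themselves are not passed to the limit.\<close>

lemma separating_functional: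
  fixes V :: "('x \<Rightarrow> 'a::euclidean_space) set" and g :: "'x \<Rightarrow> 'a"
  assumes V: "V \<subseteq> L2 M" and zero: "(\<lambda>x. 0) \<in> V"
    and add: "\<And>f h. f \<in> V \<Longrightarrow> h \<in> V \<Longrightarrow> (\<lambda>x. f x + h x) \<in> V"
    and scale: "\<And>f c. f \<in> V \<Longrightarrow> (\<lambda>x. c *\<^sub>R f x) \<in> V"
    and g: "g \<in> L2 M" and "0 < \<delta>" and far: "\<And>r. r \<in> V \<Longrightarrow> \<delta> \<le> L2norm M (\<lambda>x. g x - r x)"
  obtains l C where
    "\<And>f h. f \<in> L2 M \<Longrightarrow> h \<in> L2 M \<Longrightarrow> l (\<lambda>x. f x + h x) = l f + l h"
    "\<And>f c. f \<in> L2 M \<Longrightarrow> l (\<lambda>x. c *\<^sub>R f x) = c * l f"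
    "\<And>f. f \<in> L2 M \<Longrightarrow> \<bar>l f\<bar> \<le> C * L2norm M f"
    "\<And>r. r \<in> V \<Longrightarrow> l r = 0" "l g \<noteq> 0"
proof -
  have VL: "r \<in> V \<Longrightarrow> r \<in> L2 M" for r using V by blast
  define d where "d = (INF r\<in>V. (L2norm M (\<lambda>x. g x - r x))\<^sup>2)"
  have bdd: "bdd_below ((\<lambda>r. (L2norm M (\<lambda>x. g x - r x))\<^sup>2) ` V)" by (rule bdd_belowI2[of _ 0]) simp
  have dle: "d \<le> (L2norm M (\<lambda>x. g x - r x))\<^sup>2" if "r \<in> V" for r
    unfolding d_def by (rule cINF_lower[OF bdd that])
  have "\<delta>\<^sup>2 \<le> d"
    unfolding d_def using zero far \<open>0 < \<delta>\<close> by (intro cINF_greatest power_mono) auto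
  then have "0 < d" using zero_less_power[OF \<open>0 < \<delta>\<close>, of 2] by linarith
  have "\<exists>r\<in>V. (L2norm M (\<lambda>x. g x - r x))\<^sup>2 < d + 1 / real (Suc m)" for m
    proof -
    have "d < d + 1 / real (Suc m)" by simp
    then show ?thesis
      unfolding d_def using cINF_less_iff[OF _ bdd] zero by blast
  qed
  then obtain r where r: "\<And>m. r m \<in> V" "\<And>m. (L2norm M (\<lambda>x. g x - r m x))\<^sup>2 < d + 1 / real (Suc m)"
    by metis
  define e where "e m x = g x - r m x" for m x
  define q where "q m = sqrt (1 / real (Suc m))" for m
  have q0: "q \<longlonglongrightarrow> 0"
    unfolding q_def using tendsto_real_sqrt[OF LIMSEQ_Suc[OF lim_1_over_n]] by simp
  have qnn: "0 \<le> q m" for m by (simp add: q_def)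
  have eL: "e m \<in> L2 M" for m unfolding e_def[abs_def] by (intro L2_diff g VL r)
  \<comment> \<open>Moving \<open>r m\<close> inside V along h cannot lower the squared distance by
    more than 1/(m+1); minimising the resulting quadratic in t gives the bound.\<close>
  have orth: "\<bar>LINT x|M. e m x \<bullet> h x\<bar> \<le> q m * L2norm M h" if h: "h \<in> V" for m h
  proof -
    let ?i = "LINT x|M. e m x \<bullet> h x"
    have quad: "0 \<le> 1 / real (Suc m) + 2 * t * ?i + t\<^sup>2 * (L2norm M h)\<^sup>2" for t
    proof -
      have "(\<lambda>x. r m x + (- t) *\<^sub>R h x) \<in> V" by (intro add scale r h)
      from dle[OF this] have "d \<le> (L2norm M (\<lambda>x. e m x + t *\<^sub>R h x))\<^sup>2"
        by (simp add: e_def algebra_simps)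
      also have "\<dots> = (L2norm M (e m))\<^sup>2 + 2 * t * ?i + t\<^sup>2 * (L2norm M h)\<^sup>2"
        by (rule L2norm_add_sq[OF eL VL[OF h]])
      finally show ?thesis using r(2)[of m] unfolding e_def by linarith
    qed
    show ?thesis
    proof (cases "L2norm M h = 0")
      case True
      then show ?thesis using L2_Cauchy_Schwarz[OF eL VL[OF h], of m] by simp
    next
      case False
      let ?t = "- ?i / (L2norm M h)\<^sup>2"
      have "2 * ?t * ?i + ?t\<^sup>2 * (L2norm M h)\<^sup>2 = - (?i\<^sup>2 / (L2norm M h)\<^sup>2)"
        using False by (simp add: field_simps power2_eq_square)
      with quad[of ?t] have "?i\<^sup>2 / (L2norm M h)\<^sup>2 \<le> 1 / real (Suc m)" by linarith
      then have "?i\<^sup>2 \<le> 1 / real (Suc m) * (L2norm M h)\<^sup>2"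
        using False by (simp add: divide_le_eq)
      also have "\<dots> = (q m * L2norm M h)\<^sup>2"
        by (simp add: q_def power_mult_distrib)
      finally have "\<bar>?i\<bar> \<le> \<bar>q m * L2norm M h\<bar>" by (simp only: abs_le_square_iff)
      then show ?thesis using qnn[of m] by (simp add: L2norm_nonneg)
    qed
  qed
  \<comment> \<open>Differences of residuals lie in V, so \<open>orth\<close> applies to them; this
    is the source of the Cauchy property.\<close>
  have eV: "(\<lambda>x. e m x - e n x) \<in> V" for m n
    using add[OF r(1)[of n] scale[OF r(1)[of m], of "-1"]] by (simp add: e_def)
  have cauchy: "L2norm M (\<lambda>x. e m x - e n x) \<le> q m + q n" for m n
  proof -
    let ?h = "\<lambda>x. e m x - e n x"
    have "(L2norm M ?h)\<^sup>2 = (LINT x|M. e m x \<bullet> ?h x - e n x \<bullet> ?h x)"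
      by (simp add: L2norm_sq inner_diff_left)
    also have "\<dots> = (LINT x|M. e m x \<bullet> ?h x) - (LINT x|M. e n x \<bullet> ?h x)"
      by (intro Bochner_Integration.integral_diff L2_inner_integrable eL VL eV)
    also have "\<dots> \<le> (q m + q n) * L2norm M ?h"
      using orth[OF eV[of m n], of m] orth[OF eV[of m n], of n] by (simp add: distrib_right)
    finally have "L2norm M ?h * L2norm M ?h \<le> (q m + q n) * L2norm M ?h"
      by (simp add: power2_eq_square)
    then show ?thesis
      using L2norm_nonneg[of M ?h] qnn[of m] qnn[of n]
      by (cases "L2norm M ?h = 0") auto
  qed
  have conv: "convergent (\<lambda>m. LINT x|M. e m x \<bullet> f x)" if f: "f \<in> L2 M" for f
  proof (rule Cauchy_convergent, rule CauchyI)
    fix \<epsilon> :: real assume "0 < \<epsilon>"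
    \<comment> \<open>Adding 1 avoids division by a vanishing norm.\<close>
    define S where "S = L2norm M f + 1"
    let ?b = "\<epsilon> / (2 * S)"
    have n1: "0 < S" using L2norm_nonneg[of M f] unfolding S_def by linarith
    have "0 < ?b" using \<open>0 < \<epsilon>\<close> n1 by simp
    then obtain N where N: "\<And>m. N \<le> m \<Longrightarrow> q m < ?b"
      using order_tendstoD(2)[OF q0] by (auto simp: eventually_sequentially)
    show "\<exists>N. \<forall>m\<ge>N. \<forall>n\<ge>N. norm ((LINT x|M. e m x \<bullet> f x) - (LINT x|M. e n x \<bullet> f x)) < \<epsilon>"
    proof (intro exI allI impI)
      fix m n assume mn: "N \<le> m" "N \<le> n"
      have "(LINT x|M. e m x \<bullet> f x) - (LINT x|M. e n x \<bullet> f x) = (LINT x|M. (e m x - e n x) \<bullet> f x)"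
        unfolding inner_diff_left
        by (intro Bochner_Integration.integral_diff[symmetric] L2_inner_integrable eL f)
      then have "norm ((LINT x|M. e m x \<bullet> f x) - (LINT x|M. e n x \<bullet> f x)) \<le> L2norm M (\<lambda>x. e m x - e n x) * L2norm M f"
        using L2_Cauchy_Schwarz[OF L2_diff[OF eL eL] f] by simp
      also have "\<dots> \<le> (q m + q n) * L2norm M f"
        by (intro mult_right_mono cauchy L2norm_nonneg)
      also have "\<dots> \<le> (q m + q n) * S"
        using qnn[of m] qnn[of n] unfolding S_def by (intro mult_left_mono) auto
      also have "\<dots> < (?b + ?b) * S"
        using N mn n1 by (intro mult_strict_right_mono add_strict_mono) auto
      also have "\<dots> = \<epsilon>" using n1 by (simp add: field_simps)
      finally show "norm ((LINT x|M. e m x \<bullet> f x) - (LINT x|M. e n x \<bullet> f x)) < \<epsilon>" .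
    qed
  qed
  define l where "l f = lim (\<lambda>m. LINT x|M. e m x \<bullet> f x)" for f
  have l: "(\<lambda>m. LINT x|M. e m x \<bullet> f x) \<longlonglongrightarrow> l f" if "f \<in> L2 M" for f
    using conv[OF that] unfolding l_def by (simp add: convergent_LIMSEQ_iff)
  have eb: "L2norm M (e m) \<le> sqrt (d + 1)" for m
  proof (rule real_le_rsqrt)
    have "1 / real (Suc m) \<le> 1" by simp
    with r(2)[of m] show "(L2norm M (e m))\<^sup>2 \<le> d + 1" unfolding e_def by linarith
  qed
  show ?thesis
  proof (rule that[of l "sqrt (d + 1)"])
    fix f h :: "'x \<Rightarrow> 'a" assume fh: "f \<in> L2 M" "h \<in> L2 M"
    have "(LINT x|M. e m x \<bullet> (f x + h x)) = (LINT x|M. e m x \<bullet> f x) + (LINT x|M. e m x \<bullet> h x)" for m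
      unfolding inner_add_right by (intro Bochner_Integration.integral_add L2_inner_integrable eL fh)
    with tendsto_add[OF l[OF fh(1)] l[OF fh(2)]] l[OF L2_add[OF fh]]
    show "l (\<lambda>x. f x + h x) = l f + l h" by (simp add: LIMSEQ_unique)
  next
    fix f :: "'x \<Rightarrow> 'a" and c assume f: "f \<in> L2 M"
    have "(LINT x|M. e m x \<bullet> (c *\<^sub>R f x)) = c * (LINT x|M. e m x \<bullet> f x)" for m by simp
    with tendsto_mult_left[OF l[OF f], of c] l[OF L2_scaleR[OF f, of c]]
    show "l (\<lambda>x. c *\<^sub>R f x) = c * l f" by (simp add: LIMSEQ_unique)
  next
    fix f :: "'x \<Rightarrow> 'a" assume f: "f \<in> L2 M"
    show "\<bar>l f\<bar> \<le> sqrt (d + 1) * L2norm M f"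
    proof (rule LIMSEQ_le_const2[OF tendsto_rabs[OF l[OF f]]], intro exI allI impI)
      fix m
      have "\<bar>LINT x|M. e m x \<bullet> f x\<bar> \<le> L2norm M (e m) * L2norm M f"
        by (rule L2_Cauchy_Schwarz[OF eL f])
      also have "\<dots> \<le> sqrt (d + 1) * L2norm M f" by (intro mult_right_mono eb L2norm_nonneg)
      finally show "\<bar>LINT x|M. e m x \<bullet> f x\<bar> \<le> sqrt (d + 1) * L2norm M f" .
    qed
  next
    fix h assume h: "h \<in> V"
    have "(\<lambda>m. LINT x|M. e m x \<bullet> h x) \<longlonglongrightarrow> 0"
    proof (rule Lim_null_comparison)
      show "\<forall>\<^sub>F m in sequentially. norm (LINT x|M. e m x \<bullet> h x) \<le> q m * L2norm M h"
        using orth[OF h] by simp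
      show "(\<lambda>m. q m * L2norm M h) \<longlonglongrightarrow> 0" by (rule tendsto_mult_left_zero[OF q0])
    qed
    from LIMSEQ_unique[OF l[OF VL[OF h]] this] show "l h = 0" .
  next
    let ?B = "L2norm M g + sqrt (d + 1)"
    \<comment> \<open>The pairing of \<open>e m\<close> with g is the squared norm of
      \<open>e m\<close>, which is at least d, plus its pairing with \<open>r m\<close> in V, which
      tends to 0.\<close>
    have "d \<le> l g"
    proof (rule LIMSEQ_le)
      show "(\<lambda>m. LINT x|M. e m x \<bullet> g x) \<longlonglongrightarrow> l g" by (rule l[OF g])
      have "(\<lambda>m. d - q m * ?B) \<longlonglongrightarrow> d - 0 * ?B" by (intro tendsto_intros q0)
      then show "(\<lambda>m. d - q m * ?B) \<longlonglongrightarrow> d" by simp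
      show "\<exists>N. \<forall>m\<ge>N. d - q m * ?B \<le> (LINT x|M. e m x \<bullet> g x)"
      proof (intro exI allI impI)
        fix m
        have "(LINT x|M. e m x \<bullet> g x) = (LINT x|M. e m x \<bullet> e m x + e m x \<bullet> r m x)"
          by (simp add: e_def inner_diff_right)
        also have "\<dots> = (L2norm M (e m))\<^sup>2 + (LINT x|M. e m x \<bullet> r m x)"
          unfolding L2norm_sq by (intro Bochner_Integration.integral_add L2_inner_integrable eL VL r)
        finally have 1: "(LINT x|M. e m x \<bullet> g x) = (L2norm M (e m))\<^sup>2 + (LINT x|M. e m x \<bullet> r m x)" .
        have "r m = (\<lambda>x. g x + (- 1) *\<^sub>R e m x)" by (simp add: e_def fun_eq_iff)
        then have "L2norm M (r m) \<le> L2norm M g + L2norm M (\<lambda>x. (- 1) *\<^sub>R e m x)"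
          using L2norm_triangle[OF g L2_scaleR[OF eL[of m], of "-1"]] by simp
        also have "L2norm M (\<lambda>x. (- 1) *\<^sub>R e m x) = L2norm M (e m)"
          by (simp only: L2norm_scaleR abs_minus_cancel abs_one mult_1)
        finally have "q m * L2norm M (r m) \<le> q m * ?B" using eb[of m] qnn[of m] by (intro mult_left_mono) auto
        moreover have "d \<le> (L2norm M (e m))\<^sup>2" using dle[OF r(1), of m] by (simp add: e_def[abs_def])
        ultimately show "d - q m * ?B \<le> (LINT x|M. e m x \<bullet> g x)"
          using orth[OF r(1), of m m] unfolding 1 by linarith
      qed
    qed
    with \<open>0 < d\<close> show "l g \<noteq> 0" by simp
  qed
qed

section \<open>Sobolev spaces\<close>

text \<open>The derivative hidden by the existential quantifier in \<open>H10\<close> is exposed,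
  because the coefficient identities below relate f to it.\<close>

definition H10_deriv :: "(real \<Rightarrow> 'a::euclidean_space) \<Rightarrow> (real \<Rightarrow> 'a) \<Rightarrow> bool" where
  "H10_deriv f g \<longleftrightarrow> weak_deriv f g \<and>
     (\<forall>\<epsilon>>0. \<exists>\<phi> \<phi>'. C1c \<phi> \<phi>' \<and>
        L2norm Om (\<lambda>x. f x - \<phi> x) < \<epsilon> \<and> L2norm Om (\<lambda>x. g x - \<phi>' x) < \<epsilon>)"

lemma H10_iff: "f \<in> H10 \<longleftrightarrow> (\<exists>g. H10_deriv f g)"
  by (simp add: H10_def H10_deriv_def)

lemma weak_derivD: "weak_deriv f g \<Longrightarrow> f \<in> L2 Om" "weak_deriv f g \<Longrightarrow> g \<in> L2 Om"
  by (auto simp: weak_deriv_def)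

lemma H10_derivD: "H10_deriv f g \<Longrightarrow> weak_deriv f g" "H10_deriv f g \<Longrightarrow> f \<in> L2 Om" "H10_deriv f g \<Longrightarrow> g \<in> L2 Om"
  by (auto simp: H10_deriv_def weak_deriv_def)

lemma C1c_continuous: "C1c \<phi> \<phi>' \<Longrightarrow> continuous_on S \<phi>" "C1c \<phi> \<phi>' \<Longrightarrow> continuous_on S \<phi>'"
  unfolding C1c_def
  by (auto intro: continuous_at_imp_continuous_on has_vector_derivative_continuous continuous_on_subset)

lemma C1c_L2: "C1c \<phi> \<phi>' \<Longrightarrow> \<phi> \<in> L2 Om" "C1c \<phi> \<phi>' \<Longrightarrow> \<phi>' \<in> L2 Om"
  by (auto intro: L2_continuous C1c_continuous)

lemma C1c_boundary: "C1c \<phi> \<phi>' \<Longrightarrow> \<phi> 0 = 0" "C1c \<phi> \<phi>' \<Longrightarrow> \<phi> pi = 0"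
  unfolding C1c_def by force+

lemma integral_product_derivative:
  fixes f f' :: "real \<Rightarrow> 'a::euclidean_space" and \<phi> \<phi>' :: "real \<Rightarrow> real"
  assumes f: "\<And>x. (f has_vector_derivative f' x) (at x)" "continuous_on UNIV f'"
    and \<phi>: "\<And>x. (\<phi> has_vector_derivative \<phi>' x) (at x)" "continuous_on UNIV \<phi>'"
  shows "(LINT x|Om. \<phi>' x *\<^sub>R f x) = (\<phi> pi *\<^sub>R f pi - \<phi> 0 *\<^sub>R f 0) - (LINT x|Om. \<phi> x *\<^sub>R f' x)"
proof -
  have c: "continuous_on {0..pi} f" "continuous_on {0..pi} \<phi>" "continuous_on {0..pi} f'" "continuous_on {0..pi} \<phi>'"
    using f \<phi> by (auto intro: continuous_at_imp_continuous_on has_vector_derivative_continuous continuous_on_subset)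
  have "(LINT x|Om. \<phi> x *\<^sub>R f' x + \<phi>' x *\<^sub>R f x) = \<phi> pi *\<^sub>R f pi - \<phi> 0 *\<^sub>R f 0"
  proof (rule leb_FTC)
    fix x
    have "(\<phi> has_real_derivative \<phi>' x) (at x within {0..pi})"
      using \<phi>(1)[of x] by (auto simp: has_real_derivative_iff_has_vector_derivative
          intro: has_vector_derivative_at_within)
    then show "((\<lambda>x. \<phi> x *\<^sub>R f x) has_vector_derivative \<phi> x *\<^sub>R f' x + \<phi>' x *\<^sub>R f x) (at x within {0..pi})"
      by (rule has_vector_derivative_scaleR) (auto intro: has_vector_derivative_at_within f)
  qed (auto intro!: continuous_intros c)
  moreover have "(LINT x|Om. \<phi> x *\<^sub>R f' x + \<phi>' x *\<^sub>R f x) = (LINT x|Om. \<phi> x *\<^sub>R f' x) + (LINT x|Om. \<phi>' x *\<^sub>R f x)"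
    by (intro Bochner_Integration.integral_add leb_continuous continuous_intros c)
  ultimately show ?thesis by (simp add: algebra_simps)
qed

lemma weak_deriv_C1:
  fixes f f' :: "real \<Rightarrow> 'a::euclidean_space"
  assumes f: "\<And>x. (f has_vector_derivative f' x) (at x)" "continuous_on UNIV f'"
  shows "weak_deriv f f'"
  unfolding weak_deriv_def
proof (intro conjI allI impI)
  show "f \<in> L2 Om" "f' \<in> L2 Om"
    using f by (auto intro!: L2_continuous intro: continuous_at_imp_continuous_on
        has_vector_derivative_continuous continuous_on_subset)
  fix \<phi> \<phi>' :: "real \<Rightarrow> real" assume "C1c \<phi> \<phi>'"
  then show "(LINT x|Om. \<phi>' x *\<^sub>R f x) = - (LINT x|Om. \<phi> x *\<^sub>R f' x)"
    using integral_product_derivative[OF f, of \<phi> \<phi>'] C1c_boundary[of \<phi> \<phi>'] by (auto simp: C1c_def)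
qed

section \<open>C1 functions that vanish at the end points\<close>

lemma has_real_derivative_max_0_square:
  "((\<lambda>t. (max 0 t)\<^sup>2) has_real_derivative 2 * max 0 t) (at t)" for t :: real
proof -
  consider "t < 0" | "t = 0" | "0 < t" by linarith
  then show ?thesis
  proof cases
    case 1
    have "((\<lambda>t. 0) has_real_derivative 2 * max 0 t) (at t)" using 1 by simp
    then show ?thesis
      by (rule has_field_derivative_transform_within_open[of _ _ _ "{..<0}"]) (use 1 in auto)
  next
    case 3
    have "((\<lambda>t. t\<^sup>2) has_real_derivative 2 * max 0 t) (at t)"
      using 3 by (auto intro!: derivative_eq_intros)
    then show ?thesis
      by (rule has_field_derivative_transform_within_open[of _ _ _ "{0<..}"]) (use 3 in auto)
  next
    case 2
    have "(\<lambda>h. ((max 0 (0 + h))\<^sup>2 - (max 0 0)\<^sup>2) / h) \<midarrow>0\<rightarrow> (0::real)"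
    proof (rule Lim_null_comparison)
      show "\<forall>\<^sub>F h in at 0. norm (((max 0 (0 + h))\<^sup>2 - (max 0 0)\<^sup>2) / h) \<le> \<bar>h::real\<bar>"
        by (auto simp: max_def power2_eq_square intro!: always_eventually)
      show "(\<lambda>h::real. \<bar>h\<bar>) \<midarrow>0\<rightarrow> 0" by (auto intro!: tendsto_eq_intros)
    qed
    with 2 show ?thesis by (simp add: DERIV_def)
  qed
qed

text \<open>Test functions are only C1, so squares of \<open>max 0 t\<close> suffice: with m this
  square, \<open>1 - m (1 - m (s - 1))\<close> rises from 0 to 1 on [1,2]. The bound 4 is a product
  of two slopes of m, each at most 2 there.\<close>

lemma smooth_cutoff:
  obtains \<eta> \<eta>' :: "real \<Rightarrow> real" where
    "\<And>s. (\<eta> has_real_derivative \<eta>' s) (at s)" "continuous_on UNIV \<eta>'"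
    "\<And>s. s \<le> 1 \<Longrightarrow> \<eta> s = 0" "\<And>s. 2 \<le> s \<Longrightarrow> \<eta> s = 1" "\<And>s. 0 \<le> \<eta> s" "\<And>s. \<eta> s \<le> 1"
    "\<And>s. \<bar>\<eta>' s\<bar> \<le> 4" "\<And>s. s \<notin> {1..2} \<Longrightarrow> \<eta>' s = 0"
proof -
  define m m' where "m t = (max 0 t)\<^sup>2" and "m' t = 2 * max 0 t" for t :: real
  have dm: "(m has_real_derivative m' t) (at t)" for t
    unfolding m_def[abs_def] m'_def by (rule has_real_derivative_max_0_square)
  define \<eta> where "\<eta> s = 1 - m (1 - m (s - 1))" for s
  define \<eta>' where "\<eta>' s = m' (1 - m (s - 1)) * m' (s - 1)" for s
  have mm: "0 \<le> m t" "t \<le> 0 \<Longrightarrow> m t = 0" "1 \<le> t \<Longrightarrow> 1 \<le> m t" "0 \<le> t \<Longrightarrow> t \<le> 1 \<Longrightarrow> m t \<le> 1" for t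
    by (auto simp: m_def intro: power_le_one)
  have m1: "t \<le> 1 \<Longrightarrow> m t \<le> 1" for t using mm(2,4)[of t] by (cases "0 \<le> t") auto
  show ?thesis
  proof (rule that[of \<eta> \<eta>'])
    fix s :: real
    show "(\<eta> has_real_derivative \<eta>' s) (at s)"
      unfolding \<eta>_def[abs_def] \<eta>'_def
      by (rule derivative_eq_intros DERIV_chain'[OF _ dm] refl)+ simp
    show "0 \<le> \<eta> s" unfolding \<eta>_def using m1[of "1 - m (s - 1)"] mm(1)[of "s - 1"] by simp
    show "\<eta> s \<le> 1" unfolding \<eta>_def using mm(1) by simp
    show "s \<le> 1 \<Longrightarrow> \<eta> s = 0" by (simp add: \<eta>_def m_def)
    show "2 \<le> s \<Longrightarrow> \<eta> s = 1" using mm(3)[of "s - 1"] by (simp add: \<eta>_def mm(2))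
    show out: "s \<notin> {1..2} \<Longrightarrow> \<eta>' s = 0"
      using mm(3)[of "s - 1"] by (auto simp: \<eta>'_def m'_def max_def)
    show "\<bar>\<eta>' s\<bar> \<le> 4"
    proof (cases "s \<in> {1..2}")
      case True
      have "0 \<le> m' (1 - m (s - 1))" "m' (1 - m (s - 1)) \<le> 2" "0 \<le> m' (s - 1)" "m' (s - 1) \<le> 2"
        using True mm(1)[of "s - 1"] by (auto simp: m'_def)
      then have "m' (1 - m (s - 1)) * m' (s - 1) \<le> 2 * 2"
        by (intro mult_mono) auto
      moreover have "0 \<le> m' (1 - m (s - 1)) * m' (s - 1)"
        by (intro mult_nonneg_nonneg) (simp_all add: m'_def)
      ultimately show ?thesis by (simp add: \<eta>'_def)
    qed (simp add: out)
  next
    show "continuous_on UNIV \<eta>'"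
      unfolding \<eta>'_def m'_def m_def by (intro continuous_intros)
  qed
qed

text \<open>f is multiplied by a cutoff acting at distance about 1/(j+1) from both end points. The
  derivative of the cutoff grows like j+1, but only where f, being Lipschitz and zero at the end
  points, has size about 1/(j+1). So the extra term stays bounded, and dominated convergence
  applies.\<close>

lemma H10_deriv_C1:
  fixes f f' :: "real \<Rightarrow> 'a::euclidean_space"
  assumes f: "\<And>x. (f has_vector_derivative f' x) (at x)" "continuous_on UNIV f'"
    and f0: "f 0 = 0" "f pi = 0"
  shows "H10_deriv f f'"
proof -
  obtain \<eta> \<eta>' :: "real \<Rightarrow> real" where
    d\<eta>: "\<And>s. (\<eta> has_real_derivative \<eta>' s) (at s)" and c\<eta>: "continuous_on UNIV \<eta>'" and
    \<eta>: "\<And>s. s \<le> 1 \<Longrightarrow> \<eta> s = 0" "\<And>s. 2 \<le> s \<Longrightarrow> \<eta> s = 1" "\<And>s. 0 \<le> \<eta> s" "\<And>s. \<eta> s \<le> 1"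
    "\<And>s. \<bar>\<eta>' s\<bar> \<le> 4" "\<And>s. s \<notin> {1..2} \<Longrightarrow> \<eta>' s = 0"
    using smooth_cutoff by blast
  have cf: "continuous_on S f" "continuous_on S f'" for S
    using f by (auto intro: continuous_at_imp_continuous_on has_vector_derivative_continuous continuous_on_subset)
  have "bounded (f' ` {0..pi})"
    by (rule compact_imp_bounded[OF compact_continuous_image[OF cf(2) compact_Icc]])
  then obtain L where "\<forall>y\<in>f' ` {0..pi}. norm y \<le> L" unfolding bounded_iff by blast
  then have L: "\<And>x. x \<in> {0..pi} \<Longrightarrow> norm (f' x) \<le> L" by blast
  have "0 \<le> L" using order_trans[OF norm_ge_zero L[of 0]] by simp
  have lip: "norm (f x - f y) \<le> L * \<bar>x - y\<bar>" if "x \<in> {0..pi}" "y \<in> {0..pi}" for x y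
  proof -
    have "norm (f x - f y) \<le> L * norm (x - y)"
    proof (rule differentiable_bound[of "{0..pi}"])
      fix t assume t: "t \<in> {0..pi}"
      show "(f has_derivative (\<lambda>h. h *\<^sub>R f' t)) (at t within {0..pi})"
        using f(1)[of t] unfolding has_vector_derivative_def by (rule has_derivative_at_withinI)
      show "onorm (\<lambda>h. h *\<^sub>R f' t) \<le> L"
      proof (rule onorm_le)
        fix h :: real
        have "norm (f' t) * \<bar>h\<bar> \<le> L * \<bar>h\<bar>" by (intro mult_right_mono L t) simp
        then show "norm (h *\<^sub>R f' t) \<le> L * norm h" by (simp add: mult.commute)
      qed
    qed (use that in auto)
    then show ?thesis by simp
  qed
  define \<theta> where "\<theta> j x = \<eta> (real (Suc j) * x) * \<eta> (real (Suc j) * (pi - x))" for j x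
  define \<theta>' where "\<theta>' j x = \<eta> (real (Suc j) * x) * (- real (Suc j) * \<eta>' (real (Suc j) * (pi - x)))
      + real (Suc j) * \<eta>' (real (Suc j) * x) * \<eta> (real (Suc j) * (pi - x))" for j x
  have d\<theta>: "(\<theta> j has_real_derivative \<theta>' j x) (at x)" for j x
    unfolding \<theta>_def[abs_def] \<theta>'_def
    by (rule derivative_eq_intros DERIV_chain'[OF _ d\<eta>] refl)+ simp
  have c\<eta>0: "continuous_on UNIV \<eta>"
    by (intro continuous_at_imp_continuous_on ballI DERIV_isCont[OF d\<eta>])
  have cc: "continuous_on UNIV (\<lambda>x. \<eta> (g x))" "continuous_on UNIV (\<lambda>x. \<eta>' (g x))"
    if "continuous_on UNIV g" for g :: "real \<Rightarrow> real"
    using that by (auto intro: continuous_on_compose2[OF c\<eta>0] continuous_on_compose2[OF c\<eta>])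
  have c\<theta>: "continuous_on UNIV (\<theta> j)" "continuous_on UNIV (\<theta>' j)" for j
    unfolding \<theta>_def \<theta>'_def by (intro continuous_intros cc)+
  have \<theta>01: "0 \<le> \<theta> j x" "\<theta> j x \<le> 1" for j x
    unfolding \<theta>_def using \<eta>(3,4) by (auto intro: mult_nonneg_nonneg mult_le_one)
  let ?\<phi> = "\<lambda>j x. \<theta> j x *\<^sub>R f x" and ?\<phi>' = "\<lambda>j x. \<theta> j x *\<^sub>R f' x + \<theta>' j x *\<^sub>R f x"
  have C: "C1c (?\<phi> j) (?\<phi>' j)" for j
    unfolding C1c_def
  proof (intro conjI allI)
    show "(?\<phi> j has_vector_derivative ?\<phi>' j x) (at x)" for x
      by (intro has_vector_derivative_scaleR d\<theta> f)
    show "continuous_on UNIV (?\<phi>' j)" by (intro continuous_intros c\<theta> cf)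
    \<comment> \<open>Closer than \<open>?h\<close> to an end point, one of the two arguments of
      \<eta> is at most 1, where \<eta> vanishes.\<close>
    let ?h = "1 / real (Suc j)"
    show "\<exists>a b. 0 < a \<and> b < pi \<and> (\<forall>x. x \<notin> {a..b} \<longrightarrow> ?\<phi> j x = 0)"
    proof (intro exI conjI allI impI)
      show "0 < ?h" "pi - ?h < pi" by simp_all
      fix x assume "x \<notin> {?h..pi - ?h}"
      then have "real (Suc j) * x \<le> 1 \<or> real (Suc j) * (pi - x) \<le> 1"
        by (auto simp: field_simps not_le)
      then show "?\<phi> j x = 0" using \<eta>(1) by (auto simp: \<theta>_def)
    qed
  qed
  have ev: "\<forall>\<^sub>F j in sequentially. \<theta> j x = 1 \<and> \<theta>' j x = 0" if "x \<in> {0<..<pi}" for x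
  proof -
    have big: "\<forall>\<^sub>F j in sequentially. 2 < real (Suc j) * t" if t: "0 < t" for t
    proof -
      have "filterlim (\<lambda>j. real (Suc j) * t) at_top sequentially"
        using t by (intro filterlim_at_top_mult_tendsto_pos[OF tendsto_const]
            filterlim_compose[OF filterlim_real_sequentially filterlim_Suc]) auto
      then show ?thesis by (simp add: filterlim_at_top_dense)
    qed
    have "0 < x" "0 < pi - x" using that by auto
    from big[OF this(1)] big[OF this(2)] show ?thesis
      by eventually_elim (simp add: \<theta>_def \<theta>'_def \<eta>)
  qed
  have bd': "norm (\<theta>' j x *\<^sub>R f x) \<le> 16 * L" if x: "x \<in> {0<..<pi}" for j x
  proof -
    \<comment> \<open>\<open>\<eta>'\<close> lives where \<open>real (Suc j) * t\<close> is in
      [1,2], so the factor \<open>real (Suc j)\<close> is paid for by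
      \<open>norm (f x) \<le> L * t\<close>: 4 times 2 gives 8 for each end point, 16 in
      all.\<close>
    have one: "real (Suc j) * \<bar>\<eta>' (real (Suc j) * t)\<bar> * norm (f x) \<le> 8 * L"
      if t: "0 < t" "norm (f x) \<le> L * t" for t
    proof (cases "real (Suc j) * t \<in> {1..2}")
      case True
      have "real (Suc j) * \<bar>\<eta>' (real (Suc j) * t)\<bar> * norm (f x) \<le> real (Suc j) * 4 * (L * t)"
        by (intro mult_mono mult_left_mono \<eta> t) auto
      also have "\<dots> = 4 * L * (real (Suc j) * t)" by (simp add: algebra_simps)
      also have "\<dots> \<le> 4 * L * 2" using True \<open>0 \<le> L\<close> by (intro mult_left_mono) auto
      finally show ?thesis by simp
    next
      case False
      then show ?thesis using \<eta>(6) \<open>0 \<le> L\<close> by simp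
    qed
    have "norm (f x) \<le> L * x" using lip[of x 0] x f0 by simp
    moreover have "norm (f x) \<le> L * (pi - x)" using lip[of x pi] x f0 by simp
    ultimately have 1: "real (Suc j) * \<bar>\<eta>' (real (Suc j) * x)\<bar> * norm (f x) \<le> 8 * L"
      "real (Suc j) * \<bar>\<eta>' (real (Suc j) * (pi - x))\<bar> * norm (f x) \<le> 8 * L"
      using x by (auto intro!: one simp del: of_nat_Suc)
    have "\<bar>\<theta>' j x\<bar> \<le> 1 * (real (Suc j) * \<bar>\<eta>' (real (Suc j) * (pi - x))\<bar>) + real (Suc j) * \<bar>\<eta>' (real (Suc j) * x)\<bar> * 1"
    proof -
      define N where "N = real (Suc j)"
      have "0 \<le> N" by (simp add: N_def)
      let ?a = "N * x" and ?b = "N * (pi - x)"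
      have "\<bar>\<theta>' j x\<bar> \<le> \<bar>\<eta> ?a * (- N * \<eta>' ?b)\<bar> + \<bar>N * \<eta>' ?a * \<eta> ?b\<bar>"
        unfolding \<theta>'_def N_def by (rule abs_triangle_ineq)
      also have "\<dots> = \<eta> ?a * (N * \<bar>\<eta>' ?b\<bar>) + N * \<bar>\<eta>' ?a\<bar> * \<eta> ?b"
        using \<open>0 \<le> N\<close> \<eta>(3) by (simp add: abs_mult)
      also have "\<dots> \<le> 1 * (N * \<bar>\<eta>' ?b\<bar>) + N * \<bar>\<eta>' ?a\<bar> * 1"
        using \<open>0 \<le> N\<close> by (intro add_mono mult_right_mono mult_left_mono \<eta>(4)) auto
      finally show ?thesis unfolding N_def .
    qed
    then have "\<bar>\<theta>' j x\<bar> * norm (f x) \<le> (1 * (real (Suc j) * \<bar>\<eta>' (real (Suc j) * (pi - x))\<bar>) + real (Suc j) * \<bar>\<eta>' (real (Suc j) * x)\<bar> * 1) * norm (f x)"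
      by (intro mult_right_mono) auto
    with 1 show ?thesis by (simp add: distrib_right)
  qed
  have lim1: "(\<lambda>j. L2norm Om (\<lambda>x. ?\<phi> j x - f x)) \<longlonglongrightarrow> 0"
  proof (rule L2_dominated_convergence)
    show "?\<phi> j \<in> borel_measurable Om" for j by (rule L2_measurable[OF C1c_L2(1)[OF C]])
    show "f \<in> borel_measurable Om" by (intro L2_measurable L2_continuous cf)
    show "(\<lambda>x. norm (f x)) \<in> L2 Om" by (intro L2_continuous continuous_intros cf)
    show "AE x in Om. (\<lambda>j. ?\<phi> j x) \<longlonglongrightarrow> f x"
      by (intro AE_I2 tendsto_eventually eventually_mono[OF ev]) auto
    show "AE x in Om. norm (?\<phi> j x - f x) \<le> \<bar>norm (f x)\<bar>" for j
    proof (intro AE_I2)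
      fix x
      have "?\<phi> j x - f x = (\<theta> j x - 1) *\<^sub>R f x" by (simp add: algebra_simps)
      then show "norm (?\<phi> j x - f x) \<le> \<bar>norm (f x)\<bar>" using \<theta>01[of j x] by (simp add: mult_left_le_one_le)
    qed
  qed
  have lim2: "(\<lambda>j. L2norm Om (\<lambda>x. ?\<phi>' j x - f' x)) \<longlonglongrightarrow> 0"
  proof (rule L2_dominated_convergence)
    show "?\<phi>' j \<in> borel_measurable Om" for j by (rule L2_measurable[OF C1c_L2(2)[OF C]])
    show "f' \<in> borel_measurable Om" by (intro L2_measurable L2_continuous cf)
    show "(\<lambda>x. norm (f' x) + 16 * L) \<in> L2 Om" by (intro L2_continuous continuous_intros cf)
    show "AE x in Om. (\<lambda>j. ?\<phi>' j x) \<longlonglongrightarrow> f' x"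
      by (intro AE_I2 tendsto_eventually eventually_mono[OF ev]) auto
    show "AE x in Om. norm (?\<phi>' j x - f' x) \<le> \<bar>norm (f' x) + 16 * L\<bar>" for j
    proof (intro AE_I2)
      fix x assume x: "x \<in> space Om"
      have "?\<phi>' j x - f' x = (\<theta> j x - 1) *\<^sub>R f' x + \<theta>' j x *\<^sub>R f x" by (simp add: algebra_simps)
      then have "norm (?\<phi>' j x - f' x) \<le> norm ((\<theta> j x - 1) *\<^sub>R f' x) + norm (\<theta>' j x *\<^sub>R f x)"
        by (simp only: norm_triangle_ineq)
      also have "\<dots> \<le> norm (f' x) + 16 * L"
        using \<theta>01[of j x] bd'[of x j] x by (intro add_mono) (simp_all add: mult_left_le_one_le)
      finally show "norm (?\<phi>' j x - f' x) \<le> \<bar>norm (f' x) + 16 * L\<bar>" by linarith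
    qed
  qed
  show ?thesis
    unfolding H10_deriv_def
  proof (intro conjI allI impI weak_deriv_C1 f)
    fix \<epsilon> :: real assume "0 < \<epsilon>"
    then have "\<forall>\<^sub>F j in sequentially. L2norm Om (\<lambda>x. ?\<phi> j x - f x) < \<epsilon> \<and> L2norm Om (\<lambda>x. ?\<phi>' j x - f' x) < \<epsilon>"
      using order_tendstoD(2)[OF lim1] order_tendstoD(2)[OF lim2] by (intro eventually_conj) auto
    then obtain j where "L2norm Om (\<lambda>x. ?\<phi> j x - f x) < \<epsilon>" "L2norm Om (\<lambda>x. ?\<phi>' j x - f' x) < \<epsilon>"
      by (auto simp: eventually_sequentially)
    then show "\<exists>\<phi> \<phi>'. C1c \<phi> \<phi>' \<and> L2norm Om (\<lambda>x. f x - \<phi> x) < \<epsilon> \<and> L2norm Om (\<lambda>x. f' x - \<phi>' x) < \<epsilon>"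
      using C[of j] by (intro exI[of _ "?\<phi> j"] exI[of _ "?\<phi>' j"]) (simp add: L2norm_minus_commute[of _ f] L2norm_minus_commute[of _ f'])
  qed
qed

lemma H10_deriv_sequence:
  fixes f g :: "real \<Rightarrow> 'a::euclidean_space"
  assumes "H10_deriv f g"
  obtains \<phi> \<phi>' where "\<And>n. C1c (\<phi> n) (\<phi>' n)"
    "(\<lambda>n. L2norm Om (\<lambda>x. \<phi> n x - f x)) \<longlonglongrightarrow> 0" "(\<lambda>n. L2norm Om (\<lambda>x. \<phi>' n x - g x)) \<longlonglongrightarrow> 0"
proof -
  have "\<exists>\<phi> \<phi>'. C1c \<phi> \<phi>' \<and> L2norm Om (\<lambda>x. f x - \<phi> x) < 1 / real (Suc n) \<and> L2norm Om (\<lambda>x. g x - \<phi>' x) < 1 / real (Suc n)" for n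
  proof -
    have "0 < 1 / real (Suc n)" by simp
    with assms show ?thesis unfolding H10_deriv_def by blast
  qed
  then obtain \<phi> \<phi>' where *: "\<And>n. C1c (\<phi> n) (\<phi>' n)"
    "\<And>n. L2norm Om (\<lambda>x. f x - \<phi> n x) < 1 / real (Suc n)" "\<And>n. L2norm Om (\<lambda>x. g x - \<phi>' n x) < 1 / real (Suc n)"
    by metis
  have "(\<lambda>n. L2norm Om (\<lambda>x. \<phi> n x - f x)) \<longlonglongrightarrow> 0"
    by (rule tendsto_sandwich[OF _ _ tendsto_const LIMSEQ_Suc[OF lim_1_over_n]])
      (use *(2) in \<open>auto simp: L2norm_nonneg L2norm_minus_commute[of _ f] intro!: always_eventually less_imp_le\<close>)
  moreover have "(\<lambda>n. L2norm Om (\<lambda>x. \<phi>' n x - g x)) \<longlonglongrightarrow> 0"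
    by (rule tendsto_sandwich[OF _ _ tendsto_const LIMSEQ_Suc[OF lim_1_over_n]])
      (use *(3) in \<open>auto simp: L2norm_nonneg L2norm_minus_commute[of _ g] intro!: always_eventually less_imp_le\<close>)
  ultimately show ?thesis using that[of \<phi> \<phi>', OF *(1)] by blast
qed

section \<open>Fourier coefficients of weak derivatives\<close>

lemma trig_has_vector_derivative:
  "((\<lambda>x. sin (real k * x)) has_vector_derivative real k * cos (real k * x)) (at x)"
  "((\<lambda>x. cos (real k * x)) has_vector_derivative - real k * sin (real k * x)) (at x)"
  unfolding has_real_derivative_iff_has_vector_derivative[symmetric]
  by (auto intro!: derivative_eq_intros)

lemma H10_deriv_sin:
  fixes a :: "'a::euclidean_space"
  shows "H10_deriv (\<lambda>x. sin (real k * x) *\<^sub>R a) (\<lambda>x. (real k * cos (real k * x)) *\<^sub>R a)"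
proof (rule H10_deriv_C1)
  fix x
  show "((\<lambda>x. sin (real k * x) *\<^sub>R a) has_vector_derivative (real k * cos (real k * x)) *\<^sub>R a) (at x)"
    using has_vector_derivative_scaleR[OF _ has_vector_derivative_const[of a],
        of "\<lambda>x. sin (real k * x)" "real k * cos (real k * x)" x UNIV] trig_has_vector_derivative(1)[of k x]
    by (simp add: has_real_derivative_iff_has_vector_derivative)
qed (auto intro!: continuous_intros)

text \<open>The cosine does not vanish at the end points, so integration by parts has to use that f
  does: it is carried out for test functions and then passed to the limit.\<close>

lemma cosc_H10_deriv:
  fixes f g :: "real \<Rightarrow> 'a::euclidean_space"
  assumes "H10_deriv f g"
  shows "cosc k g = real k *\<^sub>R sinc k f"
proof -
  obtain \<phi> \<phi>' where \<phi>: "\<And>n. C1c (\<phi> n) (\<phi>' n)"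
    and lim: "(\<lambda>n. L2norm Om (\<lambda>x. \<phi> n x - f x)) \<longlonglongrightarrow> 0" "(\<lambda>n. L2norm Om (\<lambda>x. \<phi>' n x - g x)) \<longlonglongrightarrow> 0"
    using H10_deriv_sequence[OF assms] by blast
  have "cosc k (\<phi>' n) = real k *\<^sub>R sinc k (\<phi> n)" for n
  proof -
    have "continuous_on UNIV (\<lambda>x. - real k * sin (real k * x))" by (intro continuous_intros)
    moreover have "(\<phi> n has_vector_derivative \<phi>' n x) (at x)" "continuous_on UNIV (\<phi>' n)" for x
      using \<phi>[of n] by (auto simp: C1c_def)
    ultimately have "(LINT x|Om. (- real k * sin (real k * x)) *\<^sub>R \<phi> n x)
        = (cos (real k * pi) *\<^sub>R \<phi> n pi - cos (real k * 0) *\<^sub>R \<phi> n 0) - (LINT x|Om. cos (real k * x) *\<^sub>R \<phi>' n x)"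
      by (intro integral_product_derivative trig_has_vector_derivative(2))
    then have "(LINT x|Om. (- real k * sin (real k * x)) *\<^sub>R \<phi> n x) = - (LINT x|Om. cos (real k * x) *\<^sub>R \<phi>' n x)"
      by (simp only: C1c_boundary[OF \<phi>[of n]] scaleR_zero_right diff_self diff_0)
    moreover have "(LINT x|Om. (- real k * sin (real k * x)) *\<^sub>R \<phi> n x) = - real k *\<^sub>R sinc k (\<phi> n)"
      unfolding sinc_def by (simp flip: scaleR_scaleR integral_scaleR_right)
    ultimately show ?thesis by (simp add: cosc_def)
  qed
  moreover have "(\<lambda>n. cosc k (\<phi>' n)) \<longlonglongrightarrow> cosc k g"
    unfolding cosc_def by (intro L2_tendsto_scaleR C1c_L2(2)[OF \<phi>] H10_derivD(3)[OF assms] L2_cos lim)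
  moreover have "(\<lambda>n. real k *\<^sub>R sinc k (\<phi> n)) \<longlonglongrightarrow> real k *\<^sub>R sinc k f"
    unfolding sinc_def by (intro tendsto_intros L2_tendsto_scaleR C1c_L2(1)[OF \<phi>] H10_derivD(2)[OF assms] L2_sin lim)
  ultimately show ?thesis by (simp add: LIMSEQ_unique)
qed

text \<open>Here the sine carries the boundary condition: it lies in \<open>H10\<close>, so test
  functions approximating it may be inserted in the definition of the weak derivative, whatever f
  does at the boundary.\<close>

lemma sinc_weak_deriv:
  fixes f g :: "real \<Rightarrow> 'a::euclidean_space"
  assumes "weak_deriv f g"
  shows "sinc k g = - real k *\<^sub>R cosc k f"
proof -
  obtain \<phi> \<phi>' where \<phi>: "\<And>n. C1c (\<phi> n) (\<phi>' n)"
    and lim: "(\<lambda>n. L2norm Om (\<lambda>x. \<phi> n x - sin (real k * x))) \<longlonglongrightarrow> 0"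
      "(\<lambda>n. L2norm Om (\<lambda>x. \<phi>' n x - real k * cos (real k * x))) \<longlonglongrightarrow> 0"
    using H10_deriv_sequence[OF H10_deriv_sin[of k "1::real"]] by auto
  have kc: "(\<lambda>x. real k * cos (real k * x)) \<in> L2 Om" by (intro L2_continuous continuous_intros)
  have "(\<lambda>n. LINT x|Om. \<phi>' n x *\<^sub>R f x) \<longlonglongrightarrow> (LINT x|Om. (real k * cos (real k * x)) *\<^sub>R f x)"
    by (intro L2_tendsto_scaleR_left C1c_L2(2)[OF \<phi>] weak_derivD(1)[OF assms] kc lim)
  moreover have "(\<lambda>n. LINT x|Om. \<phi> n x *\<^sub>R g x) \<longlonglongrightarrow> (LINT x|Om. sin (real k * x) *\<^sub>R g x)"
    by (intro L2_tendsto_scaleR_left C1c_L2(1)[OF \<phi>] weak_derivD(2)[OF assms] L2_sin lim)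
  moreover have "(LINT x|Om. \<phi>' n x *\<^sub>R f x) = - (LINT x|Om. \<phi> n x *\<^sub>R g x)" for n
    using assms \<phi>[of n] by (simp add: weak_deriv_def)
  ultimately have "(\<lambda>n. - (LINT x|Om. \<phi> n x *\<^sub>R g x)) \<longlonglongrightarrow> (LINT x|Om. (real k * cos (real k * x)) *\<^sub>R f x)"
    "(\<lambda>n. - (LINT x|Om. \<phi> n x *\<^sub>R g x)) \<longlonglongrightarrow> - sinc k g"
    unfolding sinc_def by (simp only:, intro tendsto_minus)
  then have "(LINT x|Om. (real k * cos (real k * x)) *\<^sub>R f x) = - sinc k g"
    by (rule LIMSEQ_unique)
  moreover have "(LINT x|Om. (real k * cos (real k * x)) *\<^sub>R f x) = real k *\<^sub>R cosc k f"
    unfolding cosc_def by (simp flip: scaleR_scaleR integral_scaleR_right)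
  ultimately show ?thesis by simp
qed

text \<open>The sine coefficients of a weak derivative are determined by f through
  \<open>sinc_weak_deriv\<close>, and the sines are complete.\<close>

lemma weak_deriv_unique:
  assumes "weak_deriv f g" "weak_deriv f h"
  shows "AE x in Om. g x = h x"
  using assms by (intro sine_coefficients_unique) (auto dest: weak_derivD simp: sinc_weak_deriv)

lemma H10_deriv_if_H10:
  assumes "f \<in> H10" "weak_deriv f g"
  shows "H10_deriv f g"
proof -
  obtain h where h: "H10_deriv f h" using assms(1) by (auto simp: H10_iff)
  have ae: "AE x in Om. h x = g x" by (rule weak_deriv_unique[OF H10_derivD(1)[OF h] assms(2)])
  have "L2norm Om (\<lambda>x. g x - \<phi>' x) = L2norm Om (\<lambda>x. h x - \<phi>' x)" if "C1c \<phi> \<phi>'" for \<phi> \<phi>'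
    using ae H10_derivD(3)[OF h] weak_derivD(2)[OF assms(2)] C1c_L2(2)[OF that]
    by (intro L2norm_cong_AE) (auto dest!: L2_measurable)
  note eq = this
  show ?thesis
    unfolding H10_deriv_def
  proof (intro conjI allI impI assms(2))
    fix \<epsilon> :: real assume "0 < \<epsilon>"
    with h obtain \<phi> \<phi>' where "C1c \<phi> \<phi>'" "L2norm Om (\<lambda>x. f x - \<phi> x) < \<epsilon>" "L2norm Om (\<lambda>x. h x - \<phi>' x) < \<epsilon>"
      unfolding H10_deriv_def by blast
    with eq[of \<phi> \<phi>'] show "\<exists>\<phi> \<phi>'. C1c \<phi> \<phi>' \<and> L2norm Om (\<lambda>x. f x - \<phi> x) < \<epsilon> \<and> L2norm Om (\<lambda>x. g x - \<phi>' x) < \<epsilon>"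
      by (intro exI[of _ \<phi>] exI[of _ \<phi>']) simp
  qed
qed

lemma H10_deriv_limit:
  fixes f g :: "real \<Rightarrow> 'a::euclidean_space"
  assumes F: "\<And>n. H10_deriv (F n) (G n)" and f: "f \<in> L2 Om" and g: "g \<in> L2 Om"
    and lim: "(\<lambda>n. L2norm Om (\<lambda>x. F n x - f x)) \<longlonglongrightarrow> 0" "(\<lambda>n. L2norm Om (\<lambda>x. G n x - g x)) \<longlonglongrightarrow> 0"
  shows "H10_deriv f g"
  unfolding H10_deriv_def weak_deriv_def
proof (intro conjI allI impI f g)
  fix \<phi> \<phi>' :: "real \<Rightarrow> real" assume C: "C1c \<phi> \<phi>'"
  have "(\<lambda>n. LINT x|Om. \<phi>' x *\<^sub>R F n x) \<longlonglongrightarrow> (LINT x|Om. \<phi>' x *\<^sub>R f x)"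
    by (intro L2_tendsto_scaleR H10_derivD(2)[OF F] f C1c_L2(2)[OF C] lim)
  moreover have "(\<lambda>n. - (LINT x|Om. \<phi> x *\<^sub>R G n x)) \<longlonglongrightarrow> - (LINT x|Om. \<phi> x *\<^sub>R g x)"
    by (intro tendsto_minus L2_tendsto_scaleR H10_derivD(3)[OF F] g C1c_L2(1)[OF C] lim)
  moreover have "(LINT x|Om. \<phi>' x *\<^sub>R F n x) = - (LINT x|Om. \<phi> x *\<^sub>R G n x)" for n
    using H10_derivD(1)[OF F[of n]] C by (simp add: weak_deriv_def)
  ultimately show "(LINT x|Om. \<phi>' x *\<^sub>R f x) = - (LINT x|Om. \<phi> x *\<^sub>R g x)"
    by (simp add: LIMSEQ_unique)
next
  fix \<epsilon> :: real assume \<epsilon>: "0 < \<epsilon>"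
  have "\<forall>\<^sub>F n in sequentially. L2norm Om (\<lambda>x. F n x - f x) < \<epsilon> / 2 \<and> L2norm Om (\<lambda>x. G n x - g x) < \<epsilon> / 2"
    using order_tendstoD(2)[OF lim(1), of "\<epsilon> / 2"] order_tendstoD(2)[OF lim(2), of "\<epsilon> / 2"] \<epsilon>
    by (intro eventually_conj) auto
  then obtain n where n: "L2norm Om (\<lambda>x. F n x - f x) < \<epsilon> / 2" "L2norm Om (\<lambda>x. G n x - g x) < \<epsilon> / 2"
    by (auto simp: eventually_sequentially)
  obtain \<phi> \<phi>' where C: "C1c \<phi> \<phi>'" and
    c: "L2norm Om (\<lambda>x. F n x - \<phi> x) < \<epsilon> / 2" "L2norm Om (\<lambda>x. G n x - \<phi>' x) < \<epsilon> / 2"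
    using F[of n] half_gt_zero[OF \<epsilon>] unfolding H10_deriv_def by blast
  have "L2norm Om (\<lambda>x. f x - \<phi> x) \<le> L2norm Om (\<lambda>x. f x - F n x) + L2norm Om (\<lambda>x. F n x - \<phi> x)"
    by (intro L2norm_triangle_diff f H10_derivD(2)[OF F] C1c_L2(1)[OF C])
  moreover have "L2norm Om (\<lambda>x. g x - \<phi>' x) \<le> L2norm Om (\<lambda>x. g x - G n x) + L2norm Om (\<lambda>x. G n x - \<phi>' x)"
    by (intro L2norm_triangle_diff g H10_derivD(3)[OF F] C1c_L2(2)[OF C])
  ultimately show "\<exists>\<phi> \<phi>'. C1c \<phi> \<phi>' \<and> L2norm Om (\<lambda>x. f x - \<phi> x) < \<epsilon> \<and> L2norm Om (\<lambda>x. g x - \<phi>' x) < \<epsilon>"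
    using n c C by (intro exI[of _ \<phi>] exI[of _ \<phi>']) (simp add: L2norm_minus_commute[of _ f] L2norm_minus_commute[of _ g])
qed

text \<open>Bessel's inequality for the cosine coefficients of g controls the weighted squares.
  Plain summability follows by writing the coefficient as 1/k times its k-fold and bounding a
  product by a sum of squares.\<close>

lemma summable_norm_sinc_H10:
  fixes f g :: "real \<Rightarrow> 'a::euclidean_space"
  assumes "H10_deriv f g"
  shows "summable (\<lambda>k. (real k * norm (sinc k f))\<^sup>2)" "summable (\<lambda>k. norm (sinc k f))"
proof -
  have "(\<Sum>k<n. (real k * norm (sinc k f))\<^sup>2) \<le> pi / 2 * (L2norm Om g)\<^sup>2" for n
  proof -
    have "(\<Sum>k<n. (real k * norm (sinc k f))\<^sup>2) = (\<Sum>k\<in>{1..<n}. (norm (cosc k g))\<^sup>2)"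
      by (rule sum.mono_neutral_cong_right)
        (auto simp: cosc_H10_deriv[OF assms] not_le power_mult_distrib)
    also have "\<dots> \<le> pi / 2 * (L2norm Om g)\<^sup>2" by (rule Bessel_cosine[OF H10_derivD(3)[OF assms]])
    finally show ?thesis .
  qed
  then show 1: "summable (\<lambda>k. (real k * norm (sinc k f))\<^sup>2)"
    by (rule summableI_nonneg_bounded[rotated]) simp
  show "summable (\<lambda>k. norm (sinc k f))"
  proof (rule summable_comparison_test')
    \<comment> \<open>Division by zero makes the first summand 0 at k = 0, which is harmless because
      \<open>sinc 0 f\<close> is 0 as well.\<close>
    show "summable (\<lambda>k. 1 / (real k)\<^sup>2 + (real k * norm (sinc k f))\<^sup>2)"
      using inverse_squares_sums[THEN sums_summable] by (intro summable_add 1) (simp flip: summable_Suc_iff[of "\<lambda>k. 1 / (real k)\<^sup>2"] add: add.commute)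
    fix k :: nat assume "0 \<le> k"
    show "norm (norm (sinc k f)) \<le> 1 / (real k)\<^sup>2 + (real k * norm (sinc k f))\<^sup>2"
    proof (cases "k = 0")
      case False
      then have "norm (sinc k f) = 1 / real k * (real k * norm (sinc k f))" by simp
      also have "\<dots> \<le> (1 / real k)\<^sup>2 + (real k * norm (sinc k f))\<^sup>2"
      proof -
        have "2 * norm (sinc k f) \<le> (1 / real k)\<^sup>2 + (real k * norm (sinc k f))\<^sup>2"
          using sum_squares_bound[of "1 / real k" "real k * norm (sinc k f)"] False by simp
        then have "norm (sinc k f) \<le> (1 / real k)\<^sup>2 + (real k * norm (sinc k f))\<^sup>2"
          using norm_ge_zero[of "sinc k f"] by linarith
        with False show ?thesis by simp
      qed
      finally show ?thesis by (simp add: power_divide)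
    qed simp
  qed
qed

lemma AE_zero_continuous_imp_zero:
  fixes w :: "real \<Rightarrow> 'a::euclidean_space"
  assumes c: "continuous_on {0<..<b} w" and ae: "AE x in leb b. w x = 0" and x: "x \<in> {0<..<b}"
  shows "w x = 0"
proof (rule ccontr)
  assume "w x \<noteq> 0"
  have "open {y \<in> {0<..<b}. w y \<noteq> 0}"
    using continuous_open_preimage[OF c open_greaterThanLessThan, of "- {0}"] by (simp add: vimage_def Int_def open_Compl)
  then obtain e where e: "0 < e" "ball x e \<subseteq> {y \<in> {0<..<b}. w y \<noteq> 0}"
    using x \<open>w x \<noteq> 0\<close> by (auto simp: open_contains_ball)
  have "AE y in lborel. y \<notin> ball x e"
    using ae unfolding AE_leb_iff by eventually_elim (use e in auto)
  then have "ball x e \<in> null_sets lborel"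
    by (rule iffD2[OF AE_iff_null_sets, rotated]) simp
  then have "emeasure lborel (ball x e) = 0" by (simp only: null_setsD1)
  then have "emeasure lborel {x - e<..<x + e} = 0"
    by (simp add: ball_eq_greaterThanLessThan)
  with \<open>0 < e\<close> show False by simp
qed

text \<open>This is how the Dirac distribution acts on modes: the value of the continuous
  representative at a point is an absolutely convergent sum of \<open>sin (k x)\<close> times
  coefficients.\<close>

lemma H10_pointwise_sine_series:
  fixes v :: "real \<Rightarrow> 'a::euclidean_space"
  assumes v: "H10_deriv v v'" and c: "continuous_on {0..pi} v" and x: "x \<in> {0<..<pi}"
  shows "v x = sine_series (\<lambda>k. (2 / pi) *\<^sub>R sinc k v) x"
proof -
  let ?a = "\<lambda>k. (2 / pi) *\<^sub>R sinc k v"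
  have a: "summable (\<lambda>k. norm (?a k))"
    using summable_mult[OF summable_norm_sinc_H10(2)[OF v], of "2 / pi"] by simp
  have "sinc k v = sinc k (sine_series ?a)" for k
    by (cases "k = 0") (simp_all add: sinc_sine_series[OF a])
  then have "AE x in Om. v x = sine_series ?a x"
    by (intro sine_coefficients_unique H10_derivD(2)[OF v] sine_series_L2[OF a])
  then have ae: "AE x in Om. v x - sine_series ?a x = 0" by simp
  have "continuous_on {0<..<pi} (\<lambda>x. v x - sine_series ?a x)"
    by (intro continuous_intros continuous_on_subset[OF c] continuous_on_subset[OF sine_series_continuous[OF a]]) auto
  from AE_zero_continuous_imp_zero[OF this ae x] show ?thesis by simp
qed

section \<open>The modal matrices and their exponentials\<close>

unbundle no fps_syntax

lemma idx_strict_mono: "i < j \<Longrightarrow> idx i < idx j"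
  unfolding idx_def by (rule psubset_card_mono) auto

lemma idx_inject [simp]: "idx i = idx j \<longleftrightarrow> i = j"
  by (metis idx_strict_mono less_irrefl linorder_neqE)

lemma idx_bounds: "1 \<le> idx i" "idx (i :: 'n::{finite,linorder}) \<le> CARD('n)"
  unfolding idx_def by (auto simp: Suc_le_eq card_gt_0_iff intro: card_mono)

lemma range_idx: "range (idx :: 'n::{finite,linorder} \<Rightarrow> nat) = {1..CARD('n)}"
proof (rule card_subset_eq)
  show "card (range (idx :: 'n \<Rightarrow> nat)) = card {1..CARD('n)}"
    by (simp add: card_image inj_on_def)
qed (use idx_bounds in auto)

text \<open>Inverse of \<open>idx\<close>. Outside 1..n the value is arbitrary, so its uses carry
  bounds on m.\<close>

definition rix :: "nat \<Rightarrow> 'n::{finite,linorder}" where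
  "rix m = inv idx m"

lemma rix_idx [simp]: "rix (idx i) = i"
  unfolding rix_def by (rule inv_f_f) (simp add: inj_on_def)

lemma idx_rix: "1 \<le> m \<Longrightarrow> m \<le> CARD('n) \<Longrightarrow> idx (rix m :: 'n::{finite,linorder}) = m"
  unfolding rix_def using range_idx[where 'n = 'n] by (intro f_inv_into_f) auto

lemma idx_eq_iff_rix: "1 \<le> m \<Longrightarrow> m \<le> CARD('n) \<Longrightarrow> idx (i :: 'n::{finite,linorder}) = m \<longleftrightarrow> i = rix m"
  by (auto simp: idx_rix)

section \<open>Powers and exponentials of matrices\<close>

primrec mpow :: "'a::semiring_1^'n^'n \<Rightarrow> nat \<Rightarrow> 'a^'n^'n" where
  "mpow M 0 = mat 1"
| "mpow M (Suc m) = M ** mpow M m"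

lemma mpow_commute: "M ** mpow M m = mpow M m ** M"
proof (induction m)
  case (Suc m)
  have "M ** (M ** mpow M m) = M ** (mpow M m ** M)" by (simp only: Suc)
  then show ?case by (simp only: mpow.simps matrix_mul_assoc)
qed simp

text \<open>Conjugation by diag(w): q bounds the maximal row sum of the conjugated matrix, a
  submultiplicative norm, and undoing the conjugation costs \<open>w j / w i\<close>.\<close>

lemma mpow_entry_bound:
  fixes M :: "'a::real_normed_field^'n::finite^'n"
  assumes w: "\<And>i. 0 < w i" and q: "\<And>i. (\<Sum>j\<in>UNIV. w i * norm (M $ i $ j) / w j) \<le> q"
  shows "norm (mpow M m $ i $ j) \<le> q ^ m * (w j / w i)"
proof (induction m arbitrary: i)
  case 0
  show ?case using w[of i] w[of j] by (auto simp: mat_def intro: less_imp_le)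
next
  case (Suc m)
  have "0 \<le> q"
    by (rule order_trans[OF sum_nonneg q[of i]])
      (intro divide_nonneg_nonneg mult_nonneg_nonneg less_imp_le[OF w] norm_ge_zero)
  have "norm (mpow M (Suc m) $ i $ j) \<le> (\<Sum>l\<in>UNIV. norm (M $ i $ l) * norm (mpow M m $ l $ j))"
    by (simp add: matrix_matrix_mult_def norm_sum order_trans[OF norm_sum] norm_mult)
  also have "\<dots> \<le> (\<Sum>l\<in>UNIV. norm (M $ i $ l) * (q ^ m * (w j / w l)))"
    by (intro sum_mono mult_left_mono Suc.IH) auto
  also have "\<dots> = (\<Sum>l\<in>UNIV. (q ^ m * (w j / w i)) * (w i * norm (M $ i $ l) / w l))"
    by (intro sum.cong refl) (use w[of i] in \<open>simp add: mult_ac\<close>)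
  also have "\<dots> = (q ^ m * (w j / w i)) * (\<Sum>l\<in>UNIV. w i * norm (M $ i $ l) / w l)"
    by (rule sum_distrib_left[symmetric])
  also have "\<dots> \<le> (q ^ m * (w j / w i)) * q"
    using w[of i] w[of j] \<open>0 \<le> q\<close> by (intro mult_left_mono q) auto
  finally show ?case by (simp add: mult_ac)
qed

text \<open>An entrywise power series over any complete normed field, so that one object serves real
  times in the evolution and complex times in the sector.\<close>

definition mexp :: "'a::{real_normed_field,banach}^'n^'n \<Rightarrow> 'a \<Rightarrow> 'a^'n^'n" where
  "mexp M t = (\<chi> i j. \<Sum>m. mpow M m $ i $ j / fact m * t ^ m)"

lemma mexp_term_bound:
  fixes M :: "'a::{real_normed_field,banach}^'n::finite^'n"
  assumes w: "\<And>i. 0 < w i" and q: "\<And>i. (\<Sum>j\<in>UNIV. w i * norm (M $ i $ j) / w j) \<le> q"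
  shows "norm (mpow M m $ i $ j / fact m * t ^ m) \<le> w j / w i * ((q * norm t) ^ m /\<^sub>R fact m)"
proof -
  have "norm (mpow M m $ i $ j / fact m * t ^ m) = norm (mpow M m $ i $ j) * (norm t ^ m / fact m)"
    by (simp add: norm_mult norm_divide norm_power)
  also have "\<dots> \<le> q ^ m * (w j / w i) * (norm t ^ m / fact m)"
    by (intro mult_right_mono mpow_entry_bound[OF w q]) auto
  finally show ?thesis by (simp add: power_mult_distrib divide_inverse mult_ac)
qed

lemma mexp_summable_norm:
  fixes M :: "'a::{real_normed_field,banach}^'n::finite^'n"
  shows "summable (\<lambda>m. norm (mpow M m $ i $ j / fact m * t ^ m))"
proof -
  define q where "q = (\<Sum>i\<in>UNIV. \<Sum>j\<in>UNIV. norm (M $ i $ j))"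
  have q: "(\<Sum>j\<in>UNIV. 1 * norm (M $ i $ j) / 1) \<le> q" for i
    unfolding q_def using member_le_sum[of i UNIV "\<lambda>i. \<Sum>j\<in>UNIV. norm (M $ i $ j)"]
    by (simp add: sum_nonneg)
  show ?thesis
  proof (rule summable_comparison_test')
    show "summable (\<lambda>m. 1 / 1 * ((q * norm t) ^ m /\<^sub>R fact m))"
      by (intro summable_mult summable_exp_generic)
    show "norm (norm (mpow M m $ i $ j / fact m * t ^ m)) \<le> 1 / 1 * ((q * norm t) ^ m /\<^sub>R fact m)" for m
      using mexp_term_bound[of "\<lambda>_. 1" M q m i j t] q by simp
  qed
qed

lemma mexp_summable:
  fixes M :: "'a::{real_normed_field,banach}^'n::finite^'n"
  shows "summable (\<lambda>m. mpow M m $ i $ j / fact m * t ^ m)"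
  by (rule summable_norm_cancel[OF mexp_summable_norm])

lemma mexp_bound:
  fixes M :: "'a::{real_normed_field,banach}^'n::finite^'n"
  assumes w: "\<And>i. 0 < w i" and q: "\<And>i. (\<Sum>j\<in>UNIV. w i * norm (M $ i $ j) / w j) \<le> q"
  shows "norm (mexp M t $ i $ j) \<le> w j / w i * exp (q * norm t)"
proof -
  have "norm (mexp M t $ i $ j) \<le> (\<Sum>m. norm (mpow M m $ i $ j / fact m * t ^ m))"
    unfolding mexp_def using summable_norm[OF mexp_summable_norm] by simp
  also have "\<dots> \<le> (\<Sum>m. w j / w i * ((q * norm t) ^ m /\<^sub>R fact m))"
    by (intro suminf_le mexp_term_bound[OF w q] mexp_summable_norm summable_mult summable_exp_generic)
  also have "\<dots> = w j / w i * exp (q * norm t)"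
    unfolding exp_def by (rule suminf_mult[OF summable_exp_generic])
  finally show ?thesis .
qed

lemma mexp_mult_left:
  fixes M :: "'a::{real_normed_field,banach}^'n::finite^'n"
  shows "(M ** mexp M t) $ i $ j = (\<Sum>m. mpow M (Suc m) $ i $ j / fact m * t ^ m)"
proof -
  have "(M ** mexp M t) $ i $ j = (\<Sum>l\<in>UNIV. M $ i $ l * (\<Sum>m. mpow M m $ l $ j / fact m * t ^ m))"
    by (simp add: matrix_matrix_mult_def mexp_def)
  also have "\<dots> = (\<Sum>l\<in>UNIV. \<Sum>m. M $ i $ l * (mpow M m $ l $ j / fact m * t ^ m))"
    by (intro sum.cong refl suminf_mult[symmetric] mexp_summable)
  also have "\<dots> = (\<Sum>m. \<Sum>l\<in>UNIV. M $ i $ l * (mpow M m $ l $ j / fact m * t ^ m))"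
    by (intro suminf_sum[symmetric] summable_mult mexp_summable)
  also have "\<dots> = (\<Sum>m. mpow M (Suc m) $ i $ j / fact m * t ^ m)"
    by (simp add: matrix_matrix_mult_def sum_divide_distrib sum_distrib_right mult.assoc)
  finally show ?thesis .
qed

text \<open>The same series as in \<open>mexp_mult_left\<close>: a matrix commutes with its
  exponential. This is what gives the semigroup a second form of its derivative.\<close>

lemma mexp_mult_right:
  fixes M :: "'a::{real_normed_field,banach}^'n::finite^'n"
  shows "(mexp M t ** M) $ i $ j = (\<Sum>m. mpow M (Suc m) $ i $ j / fact m * t ^ m)"
proof -
  have "(mexp M t ** M) $ i $ j = (\<Sum>l\<in>UNIV. (\<Sum>m. mpow M m $ i $ l / fact m * t ^ m) * M $ l $ j)"
    by (simp add: matrix_matrix_mult_def mexp_def)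
  also have "\<dots> = (\<Sum>l\<in>UNIV. \<Sum>m. mpow M m $ i $ l / fact m * t ^ m * M $ l $ j)"
    by (intro sum.cong refl suminf_mult2 mexp_summable)
  also have "\<dots> = (\<Sum>m. \<Sum>l\<in>UNIV. mpow M m $ i $ l / fact m * t ^ m * M $ l $ j)"
    by (intro suminf_sum[symmetric] summable_mult2 mexp_summable)
  also have "\<dots> = (\<Sum>m. mpow M (Suc m) $ i $ j / fact m * t ^ m)"
    by (simp only: mpow.simps mpow_commute)
      (simp add: matrix_matrix_mult_def sum_divide_distrib sum_distrib_right sum_distrib_left mult_ac)
  finally show ?thesis .
qed

lemma mexp_has_field_derivative:
  fixes M :: "'a::{real_normed_field,banach}^'n::finite^'n"
  shows "((\<lambda>t. mexp M t $ i $ j) has_field_derivative (M ** mexp M t) $ i $ j) (at t)"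
proof -
  have "((\<lambda>t. \<Sum>m. mpow M m $ i $ j / fact m * t ^ m) has_field_derivative
      (\<Sum>m. diffs (\<lambda>m. mpow M m $ i $ j / fact m) m * t ^ m)) (at t)"
    by (rule termdiffs_strong_converges_everywhere[OF mexp_summable])
  moreover have "diffs (\<lambda>m. mpow M m $ i $ j / fact m) m = mpow M (Suc m) $ i $ j / fact m" for m
    by (simp add: diffs_def del: of_nat_Suc)
  ultimately show ?thesis unfolding mexp_mult_left by (simp add: mexp_def)
qed

lemma mexp_zero: "mexp (M :: 'a::{real_normed_field,banach}^'n::finite^'n) 0 = mat 1"
proof -
  have "(\<Sum>m. mpow M m $ i $ j / fact m * 0 ^ m) = mpow M 0 $ i $ j / fact 0" for i j
    by (rule powser_zero)
  then show ?thesis by (simp add: mexp_def vec_eq_iff)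
qed

lemma mexp_of_real:
  fixes M :: "real^'n::finite^'n" and N :: "'a::{real_normed_field,banach}^'n^'n"
  assumes "\<And>i j. N $ i $ j = of_real (M $ i $ j)"
  shows "mexp N (of_real t) $ i $ j = of_real (mexp M t $ i $ j)"
proof -
  have "mpow N m $ i $ j = of_real (mpow M m $ i $ j)" for m i j
    by (induction m arbitrary: i) (simp_all add: mat_def matrix_matrix_mult_def assms)
  then have "mexp N (of_real t) $ i $ j = (\<Sum>m. of_real (mpow M m $ i $ j / fact m * t ^ m))"
    by (simp add: mexp_def)
  also have "\<dots> = of_real (mexp M t $ i $ j)"
    unfolding mexp_def vec_lambda_beta by (rule suminf_of_real[OF mexp_summable, symmetric])
  finally show ?thesis .
qed

text \<open>The off-diagonal part of \<open>k\<^sup>2 D + A\<close>.\<close>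

definition Cyc :: "real \<Rightarrow> nat \<Rightarrow> 'a::real_normed_field^('n::{finite,linorder})^('n::{finite,linorder})" where
  "Cyc \<alpha> k = (\<chi> i j. if idx j = idx i + 1 then of_nat (k\<^sup>2)
      else if idx i = CARD('n) \<and> idx j = 1 then of_real \<alpha> else 0)"

definition modeM :: "real \<Rightarrow> real \<Rightarrow> nat \<Rightarrow> real^('n::{finite,linorder})^('n::{finite,linorder})" where
  "modeM d \<alpha> k = (real k)\<^sup>2 *\<^sub>R matD d + matA \<alpha>"

lemma modeM_entry: "modeM d \<alpha> k $ i $ j = (if i = j then (real k)\<^sup>2 * d else 0) + Cyc \<alpha> k $ i $ j"
  using idx_bounds(2)[of j] by (auto simp: modeM_def matD_def matA_def Cyc_def)

lemma Cyc_mult: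
  fixes x :: "'a::real_normed_field^('n::{finite,linorder})"
  shows "(Cyc \<alpha> k *v x) $ i = (if idx i < CARD('n) then of_nat (k\<^sup>2) * x $ rix (idx i + 1) else of_real \<alpha> * x $ rix 1)"
proof (cases "idx i < CARD('n)")
  case True
  have "(Cyc \<alpha> k *v x) $ i = (\<Sum>j\<in>UNIV. if j = rix (idx i + 1) then of_nat (k\<^sup>2) * x $ j else 0)"
    unfolding matrix_vector_mult_def vec_lambda_beta using True idx_eq_iff_rix[of "idx i + 1", where 'n = 'n]
    by (intro sum.cong) (auto simp: Cyc_def)
  with True show ?thesis by simp
next
  case False
  then have i: "idx i = CARD('n)" using idx_bounds(2)[of i] by simp
  have n1: "1 \<le> CARD('n)" using idx_bounds[of i] by simp
  have ne: "idx j \<noteq> CARD('n) + 1" for j :: 'n using idx_bounds(2)[of j] by simp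
  have "(Cyc \<alpha> k *v x) $ i = (\<Sum>j\<in>UNIV. if j = rix 1 then of_real \<alpha> * x $ j else 0)"
    unfolding matrix_vector_mult_def vec_lambda_beta using i n1 ne idx_eq_iff_rix[of 1, where 'n = 'n]
    by (intro sum.cong) (auto simp: Cyc_def)
  with False show ?thesis by simp
qed

lemma modeM_mult:
  fixes x :: "real^('n::{finite,linorder})"
  shows "modeM d \<alpha> k *v x = ((real k)\<^sup>2 * d) *\<^sub>R x + Cyc \<alpha> k *v x"
proof -
  have "modeM d \<alpha> k = ((real k)\<^sup>2 * d) *\<^sub>R mat 1 + (Cyc \<alpha> k :: ((real, 'n) vec, 'n) vec)"
    by (simp add: vec_eq_iff modeM_entry mat_def)
  then show ?thesis by (simp add: matrix_vector_mult_add_rdistrib scaleR_matrix_vector_assoc[symmetric])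
qed

text \<open>
  In the norm with weights \<open>4\<^sup>i\<close> the entries \<open>k\<^sup>2\<close> shrink to \<open>k\<^sup>2 / 4\<close>, so that the decay
  \<open>exp(- k\<^sup>2 d t)\<close> still dominates, even on a sector of complex times \<open>t\<close>.
\<close>

lemma Cyc_mexp_bound:
  fixes t :: "'a::{real_normed_field,banach}"
  shows "norm (mexp (Cyc \<alpha> k :: 'a^('n::{finite,linorder})^('n::{finite,linorder})) t $ i $ j)
    \<le> 4 ^ CARD('n) * exp (((real k)\<^sup>2 / 4 + \<bar>\<alpha>\<bar> * 4 ^ CARD('n)) * norm t)"
proof -
  let ?w = "\<lambda>i::'n. (4::real) ^ idx i" and ?q = "(real k)\<^sup>2 / 4 + \<bar>\<alpha>\<bar> * 4 ^ CARD('n)"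
  have "norm (mexp (Cyc \<alpha> k :: (('a, 'n) vec, 'n) vec) t $ i $ j) \<le> ?w j / ?w i * exp (?q * norm t)"
  proof (rule mexp_bound)
    fix i :: 'n
    show "(\<Sum>j\<in>UNIV. ?w i * norm (Cyc \<alpha> k $ i $ j :: 'a) / ?w j) \<le> ?q"
    proof (cases "idx i < CARD('n)")
      case True
      have "(\<Sum>j\<in>UNIV. ?w i * norm (Cyc \<alpha> k $ i $ j :: 'a) / ?w j)
          = (\<Sum>j\<in>UNIV. if j = rix (idx i + 1) then ?w i * (real k)\<^sup>2 / ?w j else 0)"
        using True idx_eq_iff_rix[of "idx i + 1", where 'n = 'n] by (intro sum.cong) (auto simp: Cyc_def norm_power)
      also have "\<dots> = (real k)\<^sup>2 / 4"
        using True by (simp add: idx_rix)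
      finally have "(\<Sum>j\<in>UNIV. ?w i * norm (Cyc \<alpha> k $ i $ j :: 'a) / ?w j) = (real k)\<^sup>2 / 4" .
      moreover have "0 \<le> \<bar>\<alpha>\<bar> * 4 ^ CARD('n)" by simp
      ultimately show ?thesis by linarith
    next
      case False
      then have i: "idx i = CARD('n)" using idx_bounds(2)[of i] by simp
      have n1: "1 \<le> CARD('n)" using idx_bounds[of i] by simp
      have ne: "idx j \<noteq> CARD('n) + 1" for j :: 'n using idx_bounds(2)[of j] by simp
      have "(\<Sum>j\<in>UNIV. ?w i * norm (Cyc \<alpha> k $ i $ j :: 'a) / ?w j)
          = (\<Sum>j\<in>UNIV. if j = rix 1 then ?w i * \<bar>\<alpha>\<bar> / ?w j else 0)"
        using i n1 ne idx_eq_iff_rix[of 1, where 'n = 'n] by (intro sum.cong) (auto simp: Cyc_def)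
      also have "\<dots> = 4 ^ CARD('n) * \<bar>\<alpha>\<bar> / 4" using i n1 idx_rix[of 1, where 'n = 'n] by simp
      also have "\<dots> \<le> \<bar>\<alpha>\<bar> * 4 ^ CARD('n)" by simp
      finally show ?thesis using zero_le_power2[of "real k"] by linarith
    qed
  qed simp
  also have "\<dots> \<le> 4 ^ CARD('n) * exp (?q * norm t)"
  proof (rule mult_right_mono)
    have "?w j / ?w i \<le> ?w j" by (simp add: divide_le_eq)
    also have "\<dots> \<le> 4 ^ CARD('n)" using idx_bounds(2)[of j] by (intro power_increasing) auto
    finally show "?w j / ?w i \<le> 4 ^ CARD('n)" .
  qed simp
  finally show ?thesis .
qed

section \<open>Modal semigroups and their decay\<close>

text \<open>The matrix \<open>exp (- t (k^2 D + A))\<close>. The multiple of the identity commutes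
  and is split off: it contributes pure decay, whereas a norm bound on the whole exponent would turn
  the diagonal into growth.\<close>

definition Sg :: "real \<Rightarrow> real \<Rightarrow> nat \<Rightarrow> 'a::{real_normed_field,banach} \<Rightarrow> 'a^('n::{finite,linorder})^('n::{finite,linorder})" where
  "Sg d \<alpha> k t = (\<chi> i j. exp (- (of_real ((real k)\<^sup>2 * d) * t)) * mexp (Cyc \<alpha> k) (- t) $ i $ j)"

lemma Sg_zero: "Sg d \<alpha> k 0 = mat 1"
  by (simp add: Sg_def mexp_zero vec_eq_iff)

lemma Sg_has_field_derivative:
  "((\<lambda>t. Sg d \<alpha> k t $ i $ j) has_field_derivative
     - (of_real ((real k)\<^sup>2 * d) * Sg d \<alpha> k t $ i $ j + exp (- (of_real ((real k)\<^sup>2 * d) * t)) * (Cyc \<alpha> k ** mexp (Cyc \<alpha> k) (- t)) $ i $ j)) (at t)"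
  unfolding Sg_def vec_lambda_beta
  by (rule derivative_eq_intros DERIV_chain'[OF _ mexp_has_field_derivative] refl)+ (simp add: algebra_simps)

lemma Sg_of_real:
  "(Sg d \<alpha> k (of_real t) :: 'a::{real_normed_field,banach}^('n::{finite,linorder})^('n::{finite,linorder})) $ i $ j = of_real (Sg d \<alpha> k t $ i $ j)"
proof -
  have "(Cyc \<alpha> k :: (('a, 'n) vec, 'n) vec) $ i $ j = of_real (Cyc \<alpha> k $ i $ j)" for i j
    by (simp add: Cyc_def)
  from mexp_of_real[OF this, of "- t" i j] show ?thesis
    by (simp add: Sg_def exp_of_real[symmetric])
qed

lemma Sg_derivative_left:
  "((\<lambda>t. Sg d \<alpha> k t $ i $ j) has_real_derivative - (modeM d \<alpha> k ** Sg d \<alpha> k t) $ i $ j) (at t)"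
proof -
  have "(modeM d \<alpha> k ** Sg d \<alpha> k t) $ i $ j = (real k)\<^sup>2 * d * Sg d \<alpha> k t $ i $ j
      + exp (- ((real k)\<^sup>2 * d * t)) * (Cyc \<alpha> k ** mexp (Cyc \<alpha> k) (- t)) $ i $ j"
  proof -
    have "(modeM d \<alpha> k ** Sg d \<alpha> k t) $ i $ j
        = (\<Sum>l\<in>UNIV. (if i = l then (real k)\<^sup>2 * d else 0) * Sg d \<alpha> k t $ l $ j) + (\<Sum>l\<in>UNIV. Cyc \<alpha> k $ i $ l * Sg d \<alpha> k t $ l $ j)"
      by (simp add: matrix_matrix_mult_def modeM_entry distrib_right sum.distrib)
    moreover have "(\<Sum>l\<in>UNIV. (if i = l then (real k)\<^sup>2 * d else 0) * Sg d \<alpha> k t $ l $ j) = (real k)\<^sup>2 * d * Sg d \<alpha> k t $ i $ j"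
      by (simp add: if_distrib[of "\<lambda>x. x * _"] cong: if_cong)
    moreover have "(\<Sum>l\<in>UNIV. Cyc \<alpha> k $ i $ l * Sg d \<alpha> k t $ l $ j) = exp (- ((real k)\<^sup>2 * d * t)) * (Cyc \<alpha> k ** mexp (Cyc \<alpha> k) (- t)) $ i $ j"
      by (simp add: matrix_matrix_mult_def Sg_def sum_distrib_left mult_ac)
    ultimately show ?thesis by simp
  qed
  with Sg_has_field_derivative[of d \<alpha> k i j t] show ?thesis by simp
qed

lemma Sg_derivative_right:
  "((\<lambda>t. Sg d \<alpha> k t $ i $ j) has_real_derivative - (Sg d \<alpha> k t ** modeM d \<alpha> k) $ i $ j) (at t)"
proof -
  have "(Sg d \<alpha> k t ** modeM d \<alpha> k) $ i $ j = (real k)\<^sup>2 * d * Sg d \<alpha> k t $ i $ j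
      + exp (- ((real k)\<^sup>2 * d * t)) * (mexp (Cyc \<alpha> k) (- t) ** Cyc \<alpha> k) $ i $ j"
  proof -
    have "(Sg d \<alpha> k t ** modeM d \<alpha> k) $ i $ j
        = (\<Sum>l\<in>UNIV. Sg d \<alpha> k t $ i $ l * (if l = j then (real k)\<^sup>2 * d else 0)) + (\<Sum>l\<in>UNIV. Sg d \<alpha> k t $ i $ l * Cyc \<alpha> k $ l $ j)"
      by (simp add: matrix_matrix_mult_def modeM_entry distrib_left sum.distrib)
    moreover have "(\<Sum>l\<in>UNIV. Sg d \<alpha> k t $ i $ l * (if l = j then (real k)\<^sup>2 * d else 0)) = (real k)\<^sup>2 * d * Sg d \<alpha> k t $ i $ j"
      by (simp add: if_distrib[of "\<lambda>x. _ * x"] cong: if_cong)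
    moreover have "(\<Sum>l\<in>UNIV. Sg d \<alpha> k t $ i $ l * Cyc \<alpha> k $ l $ j) = exp (- ((real k)\<^sup>2 * d * t)) * (mexp (Cyc \<alpha> k) (- t) ** Cyc \<alpha> k) $ i $ j"
      by (simp add: matrix_matrix_mult_def Sg_def sum_distrib_left mult_ac)
    ultimately show ?thesis by simp
  qed
  with Sg_has_field_derivative[of d \<alpha> k i j t] show ?thesis by (simp add: mexp_mult_left mexp_mult_right)
qed

text \<open>The first form is the modal equation. The second moves the matrix onto x, as is needed
  when x is a resolvent vector and the matrix is to be traded for B and \<zeta>.\<close>

lemma Sg_inner_derivative:
  fixes x w :: "real^('n::{finite,linorder})"
  shows "((\<lambda>t. (Sg d \<alpha> k t *v x) \<bullet> w) has_real_derivative - ((modeM d \<alpha> k *v (Sg d \<alpha> k t *v x)) \<bullet> w)) (at t)"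
    and "((\<lambda>t. (Sg d \<alpha> k t *v x) \<bullet> w) has_real_derivative - ((Sg d \<alpha> k t *v (modeM d \<alpha> k *v x)) \<bullet> w)) (at t)"
proof -
  have e: "(S *v x) \<bullet> w = (\<Sum>i\<in>UNIV. \<Sum>j\<in>UNIV. S $ i $ j * (x $ j * w $ i))" for S :: "((real, 'n) vec, 'n) vec"
    by (simp add: inner_vec_def matrix_vector_mult_def sum_distrib_right sum_distrib_left mult_ac)
  have "((\<lambda>t. \<Sum>i\<in>UNIV. \<Sum>j\<in>UNIV. Sg d \<alpha> k t $ i $ j * (x $ j * w $ i)) has_real_derivative
      (\<Sum>i\<in>UNIV. \<Sum>j\<in>UNIV. - (modeM d \<alpha> k ** Sg d \<alpha> k t) $ i $ j * (x $ j * w $ i))) (at t)"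
    by (intro DERIV_sum DERIV_cmult_right Sg_derivative_left)
  then show "((\<lambda>t. (Sg d \<alpha> k t *v x) \<bullet> w) has_real_derivative - ((modeM d \<alpha> k *v (Sg d \<alpha> k t *v x)) \<bullet> w)) (at t)"
    by (simp add: e matrix_vector_mul_assoc sum_negf)
  have "((\<lambda>t. \<Sum>i\<in>UNIV. \<Sum>j\<in>UNIV. Sg d \<alpha> k t $ i $ j * (x $ j * w $ i)) has_real_derivative
      (\<Sum>i\<in>UNIV. \<Sum>j\<in>UNIV. - (Sg d \<alpha> k t ** modeM d \<alpha> k) $ i $ j * (x $ j * w $ i))) (at t)"
    by (intro DERIV_sum DERIV_cmult_right Sg_derivative_right)
  then show "((\<lambda>t. (Sg d \<alpha> k t *v x) \<bullet> w) has_real_derivative - ((Sg d \<alpha> k t *v (modeM d \<alpha> k *v x)) \<bullet> w)) (at t)"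
    by (simp add: e matrix_vector_mul_assoc sum_negf)
qed

lemma Sg_entry_bound_real:
  fixes t :: real
  assumes "1 \<le> d" "0 \<le> t"
  shows "\<bar>(Sg d \<alpha> k t :: real^('n::{finite,linorder})^('n::{finite,linorder})) $ i $ j\<bar>
    \<le> 4 ^ CARD('n) * exp (2 * (\<bar>\<alpha>\<bar> * 4 ^ CARD('n)) * t) * exp (- (real k)\<^sup>2 * t / 2)"
proof -
  let ?C = "\<bar>\<alpha>\<bar> * 4 ^ CARD('n)"
  have "\<bar>(Sg d \<alpha> k t :: ((real, 'n) vec, 'n) vec) $ i $ j\<bar> \<le> exp (- ((real k)\<^sup>2 * d * t)) * (4 ^ CARD('n) * exp (((real k)\<^sup>2 / 4 + ?C) * norm t))"
    unfolding Sg_def using Cyc_mexp_bound[of \<alpha> k "- t", where 'n = 'n] by (auto simp: abs_mult)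
  also have "\<dots> = 4 ^ CARD('n) * exp (- ((real k)\<^sup>2 * d * t) + ((real k)\<^sup>2 / 4 + ?C) * t)"
    using assms by (simp only: real_norm_def abs_of_nonneg exp_add mult.left_commute)
  also have "\<dots> \<le> 4 ^ CARD('n) * exp (2 * ?C * t + - (real k)\<^sup>2 * t / 2)"
  proof -
    have "(real k)\<^sup>2 * t * 1 \<le> (real k)\<^sup>2 * t * d" using assms by (intro mult_left_mono) auto
    moreover have "0 \<le> (real k)\<^sup>2 * t" "0 \<le> ?C * t" using assms by auto
    ultimately have "- ((real k)\<^sup>2 * d * t) + ((real k)\<^sup>2 / 4 + ?C) * t \<le> 2 * ?C * t + - (real k)\<^sup>2 * t / 2"
      by (simp add: algebra_simps)
    then show ?thesis by simp
  qed
  finally show ?thesis by (simp only: exp_add mult.assoc)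
qed

text \<open>Sector and weight 4 are matched: \<open>norm z \<le> 2 * Re z\<close> doubles the k^2/4
  of the weighted norm to k^2/2, and since d \<ge> 1 a decay of at least k^2/2 survives. The same
  doubling is the factor 2 in front of \<open>\<bar>\<alpha>\<bar> * 4 ^ CARD('n)\<close>.\<close>

lemma Sg_entry_bound_complex:
  fixes z :: complex
  assumes "1 \<le> d" "norm z \<le> 2 * Re z"
  shows "norm ((Sg d \<alpha> k z :: complex^('n::{finite,linorder})^('n::{finite,linorder})) $ i $ j)
    \<le> 4 ^ CARD('n) * exp (2 * (\<bar>\<alpha>\<bar> * 4 ^ CARD('n)) * Re z) * exp (- (real k)\<^sup>2 * Re z / 2)"
proof -
  let ?C = "\<bar>\<alpha>\<bar> * 4 ^ CARD('n)"
  have "0 \<le> Re z" using order_trans[OF norm_ge_zero assms(2)] by simp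
  have "norm ((Sg d \<alpha> k z :: ((complex, 'n) vec, 'n) vec) $ i $ j) \<le> exp (- ((real k)\<^sup>2 * d * Re z)) * (4 ^ CARD('n) * exp (((real k)\<^sup>2 / 4 + ?C) * norm z))"
    unfolding Sg_def using Cyc_mexp_bound[of \<alpha> k "- z", where 'n = 'n] by (auto simp: norm_mult)
  also have "\<dots> = 4 ^ CARD('n) * exp (- ((real k)\<^sup>2 * d * Re z) + ((real k)\<^sup>2 / 4 + ?C) * norm z)"
    by (simp only: exp_add mult.left_commute)
  also have "\<dots> \<le> 4 ^ CARD('n) * exp (2 * ?C * Re z + - (real k)\<^sup>2 * Re z / 2)"
  proof -
    have "(real k)\<^sup>2 * Re z * 1 \<le> (real k)\<^sup>2 * Re z * d" using assms \<open>0 \<le> Re z\<close> by (intro mult_left_mono) auto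
    moreover have "((real k)\<^sup>2 / 4 + ?C) * norm z \<le> ((real k)\<^sup>2 / 4 + ?C) * (2 * Re z)"
      using assms by (intro mult_left_mono add_nonneg_nonneg) auto
    ultimately have "- ((real k)\<^sup>2 * d * Re z) + ((real k)\<^sup>2 / 4 + ?C) * norm z \<le> 2 * ?C * Re z + - (real k)\<^sup>2 * Re z / 2"
      by (simp add: algebra_simps)
    then show ?thesis by simp
  qed
  finally show ?thesis by (simp only: exp_add mult.assoc)
qed

lemma Sg_continuous: "continuous_on S (\<lambda>t. Sg d \<alpha> k t *v x)" for x :: "real^('n::{finite,linorder})"
proof -
  have "continuous_on S (\<lambda>t. Sg d \<alpha> k t $ i $ j)" for i j
    by (intro continuous_at_imp_continuous_on ballI DERIV_isCont[OF Sg_derivative_left])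
  then show ?thesis
    unfolding matrix_vector_mult_def
    by (intro continuous_on_vec_lambda continuous_on_sum continuous_on_mult continuous_on_const)
qed

lemma norm_matrix_vector_bound:
  fixes A :: "real^'n^'m::finite" and x :: "real^'n::finite"
  assumes "\<And>i j. \<bar>A $ i $ j\<bar> \<le> c"
  shows "norm (A *v x) \<le> CARD('m) * (CARD('n) * (c * norm x))"
proof -
  have "norm (A *v x) \<le> (\<Sum>i\<in>UNIV. \<bar>(A *v x) $ i\<bar>)" by (rule norm_le_l1_cart)
  also have "\<dots> \<le> (\<Sum>i\<in>(UNIV::'m set). \<Sum>j\<in>(UNIV::'n set). c * norm x)"
  proof (rule sum_mono)
    fix i
    have "\<bar>(A *v x) $ i\<bar> \<le> (\<Sum>j\<in>UNIV. \<bar>A $ i $ j * x $ j\<bar>)"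
      by (simp add: matrix_vector_mult_def sum_abs)
    also have "\<dots> \<le> (\<Sum>j\<in>(UNIV::'n set). c * norm x)"
      unfolding abs_mult by (intro sum_mono mult_mono assms component_le_norm_cart) (auto intro: order_trans[OF abs_ge_zero assms])
    finally show "\<bar>(A *v x) $ i\<bar> \<le> (\<Sum>j\<in>(UNIV::'n set). c * norm x)" .
  qed
  finally show ?thesis by simp
qed

section \<open>The modal resolvents\<close>

text \<open>Up to sign, \<open>Pk n d \<alpha> k z\<close> is the characteristic polynomial of \<open>k\<^sup>2 D + A\<close> at \<open>- z\<close>.\<close>

definition Pk :: "nat \<Rightarrow> real \<Rightarrow> real \<Rightarrow> nat \<Rightarrow> 'a::real_normed_field \<Rightarrow> 'a" where
  "Pk n d \<alpha> k z = (z + of_real ((real k)\<^sup>2 * d)) ^ n + of_real \<alpha> * (- of_nat (k\<^sup>2)) ^ (n - 1)"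

text \<open>The vector \<open>(k^2 D + A + z)^(-1) B\<close> by substitution: all rows but the last
  say that consecutive entries have ratio \<open>- (z + k^2 d) / k^2\<close>, and the last row fixes
  the scale through \<open>Pk\<close>. Keeping the powers of - k^2 in the numerator covers k =
  0.\<close>

definition rk :: "real \<Rightarrow> real \<Rightarrow> nat \<Rightarrow> 'a::real_normed_field \<Rightarrow> 'a^('n::{finite,linorder})" where
  "rk d \<alpha> k z = (\<chi> i. (- of_nat (k\<^sup>2)) ^ (CARD('n) - idx i) * (z + of_real ((real k)\<^sup>2 * d)) ^ (idx i - 1) / Pk CARD('n) d \<alpha> k z)"

lemma rk_resolvent:
  fixes z :: real
  assumes P: "Pk CARD('n) d \<alpha> k z \<noteq> 0"
  shows "modeM d \<alpha> k *v rk d \<alpha> k z + z *\<^sub>R rk d \<alpha> k z = (vecB :: real^('n::{finite,linorder}))"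
proof -
  let ?r = "rk d \<alpha> k z :: (real, 'n) vec" and ?s = "z + (real k)\<^sup>2 * d" and ?n = "CARD('n)"
  have "((real k)\<^sup>2 * d + z) * ?r $ i + (Cyc \<alpha> k *v ?r) $ i = (if idx i = ?n then 1 else 0)" for i
  proof (cases "idx i < ?n")
    case True
    obtain m where m: "idx i = Suc m" using idx_bounds(1)[of i] by (cases "idx i") auto
    have "?s * (?s ^ m * (- ((real k)\<^sup>2)) ^ (?n - Suc m)) + (real k)\<^sup>2 * (?s ^ Suc m * (- ((real k)\<^sup>2)) ^ (?n - Suc (Suc m))) = 0"
    proof -
      have "?n - Suc m = Suc (?n - Suc (Suc m))" using True m by simp
      then show ?thesis by (simp add: algebra_simps)
    qed
    then have "(?s * (?s ^ m * (- ((real k)\<^sup>2)) ^ (?n - Suc m)) + (real k)\<^sup>2 * (?s ^ Suc m * (- ((real k)\<^sup>2)) ^ (?n - Suc (Suc m)))) / Pk ?n d \<alpha> k z = 0"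
      by simp
    then show ?thesis
      using True m by (simp add: Cyc_mult rk_def idx_rix add_divide_distrib mult_ac add.commute)
  next
    case False
    then have i: "idx i = ?n" using idx_bounds(2)[of i] by simp
    have n1: "1 \<le> ?n" using idx_bounds[of i] by simp
    have "?s * ?s ^ (?n - 1) = ?s ^ ?n" using n1 by (simp add: power_eq_if)
    then have "(?s * ?s ^ (?n - 1) + \<alpha> * (- ((real k)\<^sup>2)) ^ (?n - 1)) / Pk ?n d \<alpha> k z = 1"
      using P by (simp add: Pk_def)
    then show ?thesis
      using i n1 idx_rix[of 1, where 'n = 'n] by (simp add: Cyc_mult rk_def add_divide_distrib add.commute)
  qed
  then show ?thesis
    by (simp add: vec_eq_iff modeM_mult vecB_def algebra_simps)
qed

text \<open>s is so large that \<open>s ^ n\<close> dominates the corner term of \<open>Pk\<close>: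
  since k^2 \<le> 2|s|, that term is at most |\<alpha>| (2|s|)^(n-1), and the second hypothesis
  makes this at most half of |s|^n. The two corollaries reach the regime differently: by a large
  real z for every k, or by a large k on a bounded disc.\<close>

lemma rk_bound:
  fixes z :: "'a::real_normed_field" and i :: "'n::{finite,linorder}" and d \<alpha> :: real and k :: nat
  defines "s \<equiv> z + of_real ((real k)\<^sup>2 * d)"
  assumes k: "(real k)\<^sup>2 \<le> 2 * norm s" and \<alpha>: "\<bar>\<alpha>\<bar> * 2 ^ CARD('n) \<le> norm s" and pos: "0 < norm s"
  shows "Pk CARD('n) d \<alpha> k z \<noteq> 0" "norm ((rk d \<alpha> k z :: ('a, 'n) vec) $ i) \<le> 2 ^ (CARD('n) + 1) / norm s"
proof -
  let ?n = "CARD('n)" and ?S = "norm s"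
  have n1: "1 \<le> ?n" by (simp add: Suc_le_eq)
  have Sn: "?S ^ ?n = ?S * ?S ^ (?n - 1)" using n1 by (simp add: power_eq_if)
  have "norm (of_real \<alpha> * (- of_nat (k\<^sup>2)) ^ (?n - 1) :: 'a) = \<bar>\<alpha>\<bar> * ((real k)\<^sup>2) ^ (?n - 1)"
    by (simp add: norm_mult norm_power)
  also have "\<dots> \<le> \<bar>\<alpha>\<bar> * (2 * ?S) ^ (?n - 1)" by (intro mult_left_mono power_mono k) auto
  also have "\<dots> = (\<bar>\<alpha>\<bar> * 2 ^ (?n - 1)) * ?S ^ (?n - 1)" by (simp add: power_mult_distrib)
  also have "\<dots> \<le> (?S / 2) * ?S ^ (?n - 1)"
  proof (rule mult_right_mono)
    have "(2::real) ^ ?n = 2 * 2 ^ (?n - 1)" using n1 by (simp add: power_eq_if)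
    then show "\<bar>\<alpha>\<bar> * 2 ^ (?n - 1) \<le> ?S / 2" using \<alpha> by simp
  qed simp
  finally have b: "norm (of_real \<alpha> * (- of_nat (k\<^sup>2)) ^ (?n - 1) :: 'a) \<le> ?S ^ ?n / 2" by (simp add: Sn)
  have "?S ^ ?n = norm (s ^ ?n)" by (simp add: norm_power)
  also have "\<dots> \<le> norm (Pk ?n d \<alpha> k z) + norm (of_real \<alpha> * (- of_nat (k\<^sup>2)) ^ (?n - 1) :: 'a)"
    using norm_triangle_ineq4[of "Pk ?n d \<alpha> k z" "of_real \<alpha> * (- of_nat (k\<^sup>2)) ^ (?n - 1)"]
    by (simp add: Pk_def s_def)
  finally have P: "?S ^ ?n / 2 \<le> norm (Pk ?n d \<alpha> k z)" using b by linarith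
  have "0 < ?S ^ ?n / 2" using pos by simp
  then show "Pk ?n d \<alpha> k z \<noteq> 0" using P by auto
  have "norm ((rk d \<alpha> k z :: ('a, 'n) vec) $ i) = ((real k)\<^sup>2) ^ (?n - idx i) * ?S ^ (idx i - 1) / norm (Pk ?n d \<alpha> k z)"
    by (simp add: rk_def s_def norm_mult norm_divide norm_power)
  also have "\<dots> \<le> ((2 * ?S) ^ (?n - idx i) * ?S ^ (idx i - 1)) / (?S ^ ?n / 2)"
    using \<open>0 < ?S ^ ?n / 2\<close> by (intro frac_le mult_right_mono power_mono k P) auto
  also have "(2 * ?S) ^ (?n - idx i) * ?S ^ (idx i - 1) = 2 ^ (?n - idx i) * ?S ^ (?n - 1)"
    using idx_bounds[of i] by (simp add: power_mult_distrib flip: power_add)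
  also have "2 ^ (?n - idx i) * ?S ^ (?n - 1) / (?S ^ ?n / 2) = 2 ^ (?n - idx i) * (2 / ?S)"
    using pos by (simp add: Sn field_simps)
  also have "\<dots> \<le> 2 ^ ?n * (2 / ?S)" using pos by (intro mult_right_mono power_increasing) auto
  finally show "norm ((rk d \<alpha> k z :: ('a, 'n) vec) $ i) \<le> 2 ^ (?n + 1) / ?S" by (simp add: mult.commute)
qed

lemma rk_bound_real:
  fixes z :: real and i :: "'n::{finite,linorder}"
  assumes "1 \<le> d" "\<bar>\<alpha>\<bar> * 2 ^ CARD('n) + 1 \<le> z"
  shows "Pk CARD('n) d \<alpha> k z \<noteq> 0" "\<bar>(rk d \<alpha> k z :: (real, 'n) vec) $ i\<bar> \<le> 2 ^ (CARD('n) + 1) / (1 + (real k)\<^sup>2)"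
proof -
  let ?s = "z + (real k)\<^sup>2 * d"
  have "(real k)\<^sup>2 * 1 \<le> (real k)\<^sup>2 * d" using assms by (intro mult_left_mono) auto
  moreover have "0 \<le> \<bar>\<alpha>\<bar> * 2 ^ CARD('n)" by simp
  ultimately have s: "1 + (real k)\<^sup>2 \<le> ?s" "\<bar>\<alpha>\<bar> * 2 ^ CARD('n) \<le> ?s"
    using assms zero_le_power2[of "real k"] by linarith+
  have "0 < 1 + (real k)\<^sup>2" by (rule add_pos_nonneg) auto
  then have p: "0 < ?s" using s by linarith
  have b: "(real k)\<^sup>2 \<le> 2 * norm (z + of_real ((real k)\<^sup>2 * d))"
    "\<bar>\<alpha>\<bar> * 2 ^ CARD('n) \<le> norm (z + of_real ((real k)\<^sup>2 * d))" "0 < norm (z + of_real ((real k)\<^sup>2 * d))"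
    using s p by auto
  show "Pk CARD('n) d \<alpha> k z \<noteq> 0" by (rule rk_bound(1)[OF b])
  have "\<bar>(rk d \<alpha> k z :: (real, 'n) vec) $ i\<bar> \<le> 2 ^ (CARD('n) + 1) / ?s"
    using rk_bound(2)[OF b, of i] p by simp
  also have "\<dots> \<le> 2 ^ (CARD('n) + 1) / (1 + (real k)\<^sup>2)"
    using s p \<open>0 < 1 + (real k)\<^sup>2\<close> by (intro divide_left_mono) auto
  finally show "\<bar>(rk d \<alpha> k z :: (real, 'n) vec) $ i\<bar> \<le> 2 ^ (CARD('n) + 1) / (1 + (real k)\<^sup>2)" .
qed

lemma rk_bound_complex:
  fixes z :: complex and i :: "'n::{finite,linorder}"
  assumes "1 \<le> d" "norm z \<le> R" "2 * R + 2 * (\<bar>\<alpha>\<bar> * 2 ^ CARD('n)) + 2 \<le> (real k)\<^sup>2"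
  shows "Pk CARD('n) d \<alpha> k z \<noteq> 0" "norm ((rk d \<alpha> k z :: (complex, 'n) vec) $ i) \<le> 2 ^ (CARD('n) + 2) / (real k)\<^sup>2"
proof -
  let ?s = "z + of_real ((real k)\<^sup>2 * d)"
  have "(real k)\<^sup>2 * 1 \<le> (real k)\<^sup>2 * d" using assms by (intro mult_left_mono) auto
  moreover have "norm (of_real ((real k)\<^sup>2 * d) :: complex) = (real k)\<^sup>2 * d" using assms by (simp only: norm_of_real) simp
  moreover have "norm (of_real ((real k)\<^sup>2 * d) :: complex) \<le> norm ?s + norm z"
    using norm_triangle_ineq4[of ?s z] by simp
  moreover have "0 \<le> \<bar>\<alpha>\<bar> * 2 ^ CARD('n)" by simp
  moreover have "0 \<le> R" using assms(2) norm_ge_zero[of z] by linarith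
  ultimately have s: "(real k)\<^sup>2 \<le> 2 * norm ?s" "\<bar>\<alpha>\<bar> * 2 ^ CARD('n) \<le> norm ?s" "0 < norm ?s" "0 < (real k)\<^sup>2"
    using assms(2,3) by linarith+
  show "Pk CARD('n) d \<alpha> k z \<noteq> 0" by (rule rk_bound(1)[OF s(1-3)])
  have "norm ((rk d \<alpha> k z :: (complex, 'n) vec) $ i) \<le> 2 ^ (CARD('n) + 1) / norm ?s"
    by (rule rk_bound(2)[OF s(1-3)])
  also have "\<dots> \<le> 2 ^ (CARD('n) + 1) / ((real k)\<^sup>2 / 2)"
    using s by (intro divide_left_mono) auto
  finally show "norm ((rk d \<alpha> k z :: (complex, 'n) vec) $ i) \<le> 2 ^ (CARD('n) + 2) / (real k)\<^sup>2" by simp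
qed

lemma rk_of_real: "(rk d \<alpha> k (of_real z) :: 'a::real_normed_field^('n::{finite,linorder})) $ i = of_real (rk d \<alpha> k z $ i)"
  by (simp add: rk_def Pk_def)

section \<open>Weak solutions from their Fourier modes\<close>

lemma summable_inverse_one_plus_square: "summable (\<lambda>k. 1 / (1 + (real k)\<^sup>2))"
proof (rule summable_comparison_test')
  show "summable (\<lambda>k. inverse ((real k)\<^sup>2))"
    by (rule inverse_power_summable) simp
  fix k :: nat assume "1 \<le> k"
  then have "1 / (1 + (real k)\<^sup>2) \<le> 1 / (real k)\<^sup>2" by (intro frac_le) auto
  moreover have "0 \<le> 1 / (1 + (real k)\<^sup>2)" by simp
  ultimately show "norm (1 / (1 + (real k)\<^sup>2)) \<le> inverse ((real k)\<^sup>2)"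
    by (simp only: real_norm_def abs_of_nonneg inverse_eq_divide)
qed

lemma sum_inverse_one_plus_square_tail:
  assumes "1 \<le> m"
  shows "(\<Sum>k\<in>{m..<N}. 1 / (1 + (real k)\<^sup>2)) \<le> 2 / real m"
proof (cases "m \<le> N")
  case True
  have "(\<Sum>k\<in>{m..<N}. 1 / (1 + (real k)\<^sup>2)) \<le> 2 / real m - 2 / real N"
    using True
  proof (induction N rule: dec_induct)
    case (step N)
    have N: "1 \<le> real N" using assms step.hyps by simp
    have "1 / (1 + (real N)\<^sup>2) \<le> 2 / (real N * (real N + 1))"
    proof (rule frac_le[of 2 2, THEN order_trans[rotated]])
      have "1 / q \<le> 2 / (2 * q)" for q :: real by simp
      then show "1 / (1 + (real N)\<^sup>2) \<le> 2 / (2 * (1 + (real N)\<^sup>2))" .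
      have "real N \<le> (real N)\<^sup>2" using N by (simp add: power2_eq_square)
      then show "real N * (real N + 1) \<le> 2 * (1 + (real N)\<^sup>2)" by (simp add: power2_eq_square algebra_simps)
    qed (use N in auto)
    also have "\<dots> = 2 / real N - 2 / real (Suc N)" using N by (simp add: field_simps)
    finally show ?case using step by simp
  qed simp
  also have "\<dots> \<le> 2 / real m" by simp
  finally show ?thesis .
qed (use assms in auto)

text \<open>Parabolic smoothing in the form used throughout: at a positive time the Gaussian factor
  is traded for a summable majorant, at a cost of 2/t.\<close>

lemma one_plus_square_exp_bound:
  assumes "0 < t"
  shows "exp (- (real k)\<^sup>2 * t / 2) \<le> (1 + 2 / t) / (1 + (real k)\<^sup>2)"
proof -
  have "1 + (real k)\<^sup>2 \<le> (1 + 2 / t) * (1 + (real k)\<^sup>2 * t / 2)"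
    using assms by (simp add: field_simps)
  also have "\<dots> \<le> (1 + 2 / t) * exp ((real k)\<^sup>2 * t / 2)"
    using assms by (intro mult_left_mono exp_ge_add_one_self) auto
  finally have "(1 + (real k)\<^sup>2) * exp (- ((real k)\<^sup>2 * t / 2)) \<le> 1 + 2 / t"
    by (simp add: exp_minus field_simps)
  moreover have "0 < 1 + (real k)\<^sup>2" by (rule add_pos_nonneg) auto
  ultimately show ?thesis by (simp add: pos_le_divide_eq mult.commute)
qed

text \<open>Uniform in k: integration in time gains the factor k^2 that two spatial derivatives
  cost. Estimates that reach down to time 0, where \<open>one_plus_square_exp_bound\<close>
  degenerates, rest on this.\<close>

lemma integral_square_exp_le:
  assumes "0 \<le> b"
  shows "(LINT t|leb b. (real k)\<^sup>2 * exp (- (real k)\<^sup>2 * t / 2)) \<le> 2"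
proof -
  have "(LINT t|leb b. (real k)\<^sup>2 * exp (- (real k)\<^sup>2 * t / 2)) = (- 2 * exp (- (real k)\<^sup>2 * b / 2)) - (- 2 * exp (- (real k)\<^sup>2 * 0 / 2))"
  proof (rule leb_FTC[OF assms])
    fix x
    have "((\<lambda>t. - 2 * exp (- (real k)\<^sup>2 * t / 2)) has_real_derivative (real k)\<^sup>2 * exp (- (real k)\<^sup>2 * x / 2)) (at x within {0..b})"
      by (auto intro!: derivative_eq_intros)
    then show "((\<lambda>t. - 2 * exp (- (real k)\<^sup>2 * t / 2)) has_vector_derivative (real k)\<^sup>2 * exp (- (real k)\<^sup>2 * x / 2)) (at x within {0..b})"
      by (simp add: has_real_derivative_iff_has_vector_derivative)
  qed (auto intro!: continuous_intros)
  then show ?thesis by simp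
qed

lemma L2_product:
  fixes f :: "real \<Rightarrow> real \<Rightarrow> 'a::euclidean_space"
  assumes m: "case_prod f \<in> borel_measurable (leb T \<Otimes>\<^sub>M Om)"
    and L: "\<And>t. t \<in> {0<..<T} \<Longrightarrow> f t \<in> L2 Om"
    and fin: "(\<integral>\<^sup>+t. ennreal ((L2norm Om (f t))\<^sup>2) \<partial>leb T) < \<infinity>"
  shows "case_prod f \<in> L2 (leb T \<Otimes>\<^sub>M Om)"
proof -
  interpret Om: finite_measure Om by (rule finite_leb)
  have m': "(\<lambda>p. ennreal ((norm (case_prod f p))\<^sup>2)) \<in> borel_measurable (leb T \<Otimes>\<^sub>M Om)"
    using m by measurable
  have "(\<integral>\<^sup>+p. ennreal ((norm (case_prod f p))\<^sup>2) \<partial>(leb T \<Otimes>\<^sub>M Om))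
      = (\<integral>\<^sup>+t. \<integral>\<^sup>+x. ennreal ((norm (f t x))\<^sup>2) \<partial>Om \<partial>leb T)"
    using Om.nn_integral_fst[OF m'] by simp
  also have "\<dots> = (\<integral>\<^sup>+t. ennreal ((L2norm Om (f t))\<^sup>2) \<partial>leb T)"
    by (intro nn_integral_cong) (use L in \<open>simp add: L2norm_def nn_integral_eq_integral L2_sq_integrable\<close>)
  finally have "(\<integral>\<^sup>+p. ennreal ((norm (case_prod f p))\<^sup>2) \<partial>(leb T \<Otimes>\<^sub>M Om)) < \<infinity>" using fin by simp
  then have "integrable (leb T \<Otimes>\<^sub>M Om) (\<lambda>p. (norm (case_prod f p))\<^sup>2)"
    using m by (intro integrableI_nonneg) auto
  with m show ?thesis by (simp add: L2_def)
qed

text \<open>Modes that solve the forced modal equations and obey this two-part bound assemble into a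
  weak solution. The first part belongs to the datum, whose coefficients are only square summable
  but damped; the second belongs to the control and is summable uniformly down to time 0.\<close>

locale modal_solution =
  fixes T d \<alpha> x0 K :: real and u :: "real \<Rightarrow> real" and y0 :: "real \<Rightarrow> real^('n::{finite,linorder})"
    and Y :: "nat \<Rightarrow> real \<Rightarrow> real^('n::{finite,linorder})"
  assumes T: "0 < T" and x0: "x0 \<in> {0<..<pi}" and y0: "y0 \<in> L2 Om"
    and u: "continuous_on UNIV u" and Yc: "\<And>k. continuous_on UNIV (Y k)"
    and ode: "\<And>k w t. ((\<lambda>t. Y k t \<bullet> w) has_real_derivative
        - ((modeM d \<alpha> k *v Y k t) \<bullet> w) + 2 / pi * sin (real k * x0) * u t * (vecB \<bullet> w)) (at t)"
    and init: "\<And>k. Y k 0 = (2 / pi) *\<^sub>R sinc k y0" and Y0: "\<And>t. Y 0 t = 0"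
    and K: "0 < K" and bound: "\<And>k t. 0 \<le> t \<Longrightarrow> t \<le> T \<Longrightarrow>
        norm (Y k t) \<le> K * (exp (- (real k)\<^sup>2 * t / 2) * norm (sinc k y0) + 1 / (1 + (real k)\<^sup>2))"
begin

text \<open>At time 0 the coefficients are merely square summable and the pointwise series need not
  converge, so the datum is inserted by hand.\<close>

definition y :: "real \<Rightarrow> real \<Rightarrow> (real, 'n) vec" where
  "y t = (if t = 0 then y0 else sine_series (\<lambda>k. Y k t))"

definition zpart :: "nat \<Rightarrow> real \<Rightarrow> real \<Rightarrow> (real, 'n) vec" where
  "zpart m t x = (\<Sum>k<m. (real k * cos (real k * x)) *\<^sub>R Y k t)"

text \<open>
  The sequence is lacunary so that the partial sums of \<open>y\<^sub>x\<close> converge fast enough in \<open>L\<^sup>2\<close> to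
  converge almost everywhere; the pointwise limit is then jointly measurable.
\<close>

definition z :: "real \<Rightarrow> real \<Rightarrow> (real, 'n) vec" where
  "z t x = lim (\<lambda>j. zpart (4 ^ j) t x)"

lemma sinc_y0_bounded: "\<exists>A>0. \<forall>k. norm (sinc k y0) \<le> A"
proof (intro exI conjI allI)
  show "0 < 1 + pi / 2 * (L2norm Om y0)\<^sup>2" by (intro add_pos_nonneg) auto
  fix k
  have "(norm (sinc k y0))\<^sup>2 \<le> (\<Sum>l<Suc k. (norm (sinc l y0))\<^sup>2)" by (simp add: sum_nonneg)
  also have "\<dots> \<le> pi / 2 * (L2norm Om y0)\<^sup>2" by (rule Bessel_sine[OF y0])
  finally have b: "(norm (sinc k y0))\<^sup>2 \<le> pi / 2 * (L2norm Om y0)\<^sup>2" .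
  show "norm (sinc k y0) \<le> 1 + pi / 2 * (L2norm Om y0)\<^sup>2"
  proof (cases "norm (sinc k y0) \<le> 1")
    case True
    have "0 \<le> pi / 2 * (L2norm Om y0)\<^sup>2" by simp
    with True show ?thesis by linarith
  next
    case False
    then have "norm (sinc k y0) \<le> (norm (sinc k y0))\<^sup>2" by (intro self_le_power) auto
    with b show ?thesis by linarith
  qed
qed

lemma Y_bound_positive_time:
  assumes "0 < t" "t \<le> T"
  shows "\<exists>C\<ge>0. \<forall>k. norm (Y k t) \<le> C / (1 + (real k)\<^sup>2)"
proof -
  obtain A where A: "0 < A" "\<And>k. norm (sinc k y0) \<le> A" using sinc_y0_bounded by blast
  let ?C = "K * ((1 + 2 / t) * A + 1)"
  have "norm (Y k t) \<le> ?C / (1 + (real k)\<^sup>2)" for k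
  proof -
    have "norm (Y k t) \<le> K * (exp (- (real k)\<^sup>2 * t / 2) * norm (sinc k y0) + 1 / (1 + (real k)\<^sup>2))"
      using bound assms by simp
    also have "\<dots> \<le> K * ((1 + 2 / t) / (1 + (real k)\<^sup>2) * A + 1 / (1 + (real k)\<^sup>2))"
      using K A assms by (intro mult_left_mono add_mono mult_mono one_plus_square_exp_bound) auto
    also have "\<dots> = ?C / (1 + (real k)\<^sup>2)"
      by (simp only: times_divide_eq_left times_divide_eq_right add_divide_distrib[symmetric])
    finally show ?thesis .
  qed
  moreover have "0 \<le> ?C" using K A(1) assms(1) by (intro mult_nonneg_nonneg add_nonneg_nonneg) auto
  ultimately show ?thesis by blast
qed

lemma Y_summable:
  assumes "0 < t" "t \<le> T"
  shows "summable (\<lambda>k. norm (Y k t))"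
proof -
  obtain C where C: "\<And>k. norm (Y k t) \<le> C / (1 + (real k)\<^sup>2)" using Y_bound_positive_time[OF assms] by blast
  show ?thesis
    by (rule summable_comparison_test'[OF summable_mult[OF summable_inverse_one_plus_square, of C], of 0]) (use C in simp)
qed

lemma y_L2: "t \<in> {0..T} \<Longrightarrow> y t \<in> L2 Om"
  using y0 sine_series_L2[OF Y_summable, of t pi] by (cases "t = 0") (auto simp: y_def)

lemma sinc_y: "t \<in> {0..T} \<Longrightarrow> sinc k (y t) = (pi / 2) *\<^sub>R Y k t"
  by (cases "k = 0"; cases "t = 0") (auto simp: y_def init Y0 intro!: sinc_sine_series Y_summable)

lemma summable_bound_square: "summable (\<lambda>k. (K * (norm (sinc k y0) + 1 / (1 + (real k)\<^sup>2)))\<^sup>2)"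
proof (rule summable_comparison_test')
  show "summable (\<lambda>k. 2 * K\<^sup>2 * ((norm (sinc k y0))\<^sup>2 + 1 / (1 + (real k)\<^sup>2)))"
    by (intro summable_mult summable_add summable_sinc y0 summable_inverse_one_plus_square)
  fix k :: nat
  define a b where "a = norm (sinc k y0)" and "b = 1 / (1 + (real k)\<^sup>2)"
  have "0 \<le> b" "b \<le> 1" unfolding b_def by (simp_all add: divide_le_eq add_pos_nonneg)
  then have "b\<^sup>2 \<le> b" by (simp add: power2_eq_square mult_left_le)
  have "(a + b)\<^sup>2 \<le> 2 * (a\<^sup>2 + b\<^sup>2)" using sum_squares_bound[of a b] by (simp add: power2_sum)
  then have "K\<^sup>2 * (a + b)\<^sup>2 \<le> K\<^sup>2 * (2 * (a\<^sup>2 + b))" using \<open>b\<^sup>2 \<le> b\<close>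
    by (intro mult_left_mono) auto
  also have "\<dots> = 2 * K\<^sup>2 * (a\<^sup>2 + b)" by (simp only: mult.left_commute mult.assoc)
  finally show "norm ((K * (a + b))\<^sup>2) \<le> 2 * K\<^sup>2 * (a\<^sup>2 + b)" by (simp add: power_mult_distrib)
qed

lemma Y_bound:
  assumes "t \<in> {0..T}"
  shows "norm (Y k t) \<le> K * (norm (sinc k y0) + 1 / (1 + (real k)\<^sup>2))"
proof -
  have "norm (Y k t) \<le> K * (exp (- (real k)\<^sup>2 * t / 2) * norm (sinc k y0) + 1 / (1 + (real k)\<^sup>2))"
    using bound assms by simp
  also have "\<dots> \<le> K * (1 * norm (sinc k y0) + 1 / (1 + (real k)\<^sup>2))"
    using K assms by (intro mult_left_mono add_mono mult_right_mono) auto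
  finally show ?thesis by simp
qed

lemma L2norm_y_diff:
  assumes "s \<in> {0..T}" "t \<in> {0..T}"
  shows "(L2norm Om (\<lambda>x. y s x - y t x))\<^sup>2 = (\<Sum>k. pi / 2 * (norm (Y k s - Y k t))\<^sup>2)"
proof -
  have "sinc k (\<lambda>x. y s x - y t x) = (pi / 2) *\<^sub>R (Y k s - Y k t)" for k
    by (simp only: sinc_diff[OF y_L2[OF assms(1)] y_L2[OF assms(2)]] sinc_y[OF assms(1)] sinc_y[OF assms(2)] scaleR_diff_right)
  moreover have "(norm ((pi / 2) *\<^sub>R v))\<^sup>2 = (pi / 2)\<^sup>2 * (norm v)\<^sup>2" for v :: "(real, 'n) vec"
    by (simp only: norm_scaleR power_mult_distrib power2_abs)
  ultimately have "(\<lambda>k. (pi / 2)\<^sup>2 * (norm (Y k s - Y k t))\<^sup>2) sums (pi / 2 * (L2norm Om (\<lambda>x. y s x - y t x))\<^sup>2)"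
    using Parseval[OF L2_diff[OF y_L2[OF assms(1)] y_L2[OF assms(2)]]] by (simp only:)
  from sums_mult[OF this, of "2 / pi"]
  have "(\<lambda>k. pi / 2 * (norm (Y k s - Y k t))\<^sup>2) sums (L2norm Om (\<lambda>x. y s x - y t x))\<^sup>2"
    by (simp add: power2_eq_square mult_ac)
  then show ?thesis by (simp add: sums_iff)
qed

text \<open>Tannery's theorem for the Parseval series of the difference: each mode is continuous,
  and \<open>Y_bound\<close> gives a square summable majorant that does not depend on time.\<close>

lemma y_continuous:
  assumes t: "t \<in> {0..T}"
  shows "((\<lambda>s. L2norm Om (\<lambda>x. y s x - y t x)) \<longlongrightarrow> 0) (at t within {0..T})"
proof -
  let ?F = "at t within {0..T}"
  have ne: "?F \<noteq> bot" using T t by (simp add: trivial_limit_within islimpt_Icc)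
  have "((\<lambda>s. \<Sum>k. pi / 2 * (norm (Y k s - Y k t))\<^sup>2) \<longlongrightarrow> (\<Sum>k. 0)) ?F"
  proof (rule tannerys_theorem[THEN conjunct2, THEN conjunct2])
    fix k
    have "(Y k \<longlongrightarrow> Y k t) ?F"
      using continuous_on_subset[OF Yc subset_UNIV, of "{0..T}" k] t by (simp add: continuous_on)
    then have "((\<lambda>s. pi / 2 * (norm (Y k s - Y k t))\<^sup>2) \<longlongrightarrow> pi / 2 * (norm (Y k t - Y k t))\<^sup>2) ?F"
      by (intro tendsto_intros)
    then show "((\<lambda>s. pi / 2 * (norm (Y k s - Y k t))\<^sup>2) \<longlongrightarrow> 0) ?F" by simp
  next
    let ?M = "\<lambda>k. 2 * pi * (K * (norm (sinc k y0) + 1 / (1 + (real k)\<^sup>2)))\<^sup>2"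
    show "summable ?M" by (intro summable_mult summable_bound_square)
    have "norm (pi / 2 * (norm (Y k s - Y k t))\<^sup>2) \<le> ?M k" if "s \<in> {0..T}" for k s
    proof -
      let ?B = "K * (norm (sinc k y0) + 1 / (1 + (real k)\<^sup>2))"
      have "norm (Y k s - Y k t) \<le> ?B + ?B"
        using norm_triangle_ineq4[of "Y k s" "Y k t"] Y_bound[OF that, of k] Y_bound[OF t, of k] by linarith
      then have "(norm (Y k s - Y k t))\<^sup>2 \<le> (?B + ?B)\<^sup>2" by (intro power_mono) auto
      then have "pi / 2 * (norm (Y k s - Y k t))\<^sup>2 \<le> pi / 2 * (?B + ?B)\<^sup>2" by (intro mult_left_mono) auto
      also have "\<dots> = ?M k" by (simp only: mult_2[symmetric] power_mult_distrib) simp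
      finally show ?thesis by simp
    qed
    then show "\<forall>\<^sub>F (k, s) in at_top \<times>\<^sub>F ?F. norm (pi / 2 * (norm (Y k s - Y k t))\<^sup>2) \<le> ?M k"
      unfolding eventually_prod_filter
      by (intro exI[of _ "\<lambda>_. True"] exI[of _ "\<lambda>s. s \<in> {0..T}"]) (auto simp: eventually_at_filter)
  qed (rule ne)
  then have "((\<lambda>s. sqrt (\<Sum>k. pi / 2 * (norm (Y k s - Y k t))\<^sup>2)) \<longlongrightarrow> sqrt 0) ?F"
    by (intro tendsto_real_sqrt) simp
  then have lim: "((\<lambda>s. sqrt (\<Sum>k. pi / 2 * (norm (Y k s - Y k t))\<^sup>2)) \<longlongrightarrow> 0) ?F" by simp
  show ?thesis
  proof (rule Lim_transform_eventually[OF lim])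
    have "sqrt (\<Sum>k. pi / 2 * (norm (Y k s - Y k t))\<^sup>2) = L2norm Om (\<lambda>x. y s x - y t x)" if "s \<in> {0..T}" for s
      by (simp only: L2norm_y_diff[OF that t, symmetric] real_sqrt_abs abs_of_nonneg L2norm_nonneg)
    then show "\<forall>\<^sub>F s in ?F. sqrt (\<Sum>k. pi / 2 * (norm (Y k s - Y k t))\<^sup>2) = L2norm Om (\<lambda>x. y s x - y t x)"
      by (auto simp: eventually_at_filter)
  qed
qed

section \<open>The spatial derivative of the solution\<close>

lemma zpart_L2: "zpart m t \<in> L2 Om"
  unfolding zpart_def[abs_def] by (intro L2_continuous continuous_intros)

lemma zpart_diff:
  assumes "m \<le> n"
  shows "zpart n t x - zpart m t x = (\<Sum>k\<in>{m..<n}. cos (real k * x) *\<^sub>R (real k *\<^sub>R Y k t))"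
proof -
  have "(\<Sum>k<n. (real k * cos (real k * x)) *\<^sub>R Y k t)
      = (\<Sum>k<m. (real k * cos (real k * x)) *\<^sub>R Y k t) + (\<Sum>k\<in>{m..<n}. (real k * cos (real k * x)) *\<^sub>R Y k t)"
    using assms by (simp add: lessThan_atLeast0 sum.atLeastLessThan_concat)
  then show ?thesis by (simp add: zpart_def mult.commute)
qed

text \<open>Between the cutoffs 4^j and 4^(j+1) the squared norm is controlled by a tail of size
  2/4^j; its square root is the rate (1/2)^j that \<open>Riesz_Fischer\<close> demands.\<close>

lemma z_limit:
  assumes t: "0 < t" "t \<le> T"
  shows "z t \<in> L2 Om" "(\<lambda>j. L2norm Om (\<lambda>x. zpart (4 ^ j) t x - z t x)) \<longlonglongrightarrow> 0"
proof -
  obtain C where C: "0 \<le> C" "\<And>k. norm (Y k t) \<le> C / (1 + (real k)\<^sup>2)" using Y_bound_positive_time[OF t] by blast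
  have fast: "L2norm Om (\<lambda>x. zpart (4 ^ Suc j) t x - zpart (4 ^ j) t x) \<le> sqrt (pi * C\<^sup>2) * (1/2) ^ j" for j
  proof (rule power2_le_imp_le)
    have "(L2norm Om (\<lambda>x. zpart (4 ^ Suc j) t x - zpart (4 ^ j) t x))\<^sup>2
        = pi / 2 * (\<Sum>k\<in>{4 ^ j..<4 ^ Suc j}. (norm (real k *\<^sub>R Y k t))\<^sup>2)"
    proof -
      have "(4::nat) ^ j \<le> 4 ^ Suc j" by simp
      moreover have "(L2norm Om (\<lambda>x. \<Sum>k\<in>{4 ^ j..<4 ^ Suc j}. cos (real k * x) *\<^sub>R (real k *\<^sub>R Y k t)))\<^sup>2
          = pi / 2 * (\<Sum>k\<in>{4 ^ j..<4 ^ Suc j}. (norm (real k *\<^sub>R Y k t))\<^sup>2)"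
        by (rule L2norm_cosine_sum) auto
      ultimately show ?thesis by (simp only: zpart_diff)
    qed
    also have "\<dots> \<le> pi / 2 * (\<Sum>k\<in>{4 ^ j..<4 ^ Suc j}. C\<^sup>2 * (1 / (1 + (real k)\<^sup>2)))"
    proof (intro mult_left_mono sum_mono)
      fix k
      define q where "q = 1 + (real k)\<^sup>2"
      have q: "0 < q" "(real k)\<^sup>2 \<le> q" unfolding q_def by (auto intro: add_pos_nonneg)
      have "(norm (real k *\<^sub>R Y k t))\<^sup>2 = (real k)\<^sup>2 * (norm (Y k t))\<^sup>2" by (simp add: power_mult_distrib)
      also have "\<dots> \<le> q * (C / q)\<^sup>2"
        using C(2)[of k] q unfolding q_def by (intro mult_mono power_mono) auto
      also have "\<dots> = C\<^sup>2 * (1 / q)" using q by (simp add: power_divide power2_eq_square)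
      finally show "(norm (real k *\<^sub>R Y k t))\<^sup>2 \<le> C\<^sup>2 * (1 / (1 + (real k)\<^sup>2))" unfolding q_def .
    qed simp
    also have "\<dots> = pi / 2 * (C\<^sup>2 * (\<Sum>k\<in>{4 ^ j..<4 ^ Suc j}. 1 / (1 + (real k)\<^sup>2)))"
      by (simp only: sum_distrib_left)
    also have "\<dots> \<le> pi / 2 * (C\<^sup>2 * (2 / real (4 ^ j)))"
      by (intro mult_left_mono sum_inverse_one_plus_square_tail) auto
    also have "\<dots> = (sqrt (pi * C\<^sup>2) * (1/2) ^ j)\<^sup>2"
    proof -
      have "((1/2::real) ^ j)\<^sup>2 = (1/2 * (1/2)) ^ j" by (simp only: power2_eq_square power_mult_distrib)
      also have "\<dots> = 1 / 4 ^ j" by (simp add: power_one_over)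
      finally have "((1/2::real) ^ j)\<^sup>2 = 1 / 4 ^ j" .
      then show ?thesis by (simp add: power_mult_distrib)
    qed
    finally show "(L2norm Om (\<lambda>x. zpart (4 ^ Suc j) t x - zpart (4 ^ j) t x))\<^sup>2 \<le> (sqrt (pi * C\<^sup>2) * (1/2) ^ j)\<^sup>2" .
  qed (use C(1) in simp)
  have "z t = (\<lambda>x. lim (\<lambda>j. zpart (4 ^ j) t x))" by (simp add: z_def[abs_def])
  with Riesz_Fischer[OF finite_leb zpart_L2 fast]
  show "z t \<in> L2 Om" "(\<lambda>j. L2norm Om (\<lambda>x. zpart (4 ^ j) t x - z t x)) \<longlonglongrightarrow> 0" by simp_all
qed

lemma H10_deriv_partial:
  "H10_deriv (\<lambda>x. \<Sum>k<m. sin (real k * x) *\<^sub>R Y k t) (zpart m t)"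
  unfolding zpart_def[abs_def]
proof (rule H10_deriv_C1)
  fix x
  have "((\<lambda>x. sin (real k * x) *\<^sub>R Y k t) has_vector_derivative (real k * cos (real k * x)) *\<^sub>R Y k t) (at x)" for k
    using has_vector_derivative_scaleR[OF _ has_vector_derivative_const[of "Y k t"],
        of "\<lambda>x. sin (real k * x)" "real k * cos (real k * x)" x UNIV] trig_has_vector_derivative(1)[of k x]
    by (simp add: has_real_derivative_iff_has_vector_derivative)
  then show "((\<lambda>x. \<Sum>k<m. sin (real k * x) *\<^sub>R Y k t) has_vector_derivative (\<Sum>k<m. (real k * cos (real k * x)) *\<^sub>R Y k t)) (at x)"
    by (intro has_vector_derivative_sum)
qed (auto intro!: continuous_intros)

lemma filterlim_power_4: "filterlim (\<lambda>j. 4 ^ j :: nat) at_top sequentially"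
  by (rule filterlim_subseq) (auto intro: strict_monoI power_strict_increasing)

lemma H10_deriv_y:
  assumes t: "0 < t" "t \<le> T"
  shows "H10_deriv (y t) (z t)"
proof (rule H10_deriv_limit[OF H10_deriv_partial _ z_limit(1)[OF t] _ z_limit(2)[OF t]])
  have tT: "t \<in> {0..T}" using t by simp
  show L: "y t \<in> L2 Om" by (rule y_L2[OF tT])
  have "(2 / pi) *\<^sub>R sinc k (y t) = Y k t" for k by (simp add: sinc_y[OF tT])
  then have "(\<lambda>m. L2norm Om (\<lambda>x. y t x - (\<Sum>k<m. sin (real k * x) *\<^sub>R Y k t))) \<longlonglongrightarrow> 0"
    using sine_partial_sums_tendsto[OF L] by simp
  from filterlim_compose[OF this filterlim_power_4]
  show "(\<lambda>j. L2norm Om (\<lambda>x. (\<Sum>k<4 ^ j. sin (real k * x) *\<^sub>R Y k t) - y t x)) \<longlonglongrightarrow> 0"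
    by (simp add: L2norm_minus_commute[of _ "y t"])
qed

lemma Y_measurable: "(\<lambda>p. Y k (fst p)) \<in> borel_measurable (leb T \<Otimes>\<^sub>M Om)"
proof -
  have [measurable]: "Y k \<in> borel_measurable (leb T)"
    using borel_measurable_continuous_onI[OF Yc] by (intro measurable_restrict_space1) simp
  show ?thesis by measurable
qed

lemma snd_measurable: "(\<lambda>p. snd p) \<in> borel_measurable (leb T \<Otimes>\<^sub>M Om)"
proof -
  have [measurable]: "(\<lambda>x. x) \<in> borel_measurable Om" by (intro measurable_restrict_space1) simp
  show ?thesis by measurable
qed

lemma y_joint_measurable: "case_prod y \<in> borel_measurable (leb T \<Otimes>\<^sub>M Om)"
proof -
  note [measurable] = Y_measurable snd_measurable
  have "(\<lambda>p. \<Sum>k. sin (real k * snd p) *\<^sub>R Y k (fst p)) \<in> borel_measurable (leb T \<Otimes>\<^sub>M Om)"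
    by (intro borel_measurable_suminf) measurable
  \<comment> \<open>The first factor is an open interval, so the exceptional definition at time 0 is
    never met.\<close>
  then show ?thesis
    by (rule measurable_cong[THEN iffD1, rotated])
      (auto simp: space_pair_measure y_def sine_series_def)
qed

lemma z_joint_measurable: "case_prod z \<in> borel_measurable (leb T \<Otimes>\<^sub>M Om)"
proof -
  note [measurable] = Y_measurable snd_measurable
  have "(\<lambda>p. lim (\<lambda>j. zpart (4 ^ j) (fst p) (snd p))) \<in> borel_measurable (leb T \<Otimes>\<^sub>M Om)"
    unfolding zpart_def by (intro borel_measurable_lim_metric) measurable
  then show ?thesis by (simp add: z_def case_prod_beta')
qed

lemma y_joint_L2: "case_prod y \<in> L2 (leb T \<Otimes>\<^sub>M Om)"
proof (rule L2_product[OF y_joint_measurable])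
  show "t \<in> {0<..<T} \<Longrightarrow> y t \<in> L2 Om" for t by (rule y_L2) simp
  define S where "S = (\<Sum>k. (K * (norm (sinc k y0) + 1 / (1 + (real k)\<^sup>2)))\<^sup>2)"
  have "(L2norm Om (y t))\<^sup>2 \<le> pi / 2 * S" if t: "t \<in> {0<..<T}" for t
  proof -
    have tT: "t \<in> {0..T}" using t by simp
    have "(\<lambda>k. pi / 2 * (norm (Y k t))\<^sup>2) sums (L2norm Om (sine_series (\<lambda>k. Y k t)))\<^sup>2"
      using t by (intro L2norm_sine_series Y_summable Y0) auto
    moreover have "y t = sine_series (\<lambda>k. Y k t)" using t by (simp add: y_def)
    ultimately have s: "(\<lambda>k. pi / 2 * (norm (Y k t))\<^sup>2) sums (L2norm Om (y t))\<^sup>2" by simp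
    have "(\<Sum>k. pi / 2 * (norm (Y k t))\<^sup>2) \<le> (\<Sum>k. pi / 2 * (K * (norm (sinc k y0) + 1 / (1 + (real k)\<^sup>2)))\<^sup>2)"
      by (intro suminf_le mult_left_mono power_mono Y_bound tT sums_summable[OF s] summable_mult summable_bound_square) auto
    also have "\<dots> = pi / 2 * S" unfolding S_def by (rule suminf_mult[OF summable_bound_square])
    finally show ?thesis using sums_unique[OF s] by simp
  qed
  then have "(\<integral>\<^sup>+t. ennreal ((L2norm Om (y t))\<^sup>2) \<partial>leb T) \<le> (\<integral>\<^sup>+t. ennreal (pi / 2 * S) \<partial>leb T)"
    by (intro nn_integral_mono ennreal_leI) simp
  also have "\<dots> < \<infinity>"
    using finite_measure.emeasure_finite[OF finite_leb, of T "space (leb T)"]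
    by (simp add: ennreal_mult_less_top top.not_eq_extremum)
  finally show "(\<integral>\<^sup>+t. ennreal ((L2norm Om (y t))\<^sup>2) \<partial>leb T) < \<infinity>" .
qed

text \<open>\<open>h k t\<close> bounds the energy of the k-th mode of the derivative. Replacing e^2
  by e for a number e in [0,1] keeps the exponent in the form of
  \<open>integral_square_exp_le\<close>, so the time integrals are summable over k.\<close>

lemma z_joint_L2: "case_prod z \<in> L2 (leb T \<Otimes>\<^sub>M Om)"
proof (rule L2_product[OF z_joint_measurable])
  show "t \<in> {0<..<T} \<Longrightarrow> z t \<in> L2 Om" for t by (rule z_limit(1)) auto
  define h where "h k t = pi * K\<^sup>2 * ((norm (sinc k y0))\<^sup>2 * ((real k)\<^sup>2 * exp (- (real k)\<^sup>2 * t / 2)) + 1 / (1 + (real k)\<^sup>2))" for k t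
  have hnn: "0 \<le> h k t" for k t
    unfolding h_def by (intro mult_nonneg_nonneg add_nonneg_nonneg) auto
  have hc: "continuous_on S (h k)" for k S unfolding h_def by (intro continuous_intros) (auto simp: add_nonneg_eq_0_iff)
  have term_le: "pi / 2 * (norm (real k *\<^sub>R Y k t))\<^sup>2 \<le> h k t" if t: "t \<in> {0<..<T}" for k t
  proof -
    define a b e q where "a = norm (sinc k y0)" and "b = 1 / (1 + (real k)\<^sup>2)"
      and "e = exp (- (real k)\<^sup>2 * t / 2)" and "q = (real k)\<^sup>2"
    have q: "0 \<le> q" by (simp add: q_def)
    have e: "0 \<le> e" "e \<le> 1" unfolding e_def using t by auto
    then have "e\<^sup>2 \<le> e" by (simp add: power2_eq_square mult_left_le)
    have "b = 1 / (1 + q)" by (simp add: b_def q_def)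
    have "0 < 1 + q" using q by simp
    have "q * b\<^sup>2 \<le> (1 + q) * b\<^sup>2" by (intro mult_right_mono) auto
    also have "\<dots> = b" using \<open>0 < 1 + q\<close> by (simp add: \<open>b = 1 / (1 + q)\<close> power2_eq_square)
    finally have qb: "q * b\<^sup>2 \<le> b" .
    have "norm (Y k t) \<le> K * (e * a + b)" using bound[of t k] t unfolding a_def b_def e_def by simp
    then have "(norm (Y k t))\<^sup>2 \<le> (K * (e * a + b))\<^sup>2" by (intro power_mono) auto
    also have "\<dots> = K\<^sup>2 * (e * a + b)\<^sup>2" by (simp add: power_mult_distrib)
    also have "\<dots> \<le> K\<^sup>2 * (2 * ((e * a)\<^sup>2 + b\<^sup>2))"
      using sum_squares_bound[of "e * a" b] by (intro mult_left_mono) (auto simp: power2_sum)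
    finally have "pi / 2 * (q * (norm (Y k t))\<^sup>2) \<le> pi / 2 * (q * (K\<^sup>2 * (2 * ((e * a)\<^sup>2 + b\<^sup>2))))"
      using q by (intro mult_left_mono) auto
    also have "\<dots> = pi * K\<^sup>2 * (a\<^sup>2 * (q * e\<^sup>2) + q * b\<^sup>2)" by (simp add: power_mult_distrib algebra_simps)
    also have "\<dots> \<le> pi * K\<^sup>2 * (a\<^sup>2 * (q * e) + b)"
      using \<open>e\<^sup>2 \<le> e\<close> q qb by (intro mult_left_mono add_mono) auto
    finally show ?thesis by (simp add: h_def a_def b_def e_def q_def power_mult_distrib)
  qed
  have zt: "ennreal ((L2norm Om (z t))\<^sup>2) \<le> (\<Sum>k. ennreal (h k t))" if t: "t \<in> {0<..<T}" for t
  proof -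
    have t': "0 < t" "t \<le> T" using t by auto
    have n0: "L2norm Om (zpart m t) \<le> sqrt (\<Sum>k<m. h k t)" for m
    proof (rule real_le_rsqrt)
      have "zpart m t = (\<lambda>x. \<Sum>k\<in>{1..<m}. cos (real k * x) *\<^sub>R (real k *\<^sub>R Y k t))"
        unfolding zpart_def[abs_def] by (intro ext sum.mono_neutral_cong_right) (auto simp: Suc_le_eq mult.commute)
      moreover have "(L2norm Om (\<lambda>x. \<Sum>k\<in>{1..<m}. cos (real k * x) *\<^sub>R (real k *\<^sub>R Y k t)))\<^sup>2
          = pi / 2 * (\<Sum>k\<in>{1..<m}. (norm (real k *\<^sub>R Y k t))\<^sup>2)"
        by (rule L2norm_cosine_sum) auto
      ultimately have "(L2norm Om (zpart m t))\<^sup>2 = pi / 2 * (\<Sum>k\<in>{1..<m}. (norm (real k *\<^sub>R Y k t))\<^sup>2)"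
        by (simp only:)
      also have "\<dots> \<le> (\<Sum>k\<in>{1..<m}. h k t)"
        unfolding sum_distrib_left by (intro sum_mono term_le t)
      also have "\<dots> \<le> (\<Sum>k<m. h k t)" by (intro sum_mono2 hnn) auto
      finally show "(L2norm Om (zpart m t))\<^sup>2 \<le> (\<Sum>k<m. h k t)" .
    qed
    have "(\<lambda>j. L2norm Om (zpart (4 ^ j) t)) \<longlonglongrightarrow> L2norm Om (z t)"
    proof (rule LIM_zero_cancel, rule Lim_null_comparison[OF _ z_limit(2)[OF t']], intro always_eventually allI)
      fix j
      have "L2norm Om (zpart (4 ^ j) t) \<le> L2norm Om (\<lambda>x. zpart (4 ^ j) t x - z t x) + L2norm Om (z t)"
        using L2norm_triangle[OF L2_diff[OF zpart_L2[of "4 ^ j" t] z_limit(1)[OF t']] z_limit(1)[OF t']] by simp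
      moreover have "L2norm Om (z t) \<le> L2norm Om (\<lambda>x. z t x - zpart (4 ^ j) t x) + L2norm Om (zpart (4 ^ j) t)"
        using L2norm_triangle[OF L2_diff[OF z_limit(1)[OF t'] zpart_L2[of "4 ^ j" t]] zpart_L2[of "4 ^ j" t]] by simp
      ultimately show "norm (L2norm Om (zpart (4 ^ j) t) - L2norm Om (z t)) \<le> L2norm Om (\<lambda>x. zpart (4 ^ j) t x - z t x)"
        by (simp add: L2norm_minus_commute[of _ "z t"] abs_le_iff)
    qed
    then have "(\<lambda>j. ennreal ((L2norm Om (zpart (4 ^ j) t))\<^sup>2)) \<longlonglongrightarrow> ennreal ((L2norm Om (z t))\<^sup>2)"
      by (intro tendsto_ennrealI tendsto_power)
    then show ?thesis
    proof (rule LIMSEQ_le_const2, intro exI allI impI)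
      fix j
      have "(L2norm Om (zpart (4 ^ j) t))\<^sup>2 \<le> (sqrt (\<Sum>k<4 ^ j. h k t))\<^sup>2"
        by (intro power_mono n0 L2norm_nonneg)
      then have "ennreal ((L2norm Om (zpart (4 ^ j) t))\<^sup>2) \<le> (\<Sum>k<4 ^ j. ennreal (h k t))"
        by (subst sum_ennreal) (auto simp: hnn sum_nonneg intro!: ennreal_leI)
      also have "\<dots> \<le> (\<Sum>k. ennreal (h k t))" by (intro sum_le_suminf) auto
      finally show "ennreal ((L2norm Om (zpart (4 ^ j) t))\<^sup>2) \<le> (\<Sum>k. ennreal (h k t))" .
    qed
  qed
  have hm: "(\<lambda>t. ennreal (h k t)) \<in> borel_measurable (leb T)" for k
    using borel_measurable_integrable[OF leb_continuous(1)[OF hc[of "{0..T}" k]]] by measurable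
  have "(\<integral>\<^sup>+t. ennreal ((L2norm Om (z t))\<^sup>2) \<partial>leb T) \<le> (\<integral>\<^sup>+t. (\<Sum>k. ennreal (h k t)) \<partial>leb T)"
    by (intro nn_integral_mono zt) simp
  also have "\<dots> = (\<Sum>k. \<integral>\<^sup>+t. ennreal (h k t) \<partial>leb T)" by (intro nn_integral_suminf hm)
  also have "\<dots> \<le> (\<Sum>k. ennreal (pi * K\<^sup>2 * ((norm (sinc k y0))\<^sup>2 * 2 + T * (1 / (1 + (real k)\<^sup>2)))))"
  proof (intro suminf_le)
    fix k
    have i1: "integrable (leb T) (\<lambda>t. (real k)\<^sup>2 * exp (- (real k)\<^sup>2 * t / 2))"
      by (intro leb_continuous continuous_intros) auto
    have i2: "integrable (leb T) (\<lambda>t. 1 / (1 + (real k)\<^sup>2))"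
      by (intro leb_continuous continuous_intros)
    have "(LINT t|leb T. h k t) = pi * K\<^sup>2 * ((norm (sinc k y0))\<^sup>2 * (LINT t|leb T. (real k)\<^sup>2 * exp (- (real k)\<^sup>2 * t / 2)) + (LINT t|leb T. 1 / (1 + (real k)\<^sup>2)))"
      unfolding h_def integral_mult_right_zero
      by (subst Bochner_Integration.integral_add[OF integrable_mult_right[OF i1] i2]) (simp only: integral_mult_right_zero)
    also have "(LINT t|leb T. 1 / (1 + (real k)\<^sup>2)) = T * (1 / (1 + (real k)\<^sup>2))"
      using T by (simp add: measure_restrict_space)
    also have "pi * K\<^sup>2 * ((norm (sinc k y0))\<^sup>2 * (LINT t|leb T. (real k)\<^sup>2 * exp (- (real k)\<^sup>2 * t / 2)) + T * (1 / (1 + (real k)\<^sup>2)))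
        \<le> pi * K\<^sup>2 * ((norm (sinc k y0))\<^sup>2 * 2 + T * (1 / (1 + (real k)\<^sup>2)))"
      using T by (intro mult_left_mono add_mono integral_square_exp_le) auto
    finally have "(LINT t|leb T. h k t) \<le> pi * K\<^sup>2 * ((norm (sinc k y0))\<^sup>2 * 2 + T * (1 / (1 + (real k)\<^sup>2)))" .
    moreover have "(\<integral>\<^sup>+t. ennreal (h k t) \<partial>leb T) = ennreal (LINT t|leb T. h k t)"
      by (intro nn_integral_eq_integral leb_continuous hc) (simp add: hnn)
    ultimately show "(\<integral>\<^sup>+t. ennreal (h k t) \<partial>leb T) \<le> ennreal (pi * K\<^sup>2 * ((norm (sinc k y0))\<^sup>2 * 2 + T * (1 / (1 + (real k)\<^sup>2))))"
      by (simp add: ennreal_leI)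
  qed auto
  also have "\<dots> = ennreal (\<Sum>k. pi * K\<^sup>2 * ((norm (sinc k y0))\<^sup>2 * 2 + T * (1 / (1 + (real k)\<^sup>2))))"
  proof (rule suminf_ennreal2)
    show "0 \<le> pi * K\<^sup>2 * ((norm (sinc k y0))\<^sup>2 * 2 + T * (1 / (1 + (real k)\<^sup>2)))" for k
      using T by (intro mult_nonneg_nonneg add_nonneg_nonneg) auto
    show "summable (\<lambda>k. pi * K\<^sup>2 * ((norm (sinc k y0))\<^sup>2 * 2 + T * (1 / (1 + (real k)\<^sup>2))))"
      by (intro summable_mult summable_add summable_mult2 summable_sinc y0 summable_inverse_one_plus_square)
  qed
  also have "\<dots> < \<infinity>" by simp
  finally show "(\<integral>\<^sup>+t. ennreal ((L2norm Om (z t))\<^sup>2) \<partial>leb T) < \<infinity>" .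
qed

section \<open>The weak formulation, mode by mode\<close>

lemma inner_y_sums:
  assumes "t \<in> {0..T}" "g \<in> L2 Om"
  shows "(\<lambda>k. Y k t \<bullet> sinc k g) sums (LINT x|Om. y t x \<bullet> g x)"
proof -
  have "(\<lambda>k. 2 / pi * (sinc k (y t) \<bullet> sinc k g)) sums (2 / pi * (pi / 2 * (LINT x|Om. y t x \<bullet> g x)))"
    by (intro sums_mult Parseval_inner y_L2 assms)
  then show ?thesis by (simp add: sinc_y[OF assms(1)])
qed

lemma norm_modeM_bound: "\<exists>C\<ge>0. \<forall>k x. norm (modeM d \<alpha> k *v (x :: (real, 'n) vec)) \<le> C * ((1 + (real k)\<^sup>2) * norm x)"
proof -
  obtain C1 where C1: "\<And>x. norm (matD d *v (x :: (real, 'n) vec)) \<le> norm x * C1" "0 \<le> C1"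
    using bounded_linear.nonneg_bounded[OF matrix_vector_mul_bounded_linear] by blast
  obtain C2 where C2: "\<And>x. norm (matA \<alpha> *v (x :: (real, 'n) vec)) \<le> norm x * C2" "0 \<le> C2"
    using bounded_linear.nonneg_bounded[OF matrix_vector_mul_bounded_linear] by blast
  have "norm (modeM d \<alpha> k *v x) \<le> (C1 + C2) * ((1 + (real k)\<^sup>2) * norm x)" for k and x :: "(real, 'n) vec"
  proof -
    have "modeM d \<alpha> k *v x = (real k)\<^sup>2 *\<^sub>R (matD d *v x) + matA \<alpha> *v x"
      by (simp add: modeM_def matrix_vector_mult_add_rdistrib scaleR_matrix_vector_assoc)
    then have "norm (modeM d \<alpha> k *v x) \<le> (real k)\<^sup>2 * norm (matD d *v x) + norm (matA \<alpha> *v x)"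
      using norm_triangle_ineq[of "(real k)\<^sup>2 *\<^sub>R (matD d *v x)" "matA \<alpha> *v x"] by simp
    also have "\<dots> \<le> (1 + (real k)\<^sup>2) * (norm x * C1) + (1 + (real k)\<^sup>2) * (norm x * C2)"
    proof (rule add_mono)
      show "(real k)\<^sup>2 * norm (matD d *v x) \<le> (1 + (real k)\<^sup>2) * (norm x * C1)"
        by (intro mult_mono C1) auto
      have "norm (matA \<alpha> *v x) \<le> 1 * (norm x * C2)" using C2 by simp
      also have "\<dots> \<le> (1 + (real k)\<^sup>2) * (norm x * C2)" using C2(2) by (intro mult_right_mono) auto
      finally show "norm (matA \<alpha> *v x) \<le> (1 + (real k)\<^sup>2) * (norm x * C2)" .
    qed
    finally show ?thesis by (simp add: algebra_simps)
  qed
  moreover have "0 \<le> C1 + C2" using C1 C2 by simp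
  ultimately show ?thesis by blast
qed

text \<open>On modes the bilinear form becomes k^2 D + A: one factor k comes from \<open>z\<close>,
  the other from the cosine coefficients of v'. The series is known to converge absolutely, so its
  sum may be computed along the lacunary partial sums that converge to \<open>z\<close>.\<close>

lemma inner_z_sums:
  assumes t: "0 < t" "t \<le> T" and v: "H10_deriv v v'"
  shows "(\<lambda>k. (modeM d \<alpha> k *v Y k t) \<bullet> sinc k v) sums
    (LINT x|Om. (matD d *v z t x) \<bullet> v' x + (matA \<alpha> *v y t x) \<bullet> v x)"
proof -
  let ?V = "\<lambda>k. sinc k v"
  have tT: "t \<in> {0..T}" using t by simp
  let ?Dv = "\<lambda>x. transpose (matD d) *v v' x" and ?Av = "\<lambda>x. transpose (matA \<alpha>) *v v x"
  have DvL: "?Dv \<in> L2 Om" by (rule L2_linear[OF H10_derivD(3)[OF v] matrix_vector_mul_linear])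
  have AvL: "?Av \<in> L2 Om" by (rule L2_linear[OF H10_derivD(2)[OF v] matrix_vector_mul_linear])
  have tr: "(M *v a) \<bullet> b = a \<bullet> (transpose M *v b)" for M :: "((real, 'n) vec, 'n) vec" and a b
    by (metis dot_lmul_matrix inner_commute transpose_matrix_vector)
  obtain C where C: "0 \<le> C" "\<And>k. norm (Y k t) \<le> C / (1 + (real k)\<^sup>2)" using Y_bound_positive_time[OF t] by blast
  have sA: "(\<lambda>k. (matA \<alpha> *v Y k t) \<bullet> ?V k) sums (LINT x|Om. (matA \<alpha> *v y t x) \<bullet> v x)"
    using inner_y_sums[OF tT AvL] by (simp only: tr sinc_linear[OF H10_derivD(2)[OF v] matrix_vector_mul_linear])
  have "summable (\<lambda>k. ((real k)\<^sup>2 *\<^sub>R (matD d *v Y k t)) \<bullet> ?V k)"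
  proof -
    obtain C1 where C1: "\<And>x. norm (matD d *v (x :: (real, 'n) vec)) \<le> norm x * C1" "0 \<le> C1"
      using bounded_linear.nonneg_bounded[OF matrix_vector_mul_bounded_linear] by blast
    show ?thesis
    proof (rule summable_comparison_test'[OF summable_mult[OF summable_norm_sinc_H10(2)[OF v], of "C * C1"], of 0])
      fix k
      have "(real k)\<^sup>2 * norm (Y k t) \<le> (1 + (real k)\<^sup>2) * (C / (1 + (real k)\<^sup>2))"
        by (intro mult_mono C) auto
      also have "\<dots> = C" by (simp add: add_nonneg_eq_0_iff)
      finally have b: "(real k)\<^sup>2 * norm (Y k t) \<le> C" .
      have "norm (((real k)\<^sup>2 *\<^sub>R (matD d *v Y k t)) \<bullet> ?V k) \<le> norm ((real k)\<^sup>2 *\<^sub>R (matD d *v Y k t)) * norm (?V k)"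
        by (simp only: real_norm_def Cauchy_Schwarz_ineq2)
      also have "\<dots> \<le> ((real k)\<^sup>2 * (norm (Y k t) * C1)) * norm (?V k)"
        using C1(1)[of "Y k t"] by (intro mult_right_mono) (auto intro: mult_left_mono)
      also have "\<dots> \<le> (C * C1) * norm (?V k)"
        using mult_right_mono[OF b C1(2)] by (intro mult_right_mono) (auto simp: mult.assoc)
      finally show "norm (((real k)\<^sup>2 *\<^sub>R (matD d *v Y k t)) \<bullet> ?V k) \<le> C * C1 * norm (?V k)" .
    qed
  qed
  then have "(\<lambda>m. \<Sum>k<m. ((real k)\<^sup>2 *\<^sub>R (matD d *v Y k t)) \<bullet> ?V k) \<longlonglongrightarrow> (\<Sum>k. ((real k)\<^sup>2 *\<^sub>R (matD d *v Y k t)) \<bullet> ?V k)"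
    by (rule summable_LIMSEQ)
  from filterlim_compose[OF this filterlim_power_4]
  have l1: "(\<lambda>j. \<Sum>k<4 ^ j. ((real k)\<^sup>2 *\<^sub>R (matD d *v Y k t)) \<bullet> ?V k) \<longlonglongrightarrow> (\<Sum>k. ((real k)\<^sup>2 *\<^sub>R (matD d *v Y k t)) \<bullet> ?V k)" .
  have part: "(LINT x|Om. zpart m t x \<bullet> ?Dv x) = (\<Sum>k<m. ((real k)\<^sup>2 *\<^sub>R (matD d *v Y k t)) \<bullet> ?V k)" for m
  proof -
    have "(LINT x|Om. zpart m t x \<bullet> ?Dv x) = (LINT x|Om. (\<Sum>k<m. (real k *\<^sub>R Y k t) \<bullet> (cos (real k * x) *\<^sub>R ?Dv x)))"
      unfolding zpart_def by (simp add: inner_sum_left mult_ac)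
    also have "\<dots> = (\<Sum>k<m. LINT x|Om. (real k *\<^sub>R Y k t) \<bullet> (cos (real k * x) *\<^sub>R ?Dv x))"
      by (intro Bochner_Integration.integral_sum integrable_inner_right L2_scaleR_integrable L2_cos DvL)
    also have "\<dots> = (\<Sum>k<m. (real k *\<^sub>R Y k t) \<bullet> cosc k ?Dv)"
      unfolding cosc_def by (intro sum.cong refl integral_inner_right L2_scaleR_integrable L2_cos DvL)
    also have "\<dots> = (\<Sum>k<m. ((real k)\<^sup>2 *\<^sub>R (matD d *v Y k t)) \<bullet> ?V k)"
    proof (intro sum.cong refl)
      fix k
      have "cosc k ?Dv = transpose (matD d) *v (real k *\<^sub>R ?V k)"
        by (simp only: cosc_linear[OF H10_derivD(3)[OF v] matrix_vector_mul_linear] cosc_H10_deriv[OF v])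
      then have "(real k *\<^sub>R Y k t) \<bullet> cosc k ?Dv = (matD d *v (real k *\<^sub>R Y k t)) \<bullet> (real k *\<^sub>R ?V k)"
        by (simp only: tr)
      then show "(real k *\<^sub>R Y k t) \<bullet> cosc k ?Dv = ((real k)\<^sup>2 *\<^sub>R (matD d *v Y k t)) \<bullet> ?V k"
        by (simp add: matrix_vector_mult_scaleR power2_eq_square)
    qed
    finally show ?thesis .
  qed
  have "(\<lambda>j. LINT x|Om. zpart (4 ^ j) t x \<bullet> ?Dv x) \<longlonglongrightarrow> (LINT x|Om. z t x \<bullet> ?Dv x)"
    by (intro L2_tendsto_inner zpart_L2 z_limit t DvL)
  with l1 have "(\<Sum>k. ((real k)\<^sup>2 *\<^sub>R (matD d *v Y k t)) \<bullet> ?V k) = (LINT x|Om. z t x \<bullet> ?Dv x)"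
    unfolding part by (rule LIMSEQ_unique)
  with \<open>summable (\<lambda>k. ((real k)\<^sup>2 *\<^sub>R (matD d *v Y k t)) \<bullet> ?V k)\<close>
  have sD: "(\<lambda>k. ((real k)\<^sup>2 *\<^sub>R (matD d *v Y k t)) \<bullet> ?V k) sums (LINT x|Om. (matD d *v z t x) \<bullet> v' x)"
    by (simp add: sums_iff tr)
  have "integrable Om (\<lambda>x. (matD d *v z t x) \<bullet> v' x)" "integrable Om (\<lambda>x. (matA \<alpha> *v y t x) \<bullet> v x)"
    by (intro L2_inner_integrable L2_linear[OF z_limit(1)[OF t] matrix_vector_mul_linear] H10_derivD[OF v]
        L2_linear[OF y_L2[OF tT] matrix_vector_mul_linear])+
  then have "(LINT x|Om. (matD d *v z t x) \<bullet> v' x + (matA \<alpha> *v y t x) \<bullet> v x)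
      = (LINT x|Om. (matD d *v z t x) \<bullet> v' x) + (LINT x|Om. (matA \<alpha> *v y t x) \<bullet> v x)"
    by (rule Bochner_Integration.integral_add)
  with sums_add[OF sD sA] show ?thesis
    by (simp add: modeM_def matrix_vector_mult_add_rdistrib scaleR_matrix_vector_assoc inner_add_left)
qed

lemma modal_identity:
  assumes t: "t \<in> {0..T}"
  shows "(LINT s|leb t. (modeM d \<alpha> k *v Y k s) \<bullet> w)
    = Y k 0 \<bullet> w - Y k t \<bullet> w + 2 / pi * sin (real k * x0) * (LINT s|leb t. u s) * (vecB \<bullet> w)"
proof -
  let ?c = "2 / pi * sin (real k * x0) * (vecB \<bullet> w)"
  have c1: "continuous_on S (\<lambda>s. (modeM d \<alpha> k *v Y k s) \<bullet> w)" for S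
    by (intro continuous_intros continuous_on_subset[OF Yc]
        linear_continuous_on_compose[OF _ matrix_vector_mul_linear]) auto
  have c2: "continuous_on S u" for S by (rule continuous_on_subset[OF u]) auto
  have "(LINT s|leb t. - ((modeM d \<alpha> k *v Y k s) \<bullet> w) + ?c * u s) = Y k t \<bullet> w - Y k 0 \<bullet> w"
  proof (rule leb_FTC)
    fix s
    have "((\<lambda>t. Y k t \<bullet> w) has_real_derivative - ((modeM d \<alpha> k *v Y k s) \<bullet> w) + ?c * u s) (at s within {0..t})"
      using has_field_derivative_at_within[OF ode[of k w s]] by (simp add: mult_ac)
    then show "((\<lambda>t. Y k t \<bullet> w) has_vector_derivative - ((modeM d \<alpha> k *v Y k s) \<bullet> w) + ?c * u s) (at s within {0..t})"
      by (simp add: has_real_derivative_iff_has_vector_derivative)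
  qed (use t in \<open>auto intro!: continuous_intros c1 c2\<close>)
  moreover have "(LINT s|leb t. - ((modeM d \<alpha> k *v Y k s) \<bullet> w) + ?c * u s)
      = - (LINT s|leb t. (modeM d \<alpha> k *v Y k s) \<bullet> w) + ?c * (LINT s|leb t. u s)"
    using leb_continuous(1)[OF c1, of t] leb_continuous(1)[OF c2, of t]
    by (subst Bochner_Integration.integral_add) auto
  ultimately show ?thesis by (simp add: mult_ac)
qed

text \<open>The modal equations are integrated in time, paired with v and summed. The delicate point
  is exchanging sum and time integral near time 0; it succeeds because
  \<open>integral_square_exp_le\<close> bounds the integral of k^2 times the exponential
  independently of k. The Dirac term reappears through the sine series of v at
  \<open>x0\<close>.\<close>

lemma weak_identity:
  assumes v: "H10_deriv v v'" and c: "continuous_on {0..pi} v" and t: "t \<in> {0..T}"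
  shows "(LINT x|Om. y t x \<bullet> v x) - (LINT x|Om. y0 x \<bullet> v x)
    + (LINT s|leb t. LINT x|Om. (matD d *v z s x) \<bullet> v' x + (matA \<alpha> *v y s x) \<bullet> v x)
    = (LINT s|leb t. u s * (vecB \<bullet> v x0))"
proof -
  let ?V = "\<lambda>k. sinc k v" and ?U = "LINT s|leb t. u s"
  let ?g = "\<lambda>k s. (modeM d \<alpha> k *v Y k s) \<bullet> ?V k"
  obtain A where A: "0 < A" "\<And>k. norm (sinc k y0) \<le> A" using sinc_y0_bounded by blast
  obtain Cm where Cm: "0 \<le> Cm" "\<And>k x. norm (modeM d \<alpha> k *v (x :: (real, 'n) vec)) \<le> Cm * ((1 + (real k)\<^sup>2) * norm x)"
    using norm_modeM_bound by blast
  have VS: "summable (\<lambda>k. norm (?V k))" by (rule summable_norm_sinc_H10(2)[OF v])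
  have gb: "norm (?g k s) \<le> Cm * ((1 + (real k)\<^sup>2) * norm (Y k s)) * norm (?V k)" for k s
    using order_trans[OF Cauchy_Schwarz_ineq2 mult_right_mono[OF Cm(2) norm_ge_zero]] by simp
  have gc: "continuous_on S (?g k)" for S k
    by (intro continuous_intros continuous_on_subset[OF Yc]
        linear_continuous_on_compose[OF _ matrix_vector_mul_linear]) auto
  have gi: "integrable (leb t) (?g k)" for k by (rule leb_continuous[OF gc])
  have "(LINT s|leb t. LINT x|Om. (matD d *v z s x) \<bullet> v' x + (matA \<alpha> *v y s x) \<bullet> v x) = (LINT s|leb t. (\<Sum>k. ?g k s))"
    by (intro Bochner_Integration.integral_cong refl) (use inner_z_sums[OF _ _ v] t in \<open>auto simp: sums_iff\<close>)
  also have "\<dots> = (\<Sum>k. LINT s|leb t. ?g k s)"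
  proof (rule integral_suminf[OF gi])
    show "AE s in leb t. summable (\<lambda>k. norm (?g k s))"
    proof (intro AE_I2)
      fix s assume s: "s \<in> space (leb t)"
      then have s': "0 < s" "s \<le> T" using t by auto
      obtain C where C: "0 \<le> C" "\<And>k. norm (Y k s) \<le> C / (1 + (real k)\<^sup>2)" using Y_bound_positive_time[OF s'] by blast
      show "summable (\<lambda>k. norm (?g k s))"
      proof (rule summable_comparison_test'[OF summable_mult[OF VS, of "Cm * C"], of 0])
        fix k
        have "(1 + (real k)\<^sup>2) * norm (Y k s) \<le> (1 + (real k)\<^sup>2) * (C / (1 + (real k)\<^sup>2))"
          by (intro mult_left_mono C) auto
        also have "\<dots> = C" by (simp add: add_nonneg_eq_0_iff)
        finally have "Cm * ((1 + (real k)\<^sup>2) * norm (Y k s)) * norm (?V k) \<le> Cm * C * norm (?V k)"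
          using Cm(1) by (intro mult_right_mono mult_left_mono) auto
        with gb[of k s] show "norm (norm (?g k s)) \<le> Cm * C * norm (?V k)" by simp
      qed
    qed
    \<comment> \<open>T + 2 bounds the integral of \<open>1 + k^2 exp (- k^2 s / 2)\<close> from the
      datum; the last T bounds the integral of 1 from the control.\<close>
    show "summable (\<lambda>k. LINT s|leb t. norm (?g k s))"
    proof (rule summable_comparison_test'[OF summable_mult[OF VS, of "Cm * (K * (A * (T + 2) + T))"], of 0])
      fix k
      let ?e = "\<lambda>s. exp (- (real k)\<^sup>2 * s / 2)"
      let ?h = "\<lambda>s. Cm * (K * (A * (1 + (real k)\<^sup>2 * ?e s) + 1)) * norm (?V k)"
      have hc: "continuous_on S (\<lambda>s. (real k)\<^sup>2 * ?e s)" for S by (intro continuous_intros) auto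
      have hi: "integrable (leb t) (\<lambda>s. (real k)\<^sup>2 * ?e s)" by (rule leb_continuous[OF hc])
      have ci: "integrable (leb t) (\<lambda>s. c :: real)" for c by (rule leb_continuous) (intro continuous_intros)
      have "(LINT s|leb t. norm (?g k s)) \<le> (LINT s|leb t. ?h s)"
      proof (rule integral_mono[OF integrable_norm[OF gi]])
        show "integrable (leb t) ?h"
          by (intro integrable_mult_left integrable_mult_right Bochner_Integration.integrable_add hi ci)
        fix s assume "s \<in> space (leb t)"
        then have s: "0 \<le> s" "s \<le> T" using t by auto
        have e: "0 \<le> ?e s" "?e s \<le> 1" using s by auto
        have "(1 + (real k)\<^sup>2) * norm (Y k s) \<le> (1 + (real k)\<^sup>2) * (K * (?e s * A + 1 / (1 + (real k)\<^sup>2)))"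
          using K A e by (intro mult_left_mono order_trans[OF bound[OF s]] add_mono) auto
        also have "\<dots> = K * (A * ((1 + (real k)\<^sup>2) * ?e s) + (1 + (real k)\<^sup>2) * (1 / (1 + (real k)\<^sup>2)))"
        proof -
          have "q * (K * (e * A + b)) = K * (A * (q * e) + q * b)" for q e b :: real
            by (simp add: algebra_simps)
          then show ?thesis .
        qed
        also have "(1 + (real k)\<^sup>2) * (1 / (1 + (real k)\<^sup>2)) = 1" by (simp add: add_nonneg_eq_0_iff)
        also have "K * (A * ((1 + (real k)\<^sup>2) * ?e s) + 1) \<le> K * (A * (1 + (real k)\<^sup>2 * ?e s) + 1)"
          using K A e by (intro mult_left_mono add_mono) (auto simp: distrib_right)
        finally have "Cm * ((1 + (real k)\<^sup>2) * norm (Y k s)) * norm (?V k) \<le> ?h s"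
          using Cm(1) by (intro mult_right_mono mult_left_mono) auto
        with gb[of k s] show "norm (?g k s) \<le> ?h s" by linarith
      qed
      also have "(LINT s|leb t. ?h s) = Cm * (K * (A * (t + (LINT s|leb t. (real k)\<^sup>2 * ?e s)) + t)) * norm (?V k)"
      proof -
        have m: "measure (leb t) {0<..<t} = t" using t by (simp add: measure_restrict_space)
        have "(LINT s|leb t. A * (1 + (real k)\<^sup>2 * ?e s) + 1) = A * (t + (LINT s|leb t. (real k)\<^sup>2 * ?e s)) + t"
          using hi ci by (subst Bochner_Integration.integral_add integral_mult_right_zero;
            (intro integrable_mult_right Bochner_Integration.integrable_add)?)+ (simp_all add: m)
        then show ?thesis by simp
      qed
      also have "\<dots> \<le> Cm * (K * (A * (T + 2) + T)) * norm (?V k)"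
        using Cm(1) K A t by (intro mult_right_mono mult_left_mono add_mono integral_square_exp_le) auto
      finally show "norm (LINT s|leb t. norm (?g k s)) \<le> Cm * (K * (A * (T + 2) + T)) * norm (?V k)"
        by simp
    qed
  qed
  also have "\<dots> = (\<Sum>k. Y k 0 \<bullet> ?V k - Y k t \<bullet> ?V k + 2 / pi * sin (real k * x0) * ?U * (vecB \<bullet> ?V k))"
    by (simp add: modal_identity[OF t])
  also have "\<dots> = (LINT x|Om. y0 x \<bullet> v x) - (LINT x|Om. y t x \<bullet> v x) + ?U * (vecB \<bullet> v x0)"
  proof (rule sums_unique[symmetric], intro sums_add sums_diff)
    have "y 0 = y0" by (simp add: y_def)
    then show "(\<lambda>k. Y k 0 \<bullet> ?V k) sums (LINT x|Om. y0 x \<bullet> v x)"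
      using inner_y_sums[of 0 v] T H10_derivD(2)[OF v] by simp
    show "(\<lambda>k. Y k t \<bullet> ?V k) sums (LINT x|Om. y t x \<bullet> v x)"
      by (intro inner_y_sums t H10_derivD(2)[OF v])
    let ?a = "\<lambda>k. (2 / pi) *\<^sub>R ?V k"
    have "summable (\<lambda>k. norm (?a k))" using summable_mult[OF VS, of "2 / pi"] by simp
    then have "summable (\<lambda>k. sin (real k * x0) *\<^sub>R ?a k)"
      by (intro summable_norm_cancel[OF sine_series_summable])
    then have "(\<lambda>k. sin (real k * x0) *\<^sub>R ?a k) sums v x0"
      using H10_pointwise_sine_series[OF v c x0] by (simp add: sums_iff sine_series_def)
    from bounded_linear.sums[OF bounded_linear_inner_right[of vecB] this]
    have "(\<lambda>k. ?U * (vecB \<bullet> (sin (real k * x0) *\<^sub>R ?a k))) sums (?U * (vecB \<bullet> v x0))"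
      by (rule sums_mult)
    then show "(\<lambda>k. 2 / pi * sin (real k * x0) * ?U * (vecB \<bullet> ?V k)) sums (?U * (vecB \<bullet> v x0))"
      by (simp add: mult_ac)
  qed
  finally show ?thesis by simp
qed

theorem weak_solution_y: "weak_solution T (matD d) (matA \<alpha>) vecB x0 y0 u y"
  unfolding weak_solution_def
proof (intro conjI ballI exI[of _ z] allI impI)
  show "AE x in Om. y 0 x = y0 x" by (simp add: y_def)
  show "case_prod y \<in> L2 (leb T \<Otimes>\<^sub>M Om)" "case_prod z \<in> L2 (leb T \<Otimes>\<^sub>M Om)"
    by (rule y_joint_L2, rule z_joint_L2)
  show "AE t in leb T. y t \<in> H10 \<and> weak_deriv (y t) (z t)"
  proof (intro AE_I2)
    fix t assume "t \<in> space (leb T)"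
    then have "H10_deriv (y t) (z t)" by (intro H10_deriv_y) auto
    then show "y t \<in> H10 \<and> weak_deriv (y t) (z t)"
      unfolding H10_iff by (blast intro: H10_derivD(1))
  qed
  fix v v' :: "real \<Rightarrow> (real, 'n) vec" and t
  assume "v \<in> H10 \<and> weak_deriv v v' \<and> continuous_on {0..pi} v" "t \<in> {0..T}"
  then show "(LINT x|Om. y t x \<bullet> v x) - (LINT x|Om. y0 x \<bullet> v x)
      + (LINT s|leb t. LINT x|Om. (matD d *v z s x) \<bullet> v' x + (matA \<alpha> *v y s x) \<bullet> v x)
      = (LINT s|leb t. u s * (vecB \<bullet> v x0))"
    using weak_identity[OF H10_deriv_if_H10] by blast
qed (auto intro: y_L2 y_continuous)

end

section \<open>A uniqueness theorem for the adjoint observation\<close>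

text \<open>With s = exp(-t) the moments are integrals against polynomials in s, which are uniformly
  dense among the continuous functions on the closed interval. Hence F annihilates every continuous
  h, and it remains to choose h as a cut-off copy of F.\<close>

lemma moments_zero_imp_zero:
  fixes F :: "real \<Rightarrow> real"
  assumes "0 < b" and F: "continuous_on {0<..} F" and int: "integrable (leb b) F"
    and mom: "\<And>j. (LINT t|leb b. F t * exp (- t) ^ j) = 0" and t: "t \<in> {0<..<b}"
  shows "F t = 0"
proof -
  have zero: "(LINT t|leb b. F t * h t) = 0" if h: "continuous_on {0..b} h" for h
  proof -
    have Fm[measurable]: "F \<in> borel_measurable (leb b)" by (rule borel_measurable_integrable[OF int])
    define I where "I = (LINT t|leb b. \<bar>F t\<bar>)"
    have I: "0 \<le> I" unfolding I_def by simp
    have Fh: "integrable (leb b) (\<lambda>t. F t * g t)" if g: "continuous_on {0..b} g" for g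
    proof -
      have "bounded (g ` {0..b})" by (rule compact_imp_bounded[OF compact_continuous_image[OF g compact_Icc]])
      then obtain C where "\<forall>y\<in>g ` {0..b}. norm y \<le> C" unfolding bounded_iff by blast
      then have C: "\<bar>g t\<bar> \<le> C" if "t \<in> {0..b}" for t using that by simp
      have gm: "g \<in> borel_measurable (leb b)" by (rule borel_measurable_integrable[OF leb_continuous(1)[OF g]])
      show ?thesis
      proof (rule Bochner_Integration.integrable_bound[OF integrable_mult_left[OF integrable_abs[OF int], of C]])
        show "(\<lambda>t. F t * g t) \<in> borel_measurable (leb b)" using gm by measurable
        show "AE t in leb b. norm (F t * g t) \<le> norm (\<bar>F t\<bar> * C)"
        proof (intro AE_I2)
          fix t assume "t \<in> space (leb b)"
          then have "\<bar>g t\<bar> \<le> C" by (intro C) auto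
          then have "\<bar>F t\<bar> * \<bar>g t\<bar> \<le> \<bar>F t\<bar> * \<bar>C\<bar>" by (intro mult_left_mono) auto
          then show "norm (F t * g t) \<le> norm (\<bar>F t\<bar> * C)" by (simp add: abs_mult)
        qed
      qed
    qed
    have small: "\<bar>LINT t|leb b. F t * h t\<bar> \<le> e * I" if "0 < e" for e
    proof -
      have "continuous_on {exp (- b)..1} (\<lambda>s. h (- ln s))"
      proof (rule continuous_on_compose2[OF h])
        show "continuous_on {exp (- b)..1} (\<lambda>s. - ln s)"
          by (intro continuous_intros) (use exp_gt_zero[of "- b"] in \<open>auto intro: less_le_trans\<close>)
        show "(\<lambda>s. - ln s) ` {exp (- b)..1} \<subseteq> {0..b}"
        proof (intro image_subsetI)
          fix s assume "s \<in> {exp (- b)..1}"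
          then have s: "exp (- b) \<le> s" "s \<le> 1" by auto
          have "0 < s" using exp_gt_zero[of "- b"] s(1) by linarith
          moreover have "ln (exp (- b)) \<le> ln s" using s(1) \<open>0 < s\<close> by (subst ln_le_cancel_iff) auto
          ultimately show "- ln s \<in> {0..b}" using s by simp
        qed
      qed
      then obtain p where p: "real_polynomial_function p"
        "\<And>s. s \<in> {exp (- b)..1} \<Longrightarrow> \<bar>h (- ln s) - p s\<bar> < e"
        using Stone_Weierstrass_real_polynomial_function[of "{exp (- b)..1}" _ e] \<open>0 < e\<close> by auto
      obtain a n where pa: "p = (\<lambda>s. \<Sum>i\<le>n. a i * s ^ i)"
        using p(1) real_polynomial_function_iff_sum by blast
      have pc: "continuous_on {0..b} (\<lambda>t. p (exp (- t)))" unfolding pa by (intro continuous_intros)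
      have "(LINT t|leb b. F t * p (exp (- t))) = (LINT t|leb b. (\<Sum>i\<le>n. a i * (F t * exp (- t) ^ i)))"
        unfolding pa by (simp add: sum_distrib_left mult_ac)
      also have "\<dots> = (\<Sum>i\<le>n. LINT t|leb b. a i * (F t * exp (- t) ^ i))"
        by (intro Bochner_Integration.integral_sum integrable_mult_right Fh continuous_intros)
      also have "\<dots> = 0" by (simp add: mom)
      finally have "(LINT t|leb b. F t * h t) = (LINT t|leb b. F t * h t - F t * p (exp (- t)))"
        using Fh[OF h] Fh[OF pc] by simp
      also have "\<bar>\<dots>\<bar> \<le> (LINT t|leb b. \<bar>F t * h t - F t * p (exp (- t))\<bar>)"
        by (rule integral_abs_bound)
      also have "\<dots> \<le> (LINT t|leb b. e * \<bar>F t\<bar>)"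
      proof (intro integral_mono integrable_abs integrable_mult_right Bochner_Integration.integrable_diff Fh h pc int)
        fix t assume "t \<in> space (leb b)"
        then have "\<bar>h t - p (exp (- t))\<bar> \<le> e" using p(2)[of "exp (- t)"] by auto
        then have "\<bar>F t\<bar> * \<bar>h t - p (exp (- t))\<bar> \<le> \<bar>F t\<bar> * e" by (intro mult_left_mono) auto
        then show "\<bar>F t * h t - F t * p (exp (- t))\<bar> \<le> e * \<bar>F t\<bar>"
          by (simp add: abs_mult[symmetric] right_diff_distrib mult.commute)
      qed
      also have "\<dots> = e * I" by (simp add: I_def)
      finally show ?thesis .
    qed
    show ?thesis
    proof (rule ccontr)
      assume ne: "(LINT t|leb b. F t * h t) \<noteq> 0"
      let ?J = "\<bar>LINT t|leb b. F t * h t\<bar>"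
      have pos: "0 < ?J" using ne by simp
      \<comment> \<open>A strictly positive bound, since I may be 0.\<close>
      define P where "P = I + 1"
      have P: "0 < P" "I \<le> P" using I by (auto simp: P_def)
      have "?J \<le> ?J / (2 * P) * I" using pos P by (intro small) simp
      also have "\<dots> \<le> ?J / (2 * P) * P" using pos P by (intro mult_left_mono) auto
      also have "\<dots> = ?J / 2" using P by simp
      finally show False using pos by simp
    qed
  qed
  define a where "a = t / 2"
  have a: "0 < a" "a < t" "t < b" using t by (auto simp: a_def)
  \<comment> \<open>F may be singular at 0: the test function vanishes below a = t / 2, and
    \<open>max a s\<close> keeps the argument of F away from 0.\<close>
  let ?G = "\<lambda>s. max 0 (s - a) * F (max a s)"
  have Fa: "continuous_on S (\<lambda>s. F (max a s))" for S
    by (rule continuous_on_compose2[OF F]) (use a in \<open>auto intro!: continuous_intros\<close>)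
  then have G: "continuous_on {0..b} ?G" by (intro continuous_intros)
  have "(LINT s|leb b. max 0 (s - a) * (F (max a s))\<^sup>2) = (LINT s|leb b. F s * ?G s)"
    by (intro Bochner_Integration.integral_cong refl) (auto simp: max_def power2_eq_square)
  also have "\<dots> = 0" by (rule zero[OF G])
  finally have "integral {0..b} (\<lambda>s. max 0 (s - a) * (F (max a s))\<^sup>2) = 0"
    by (subst (asm) leb_continuous(2)) (intro continuous_intros Fa)
  moreover have "(\<lambda>s. max 0 (s - a) * (F (max a s))\<^sup>2) integrable_on {0..b}"
    by (intro integrable_continuous_real continuous_intros Fa)
  ultimately have "((\<lambda>s. max 0 (s - a) * (F (max a s))\<^sup>2) has_integral 0) (cbox 0 b)"
    by (simp add: has_integral_integral)
  then have "max 0 (t - a) * (F (max a t))\<^sup>2 = 0"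
    by (rule has_integral_0_cbox_imp_0[rotated 2]) (use a in \<open>auto intro!: continuous_intros Fa\<close>)
  then show ?thesis using a by (auto simp: max_def)
qed

lemma of_real_islimpt:
  assumes "a < t" "t < b"
  shows "(of_real t :: complex) islimpt (of_real ` {a<..<b})"
  unfolding islimpt_approachable
proof (intro allI impI)
  fix e :: real assume "0 < e"
  define s where "s = t + min (e / 2) ((b - t) / 2)"
  have "s \<in> {a<..<b}" "s \<noteq> t" "\<bar>s - t\<bar> < e" using assms \<open>0 < e\<close> by (auto simp: s_def min_def field_simps)
  then show "\<exists>x'\<in>of_real ` {a<..<b}. x' \<noteq> (of_real t :: complex) \<and> dist x' (of_real t) < e"
    by (intro bexI[of _ "of_real s"]) (auto simp: dist_norm of_real_diff[symmetric] simp del: of_real_diff)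
qed

lemma norm_vec_le_sum_bound:
  fixes x :: "real^'n" and c :: real
  assumes "\<And>i. \<bar>x $ i\<bar> \<le> c"
  shows "norm x \<le> CARD('n) * c"
proof -
  have "norm x \<le> (\<Sum>i\<in>UNIV. \<bar>x $ i\<bar>)" by (rule norm_le_l1_cart)
  also have "\<dots> \<le> (\<Sum>i\<in>(UNIV::'n set). c)" by (intro sum_mono assms)
  finally show ?thesis by simp
qed

section \<open>The observation and its holomorphic extension\<close>

text \<open>For d \<ge> 1 and real arguments from here on, \<open>Pk\<close> has no zero for any k,
  k = 0 included, and the resolvent vectors obey \<open>rk_bound_real\<close>. Only such exponents
  are used in controls.\<close>

definition zeta0 :: "real \<Rightarrow> nat \<Rightarrow> real" where
  "zeta0 \<alpha> n = \<bar>\<alpha>\<bar> * 2 ^ n + 1"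

text \<open>4^n comes from the weighted entry bound; the two factors n pass from entries to the norm
  of a matrix-vector product.\<close>

definition KS :: "nat \<Rightarrow> real" where
  "KS n = real n * (real n * 4 ^ n)"

lemma KS_nonneg [simp]: "0 \<le> KS n"
  by (simp add: KS_def)

definition growth :: "real \<Rightarrow> nat \<Rightarrow> real" where
  "growth \<alpha> n = 2 * (\<bar>\<alpha>\<bar> * 4 ^ n)"

lemma Sg_norm_growth:
  fixes x :: "real^('n::{finite,linorder})"
  assumes "1 \<le> d" "0 \<le> t"
  shows "norm (Sg d \<alpha> k t *v x) \<le> KS CARD('n) * exp (growth \<alpha> CARD('n) * t) * exp (- (real k)\<^sup>2 * t / 2) * norm x"
  using norm_matrix_vector_bound[OF Sg_entry_bound_real[OF assms], of \<alpha> k x]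
  by (simp add: growth_def KS_def mult_ac)

text \<open>In the application \<open>c k\<close> is \<open>sin(k x\<^sub>0)\<close> and \<open>v k\<close> is the functional on the \<open>k\<close>-th mode.\<close>

locale observation =
  fixes T d \<alpha> Bv :: real and c :: "nat \<Rightarrow> real" and v :: "nat \<Rightarrow> real^('n::{finite,linorder})"
  assumes T: "0 < T" and d: "1 \<le> d" and c0: "c 0 = 0" and c1: "\<And>k. \<bar>c k\<bar> \<le> 1" and v: "\<And>k. norm (v k) \<le> Bv"
begin

definition f :: "nat \<Rightarrow> real \<Rightarrow> real" where
  "f k t = c k * ((Sg d \<alpha> k t *v vecB) \<bullet> v k)"

definition F :: "real \<Rightarrow> real" where
  "F t = (\<Sum>k. f k t)"

text \<open>The extension of \<open>f\<close> to complex times, written entrywise because the inner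
  product on complex vectors is real-valued and would not be holomorphic.\<close>

definition fc :: "nat \<Rightarrow> complex \<Rightarrow> complex" where
  "fc k z = of_real (c k) * (\<Sum>i\<in>UNIV. \<Sum>j\<in>UNIV. Sg d \<alpha> k z $ i $ j * of_real ((vecB $ j :: real) * v k $ i))"

definition Fc :: "complex \<Rightarrow> complex" where
  "Fc z = (\<Sum>k. fc k z)"

definition sector :: "complex set" where
  "sector = {z. norm z < 2 * Re z}"

lemma Bv: "0 \<le> Bv"
  using order_trans[OF norm_ge_zero v[of 0]] .

lemma fc_of_real: "fc k (of_real t) = of_real (f k t)"
proof -
  have "(Sg d \<alpha> k t *v vecB) \<bullet> v k = (\<Sum>i\<in>UNIV. \<Sum>j\<in>UNIV. Sg d \<alpha> k t $ i $ j * (vecB $ j * v k $ i))"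
    by (simp add: inner_vec_def matrix_vector_mult_def sum_distrib_right sum_distrib_left mult_ac)
  then show ?thesis by (simp add: fc_def f_def Sg_of_real)
qed

lemma f_bound:
  assumes "0 \<le> t"
  shows "\<bar>f k t\<bar> \<le> KS CARD('n) * Bv * norm (vecB :: (real, 'n) vec) * exp (growth \<alpha> CARD('n) * t) * exp (- (real k)\<^sup>2 * t / 2)"
proof -
  have "\<bar>f k t\<bar> \<le> 1 * (norm (Sg d \<alpha> k t *v vecB :: (real, 'n) vec) * norm (v k))"
    unfolding f_def abs_mult by (rule mult_mono[OF c1 Cauchy_Schwarz_ineq2]) auto
  also have "\<dots> \<le> 1 * ((KS CARD('n) * exp (growth \<alpha> CARD('n) * t) * exp (- (real k)\<^sup>2 * t / 2) * norm (vecB :: (real, 'n) vec)) * Bv)"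
    by (intro mult_mono Sg_norm_growth d assms v) auto
  finally show ?thesis by (simp add: mult_ac)
qed

lemma open_sector: "open sector"
  unfolding sector_def by (intro open_Collect_less continuous_intros)

lemma convex_sector: "convex sector"
proof (rule convexI)
  fix x y and u w :: real assume xy: "x \<in> sector" "y \<in> sector" and uw: "0 \<le> u" "0 \<le> w" "u + w = 1"
  have "norm (u *\<^sub>R x + w *\<^sub>R y) \<le> u * norm x + w * norm y"
    using norm_triangle_ineq[of "u *\<^sub>R x" "w *\<^sub>R y"] uw by simp
  also have "\<dots> < u * (2 * Re x) + w * (2 * Re y)"
  proof (cases "u = 0")
    case True
    then show ?thesis using xy uw by (simp add: sector_def)
  next
    case False
    then have "u * norm x < u * (2 * Re x)" using xy uw by (auto simp: sector_def intro: mult_strict_left_mono)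
    moreover have "w * norm y \<le> w * (2 * Re y)" using xy uw by (auto simp: sector_def intro: mult_left_mono)
    ultimately show ?thesis by linarith
  qed
  finally show "u *\<^sub>R x + w *\<^sub>R y \<in> sector" by (simp add: sector_def)
qed

lemma fc_bound:
  assumes z: "z \<in> sector" and \<delta>: "0 < \<delta>" "\<delta> \<le> Re z" and R: "Re z \<le> R"
  shows "norm (fc k z) \<le> (\<Sum>i\<in>(UNIV :: 'n set). \<Sum>j\<in>(UNIV :: 'n set). 4 ^ CARD('n) * exp (growth \<alpha> CARD('n) * R) * Bv)
    * ((1 + 2 / \<delta>) / (1 + (real k)\<^sup>2))"
proof -
  let ?e = "exp (- (real k)\<^sup>2 * \<delta> / 2)"
  have "norm (fc k z) = \<bar>c k\<bar> * norm (\<Sum>i\<in>UNIV. \<Sum>j\<in>UNIV. Sg d \<alpha> k z $ i $ j * of_real ((vecB $ j :: real) * v k $ i))"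
    by (simp only: fc_def norm_mult norm_of_real)
  also have "\<dots> \<le> 1 * (\<Sum>i\<in>(UNIV :: 'n set). \<Sum>j\<in>(UNIV :: 'n set). (4 ^ CARD('n) * exp (growth \<alpha> CARD('n) * R) * ?e) * Bv)"
  proof (intro mult_mono c1 order_trans[OF norm_sum sum_mono] order_trans[OF norm_sum sum_mono])
    fix i j :: 'n
    have "norm (Sg d \<alpha> k z $ i $ j) \<le> 4 ^ CARD('n) * exp (growth \<alpha> CARD('n) * Re z) * exp (- (real k)\<^sup>2 * Re z / 2)"
      unfolding growth_def using z by (intro Sg_entry_bound_complex d) (simp add: sector_def)
    also have "\<dots> \<le> 4 ^ CARD('n) * exp (growth \<alpha> CARD('n) * R) * ?e"
    proof (intro mult_mono)
      show "exp (growth \<alpha> CARD('n) * Re z) \<le> exp (growth \<alpha> CARD('n) * R)"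
        using R by (simp add: growth_def mult_left_mono)
      show "exp (- (real k)\<^sup>2 * Re z / 2) \<le> ?e"
        using \<delta> by (simp add: mult_left_mono)
    qed auto
    finally have 1: "norm (Sg d \<alpha> k z $ i $ j) \<le> 4 ^ CARD('n) * exp (growth \<alpha> CARD('n) * R) * ?e" .
    have "\<bar>(vecB $ j :: real) * v k $ i\<bar> \<le> 1 * Bv"
      unfolding abs_mult by (intro mult_mono order_trans[OF component_le_norm_cart v]) (auto simp: vecB_def)
    then have 2: "norm (of_real ((vecB $ j :: real) * v k $ i) :: complex) \<le> Bv" by (simp only: norm_of_real mult_1)
    show "norm (Sg d \<alpha> k z $ i $ j * of_real ((vecB $ j :: real) * v k $ i)) \<le> (4 ^ CARD('n) * exp (growth \<alpha> CARD('n) * R) * ?e) * Bv"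
      unfolding norm_mult by (intro mult_mono 1 2) auto
  qed (auto intro: sum_nonneg)
  also have "\<dots> = (\<Sum>i\<in>(UNIV :: 'n set). \<Sum>j\<in>(UNIV :: 'n set). 4 ^ CARD('n) * exp (growth \<alpha> CARD('n) * R) * Bv) * ?e"
    by simp
  also have "\<dots> \<le> (\<Sum>i\<in>(UNIV :: 'n set). \<Sum>j\<in>(UNIV :: 'n set). 4 ^ CARD('n) * exp (growth \<alpha> CARD('n) * R) * Bv) * ((1 + 2 / \<delta>) / (1 + (real k)\<^sup>2))"
    using Bv by (intro mult_left_mono one_plus_square_exp_bound \<delta> sum_nonneg) auto
  finally show ?thesis .
qed

text \<open>Around each z there is a disc in the sector on which the real part stays above Re z / 2;
  there the smoothing factor gives a uniform majorant, so the series converges uniformly.\<close>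

lemma Fc_holomorphic: "Fc holomorphic_on sector"
proof (rule holomorphic_uniform_sequence[OF open_sector])
  show "(\<lambda>z. \<Sum>k<n. fc k z) holomorphic_on sector" for n
  proof (intro holomorphic_on_sum)
    fix k
    have "(\<lambda>z. Sg d \<alpha> k z $ i $ j :: complex) holomorphic_on sector" for i j :: 'n
      unfolding holomorphic_on_def field_differentiable_def
      using has_field_derivative_at_within[OF Sg_has_field_derivative] by blast
    then show "fc k holomorphic_on sector"
      unfolding fc_def by (intro holomorphic_intros)
  qed
  fix z assume z: "z \<in> sector"
  then have "norm z < 2 * Re z" by (simp add: sector_def)
  then have Rez: "0 < Re z" using norm_ge_zero[of z] by linarith
  have "open (sector \<inter> {w. Re z / 2 < Re w})" by (intro open_Int open_sector open_halfspace_Re_gt)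
  moreover have "z \<in> sector \<inter> {w. Re z / 2 < Re w}" using z Rez by simp
  ultimately obtain r where r: "0 < r" "cball z r \<subseteq> sector \<inter> {w. Re z / 2 < Re w}"
    unfolding open_contains_cball by blast
  have "uniform_limit (cball z r) (\<lambda>n w. \<Sum>k<n. fc k w) (\<lambda>w. \<Sum>k. fc k w) sequentially"
  proof (rule Weierstrass_m_test)
    fix k w assume w: "w \<in> cball z r"
    have "\<bar>Re w - Re z\<bar> \<le> norm (w - z)" using abs_Re_le_cmod[of "w - z"] by simp
    then have "Re w \<le> Re z + r" using w by (simp add: dist_norm norm_minus_commute)
    then show "norm (fc k w) \<le> (\<Sum>i\<in>(UNIV :: 'n set). \<Sum>j\<in>(UNIV :: 'n set). 4 ^ CARD('n) * exp (growth \<alpha> CARD('n) * (Re z + r)) * Bv)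
        * ((1 + 2 / (Re z / 2)) / (1 + (real k)\<^sup>2))"
      using w r Rez by (intro fc_bound) auto
  next
    have "summable (\<lambda>k. (1 + 2 / (Re z / 2)) * (1 / (1 + (real k)\<^sup>2)))"
      by (intro summable_mult summable_inverse_one_plus_square)
    then show "summable (\<lambda>k. (\<Sum>i\<in>(UNIV :: 'n set). \<Sum>j\<in>(UNIV :: 'n set). 4 ^ CARD('n) * exp (growth \<alpha> CARD('n) * (Re z + r)) * Bv)
        * ((1 + 2 / (Re z / 2)) / (1 + (real k)\<^sup>2)))"
      by (intro summable_mult) simp
  qed
  then have "uniform_limit (cball z r) (\<lambda>n w. \<Sum>k<n. fc k w) Fc sequentially" by (simp add: Fc_def[abs_def])
  with r show "\<exists>r>0. cball z r \<subseteq> sector \<and> uniform_limit (cball z r) (\<lambda>n w. \<Sum>k<n. fc k w) Fc sequentially" by blast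
qed

lemma f_summable:
  assumes "0 < t"
  shows "summable (\<lambda>k. \<bar>f k t\<bar>)"
proof -
  let ?C = "KS CARD('n) * Bv * norm (vecB :: (real, 'n) vec) * exp (growth \<alpha> CARD('n) * t)"
  show ?thesis
  proof (rule summable_comparison_test'[of "\<lambda>k. ?C * ((1 + 2 / t) * (1 / (1 + (real k)\<^sup>2)))" 0])
    show "summable (\<lambda>k. ?C * ((1 + 2 / t) * (1 / (1 + (real k)\<^sup>2))))"
      by (intro summable_mult summable_inverse_one_plus_square)
    fix k
    have "\<bar>f k t\<bar> \<le> ?C * exp (- (real k)\<^sup>2 * t / 2)" using f_bound assms by simp
    also have "\<dots> \<le> ?C * ((1 + 2 / t) / (1 + (real k)\<^sup>2))"
      using Bv by (intro mult_left_mono one_plus_square_exp_bound assms) auto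
    finally show "norm \<bar>f k t\<bar> \<le> ?C * ((1 + 2 / t) * (1 / (1 + (real k)\<^sup>2)))" by simp
  qed
qed

lemma Fc_of_real: "0 < t \<Longrightarrow> Fc (of_real t) = of_real (F t)"
  unfolding Fc_def F_def fc_of_real
  by (rule suminf_of_real[symmetric, OF summable_rabs_cancel[OF f_summable]])

lemma F_continuous: "continuous_on {0<..} F"
proof -
  have "continuous_on sector Fc" by (rule holomorphic_on_imp_continuous_on[OF Fc_holomorphic])
  then have "continuous_on {0<..} (\<lambda>t. Fc (of_real t))"
  proof (rule continuous_on_compose2)
    show "continuous_on {0<..} (of_real :: real \<Rightarrow> complex)" by (rule continuous_on_of_real[OF continuous_on_id])
    show "of_real ` {0<..} \<subseteq> sector" by (auto simp: sector_def)
  qed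
  then have "continuous_on {0<..} (\<lambda>t. Re (Fc (of_real t)))" by (rule continuous_on_Re)
  then show ?thesis
    by (rule continuous_on_eq) (simp add: Fc_of_real)
qed

text \<open>The identity theorem, with zeros accumulating at T/2 inside the sector. This is where
  the control time T drops out.\<close>

lemma F_zero_extends:
  assumes "\<And>t. t \<in> {0<..<T} \<Longrightarrow> F t = 0" and "0 < t"
  shows "F t = 0"
proof -
  have "Fc (of_real t) = 0"
  proof (rule analytic_continuation[OF Fc_holomorphic open_sector convex_connected[OF convex_sector]])
    show "of_real ` {0<..<T} \<subseteq> sector" by (auto simp: sector_def)
    show "of_real (T / 2) \<in> sector" using T by (simp add: sector_def)
    show "(of_real (T / 2) :: complex) islimpt (of_real ` {0<..<T})" using T by (intro of_real_islimpt) auto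
    show "z \<in> of_real ` {0<..<T} \<Longrightarrow> Fc z = 0" for z using assms(1) by (auto simp: Fc_of_real)
    show "of_real t \<in> sector" using assms(2) by (simp add: sector_def)
  qed
  then show ?thesis using assms(2) by (simp add: Fc_of_real)
qed

section \<open>Laplace transform of the observation\<close>

text \<open>Writing B as \<open>(k^2 D + A + \<zeta>) r\<close> makes the integrand the derivative
  of - \<open>exp (- \<zeta> t)\<close> times the free evolution of r, paired with
  \<open>v k\<close>, so the integral is explicit.\<close>

lemma laplace_mode:
  assumes "0 \<le> X" "zeta0 \<alpha> CARD('n) \<le> \<zeta>"
  shows "(LINT t|leb X. exp (- \<zeta> * t) * f k t)
    = c k * ((rk d \<alpha> k \<zeta> - exp (- \<zeta> * X) *\<^sub>R (Sg d \<alpha> k X *v rk d \<alpha> k \<zeta>)) \<bullet> v k)"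
proof -
  let ?r = "rk d \<alpha> k \<zeta> :: (real, 'n) vec"
  let ?h = "\<lambda>t. - c k * (exp (- \<zeta> * t) * ((Sg d \<alpha> k t *v ?r) \<bullet> v k))"
  have res: "modeM d \<alpha> k *v ?r + \<zeta> *\<^sub>R ?r = vecB"
    by (rule rk_resolvent[OF rk_bound_real(1)[OF d assms(2)[unfolded zeta0_def]]])
  have "(LINT t|leb X. exp (- \<zeta> * t) * f k t) = ?h X - ?h 0"
  proof (rule leb_FTC[OF assms(1)])
    fix t
    have "(?h has_real_derivative - c k * (exp (- \<zeta> * t) * - ((Sg d \<alpha> k t *v (modeM d \<alpha> k *v ?r)) \<bullet> v k)
        + (exp (- \<zeta> * t) * (- \<zeta>)) * ((Sg d \<alpha> k t *v ?r) \<bullet> v k))) (at t)"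
      by (intro DERIV_cmult DERIV_mult' Sg_inner_derivative(2)) (auto intro!: derivative_eq_intros)
    moreover have "- c k * (exp (- \<zeta> * t) * - ((Sg d \<alpha> k t *v (modeM d \<alpha> k *v ?r)) \<bullet> v k)
        + (exp (- \<zeta> * t) * (- \<zeta>)) * ((Sg d \<alpha> k t *v ?r) \<bullet> v k))
      = c k * exp (- \<zeta> * t) * ((Sg d \<alpha> k t *v (modeM d \<alpha> k *v ?r + \<zeta> *\<^sub>R ?r)) \<bullet> v k)"
      by (simp add: matrix_vector_right_distrib matrix_vector_mult_scaleR inner_add_left algebra_simps)
    ultimately have "(?h has_real_derivative exp (- \<zeta> * t) * f k t) (at t)"
      by (simp add: res f_def mult_ac)
    then show "(?h has_vector_derivative exp (- \<zeta> * t) * f k t) (at t within {0..X})"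
      by (simp add: has_real_derivative_iff_has_vector_derivative has_vector_derivative_at_within)
  next
    show "continuous_on {0..X} (\<lambda>t. exp (- \<zeta> * t) * f k t)"
      unfolding f_def by (intro continuous_intros Sg_continuous)
  qed
  then show ?thesis by (simp add: Sg_zero inner_diff_left algebra_simps)
qed

text \<open>F may blow up at 0, where the bounds on single terms are not summable. Integrated over
  (0,X), however, each Gaussian is O(1/(1+k^2)), which justifies summing term by term.\<close>

lemma laplace:
  assumes X: "0 < X" and \<zeta>: "zeta0 \<alpha> CARD('n) \<le> \<zeta>"
  shows "integrable (leb X) (\<lambda>t. exp (- \<zeta> * t) * F t)"
    and "(\<lambda>k. c k * ((rk d \<alpha> k \<zeta> - exp (- \<zeta> * X) *\<^sub>R (Sg d \<alpha> k X *v rk d \<alpha> k \<zeta>)) \<bullet> v k)) sums (LINT t|leb X. exp (- \<zeta> * t) * F t)"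
proof -
  let ?g = "\<lambda>k t. exp (- \<zeta> * t) * f k t"
  have "0 \<le> \<bar>\<alpha>\<bar> * 2 ^ CARD('n)" by simp
  then have "0 \<le> \<zeta>" using \<zeta> unfolding zeta0_def by linarith
  have gi: "integrable (leb X) (?g k)" for k
    unfolding f_def by (intro leb_continuous continuous_intros Sg_continuous)
  have sm: "AE t in leb X. summable (\<lambda>k. norm (?g k t))"
    by (intro AE_I2) (simp add: abs_mult summable_mult f_summable)
  let ?C = "KS CARD('n) * Bv * norm (vecB :: (real, 'n) vec) * exp (growth \<alpha> CARD('n) * X)"
  have C: "0 \<le> ?C" using Bv by simp
  have si: "summable (\<lambda>k. LINT t|leb X. norm (?g k t))"
  proof (rule summable_comparison_test'[of "\<lambda>k. ?C * ((X + 2) * (1 / (1 + (real k)\<^sup>2)))" 0])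
    show "summable (\<lambda>k. ?C * ((X + 2) * (1 / (1 + (real k)\<^sup>2))))"
      by (intro summable_mult summable_inverse_one_plus_square)
    fix k
    let ?e = "\<lambda>t. exp (- (real k)\<^sup>2 * t / 2)"
    let ?q = "1 + (real k)\<^sup>2"
    have q: "0 < ?q" by (rule add_pos_nonneg) auto
    have ei: "integrable (leb X) (\<lambda>t. ?e t)" "integrable (leb X) (\<lambda>t. (real k)\<^sup>2 * ?e t)" "integrable (leb X) (\<lambda>t. 1 :: real)"
      by (intro leb_continuous continuous_intros; simp)+
    have "(LINT t|leb X. norm (?g k t)) \<le> (LINT t|leb X. ?C * ?e t)"
    proof (intro integral_mono integrable_norm gi integrable_mult_right ei)
      fix t assume "t \<in> space (leb X)"
      then have t: "0 \<le> t" "t \<le> X" by auto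
      have "norm (?g k t) = exp (- \<zeta> * t) * \<bar>f k t\<bar>" by (simp add: abs_mult)
      also have "\<dots> \<le> 1 * (KS CARD('n) * Bv * norm (vecB :: (real, 'n) vec) * exp (growth \<alpha> CARD('n) * t) * ?e t)"
        using t \<open>0 \<le> \<zeta>\<close> by (intro mult_mono f_bound) auto
      also have "\<dots> \<le> 1 * (?C * ?e t)"
        using t Bv by (intro mult_left_mono mult_right_mono) (auto simp: growth_def intro!: mult_left_mono)
      finally show "norm (?g k t) \<le> ?C * ?e t" by simp
    qed
    also have "\<dots> = ?C * (LINT t|leb X. ?e t)" by simp
    also have "(LINT t|leb X. ?e t) \<le> (X + 2) * (1 / ?q)"
    proof -
      \<comment> \<open>The factor 1 + k^2 splits the integral into one bounded by X and one bounded
        by 2.\<close>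
      have "?q * (LINT t|leb X. ?e t) = (LINT t|leb X. ?e t + (real k)\<^sup>2 * ?e t)"
        using ei(1,2) by (subst Bochner_Integration.integral_add) (simp_all add: distrib_right)
      also have "\<dots> = (LINT t|leb X. ?e t) + (LINT t|leb X. (real k)\<^sup>2 * ?e t)"
        by (rule Bochner_Integration.integral_add[OF ei(1,2)])
      also have "\<dots> \<le> (LINT t|leb X. 1) + 2"
        using X by (intro add_mono integral_mono ei integral_square_exp_le) auto
      also have "(LINT t|leb X. 1 :: real) = X" using X by (simp add: measure_restrict_space)
      finally show ?thesis using q by (simp add: field_simps)
    qed
    finally show "norm (LINT t|leb X. norm (?g k t)) \<le> ?C * ((X + 2) * (1 / ?q))"
      using C by (simp add: mult_left_mono)
  qed
  have eq: "(\<Sum>k. ?g k t) = exp (- \<zeta> * t) * F t" if "t \<in> space (leb X)" for t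
    unfolding F_def using that by (intro suminf_mult summable_rabs_cancel[OF f_summable]) simp
  have "integrable (leb X) (\<lambda>t. \<Sum>k. ?g k t)" by (rule integrable_suminf[OF gi sm si])
  then show "integrable (leb X) (\<lambda>t. exp (- \<zeta> * t) * F t)"
    using eq by (subst Bochner_Integration.integrable_cong[OF refl, of _ _ "\<lambda>t. \<Sum>k. ?g k t"]) auto
  have "(\<lambda>k. LINT t|leb X. ?g k t) sums (LINT t|leb X. (\<Sum>k. ?g k t))" by (rule sums_integral[OF gi sm si])
  moreover have "(LINT t|leb X. (\<Sum>k. ?g k t)) = (LINT t|leb X. exp (- \<zeta> * t) * F t)"
    by (intro Bochner_Integration.integral_cong refl eq)
  ultimately show "(\<lambda>k. c k * ((rk d \<alpha> k \<zeta> - exp (- \<zeta> * X) *\<^sub>R (Sg d \<alpha> k X *v rk d \<alpha> k \<zeta>)) \<bullet> v k)) sums (LINT t|leb X. exp (- \<zeta> * t) * F t)"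
    by (simp only: laplace_mode[OF less_imp_le[OF X] \<zeta>])
qed

lemma norm_rk_bound:
  assumes "zeta0 \<alpha> CARD('n) \<le> \<zeta>"
  shows "norm (rk d \<alpha> k \<zeta> :: (real, 'n) vec) \<le> CARD('n) * 2 ^ (CARD('n) + 1) * (1 / (1 + (real k)\<^sup>2))"
  using norm_vec_le_sum_bound[OF rk_bound_real(2)[OF d assms[unfolded zeta0_def]]] by simp

lemma rk_inner_summable:
  assumes "zeta0 \<alpha> CARD('n) \<le> \<zeta>"
  shows "summable (\<lambda>k. \<bar>c k\<bar> * (norm (rk d \<alpha> k \<zeta> :: (real, 'n) vec) * Bv))"
proof (rule summable_comparison_test'[of "\<lambda>k. CARD('n) * 2 ^ (CARD('n) + 1) * (1 / (1 + (real k)\<^sup>2)) * Bv" 0])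
  show "summable (\<lambda>k. CARD('n) * 2 ^ (CARD('n) + 1) * (1 / (1 + (real k)\<^sup>2)) * Bv)"
    by (intro summable_mult2 summable_mult summable_inverse_one_plus_square)
  fix k
  have "\<bar>c k\<bar> * (norm (rk d \<alpha> k \<zeta> :: (real, 'n) vec) * Bv) \<le> 1 * (CARD('n) * 2 ^ (CARD('n) + 1) * (1 / (1 + (real k)\<^sup>2)) * Bv)"
    by (intro mult_mono mult_right_mono c1 norm_rk_bound assms Bv) (auto simp: Bv)
  then show "norm (\<bar>c k\<bar> * (norm (rk d \<alpha> k \<zeta> :: (real, 'n) vec) * Bv)) \<le> CARD('n) * 2 ^ (CARD('n) + 1) * (1 / (1 + (real k)\<^sup>2)) * Bv"
    using Bv by simp
qed

text \<open>X tends to infinity in \<open>laplace\<close>: the boundary terms carry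
  \<open>exp ((growth - \<zeta>) X)\<close>, at most exp(-X) by the second condition on \<zeta>, and
  only the resolvents remain.\<close>

lemma resolvent_sum_zero:
  assumes F: "\<And>t. 0 < t \<Longrightarrow> F t = 0" and \<zeta>: "zeta0 \<alpha> CARD('n) \<le> \<zeta>" "growth \<alpha> CARD('n) + 1 \<le> \<zeta>"
  shows "(\<lambda>k. c k * (rk d \<alpha> k \<zeta> \<bullet> v k)) sums 0"
proof -
  let ?r = "\<lambda>k. rk d \<alpha> k \<zeta> :: (real, 'n) vec"
  let ?b = "\<lambda>k. \<bar>c k\<bar> * (norm (?r k) * Bv)"
  define S where "S = (\<Sum>k. ?b k)"
  have b1: "\<bar>c k * (?r k \<bullet> v k)\<bar> \<le> ?b k" for k
    unfolding abs_mult by (intro mult_left_mono order_trans[OF Cauchy_Schwarz_ineq2] v) auto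
  have s1: "summable (\<lambda>k. c k * (?r k \<bullet> v k))"
    by (rule summable_comparison_test'[OF rk_inner_summable[OF \<zeta>(1)], of 0]) (use b1 in simp)
  have small: "\<bar>\<Sum>k. c k * (?r k \<bullet> v k)\<bar> \<le> KS CARD('n) * S * exp (- X)" if X: "0 < X" for X
  proof -
    let ?g = "\<lambda>k. c k * ((exp (- \<zeta> * X) *\<^sub>R (Sg d \<alpha> k X *v ?r k)) \<bullet> v k)"
    have gb: "\<bar>?g k\<bar> \<le> KS CARD('n) * exp (- X) * ?b k" for k
    proof -
      have "norm (Sg d \<alpha> k X *v ?r k) \<le> KS CARD('n) * exp (growth \<alpha> CARD('n) * X) * exp (- (real k)\<^sup>2 * X / 2) * norm (?r k)"
        using X by (intro Sg_norm_growth d) simp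
      also have "\<dots> \<le> KS CARD('n) * exp (growth \<alpha> CARD('n) * X) * 1 * norm (?r k)"
        using X by (intro mult_right_mono mult_left_mono) auto
      finally have "exp (- \<zeta> * X) * norm (Sg d \<alpha> k X *v ?r k) \<le> exp (- \<zeta> * X) * (KS CARD('n) * exp (growth \<alpha> CARD('n) * X) * 1 * norm (?r k))"
        by (intro mult_left_mono) auto
      also have "\<dots> = KS CARD('n) * exp ((growth \<alpha> CARD('n) - \<zeta>) * X) * norm (?r k)"
        by (simp add: exp_add[symmetric] algebra_simps)
      also have "\<dots> \<le> KS CARD('n) * exp (- X) * norm (?r k)"
      proof (intro mult_right_mono mult_left_mono)
        have "(growth \<alpha> CARD('n) - \<zeta>) * X \<le> (- 1) * X" using \<zeta>(2) X by (intro mult_right_mono) auto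
        then show "exp ((growth \<alpha> CARD('n) - \<zeta>) * X) \<le> exp (- X)" by simp
      qed auto
      finally have n: "norm (exp (- \<zeta> * X) *\<^sub>R (Sg d \<alpha> k X *v ?r k)) \<le> KS CARD('n) * exp (- X) * norm (?r k)" by simp
      have "\<bar>?g k\<bar> \<le> \<bar>c k\<bar> * (norm (exp (- \<zeta> * X) *\<^sub>R (Sg d \<alpha> k X *v ?r k)) * norm (v k))"
        unfolding abs_mult by (intro mult_left_mono Cauchy_Schwarz_ineq2) auto
      also have "\<dots> \<le> \<bar>c k\<bar> * ((KS CARD('n) * exp (- X) * norm (?r k)) * Bv)"
        by (intro mult_left_mono mult_mono n v) auto
      finally show ?thesis by (simp add: mult_ac)
    qed
    have gs: "summable (\<lambda>k. \<bar>?g k\<bar>)"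
      by (rule summable_comparison_test'[OF summable_mult[OF rk_inner_summable[OF \<zeta>(1)], of "KS CARD('n) * exp (- X)"], of 0]) (use gb in simp)
    have "(LINT t|leb X. exp (- \<zeta> * t) * F t) = (LINT t|leb X. 0)"
      by (intro Bochner_Integration.integral_cong refl) (simp add: F)
    then have "(\<lambda>k. c k * (?r k \<bullet> v k) - ?g k) sums 0"
      using laplace(2)[OF X \<zeta>(1)] by (simp add: inner_diff_left right_diff_distrib)
    then have "(\<Sum>k. c k * (?r k \<bullet> v k)) = (\<Sum>k. ?g k)"
      using suminf_diff[OF s1 summable_rabs_cancel[OF gs]] by (simp add: sums_iff)
    also have "\<bar>\<dots>\<bar> \<le> (\<Sum>k. \<bar>?g k\<bar>)" by (rule summable_rabs[OF gs])
    also have "\<dots> \<le> (\<Sum>k. KS CARD('n) * exp (- X) * ?b k)"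
      by (intro suminf_le gb gs summable_mult rk_inner_summable \<zeta>)
    also have "\<dots> = KS CARD('n) * exp (- X) * S" unfolding S_def by (intro suminf_mult rk_inner_summable \<zeta>)
    finally show ?thesis by (simp add: mult_ac)
  qed
  have "((\<lambda>X. KS CARD('n) * S * exp (- X)) \<longlongrightarrow> KS CARD('n) * S * 0) at_top"
    by (intro tendsto_intros filterlim_compose[OF exp_at_bot] filterlim_uminus_at_bot_at_top)
  then have "((\<lambda>X. KS CARD('n) * S * exp (- X)) \<longlongrightarrow> 0) at_top" by simp
  then have "\<bar>\<Sum>k. c k * (?r k \<bullet> v k)\<bar> \<le> 0"
    by (rule tendsto_lowerbound) (use small in \<open>auto simp: eventually_at_top_dense\<close>)
  with s1 show ?thesis by (simp add: sums_iff)
qed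

end

section \<open>Separation of the modes by their poles\<close>

text \<open>A count of zeros: p h1 vanishes where s^n + \<beta> does, and h1 is nonzero there. For
  \<beta> different from 0 these are n distinct points, more than p can have as zeros; for \<beta> =
  0 the zero at 0 has multiplicity n, more than the order of p there.\<close>

lemma polynomial_divisible_imp_zero:
  fixes p :: "complex poly" and \<beta> :: complex
  assumes deg: "degree p < n" and U: "open U" and roots: "\<And>s. s ^ n + \<beta> = 0 \<Longrightarrow> s \<in> U"
    and eq: "\<And>s. s \<in> U \<Longrightarrow> poly p s * h1 s = (s ^ n + \<beta>) * h2 s"
    and c: "continuous_on U h1" "continuous_on U h2" and h1: "\<And>s. s ^ n + \<beta> = 0 \<Longrightarrow> h1 s \<noteq> 0"
  shows "p = 0"
proof (rule ccontr)
  assume "p \<noteq> 0"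
  show False
  proof (cases "\<beta> = 0")
    case False
    have "{s. s ^ n = - \<beta>} \<subseteq> {s. poly p s = 0}"
    proof
      fix s assume "s \<in> {s. s ^ n = - \<beta>}"
      then have r: "s ^ n + \<beta> = 0" by simp
      from eq[OF roots[OF r]] h1[OF r] r show "s \<in> {s. poly p s = 0}" by simp
    qed
    then have "card {s. s ^ n = - \<beta>} \<le> card {s. poly p s = 0}"
      by (intro card_mono poly_roots_finite \<open>p \<noteq> 0\<close>)
    also have "\<dots> \<le> degree p" by (rule card_poly_roots_bound[OF \<open>p \<noteq> 0\<close>])
    finally show False using card_nth_roots[of "- \<beta>" n] False deg by simp
  next
    case True
    have n: "0 < n" using deg by simp
    then have r: "0 ^ n + \<beta> = 0" using True by simp
    define m where "m = order 0 p"
    have mn: "m < n" using order_degree[OF \<open>p \<noteq> 0\<close>, of 0] deg by (simp add: m_def)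
    obtain p1 where p1: "p = [:- 0, 1:] ^ m * p1" "\<not> [:- 0, 1:] dvd p1"
      using order_decomp[OF \<open>p \<noteq> 0\<close>, of 0] unfolding m_def by blast
    have p10: "poly p1 0 \<noteq> 0" using p1(2) by (simp add: poly_eq_0_iff_dvd)
    have 0: "0 \<in> U" by (rule roots[OF r])
    have cU: "isCont h1 0" "isCont h2 0"
      using c U 0 by (auto simp: continuous_on_eq_continuous_at)
    have l1: "((\<lambda>s. poly p1 s * h1 s) \<longlongrightarrow> poly p1 0 * h1 0) (at 0)"
      using cU by (intro tendsto_intros poly_isCont[THEN isContD]) (simp add: isCont_def)
    have l2: "((\<lambda>s. s ^ (n - m) * h2 s) \<longlongrightarrow> 0 ^ (n - m) * h2 0) (at 0)"
      using cU by (intro tendsto_intros) (simp add: isCont_def)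
    have "\<forall>\<^sub>F s in at 0. s \<in> U" using U 0 by (rule eventually_at_topological[THEN iffD2, OF exI, OF conjI, OF _ conjI]) simp
    \<comment> \<open>After cancelling s^m the right side keeps a positive power of s and tends to
      0, while the left side tends to a nonzero value.\<close>
    then have "\<forall>\<^sub>F s in at 0. poly p1 s * h1 s = s ^ (n - m) * h2 s"
      using eventually_neq_at_within[of 0]
    proof eventually_elim
      case (elim s)
      have "s ^ m * (poly p1 s * h1 s) = s ^ m * (s ^ (n - m) * h2 s)"
        using eq[OF elim(1)] True mn by (simp add: p1(1) poly_power mult.assoc[symmetric] power_add[symmetric])
      then show ?case using elim(2) by simp
    qed
    from tendsto_unique[OF _ Lim_transform_eventually[OF l1 this] l2] have "poly p1 0 * h1 0 = 0"
      using mn by simp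
    with p10 h1[OF r] show False by simp
  qed
qed

context observation
begin

text \<open>Numerator of the resolvent term \<open>g\<close>: a polynomial in
  \<open>z + k^2 d\<close> of degree below n whose coefficients are, for k \<ge> 1, nonzero
  multiples of the entries of \<open>c k * v k\<close>. Its vanishing is therefore what has to be
  shown.\<close>

definition num :: "nat \<Rightarrow> complex \<Rightarrow> complex" where
  "num k z = (\<Sum>i\<in>UNIV. of_real (c k * v k $ i) * (- of_nat (k\<^sup>2)) ^ (CARD('n) - idx i) * (z + of_real ((real k)\<^sup>2 * d)) ^ (idx i - 1))"

definition g :: "nat \<Rightarrow> complex \<Rightarrow> complex" where
  "g k z = of_real (c k) * (\<Sum>i\<in>UNIV. (rk d \<alpha> k z :: (complex, 'n) vec) $ i * of_real (v k $ i))"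

lemma g_eq: "g k z = num k z / Pk CARD('n) d \<alpha> k z"
  by (simp add: g_def num_def rk_def sum_divide_distrib sum_distrib_left mult_ac)

lemma num_eq: "Pk CARD('n) d \<alpha> k z \<noteq> 0 \<Longrightarrow> num k z = g k z * Pk CARD('n) d \<alpha> k z"
  by (simp add: g_eq)

lemma g_of_real: "g k (of_real \<zeta>) = of_real (c k * (rk d \<alpha> k \<zeta> \<bullet> v k))"
  by (simp add: g_def rk_of_real inner_vec_def)

lemma P_of_real: "Pk CARD('n) d \<alpha> k (of_real \<zeta>) = of_real (Pk CARD('n) d \<alpha> k \<zeta>)"
  by (simp add: Pk_def)

lemma holomorphic_num: "num k holomorphic_on S"
  unfolding num_def by (intro holomorphic_intros)

lemma holomorphic_P: "Pk CARD('n) d \<alpha> k holomorphic_on S"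
  unfolding Pk_def by (intro holomorphic_intros)

text \<open>
  The series of resolvents converges on the whole plane away from the poles, so it stays zero
  there; at a zero of \<open>Pk n d \<alpha> m\<close> only the \<open>m\<close>-th term can be singular, hence that term is entire
  and its numerator, of degree less than \<open>n\<close>, vanishes.
\<close>

lemma coefficients_vanish:
  assumes res: "\<And>\<zeta>. zeta0 \<alpha> CARD('n) \<le> \<zeta> \<Longrightarrow> growth \<alpha> CARD('n) + 1 \<le> \<zeta> \<Longrightarrow> (\<lambda>k. c k * (rk d \<alpha> k \<zeta> \<bullet> v k)) sums 0"
    and cne: "\<And>k. 1 \<le> k \<Longrightarrow> c k \<noteq> 0"
    and disj: "\<And>k l (z :: complex). 1 \<le> k \<Longrightarrow> 1 \<le> l \<Longrightarrow> k \<noteq> l \<Longrightarrow> Pk CARD('n) d \<alpha> k z = 0 \<Longrightarrow> Pk CARD('n) d \<alpha> l z \<noteq> 0"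
    and m: "1 \<le> m"
  shows "v m = 0"
proof -
  let ?n = "CARD('n)"
  have nonneg: "0 \<le> \<bar>\<alpha>\<bar> * 2 ^ ?n" "0 \<le> growth \<alpha> ?n" "0 \<le> (real m)\<^sup>2" "0 \<le> (real m)\<^sup>2 * d"
    using d by (auto simp: growth_def)
  \<comment> \<open>All zeros of the m-th denominator have modulus below R0: after the shift by m^2
    d they lie below the sum of the first three terms by \<open>rk_bound\<close>, and the last term
    undoes the shift. R also exceeds z1, so the disc contains a real interval on which the series is
    known to vanish.\<close>
  define R0 where "R0 = (real m)\<^sup>2 + \<bar>\<alpha>\<bar> * 2 ^ ?n + 1 + (real m)\<^sup>2 * d"
  define z1 where "z1 = zeta0 \<alpha> ?n + growth \<alpha> ?n + 1"
  define R where "R = R0 + z1 + 1"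
  have z1: "0 < z1" "zeta0 \<alpha> ?n \<le> z1" "growth \<alpha> ?n + 1 \<le> z1" using nonneg unfolding z1_def zeta0_def by linarith+
  have R: "0 < R" "R0 < R" "z1 < R" using nonneg z1 unfolding R_def R0_def by linarith+
  obtain K0 :: nat where K0: "2 * R + 2 * (\<bar>\<alpha>\<bar> * 2 ^ ?n) + 2 \<le> real K0" using real_arch_simple by blast
  define K where "K = K0 + m + 1"
  \<comment> \<open>From K on the terms have no pole in the disc and are O(1/k^2), so the tail H
    will be holomorphic there.\<close>
  have big: "2 * R + 2 * (\<bar>\<alpha>\<bar> * 2 ^ ?n) + 2 \<le> (real k)\<^sup>2" if "K \<le> k" for k
  proof -
    have "real K0 \<le> real k" "1 \<le> real k" using that by (auto simp: K_def)
    then have "real K0 \<le> (real k)\<^sup>2" using self_le_power[of "real k" 2] by simp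
    then show ?thesis using K0 by linarith
  qed
  let ?B = "ball (0 :: complex) R"
  have tail: "Pk CARD('n) d \<alpha> k z \<noteq> 0" "norm (g k z) \<le> real ?n * (2 ^ (?n + 2) * Bv) * inverse ((real k)\<^sup>2)" if "K \<le> k" "z \<in> ?B" for k z
  proof -
    have z: "norm z \<le> R" using that(2) by simp
    show "Pk CARD('n) d \<alpha> k z \<noteq> 0" by (rule rk_bound_complex(1)[OF d z big[OF that(1)]])
    have "norm (g k z) \<le> 1 * (\<Sum>i\<in>(UNIV :: 'n set). 2 ^ (?n + 2) / (real k)\<^sup>2 * Bv)"
      unfolding g_def norm_mult norm_of_real
    proof (intro mult_mono c1 order_trans[OF norm_sum sum_mono])
      fix i :: 'n
      have "norm (of_real (v k $ i) :: complex) \<le> Bv"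
        using order_trans[OF component_le_norm_cart v, of k i] by simp
      then show "norm ((rk d \<alpha> k z :: (complex, 'n) vec) $ i * of_real (v k $ i)) \<le> 2 ^ (?n + 2) / (real k)\<^sup>2 * Bv"
        unfolding norm_mult by (intro mult_mono rk_bound_complex(2)[OF d z big[OF that(1)]]) auto
    qed auto
    then show "norm (g k z) \<le> real ?n * (2 ^ (?n + 2) * Bv) * inverse ((real k)\<^sup>2)"
      by (simp add: divide_inverse mult_ac)
  qed
  define H where "H z = (\<Sum>k. g (k + K) z)" for z
  have sq: "summable (\<lambda>k. real ?n * (2 ^ (?n + 2) * Bv) * inverse ((real (k + K))\<^sup>2))"
    using summable_ignore_initial_segment[OF summable_mult[OF inverse_power_summable[of 2, where 'a = real], of "real ?n * (2 ^ (?n + 2) * Bv)"], of K]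
    by simp
  have Hsum: "summable (\<lambda>k. g (k + K) z)" if "z \<in> ?B" for z
    by (rule summable_comparison_test'[OF sq, of 0]) (rule tail(2)[OF le_add2 that])
  have Hhol: "H holomorphic_on ?B"
  proof (rule holomorphic_uniform_sequence[OF open_ball])
    show "(\<lambda>z. \<Sum>k<j. g (k + K) z) holomorphic_on ?B" for j
      unfolding g_eq by (intro holomorphic_on_sum holomorphic_on_divide holomorphic_num holomorphic_P) (use tail(1) in auto)
    have "uniform_limit ?B (\<lambda>j z. \<Sum>k<j. g (k + K) z) (\<lambda>z. \<Sum>k. g (k + K) z) sequentially"
      by (rule Weierstrass_m_test[OF _ sq]) (rule tail(2)[OF le_add2])
    then have ul: "uniform_limit ?B (\<lambda>j z. \<Sum>k<j. g (k + K) z) H sequentially" by (simp add: H_def[abs_def])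
    fix z assume "z \<in> ?B"
    then obtain r where "0 < r" "cball z r \<subseteq> ?B" using open_contains_cball[of ?B] by blast
    then show "\<exists>r>0. cball z r \<subseteq> ?B \<and> uniform_limit (cball z r) (\<lambda>j z. \<Sum>k<j. g (k + K) z) H sequentially"
      using uniform_limit_on_subset[OF ul] by blast
  qed
  define I where "I = {1..<K}"
  have I: "finite I" "m \<in> I" "\<And>k. k \<in> I \<Longrightarrow> 1 \<le> k" using m by (auto simp: I_def K_def)
  \<comment> \<open>The series multiplied by all denominators below K: holomorphic on the whole
    disc, poles included.\<close>
  define E where "E z = (\<Sum>k\<in>I. num k z * (\<Prod>l\<in>I - {k}. Pk CARD('n) d \<alpha> l z)) + (\<Prod>l\<in>I. Pk CARD('n) d \<alpha> l z) * H z" for z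
  have Ehol: "E holomorphic_on ?B"
    unfolding E_def[abs_def]
    by (intro holomorphic_on_add holomorphic_on_sum holomorphic_on_mult holomorphic_on_prod holomorphic_num holomorphic_P Hhol)
  have Ereal: "E (of_real \<zeta>) = 0" if "\<zeta> \<in> {z1<..<R}" for \<zeta>
  proof -
    have \<zeta>: "zeta0 \<alpha> ?n \<le> \<zeta>" "growth \<alpha> ?n + 1 \<le> \<zeta>" "of_real \<zeta> \<in> ?B" using that z1 by auto
    have Pne: "Pk CARD('n) d \<alpha> k (of_real \<zeta>) \<noteq> 0" for k
      unfolding P_of_real using rk_bound_real(1)[OF d \<zeta>(1)[unfolded zeta0_def]] by simp
    have "(\<lambda>k. of_real (c k * (rk d \<alpha> k \<zeta> \<bullet> v k)) :: complex) sums of_real 0"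
      by (intro sums_of_real res \<zeta>)
    then have gs: "(\<lambda>k. g k (of_real \<zeta>)) sums 0" by (simp add: g_of_real)
    have "(\<Sum>k. g k (of_real \<zeta>)) = H (of_real \<zeta>) + (\<Sum>k<K. g k (of_real \<zeta>))"
      unfolding H_def by (rule suminf_split_initial_segment[OF sums_summable[OF gs]])
    moreover have "(\<Sum>k<K. g k (of_real \<zeta>)) = (\<Sum>k\<in>I. g k (of_real \<zeta>))"
      unfolding I_def by (rule sum.mono_neutral_right) (auto simp: Suc_le_eq g_def c0 intro!: gr0I)
    ultimately have 0: "(\<Sum>k\<in>I. g k (of_real \<zeta>)) + H (of_real \<zeta>) = 0" using sums_unique[OF gs] by (simp add: add.commute)
    have "num k (of_real \<zeta>) * (\<Prod>l\<in>I - {k}. Pk CARD('n) d \<alpha> l (of_real \<zeta>)) = g k (of_real \<zeta>) * (\<Prod>l\<in>I. Pk CARD('n) d \<alpha> l (of_real \<zeta>))" if "k \<in> I" for k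
      by (simp add: num_eq[OF Pne] prod.remove[OF I(1) that] mult.assoc)
    then have "E (of_real \<zeta>) = (\<Prod>l\<in>I. Pk CARD('n) d \<alpha> l (of_real \<zeta>)) * ((\<Sum>k\<in>I. g k (of_real \<zeta>)) + H (of_real \<zeta>))"
      unfolding E_def by (simp add: sum_distrib_left sum_distrib_right distrib_left mult.commute)
    then show ?thesis by (simp add: 0)
  qed
  have E0: "E z = 0" if "z \<in> ?B" for z
  proof (rule analytic_continuation[OF Ehol open_ball connected_ball _ _ _ _ that])
    let ?t = "(z1 + R) / 2"
    show "of_real ` {z1<..<R} \<subseteq> ?B" using z1 by auto
    have "\<bar>?t\<bar> < R" using z1 R by simp
    then show "of_real ?t \<in> ?B" by (simp only: mem_ball_0 norm_of_real)
    show "(of_real ?t :: complex) islimpt (of_real ` {z1<..<R})" using R by (intro of_real_islimpt) auto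
    show "w \<in> of_real ` {z1<..<R} \<Longrightarrow> E w = 0" for w using Ereal by auto
  qed
  \<comment> \<open>With the m-th term singled out, E = 0 becomes \<open>num m * h1\<close> equal to
    the m-th denominator times h2, and by \<open>disj\<close> h1 shares no zero with that
    denominator.\<close>
  define h1 where "h1 z = (\<Prod>l\<in>I - {m}. Pk CARD('n) d \<alpha> l z)" for z :: complex
  define h2 where "h2 z = - ((\<Sum>k\<in>I - {m}. num k z * (\<Prod>l\<in>I - {k} - {m}. Pk CARD('n) d \<alpha> l z)) + h1 z * H z)" for z :: complex
  have hol: "h1 holomorphic_on ?B" "h2 holomorphic_on ?B"
    unfolding h1_def[abs_def] h2_def[abs_def]
    by (intro holomorphic_on_minus holomorphic_on_add holomorphic_on_sum holomorphic_on_mult holomorphic_on_prod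
        holomorphic_num holomorphic_P Hhol)+
  have key: "num m z * h1 z = Pk CARD('n) d \<alpha> m z * h2 z" if "z \<in> ?B" for z
  proof -
    have "(\<Prod>l\<in>I - {k}. Pk CARD('n) d \<alpha> l z) = Pk CARD('n) d \<alpha> m z * (\<Prod>l\<in>I - {k} - {m}. Pk CARD('n) d \<alpha> l z)" if "k \<in> I - {m}" for k
      using I that by (intro prod.remove) auto
    then have "(\<Sum>k\<in>I - {m}. num k z * (\<Prod>l\<in>I - {k}. Pk CARD('n) d \<alpha> l z)) = Pk CARD('n) d \<alpha> m z * (\<Sum>k\<in>I - {m}. num k z * (\<Prod>l\<in>I - {k} - {m}. Pk CARD('n) d \<alpha> l z))"
      unfolding sum_distrib_left by (intro sum.cong refl) (simp add: mult.left_commute)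
    moreover have "(\<Prod>l\<in>I. Pk CARD('n) d \<alpha> l z) = Pk CARD('n) d \<alpha> m z * h1 z" unfolding h1_def by (rule prod.remove[OF I(1,2)])
    moreover have "E z = num m z * h1 z + (\<Sum>k\<in>I - {m}. num k z * (\<Prod>l\<in>I - {k}. Pk CARD('n) d \<alpha> l z)) + (\<Prod>l\<in>I. Pk CARD('n) d \<alpha> l z) * H z"
      unfolding E_def h1_def by (subst sum.remove[OF I(1,2)]) simp
    ultimately have "0 = num m z * h1 z - Pk CARD('n) d \<alpha> m z * h2 z"
      using E0[OF that] by (simp add: h2_def algebra_simps)
    then show ?thesis by simp
  qed
  let ?sh = "of_real ((real m)\<^sup>2 * d) :: complex"
  let ?\<beta> = "of_real \<alpha> * (- of_nat (m\<^sup>2)) ^ (?n - 1) :: complex"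
  define a :: "'n \<Rightarrow> complex" where "a i = of_real (c m * v m $ i) * (- of_nat (m\<^sup>2)) ^ (?n - idx i)" for i
  define p :: "complex poly" where "p = (\<Sum>i\<in>(UNIV :: 'n set). monom (a i) (idx i - 1))"
  have ps: "poly p s = num m (s - ?sh)" for s
    by (simp add: p_def num_def a_def poly_sum poly_monom)
  have Ps: "Pk CARD('n) d \<alpha> m (s - ?sh) = s ^ ?n + ?\<beta>" for s by (simp add: Pk_def)
  have n0: "0 < ?n" by simp
  have "p = 0"
  proof (rule polynomial_divisible_imp_zero)
    show "degree p < ?n"
      unfolding p_def
    proof (rule degree_sum_less[OF _ n0])
      fix i :: 'n
      have "degree (monom (a i) (idx i - 1)) \<le> idx i - 1" by (rule degree_monom_le)
      also have "\<dots> < ?n" using idx_bounds[of i] by linarith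
      finally show "degree (monom (a i) (idx i - 1)) < ?n" .
    qed
    let ?U = "ball ?sh R"
    have U: "s - ?sh \<in> ?B" if "s \<in> ?U" for s using that by (simp add: dist_norm norm_minus_commute)
    show "open ?U" by simp
    have "s - ?sh \<in> ?B" if "s ^ ?n + ?\<beta> = 0" for s
    proof (rule ccontr)
      assume "s - ?sh \<notin> ?B"
      then have "R \<le> norm (s - ?sh)" by simp
      also have "\<dots> \<le> norm s + norm ?sh" by (rule norm_triangle_ineq4)
      also have "norm ?sh = (real m)\<^sup>2 * d" using nonneg(4) by (simp only: norm_of_real abs_of_nonneg)
      finally have s: "(real m)\<^sup>2 + \<bar>\<alpha>\<bar> * 2 ^ ?n + 1 \<le> norm s" using R(2) unfolding R0_def by linarith
      have "Pk CARD('n) d \<alpha> m (s - ?sh) \<noteq> 0"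
      proof (rule rk_bound(1))
        show "(real m)\<^sup>2 \<le> 2 * norm (s - ?sh + ?sh)" "\<bar>\<alpha>\<bar> * 2 ^ ?n \<le> norm (s - ?sh + ?sh)" "0 < norm (s - ?sh + ?sh)"
          unfolding diff_add_cancel using s nonneg norm_ge_zero[of s] by linarith+
      qed
      with that show False by (simp only: Ps)
    qed
    then show "s ^ ?n + ?\<beta> = 0 \<Longrightarrow> s \<in> ?U" for s by (simp add: dist_norm norm_minus_commute)
    show "poly p s * h1 (s - ?sh) = (s ^ ?n + ?\<beta>) * h2 (s - ?sh)" if "s \<in> ?U" for s
      using key[OF U[OF that]] by (simp only: ps Ps)
    have shc: "continuous_on ?U (\<lambda>s. s - ?sh)" by (intro continuous_intros)
    show "continuous_on ?U (\<lambda>s. h1 (s - ?sh))" "continuous_on ?U (\<lambda>s. h2 (s - ?sh))"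
      by (rule continuous_on_compose2[OF holomorphic_on_imp_continuous_on[OF hol(1)] shc], use U in blast,
          rule continuous_on_compose2[OF holomorphic_on_imp_continuous_on[OF hol(2)] shc], use U in blast)
    show "h1 (s - ?sh) \<noteq> 0" if "s ^ ?n + ?\<beta> = 0" for s
      unfolding h1_def using I disj[OF m _ _ that[folded Ps]] by (subst prod_zero_iff) auto
  qed
  have "v m $ j = 0" for j
  proof -
    have "coeff p (idx j - 1) = (\<Sum>i\<in>UNIV. if i = j then a i else 0)"
      unfolding p_def coeff_sum
    proof (intro sum.cong refl)
      fix i
      \<comment> \<open>Indices start at 1, so the truncated subtraction loses nothing.\<close>
      have "idx i - 1 = idx j - 1 \<longleftrightarrow> i = j"
        using idx_bounds(1)[of i] idx_bounds(1)[of j] idx_inject[of i j] by (metis eq_diff_iff)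
      then show "coeff (monom (a i) (idx i - 1)) (idx j - 1) = (if i = j then a i else 0)" by simp
    qed
    then have "a j = 0" using \<open>p = 0\<close> by simp
    then show ?thesis using cne[OF m] m by (simp add: a_def)
  qed
  then show ?thesis by (simp add: vec_eq_iff)
qed

end

section \<open>Sufficiency\<close>

text \<open>Response from rest of the k-th mode to the control
  \<open>pi / 2 * s * exp (\<zeta> * t)\<close>, where pi/2 cancels the 2/pi of the sine expansion:
  a particular solution minus the free evolution that corrects its initial value.\<close>

definition control_mode :: "real \<Rightarrow> real \<Rightarrow> real \<Rightarrow> real \<Rightarrow> real \<Rightarrow> nat \<Rightarrow> real \<Rightarrow> real^('n::{finite,linorder})" where
  "control_mode d \<alpha> x0 \<zeta> s k t = (s * sin (real k * x0)) *\<^sub>R (exp (\<zeta> * t) *\<^sub>R rk d \<alpha> k \<zeta> - Sg d \<alpha> k t *v rk d \<alpha> k \<zeta>)"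

lemma norm_control_mode:
  assumes d: "1 \<le> d" and \<zeta>: "zeta0 \<alpha> CARD('n::{finite,linorder}) \<le> \<zeta>" and t: "0 \<le> t" "t \<le> T"
  shows "norm (control_mode d \<alpha> x0 \<zeta> s k t :: (real, 'n) vec)
    \<le> \<bar>s\<bar> * ((exp (\<zeta> * T) + KS CARD('n) * exp (growth \<alpha> CARD('n) * T)) * (real CARD('n) * 2 ^ (CARD('n) + 1))) * (1 / (1 + (real k)\<^sup>2))"
proof -
  let ?r = "rk d \<alpha> k \<zeta> :: (real, 'n) vec"
  let ?C = "exp (\<zeta> * T) + KS CARD('n) * exp (growth \<alpha> CARD('n) * T)"
  have "0 \<le> \<bar>\<alpha>\<bar> * 2 ^ CARD('n)" by simp
  then have "0 \<le> \<zeta>" using \<zeta> unfolding zeta0_def by linarith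
  have r: "norm ?r \<le> real CARD('n) * 2 ^ (CARD('n) + 1) * (1 / (1 + (real k)\<^sup>2))"
    using norm_vec_le_sum_bound[OF rk_bound_real(2)[OF d \<zeta>[unfolded zeta0_def]]] by simp
  have "norm (Sg d \<alpha> k t *v ?r) \<le> KS CARD('n) * exp (growth \<alpha> CARD('n) * t) * exp (- (real k)\<^sup>2 * t / 2) * norm ?r"
    by (rule Sg_norm_growth[OF d t(1)])
  also have "\<dots> \<le> KS CARD('n) * exp (growth \<alpha> CARD('n) * T) * 1 * norm ?r"
    using t by (intro mult_mono) (auto simp: growth_def intro!: mult_left_mono)
  finally have "norm (Sg d \<alpha> k t *v ?r) \<le> KS CARD('n) * exp (growth \<alpha> CARD('n) * T) * norm ?r" by simp
  moreover have "norm (exp (\<zeta> * t) *\<^sub>R ?r) \<le> exp (\<zeta> * T) * norm ?r"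
    using t \<open>0 \<le> \<zeta>\<close> by (auto intro!: mult_right_mono mult_left_mono)
  ultimately have "norm (exp (\<zeta> * t) *\<^sub>R ?r - Sg d \<alpha> k t *v ?r) \<le> ?C * norm ?r"
    using norm_triangle_ineq4[of "exp (\<zeta> * t) *\<^sub>R ?r" "Sg d \<alpha> k t *v ?r"] by (simp add: distrib_right)
  also have "\<dots> \<le> ?C * (real CARD('n) * 2 ^ (CARD('n) + 1) * (1 / (1 + (real k)\<^sup>2)))"
    by (intro mult_left_mono r) (auto intro: add_nonneg_nonneg)
  finally have b: "norm (exp (\<zeta> * t) *\<^sub>R ?r - Sg d \<alpha> k t *v ?r) \<le> ?C * (real CARD('n) * 2 ^ (CARD('n) + 1) * (1 / (1 + (real k)\<^sup>2)))" .
  have "norm (control_mode d \<alpha> x0 \<zeta> s k t :: (real, 'n) vec) = (\<bar>s\<bar> * \<bar>sin (real k * x0)\<bar>) * norm (exp (\<zeta> * t) *\<^sub>R ?r - Sg d \<alpha> k t *v ?r)"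
    by (simp add: control_mode_def abs_mult)
  also have "\<dots> \<le> (\<bar>s\<bar> * 1) * (?C * (real CARD('n) * 2 ^ (CARD('n) + 1) * (1 / (1 + (real k)\<^sup>2))))"
    by (intro mult_mono mult_left_mono b abs_sin_le_one) auto
  finally show ?thesis by (simp only: mult_1_right mult.assoc)
qed

lemma control_mode_summable:
  assumes "1 \<le> d" "zeta0 \<alpha> CARD('n::{finite,linorder}) \<le> \<zeta>" "0 \<le> T"
  shows "summable (\<lambda>k. norm (control_mode d \<alpha> x0 \<zeta> s k T :: (real, 'n) vec))"
  by (rule summable_comparison_test'[OF summable_mult[OF summable_inverse_one_plus_square], of 0])
    (simp only: real_norm_def abs_norm_cancel, rule norm_control_mode[OF assms(1,2,3) order_refl])

lemma control_mode_continuous: "continuous_on S (control_mode d \<alpha> x0 \<zeta> s k :: real \<Rightarrow> real^('n::{finite,linorder}))"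
  unfolding control_mode_def[abs_def] by (intro continuous_intros Sg_continuous)

lemma control_mode_derivative:
  fixes w :: "real^('n::{finite,linorder})"
  assumes d: "1 \<le> d" and \<zeta>: "zeta0 \<alpha> CARD('n) \<le> \<zeta>"
  shows "((\<lambda>t. control_mode d \<alpha> x0 \<zeta> s k t \<bullet> w) has_real_derivative
    - ((modeM d \<alpha> k *v control_mode d \<alpha> x0 \<zeta> s k t) \<bullet> w) + sin (real k * x0) * (s * exp (\<zeta> * t)) * (vecB \<bullet> w)) (at t)"
proof -
  let ?r = "rk d \<alpha> k \<zeta> :: (real, 'n) vec" and ?c = "s * sin (real k * x0)"
  have res: "modeM d \<alpha> k *v ?r + \<zeta> *\<^sub>R ?r = vecB"
    by (rule rk_resolvent[OF rk_bound_real(1)[OF d \<zeta>[unfolded zeta0_def]]])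
  have "((\<lambda>t. exp (\<zeta> * t) * (?r \<bullet> w)) has_real_derivative \<zeta> * exp (\<zeta> * t) * (?r \<bullet> w)) (at t)"
    by (auto intro!: derivative_eq_intros)
  then have "((\<lambda>t. ?c * (exp (\<zeta> * t) * (?r \<bullet> w) - (Sg d \<alpha> k t *v ?r) \<bullet> w)) has_real_derivative
      ?c * (\<zeta> * exp (\<zeta> * t) * (?r \<bullet> w) - - ((modeM d \<alpha> k *v (Sg d \<alpha> k t *v ?r)) \<bullet> w))) (at t)"
    by (intro DERIV_cmult DERIV_diff Sg_inner_derivative(1))
  moreover have "?c * (exp (\<zeta> * t) * (?r \<bullet> w) - (Sg d \<alpha> k t *v ?r) \<bullet> w) = control_mode d \<alpha> x0 \<zeta> s k t \<bullet> w" for t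
    by (simp add: control_mode_def inner_diff_left)
  moreover have "?c * (\<zeta> * exp (\<zeta> * t) * (?r \<bullet> w) - - ((modeM d \<alpha> k *v (Sg d \<alpha> k t *v ?r)) \<bullet> w))
      = - ((modeM d \<alpha> k *v control_mode d \<alpha> x0 \<zeta> s k t) \<bullet> w) + sin (real k * x0) * (s * exp (\<zeta> * t)) * (vecB \<bullet> w)"
    unfolding res[symmetric] control_mode_def
    by (simp add: matrix_vector_mult_scaleR matrix_vector_mult_diff_distrib inner_diff_left inner_add_left algebra_simps)
  ultimately show ?thesis by simp
qed

section \<open>States reached by exponential controls\<close>

definition free_evolution :: "real \<Rightarrow> real \<Rightarrow> real \<Rightarrow> (real \<Rightarrow> real^('n::{finite,linorder})) \<Rightarrow> real \<Rightarrow> real^('n::{finite,linorder})" where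
  "free_evolution T d \<alpha> y0 = sine_series (\<lambda>k. Sg d \<alpha> k T *v ((2 / pi) *\<^sub>R sinc k y0))"

definition reached :: "real \<Rightarrow> real \<Rightarrow> real \<Rightarrow> real \<Rightarrow> real \<Rightarrow> real \<Rightarrow> real^('n::{finite,linorder})" where
  "reached T d \<alpha> x0 \<zeta> = sine_series (\<lambda>k. control_mode d \<alpha> x0 \<zeta> 1 k T)"

lemma sine_series_add:
  fixes a b :: "nat \<Rightarrow> 'a::euclidean_space"
  assumes "summable (\<lambda>k. norm (a k))" "summable (\<lambda>k. norm (b k))"
  shows "sine_series (\<lambda>k. a k + b k) x = sine_series a x + sine_series b x"
  unfolding sine_series_def scaleR_add_right
  by (rule suminf_add[symmetric]) (intro summable_norm_cancel[OF sine_series_summable] assms)+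

lemma sine_series_scaleR:
  fixes a :: "nat \<Rightarrow> 'a::euclidean_space"
  assumes "summable (\<lambda>k. norm (a k))"
  shows "sine_series (\<lambda>k. c *\<^sub>R a k) x = c *\<^sub>R sine_series a x"
proof -
  have "(\<Sum>k. c *\<^sub>R (sin (real k * x) *\<^sub>R a k)) = c *\<^sub>R (\<Sum>k. sin (real k * x) *\<^sub>R a k)"
    by (rule suminf_scaleR_right[symmetric]) (intro summable_norm_cancel[OF sine_series_summable] assms)
  then show ?thesis by (simp add: sine_series_def mult.commute)
qed

lemma sine_series_sum:
  fixes a :: "'i \<Rightarrow> nat \<Rightarrow> 'a::euclidean_space"
  assumes "finite J" "\<And>j. j \<in> J \<Longrightarrow> summable (\<lambda>k. norm (a j k))"
  shows "summable (\<lambda>k. norm (\<Sum>j\<in>J. a j k)) \<and> sine_series (\<lambda>k. \<Sum>j\<in>J. a j k) x = (\<Sum>j\<in>J. sine_series (a j) x)"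
  using assms
proof (induction J rule: finite_induct)
  case empty
  show ?case by (simp add: sine_series_def)
next
  case (insert j J)
  have j: "summable (\<lambda>k. norm (a j k))" by (simp add: insert.prems)
  have IH: "summable (\<lambda>k. norm (\<Sum>j\<in>J. a j k))" "sine_series (\<lambda>k. \<Sum>j\<in>J. a j k) x = (\<Sum>j\<in>J. sine_series (a j) x)"
    using insert.IH insert.prems by blast+
  have "summable (\<lambda>k. norm (a j k + (\<Sum>j\<in>J. a j k)))"
    by (rule summable_comparison_test'[OF summable_add[OF j IH(1)], of 0]) (simp add: norm_triangle_ineq)
  then show ?case using insert.hyps sine_series_add[OF j IH(1)] IH(2) by simp
qed

text \<open>Superposition: the free evolution of the datum and finitely many control responses
  together satisfy the assumptions of \<open>modal_solution\<close>. The coefficients b stay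
  arbitrary, so the reached states form a translated linear span.\<close>

lemma reachable_states:
  fixes y0 :: "real \<Rightarrow> real^('n::{finite,linorder})"
  assumes T: "0 < T" and d: "1 \<le> d" and x0: "x0 \<in> {0<..<pi}" and y0: "y0 \<in> L2 Om"
    and J: "finite J" "\<And>\<zeta>. \<zeta> \<in> J \<Longrightarrow> zeta0 \<alpha> CARD('n) \<le> \<zeta>"
  shows "free_evolution T d \<alpha> y0 \<in> L2 Om"
    and "\<exists>u \<in> L2 (leb T). \<exists>y. weak_solution T (matD d) (matA \<alpha>) vecB x0 y0 u y \<and>
      y T = (\<lambda>x. free_evolution T d \<alpha> y0 x + (\<Sum>\<zeta>\<in>J. b \<zeta> *\<^sub>R reached T d \<alpha> x0 \<zeta> x))"
proof -
  let ?h = "\<lambda>k t. Sg d \<alpha> k t *v ((2 / pi) *\<^sub>R sinc k y0)"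
  define Y where "Y k t = ?h k t + (\<Sum>\<zeta>\<in>J. control_mode d \<alpha> x0 \<zeta> (b \<zeta>) k t)" for k t
  define u where "u t = pi / 2 * (\<Sum>\<zeta>\<in>J. b \<zeta> * exp (\<zeta> * t))" for t
  let ?G = "KS CARD('n) * exp (growth \<alpha> CARD('n) * T)"
  let ?L = "\<lambda>\<zeta>. \<bar>b \<zeta>\<bar> * ((exp (\<zeta> * T) + ?G) * (real CARD('n) * 2 ^ (CARD('n) + 1)))"
  \<comment> \<open>One constant for both parts of the bound; the summand 1 secures
    positivity.\<close>
  define K where "K = ?G + (\<Sum>\<zeta>\<in>J. ?L \<zeta>) + 1"
  have L: "0 \<le> ?L \<zeta>" for \<zeta> by (intro mult_nonneg_nonneg add_nonneg_nonneg) auto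
  have K: "?G \<le> K" "(\<Sum>\<zeta>\<in>J. ?L \<zeta>) \<le> K" "0 < K"
    using sum_nonneg[of J ?L, OF L] mult_nonneg_nonneg[OF KS_nonneg[of "CARD('n)"] exp_ge_zero[of "growth \<alpha> CARD('n) * T"]]
    unfolding K_def by linarith+
  have hb: "norm (?h k t) \<le> K * (exp (- (real k)\<^sup>2 * t / 2) * norm (sinc k y0))" if t: "0 \<le> t" "t \<le> T" for k t
  proof -
    have "norm (?h k t) \<le> KS CARD('n) * exp (growth \<alpha> CARD('n) * t) * exp (- (real k)\<^sup>2 * t / 2) * norm ((2 / pi) *\<^sub>R sinc k y0)"
      by (rule Sg_norm_growth[OF d t(1)])
    also have "\<dots> \<le> ?G * exp (- (real k)\<^sup>2 * t / 2) * norm ((2 / pi) *\<^sub>R sinc k y0)"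
      using t by (intro mult_right_mono mult_left_mono) (auto simp: growth_def intro!: mult_left_mono)
    also have "\<dots> \<le> K * exp (- (real k)\<^sup>2 * t / 2) * (1 * norm (sinc k y0))"
    proof (intro mult_mono K)
      have "\<bar>2 / pi\<bar> \<le> 1" using pi_ge_two by simp
      then show "norm ((2 / pi) *\<^sub>R sinc k y0) \<le> 1 * norm (sinc k y0)"
        unfolding norm_scaleR by (intro mult_right_mono) auto
    qed (use K in auto)
    finally show ?thesis by simp
  qed
  have cb: "norm (\<Sum>\<zeta>\<in>J. control_mode d \<alpha> x0 \<zeta> (b \<zeta>) k t :: (real, 'n) vec) \<le> K * (1 / (1 + (real k)\<^sup>2))" if t: "0 \<le> t" "t \<le> T" for k t
  proof -
    have "norm (\<Sum>\<zeta>\<in>J. control_mode d \<alpha> x0 \<zeta> (b \<zeta>) k t :: (real, 'n) vec) \<le> (\<Sum>\<zeta>\<in>J. ?L \<zeta> * (1 / (1 + (real k)\<^sup>2)))"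
      by (intro order_trans[OF norm_sum sum_mono] norm_control_mode d J t)
    also have "\<dots> = (\<Sum>\<zeta>\<in>J. ?L \<zeta>) * (1 / (1 + (real k)\<^sup>2))" by (simp only: sum_distrib_right)
    also have "\<dots> \<le> K * (1 / (1 + (real k)\<^sup>2))" by (intro mult_right_mono K) auto
    finally show ?thesis .
  qed
  interpret modal_solution T d \<alpha> x0 K u y0 Y
  proof
    show "continuous_on UNIV u" unfolding u_def by (intro continuous_intros)
    show "continuous_on UNIV (Y k)" for k
      unfolding Y_def by (intro continuous_intros Sg_continuous control_mode_continuous)
    show "((\<lambda>t. Y k t \<bullet> w) has_real_derivative - ((modeM d \<alpha> k *v Y k t) \<bullet> w) + 2 / pi * sin (real k * x0) * u t * (vecB \<bullet> w)) (at t)" for k w t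
    proof -
      have "((\<lambda>t. ?h k t \<bullet> w + (\<Sum>\<zeta>\<in>J. control_mode d \<alpha> x0 \<zeta> (b \<zeta>) k t \<bullet> w)) has_real_derivative
          - ((modeM d \<alpha> k *v ?h k t) \<bullet> w) + (\<Sum>\<zeta>\<in>J. - ((modeM d \<alpha> k *v control_mode d \<alpha> x0 \<zeta> (b \<zeta>) k t) \<bullet> w)
            + sin (real k * x0) * (b \<zeta> * exp (\<zeta> * t)) * (vecB \<bullet> w))) (at t)"
        by (intro DERIV_add DERIV_sum Sg_inner_derivative(1) control_mode_derivative d J)
      moreover have "?h k t \<bullet> w + (\<Sum>\<zeta>\<in>J. control_mode d \<alpha> x0 \<zeta> (b \<zeta>) k t \<bullet> w) = Y k t \<bullet> w" for t
        by (simp add: Y_def inner_add_left inner_sum_left)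
      moreover have "(\<Sum>\<zeta>\<in>J. - ((modeM d \<alpha> k *v control_mode d \<alpha> x0 \<zeta> (b \<zeta>) k t) \<bullet> w)
            + sin (real k * x0) * (b \<zeta> * exp (\<zeta> * t)) * (vecB \<bullet> w))
          = - ((modeM d \<alpha> k *v (\<Sum>\<zeta>\<in>J. control_mode d \<alpha> x0 \<zeta> (b \<zeta>) k t)) \<bullet> w)
            + sin (real k * x0) * (\<Sum>\<zeta>\<in>J. b \<zeta> * exp (\<zeta> * t)) * (vecB \<bullet> w)"
        by (simp add: sum.distrib sum_negf linear_sum[OF matrix_vector_mul_linear] inner_sum_left
            sum_distrib_left sum_distrib_right sum_subtractf)
      ultimately have "((\<lambda>t. Y k t \<bullet> w) has_real_derivative - ((modeM d \<alpha> k *v ?h k t) \<bullet> w)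
          + (- ((modeM d \<alpha> k *v (\<Sum>\<zeta>\<in>J. control_mode d \<alpha> x0 \<zeta> (b \<zeta>) k t)) \<bullet> w)
            + sin (real k * x0) * (\<Sum>\<zeta>\<in>J. b \<zeta> * exp (\<zeta> * t)) * (vecB \<bullet> w))) (at t)"
        by (simp only:)
      then show ?thesis
        by (rule DERIV_cong) (simp add: Y_def u_def matrix_vector_right_distrib inner_add_left)
    qed
    show "Y k 0 = (2 / pi) *\<^sub>R sinc k y0" for k by (simp add: Y_def control_mode_def Sg_zero)
    show "Y 0 t = 0" for t by (simp add: Y_def control_mode_def)
    show "norm (Y k t) \<le> K * (exp (- (real k)\<^sup>2 * t / 2) * norm (sinc k y0) + 1 / (1 + (real k)\<^sup>2))" if "0 \<le> t" "t \<le> T" for k t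
      using norm_triangle_ineq[of "?h k t" "\<Sum>\<zeta>\<in>J. control_mode d \<alpha> x0 \<zeta> (b \<zeta>) k t"] hb[OF that, of k] cb[OF that, of k]
      unfolding Y_def by (simp only: distrib_left)
  qed (use T x0 y0 K in auto)
  have "0 \<le> T" using T by simp
  have cs: "summable (\<lambda>k. norm (control_mode d \<alpha> x0 \<zeta> s k T :: (real, 'n) vec))" if "\<zeta> \<in> J" for \<zeta> s
    by (rule control_mode_summable[OF d J(2)[OF that] \<open>0 \<le> T\<close>])
  have hs: "summable (\<lambda>k. norm (?h k T))"
  proof -
    obtain A where A: "0 < A" "\<And>k. norm (sinc k y0) \<le> A" using sinc_y0_bounded by blast
    show ?thesis
    proof (rule summable_comparison_test'[of "\<lambda>k. K * A * (1 + 2 / T) * (1 / (1 + (real k)\<^sup>2))" 0])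
      show "summable (\<lambda>k. K * A * (1 + 2 / T) * (1 / (1 + (real k)\<^sup>2)))"
        by (intro summable_mult summable_inverse_one_plus_square)
      fix k
      have "norm (?h k T) \<le> K * (exp (- (real k)\<^sup>2 * T / 2) * norm (sinc k y0))" using hb[of T k] T by simp
      also have "\<dots> \<le> K * ((1 + 2 / T) / (1 + (real k)\<^sup>2) * A)"
        using K T A by (intro mult_left_mono mult_mono one_plus_square_exp_bound) auto
      finally show "norm (norm (?h k T)) \<le> K * A * (1 + 2 / T) * (1 / (1 + (real k)\<^sup>2))" by (simp add: mult_ac)
    qed
  qed
  show "free_evolution T d \<alpha> y0 \<in> L2 Om" unfolding free_evolution_def by (rule sine_series_L2[OF hs])
  have "y T x = free_evolution T d \<alpha> y0 x + (\<Sum>\<zeta>\<in>J. b \<zeta> *\<^sub>R reached T d \<alpha> x0 \<zeta> x)" for x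
  proof -
    have "y T x = sine_series (\<lambda>k. ?h k T + (\<Sum>\<zeta>\<in>J. control_mode d \<alpha> x0 \<zeta> (b \<zeta>) k T)) x"
      using T by (simp add: y_def Y_def)
    also have "\<dots> = sine_series (\<lambda>k. ?h k T) x + sine_series (\<lambda>k. \<Sum>\<zeta>\<in>J. control_mode d \<alpha> x0 \<zeta> (b \<zeta>) k T) x"
      by (rule sine_series_add[OF hs conjunct1[OF sine_series_sum[OF J(1) cs]]])
    also have "sine_series (\<lambda>k. \<Sum>\<zeta>\<in>J. control_mode d \<alpha> x0 \<zeta> (b \<zeta>) k T) x
        = (\<Sum>\<zeta>\<in>J. sine_series (\<lambda>k. control_mode d \<alpha> x0 \<zeta> (b \<zeta>) k T :: (real, 'n) vec) x)"
      by (rule conjunct2[OF sine_series_sum[OF J(1) cs]])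
    also have "\<dots> = (\<Sum>\<zeta>\<in>J. b \<zeta> *\<^sub>R reached T d \<alpha> x0 \<zeta> x)"
    proof (intro sum.cong refl)
      fix \<zeta> assume z: "\<zeta> \<in> J"
      have "control_mode d \<alpha> x0 \<zeta> (b \<zeta>) k T = b \<zeta> *\<^sub>R (control_mode d \<alpha> x0 \<zeta> 1 k T :: (real, 'n) vec)" for k
        by (simp add: control_mode_def)
      then show "sine_series (\<lambda>k. control_mode d \<alpha> x0 \<zeta> (b \<zeta>) k T) x = b \<zeta> *\<^sub>R (reached T d \<alpha> x0 \<zeta> x :: (real, 'n) vec)"
        unfolding reached_def using sine_series_scaleR[OF cs[OF z, of 1]] by simp
    qed
    finally show ?thesis by (simp add: free_evolution_def)
  qed
  moreover have "u \<in> L2 (leb T)" by (intro L2_continuous continuous_on_subset[OF u]) auto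
  ultimately show "\<exists>u \<in> L2 (leb T). \<exists>y. weak_solution T (matD d) (matA \<alpha>) vecB x0 y0 u y \<and>
      y T = (\<lambda>x. free_evolution T d \<alpha> y0 x + (\<Sum>\<zeta>\<in>J. b \<zeta> *\<^sub>R reached T d \<alpha> x0 \<zeta> x))"
    using weak_solution_y by (intro bexI[of _ u] exI[of _ y]) auto
qed

text \<open>\<open>v k\<close> represents l on the k-th mode. Annihilating the state reached with
  exponent \<zeta> says, after multiplication by exp(-\<zeta> T), that the Laplace integral of F
  over (0,T) vanishes at \<zeta>. The results on \<open>observation\<close> then remove every
  \<open>v k\<close>, and a bounded functional that vanishes on all sine modes is zero.\<close>

lemma annihilating_functional_zero:
  fixes l :: "(real \<Rightarrow> real^('n::{finite,linorder})) \<Rightarrow> real"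
  assumes T: "0 < T" and d: "1 \<le> d"
    and add: "\<And>f h. f \<in> L2 Om \<Longrightarrow> h \<in> L2 Om \<Longrightarrow> l (\<lambda>x. f x + h x) = l f + l h"
    and scale: "\<And>f c. f \<in> L2 Om \<Longrightarrow> l (\<lambda>x. c *\<^sub>R f x) = c * l f"
    and bdd: "\<And>f. f \<in> L2 Om \<Longrightarrow> \<bar>l f\<bar> \<le> C * L2norm Om f"
    and ann: "\<And>\<zeta>. zeta0 \<alpha> CARD('n) \<le> \<zeta> \<Longrightarrow> l (reached T d \<alpha> x0 \<zeta>) = 0"
    and irr: "\<And>k. 1 \<le> k \<Longrightarrow> sin (real k * x0) \<noteq> 0"
    and disj: "\<And>k m (z :: complex). 1 \<le> k \<Longrightarrow> 1 \<le> m \<Longrightarrow> k \<noteq> m \<Longrightarrow> Pk CARD('n) d \<alpha> k z = 0 \<Longrightarrow> Pk CARD('n) d \<alpha> m z \<noteq> 0"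
    and g: "g \<in> L2 Om"
  shows "l g = 0"
proof -
  have sL: "(\<lambda>x. sin (real k * x) *\<^sub>R a) \<in> L2 Om" for k and a :: "(real, 'n) vec" by (intro L2_scaleR_left L2_sin)
  have l0: "l (\<lambda>x. 0) = 0" using scale[OF L2_zero, of 0] by simp
  have lsum: "l (\<lambda>x. \<Sum>i\<in>I. F i x) = (\<Sum>i\<in>I. l (F i))" if "finite I" "\<And>i. i \<in> I \<Longrightarrow> F i \<in> L2 Om"
    for I :: "'i set" and F :: "'i \<Rightarrow> real \<Rightarrow> (real, 'n) vec"
    using that
  proof (induction I rule: finite_induct)
    case (insert i I)
    then have "l (\<lambda>x. F i x + (\<Sum>i\<in>I. F i x)) = l (F i) + l (\<lambda>x. \<Sum>i\<in>I. F i x)" by (intro add L2_sum) auto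
    with insert show ?case by simp
  qed (simp add: l0)
  define v :: "nat \<Rightarrow> (real, 'n) vec" where "v k = (\<chi> i. l (\<lambda>x. sin (real k * x) *\<^sub>R axis i 1))" for k
  have lsin: "l (\<lambda>x. sin (real k * x) *\<^sub>R a) = a \<bullet> v k" for k a
  proof -
    have "sin (real k * x) *\<^sub>R a = (\<Sum>i\<in>UNIV. (a $ i) *\<^sub>R (sin (real k * x) *\<^sub>R axis i 1))" for x
      by (simp add: vec_eq_iff axis_def if_distrib[of "\<lambda>x. x * _"] mult.commute cong: if_cong)
    then have "l (\<lambda>x. sin (real k * x) *\<^sub>R a) = (\<Sum>i\<in>UNIV. l (\<lambda>x. (a $ i) *\<^sub>R (sin (real k * x) *\<^sub>R axis i 1)))"
      by (simp only: lsum[OF finite L2_scaleR[OF sL]])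
    also have "\<dots> = (\<Sum>i\<in>UNIV. a $ i * l (\<lambda>x. sin (real k * x) *\<^sub>R axis i 1))"
      by (simp only: scale[OF sL])
    finally show ?thesis by (simp add: inner_vec_def v_def)
  qed
  define Bv where "Bv = real CARD('n) * (\<bar>C\<bar> * sqrt pi)"
  have vb: "norm (v k) \<le> Bv" for k
    unfolding Bv_def
  proof (rule norm_vec_le_sum_bound)
    fix i
    have "\<bar>v k $ i\<bar> \<le> C * L2norm Om (\<lambda>x. sin (real k * x) *\<^sub>R axis i 1 :: (real, 'n) vec)"
      by (simp add: v_def bdd[OF sL])
    also have "\<dots> \<le> \<bar>C\<bar> * (1 * sqrt (measure Om (space Om)))"
      by (intro mult_mono L2norm_bounded[OF finite_leb] L2_measurable[OF sL]) (auto simp: L2norm_nonneg)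
    finally show "\<bar>v k $ i\<bar> \<le> \<bar>C\<bar> * sqrt pi" by (simp add: measure_leb_pi)
  qed
  \<comment> \<open>Boundedness of l transfers the L2 convergence of the sine expansion to its
    values.\<close>
  have lpart: "(\<lambda>k. (2 / pi) *\<^sub>R sinc k f \<bullet> v k) sums l f" if f: "f \<in> L2 Om" for f
    unfolding sums_def
  proof (rule LIM_zero_cancel, rule Lim_null_comparison[OF always_eventually[OF allI] tendsto_mult_right_zero[OF sine_partial_sums_tendsto[OF f], of C]])
    fix m
    let ?S = "\<lambda>x. \<Sum>k<m. sin (real k * x) *\<^sub>R (2 / pi) *\<^sub>R sinc k f"
    have SL: "?S \<in> L2 Om" by (intro L2_sum sL)
    have "l ?S = (\<Sum>k<m. (2 / pi) *\<^sub>R sinc k f \<bullet> v k)"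
      by (simp only: lsum[OF finite_lessThan sL] lsin)
    moreover have "l (\<lambda>x. f x - ?S x) = l f - l ?S"
      using add[OF f L2_scaleR[OF SL, of "-1"]] scale[OF SL, of "-1"] by simp
    ultimately show "norm ((\<Sum>k<m. (2 / pi) *\<^sub>R sinc k f \<bullet> v k) - l f) \<le> C * L2norm Om (\<lambda>x. f x - ?S x)"
      using bdd[OF L2_diff[OF f SL]] by (simp add: abs_minus_commute)
  qed
  have lseries: "(\<lambda>k. a k \<bullet> v k) sums l (sine_series a)" if a: "summable (\<lambda>k. norm (a k))" "a 0 = 0" for a
  proof -
    have "(2 / pi) *\<^sub>R sinc k (sine_series a) = a k" for k
      by (cases "k = 0") (simp_all add: a sinc_sine_series[OF a(1)])
    then show ?thesis using lpart[OF sine_series_L2[OF a(1)]] by simp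
  qed
  interpret observation T d \<alpha> Bv "\<lambda>k. sin (real k * x0)" v
    by unfold_locales (use T d vb in auto)
  have lap: "(LINT t|leb T. exp (- \<zeta> * t) * F t) = 0" if \<zeta>: "zeta0 \<alpha> CARD('n) \<le> \<zeta>" for \<zeta>
  proof -
    let ?r = "\<lambda>k. rk d \<alpha> k \<zeta> :: (real, 'n) vec"
    have "(\<lambda>k. control_mode d \<alpha> x0 \<zeta> 1 k T \<bullet> v k) sums 0"
      using lseries[OF control_mode_summable[OF d \<zeta> less_imp_le[OF T], of x0 1]] ann[OF \<zeta>]
      by (simp add: reached_def control_mode_def)
    from sums_mult[OF this, of "exp (- \<zeta> * T)"]
    have "(\<lambda>k. exp (- \<zeta> * T) * (control_mode d \<alpha> x0 \<zeta> 1 k T \<bullet> v k)) sums 0" by simp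
    moreover have "exp (- \<zeta> * T) * (control_mode d \<alpha> x0 \<zeta> 1 k T \<bullet> v k)
        = sin (real k * x0) * ((?r k - exp (- \<zeta> * T) *\<^sub>R (Sg d \<alpha> k T *v ?r k)) \<bullet> v k)" for k
    proof -
      have "exp (- \<zeta> * T) * exp (\<zeta> * T) = 1" by (simp add: exp_add[symmetric])
      moreover have "exp (- \<zeta> * T) * (control_mode d \<alpha> x0 \<zeta> 1 k T \<bullet> v k)
          = sin (real k * x0) * ((exp (- \<zeta> * T) * exp (\<zeta> * T)) * (?r k \<bullet> v k) - exp (- \<zeta> * T) * ((Sg d \<alpha> k T *v ?r k) \<bullet> v k))"
        by (simp only: control_mode_def inner_diff_left inner_scaleR_left mult_1 right_diff_distrib mult.assoc mult.left_commute)
      ultimately show ?thesis by (simp only: inner_diff_left inner_scaleR_left mult_1)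
    qed
    ultimately have "(\<lambda>k. sin (real k * x0) * ((?r k - exp (- \<zeta> * T) *\<^sub>R (Sg d \<alpha> k T *v ?r k)) \<bullet> v k)) sums 0"
      by (simp only:)
    then show ?thesis using sums_unique2[OF laplace(2)[OF T \<zeta>]] by blast
  qed
  have FT: "F t = 0" if t: "t \<in> {0<..<T}" for t
  proof -
    let ?z = "zeta0 \<alpha> CARD('n)"
    have "exp (- ?z * t) * F t = 0"
    proof (rule moments_zero_imp_zero[OF T _ _ _ t])
      show "continuous_on {0<..} (\<lambda>t. exp (- ?z * t) * F t)" by (intro continuous_intros F_continuous)
      show "integrable (leb T) (\<lambda>t. exp (- ?z * t) * F t)" by (rule laplace(1)[OF T order_refl])
      fix j :: nat
      have "exp (- ?z * t) * F t * exp (- t) ^ j = exp (- (?z + real j) * t) * F t" for t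
        by (simp add: exp_of_nat_mult[symmetric] exp_add[symmetric] algebra_simps)
      then have "(LINT t|leb T. exp (- ?z * t) * F t * exp (- t) ^ j) = (LINT t|leb T. exp (- (?z + real j) * t) * F t)"
        by (simp only:)
      also have "\<dots> = 0" by (rule lap) simp
      finally show "(LINT t|leb T. exp (- ?z * t) * F t * exp (- t) ^ j) = 0" .
    qed
    then show ?thesis by simp
  qed
  have F0: "F t = 0" if "0 < t" for t by (rule F_zero_extends[OF FT that])
  have rs: "(\<lambda>k. sin (real k * x0) * (rk d \<alpha> k \<zeta> \<bullet> v k)) sums 0"
    if "zeta0 \<alpha> CARD('n) \<le> \<zeta>" "growth \<alpha> CARD('n) + 1 \<le> \<zeta>" for \<zeta>
    by (rule resolvent_sum_zero[OF F0 that])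
  have "v m = 0" if "1 \<le> m" for m
    by (rule coefficients_vanish[OF rs irr disj that])
  moreover have "sinc k f \<bullet> v k = 0" if "k = 0" for k and f :: "real \<Rightarrow> (real, 'n) vec" using that by simp
  ultimately have "(2 / pi) *\<^sub>R sinc k g \<bullet> v k = 0" for k by (cases "k = 0") simp_all
  then show ?thesis using sums_unique2[OF lpart[OF g], of 0] by simp
qed

text \<open>It suffices to approximate the target minus the free evolution by the span of the
  reached states. Were this impossible, a separating functional would annihilate all reached states
  and yet be nonzero at that difference.\<close>

theorem approx_controllable_if:
  assumes T: "0 < T" and d: "1 \<le> d" and x0: "x0 \<in> {0<..<pi}"
    and irr: "\<And>k. 1 \<le> k \<Longrightarrow> sin (real k * x0) \<noteq> 0"
    and disj: "\<And>k m (z :: complex). 1 \<le> k \<Longrightarrow> 1 \<le> m \<Longrightarrow> k \<noteq> m \<Longrightarrow>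
      Pk CARD('n::{finite,linorder}) d \<alpha> k z = 0 \<Longrightarrow> Pk CARD('n) d \<alpha> m z \<noteq> 0"
  shows "approx_controllable T (matD d) (matA \<alpha>) (vecB :: (real, 'n) vec) x0"
  unfolding approx_controllable_def
proof (intro ballI allI impI)
  fix y0 yT :: "real \<Rightarrow> (real, 'n) vec" and \<epsilon> :: real
  assume y0: "y0 \<in> L2 Om" and yT: "yT \<in> L2 Om" and \<epsilon>: "0 < \<epsilon>"
  let ?z = "zeta0 \<alpha> CARD('n)"
  let ?h = "free_evolution T d \<alpha> y0" and ?w = "\<lambda>\<zeta>. reached T d \<alpha> x0 \<zeta> :: real \<Rightarrow> (real, 'n) vec"
  have hL: "?h \<in> L2 Om" by (rule reachable_states(1)[OF T d x0 y0, of "{}"]) auto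
  define g where "g x = yT x - ?h x" for x
  have gL: "g \<in> L2 Om" unfolding g_def[abs_def] by (intro L2_diff yT hL)
  define V where "V = {f. \<exists>J b. finite J \<and> J \<subseteq> {?z..} \<and> f = (\<lambda>x. \<Sum>\<zeta>\<in>J. b \<zeta> *\<^sub>R ?w \<zeta> x)}"
  have wL: "?w \<zeta> \<in> L2 Om" if "?z \<le> \<zeta>" for \<zeta>
    unfolding reached_def by (intro sine_series_L2 control_mode_summable d that less_imp_le[OF T])
  have "\<exists>f\<in>V. L2norm Om (\<lambda>x. g x - f x) < \<epsilon>"
  proof (rule ccontr)
    assume "\<not> ?thesis"
    then have far: "\<epsilon> \<le> L2norm Om (\<lambda>x. g x - f x)" if "f \<in> V" for f using that by force
    have VL: "V \<subseteq> L2 Om" unfolding V_def by (auto intro!: L2_sum L2_scaleR wL)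
    have V0: "(\<lambda>x. 0) \<in> V" unfolding V_def by (intro CollectI exI[of _ "{}"]) simp
    have Vadd: "(\<lambda>x. f x + h x) \<in> V" if fh: "f \<in> V" "h \<in> V" for f h
    proof -
      obtain J b where J: "finite J" "J \<subseteq> {?z..}" "f = (\<lambda>x. \<Sum>\<zeta>\<in>J. b \<zeta> *\<^sub>R ?w \<zeta> x)" using fh(1) unfolding V_def by blast
      obtain J' b' where J': "finite J'" "J' \<subseteq> {?z..}" "h = (\<lambda>x. \<Sum>\<zeta>\<in>J'. b' \<zeta> *\<^sub>R ?w \<zeta> x)" using fh(2) unfolding V_def by blast
      \<comment> \<open>The index sets may overlap, so coefficients are added after extension by
        zero.\<close>
      define b2 where "b2 \<zeta> = (if \<zeta> \<in> J then b \<zeta> else 0) + (if \<zeta> \<in> J' then b' \<zeta> else 0)" for \<zeta>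
      have "f x + h x = (\<Sum>\<zeta>\<in>J \<union> J'. b2 \<zeta> *\<^sub>R ?w \<zeta> x)" for x
      proof -
        have "f x = (\<Sum>\<zeta>\<in>J \<union> J'. (if \<zeta> \<in> J then b \<zeta> else 0) *\<^sub>R ?w \<zeta> x)"
          unfolding J(3) using J(1) J'(1) by (intro sum.mono_neutral_cong_left) auto
        moreover have "h x = (\<Sum>\<zeta>\<in>J \<union> J'. (if \<zeta> \<in> J' then b' \<zeta> else 0) *\<^sub>R ?w \<zeta> x)"
          unfolding J'(3) using J(1) J'(1) by (intro sum.mono_neutral_cong_left) auto
        ultimately show ?thesis by (simp only: b2_def scaleR_add_left sum.distrib)
      qed
      then have "(\<lambda>x. f x + h x) = (\<lambda>x. \<Sum>\<zeta>\<in>J \<union> J'. b2 \<zeta> *\<^sub>R ?w \<zeta> x)" by (rule ext)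
      moreover have "finite (J \<union> J')" "J \<union> J' \<subseteq> {?z..}" using J J' by auto
      ultimately show ?thesis unfolding V_def by blast
    qed
    have Vscale: "(\<lambda>x. c *\<^sub>R f x) \<in> V" if f: "f \<in> V" for f c
    proof -
      obtain J b where J: "finite J" "J \<subseteq> {?z..}" "f = (\<lambda>x. \<Sum>\<zeta>\<in>J. b \<zeta> *\<^sub>R ?w \<zeta> x)" using f unfolding V_def by blast
      have "(\<lambda>x. c *\<^sub>R f x) = (\<lambda>x. \<Sum>\<zeta>\<in>J. (c * b \<zeta>) *\<^sub>R ?w \<zeta> x)" unfolding J(3) by (simp add: scaleR_sum_right)
      with J(1,2) show ?thesis unfolding V_def by (intro CollectI exI[of _ J] exI[of _ "\<lambda>\<zeta>. c * b \<zeta>"]) simp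
    qed
    obtain l C where l: "\<And>f h. f \<in> L2 Om \<Longrightarrow> h \<in> L2 Om \<Longrightarrow> l (\<lambda>x. f x + h x) = l f + l h"
      "\<And>f c. f \<in> L2 Om \<Longrightarrow> l (\<lambda>x. c *\<^sub>R f x) = c * l f"
      "\<And>f. f \<in> L2 Om \<Longrightarrow> \<bar>l f\<bar> \<le> C * L2norm Om f" "\<And>r. r \<in> V \<Longrightarrow> l r = 0" "l g \<noteq> 0"
      using separating_functional[OF VL V0 Vadd Vscale gL \<epsilon> far] by blast
    have ann: "l (?w \<zeta>) = 0" if "?z \<le> \<zeta>" for \<zeta>
    proof (rule l(4))
      have "?w \<zeta> = (\<lambda>x. \<Sum>\<zeta>\<in>{\<zeta>}. 1 *\<^sub>R ?w \<zeta> x)" by simp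
      then show "?w \<zeta> \<in> V" using that unfolding V_def by (intro CollectI exI[of _ "{\<zeta>}"] exI[of _ "\<lambda>_. 1"]) simp
    qed
    have "l g = 0" by (rule annihilating_functional_zero[OF T d l(1-3) ann irr disj gL])
    with l(5) show False by blast
  qed
  then obtain f where f: "f \<in> V" "L2norm Om (\<lambda>x. g x - f x) < \<epsilon>" by blast
  then obtain J b where J: "finite J" "J \<subseteq> {?z..}" "f = (\<lambda>x. \<Sum>\<zeta>\<in>J. b \<zeta> *\<^sub>R ?w \<zeta> x)" unfolding V_def by blast
  have Jz: "?z \<le> \<zeta>" if "\<zeta> \<in> J" for \<zeta> using J(2) that by auto
  obtain u y where u: "u \<in> L2 (leb T)" "weak_solution T (matD d) (matA \<alpha>) vecB x0 y0 u y"
    "y T = (\<lambda>x. ?h x + (\<Sum>\<zeta>\<in>J. b \<zeta> *\<^sub>R ?w \<zeta> x))"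
    using reachable_states(2)[OF T d x0 y0 J(1) Jz, of b] by blast
  have "(\<lambda>x. yT x - y T x) = (\<lambda>x. g x - f x)" by (simp add: u(3) J(3) g_def diff_diff_add)
  then have "L2norm Om (\<lambda>x. y T x - yT x) \<le> \<epsilon>"
    using f(2) by (simp add: L2norm_minus_commute[of _ "y T"])
  with u(1,2) show "\<exists>u\<in>L2 (leb T). \<exists>y. weak_solution T (matD d) (matA \<alpha>) vecB x0 y0 u y \<and> L2norm Om (\<lambda>x. y T x - yT x) \<le> \<epsilon>"
    by blast
qed

section \<open>Eigenvectors of the adjoint modes\<close>

definition eigvec :: "real \<Rightarrow> real \<Rightarrow> nat \<Rightarrow> complex \<Rightarrow> complex^('n::{finite,linorder}) \<Rightarrow> bool" where
  "eigvec d \<alpha> k \<mu> a \<longleftrightarrow> (\<forall>i. (\<Sum>j\<in>UNIV. of_real (modeM d \<alpha> k $ j $ i) * a $ j) = \<mu> * a $ i)"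

lemma eigvec_iff:
  fixes a :: "complex^('n::{finite,linorder})"
  shows "eigvec d \<alpha> k \<mu> a \<longleftrightarrow>
    (\<forall>i. (of_real ((real k)\<^sup>2 * d) - \<mu>) * a $ i
      + (if idx i = 1 then of_real \<alpha> * a $ rix CARD('n) else of_nat (k\<^sup>2) * a $ rix (idx i - 1)) = 0)"
proof -
  have n1: "1 \<le> CARD('n)" by (simp add: Suc_le_eq)
  have cyc: "(\<Sum>j\<in>UNIV. of_real (Cyc \<alpha> k $ j $ i) * a $ j)
      = (if idx i = 1 then of_real \<alpha> * a $ rix CARD('n) else of_nat (k\<^sup>2) * a $ rix (idx i - 1))" for i :: 'n
  proof (cases "idx i = 1")
    case True
    have nz: "(idx j = 0) = False" for j :: 'n using idx_bounds(1)[of j] by simp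
    have "(\<Sum>j\<in>UNIV. of_real (Cyc \<alpha> k $ j $ i) * a $ j) = (\<Sum>j\<in>UNIV. if j = rix CARD('n) then of_real \<alpha> * a $ j else 0)"
      using True idx_eq_iff_rix[OF n1 order_refl] by (intro sum.cong) (auto simp: Cyc_def nz)
    with True show ?thesis by simp
  next
    case False
    then have i: "1 \<le> idx i - 1" "idx i - 1 \<le> CARD('n)" "Suc (idx i - 1) = idx i"
      using idx_bounds[of i] by auto
    have "idx i = idx j + 1 \<longleftrightarrow> idx j = idx i - 1" for j :: 'n using i by auto
    then have e: "idx i = idx j + 1 \<longleftrightarrow> j = rix (idx i - 1)" for j :: 'n
      using idx_eq_iff_rix[OF i(1,2), of j] by blast
    have "(\<Sum>j\<in>UNIV. of_real (Cyc \<alpha> k $ j $ i) * a $ j) = (\<Sum>j\<in>UNIV. if j = rix (idx i - 1) then of_nat (k\<^sup>2) * a $ j else 0)"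
      using False by (intro sum.cong) (simp_all only: Cyc_def vec_lambda_beta e, simp_all)
    with False show ?thesis by simp
  qed
  have "(\<Sum>j\<in>UNIV. of_real (modeM d \<alpha> k $ j $ i) * a $ j)
      = of_real ((real k)\<^sup>2 * d) * a $ i + (\<Sum>j\<in>UNIV. of_real (Cyc \<alpha> k $ j $ i) * a $ j)" for i
  proof -
    have "(\<Sum>j\<in>UNIV. of_real (modeM d \<alpha> k $ j $ i) * a $ j)
        = (\<Sum>j\<in>UNIV. (if j = i then of_real ((real k)\<^sup>2 * d) * a $ j else 0) + of_real (Cyc \<alpha> k $ j $ i) * a $ j)"
      by (intro sum.cong refl) (simp add: modeM_entry distrib_right)
    then show ?thesis by (simp add: sum.distrib)
  qed
  then show ?thesis unfolding eigvec_def cyc by (simp add: algebra_simps)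
qed

text \<open>All rows but the first determine an entry from the following one. So the last entry, the
  pairing of a with B, determines a: the eigenspace of a mode is at most one-dimensional and no
  eigenvector is invisible to B.\<close>

lemma eigvec_entries:
  fixes a :: "complex^('n::{finite,linorder})"
  assumes k: "1 \<le> k" and e: "eigvec d \<alpha> k \<mu> a"
  shows "a $ i = (- (of_real ((real k)\<^sup>2 * d) - \<mu>) / of_nat (k\<^sup>2)) ^ (CARD('n) - idx i) * a $ rix CARD('n)"
proof -
  let ?s = "of_real ((real k)\<^sup>2 * d) - \<mu>"
  let ?q = "- ?s / of_nat (k\<^sup>2)"
  have "a $ rix (CARD('n) - j) = ?q ^ j * a $ rix CARD('n)" if "j < CARD('n)" for j
    using that
  proof (induction j)
    case (Suc j)
    let ?m = "CARD('n) - j"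
    have m: "1 \<le> ?m" "?m \<le> CARD('n)" "?m - 1 = CARD('n) - Suc j" "?m \<noteq> 1" using Suc.prems by auto
    have "?s * a $ rix ?m + of_nat (k\<^sup>2) * a $ rix (CARD('n) - Suc j) = 0"
      using e[unfolded eigvec_iff, rule_format, of "rix ?m"] m by (simp add: idx_rix)
    then have "of_nat (k\<^sup>2) * a $ rix (CARD('n) - Suc j) = - ?s * a $ rix ?m"
      by (metis add.commute eq_neg_iff_add_eq_0 mult_minus_left)
    then have "a $ rix (CARD('n) - Suc j) = - ?s * a $ rix ?m / of_nat (k\<^sup>2)"
      using k by (simp add: nonzero_eq_divide_eq mult.commute)
    also have "\<dots> = ?q * a $ rix ?m" by simp
    also have "a $ rix ?m = ?q ^ j * a $ rix CARD('n)" using Suc by simp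
    finally show ?case by (simp only: power_Suc mult.assoc)
  qed simp
  moreover have "CARD('n) - idx i < CARD('n)" "CARD('n) - (CARD('n) - idx i) = idx i"
    using idx_bounds[of i] by auto
  ultimately show ?thesis using rix_idx[of i] by metis
qed

text \<open>The first row closes the recursion; multiplied by a power of - k^2 it becomes the
  equation for a zero of \<open>Pk\<close>.\<close>

lemma eigvec_root:
  fixes a :: "complex^('n::{finite,linorder})"
  assumes k: "1 \<le> k" and e: "eigvec d \<alpha> k \<mu> a" and a: "a \<noteq> 0"
  shows "Pk CARD('n) d \<alpha> k (- \<mu>) = 0"
proof -
  let ?s = "of_real ((real k)\<^sup>2 * d) - \<mu>" and ?K = "of_nat (k\<^sup>2) :: complex" and ?n = "CARD('n)"
  let ?l = "a $ rix ?n"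
  have l: "?l \<noteq> 0"
  proof
    assume "?l = 0"
    then have "a $ i = 0" for i using eigvec_entries[OF k e, of i] by simp
    with a show False by (simp add: vec_eq_iff)
  qed
  have K: "?K \<noteq> 0" using k by simp
  have n1: "1 \<le> ?n" by (simp add: Suc_le_eq)
  have r1: "idx (rix 1 :: 'n) = 1" by (rule idx_rix) (use n1 in auto)
  have "?s * a $ rix 1 + of_real \<alpha> * ?l = 0"
    using e[unfolded eigvec_iff, rule_format, of "rix 1"] r1 by simp
  moreover have "a $ rix 1 = (- ?s / ?K) ^ (?n - 1) * ?l" using eigvec_entries[OF k e, of "rix 1"] r1 by simp
  ultimately have "(?s * (- ?s / ?K) ^ (?n - 1) + of_real \<alpha>) * ?l = 0" by (simp add: algebra_simps)
  then have "?s * (- ?s / ?K) ^ (?n - 1) + of_real \<alpha> = 0" using l by simp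
  then have "(- ?K) ^ (?n - 1) * (?s * (- ?s / ?K) ^ (?n - 1) + of_real \<alpha>) = 0" by simp
  moreover have "(- ?K) ^ (?n - 1) * (- ?s / ?K) ^ (?n - 1) = ?s ^ (?n - 1)"
    using K by (simp flip: power_mult_distrib)
  ultimately have "?s * ?s ^ (?n - 1) + of_real \<alpha> * (- ?K) ^ (?n - 1) = 0"
    by (simp add: distrib_left mult.left_commute mult.commute)
  moreover have "?s * ?s ^ (?n - 1) = ?s ^ ?n" using n1 by (simp add: power_eq_if)
  ultimately show ?thesis by (simp add: Pk_def add.commute)
qed

text \<open>The powers from \<open>eigvec_entries\<close>, normalised to last entry 1, satisfy all
  rows but the first by construction; the root condition is the first row.\<close>

lemma eigvec_exists:
  assumes k: "1 \<le> k" and root: "Pk CARD('n::{finite,linorder}) d \<alpha> k (- \<mu>) = 0"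
  obtains a :: "complex^('n::{finite,linorder})" where "eigvec d \<alpha> k \<mu> a" "a $ rix CARD('n) = 1"
proof -
  let ?s = "of_real ((real k)\<^sup>2 * d) - \<mu>" and ?K = "of_nat (k\<^sup>2) :: complex" and ?n = "CARD('n)"
  let ?q = "- ?s / ?K"
  have K: "?K \<noteq> 0" using k by simp
  have n1: "1 \<le> ?n" by (simp add: Suc_le_eq)
  define a :: "(complex, 'n) vec" where "a = (\<chi> i. ?q ^ (?n - idx i))"
  have an: "a $ rix ?n = 1" using idx_rix[OF n1 order_refl] by (simp add: a_def)
  have sq: "?s + ?K * ?q = 0" using K by simp
  have "?s * a $ i + (if idx i = 1 then of_real \<alpha> * a $ rix ?n else ?K * a $ rix (idx i - 1)) = 0" for i
  proof (cases "idx i = 1")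
    case True
    have "(- ?K) ^ (?n - 1) * (?s * ?q ^ (?n - 1) + of_real \<alpha>) = ?s * ((- ?K) ^ (?n - 1) * ?q ^ (?n - 1)) + of_real \<alpha> * (- ?K) ^ (?n - 1)"
      by (simp add: algebra_simps)
    also have "(- ?K) ^ (?n - 1) * ?q ^ (?n - 1) = ?s ^ (?n - 1)"
      using K by (simp flip: power_mult_distrib)
    also have "?s * ?s ^ (?n - 1) = ?s ^ ?n" using n1 by (simp add: power_eq_if)
    also have "?s ^ ?n + of_real \<alpha> * (- ?K) ^ (?n - 1) = 0" using root by (simp add: Pk_def add.commute)
    finally have "?s * ?q ^ (?n - 1) + of_real \<alpha> = 0" using K by simp
    then show ?thesis using True an by (simp add: a_def)
  next
    case False
    then have i: "1 \<le> idx i - 1" "idx i - 1 \<le> ?n" "?n - (idx i - 1) = Suc (?n - idx i)"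
      using idx_bounds[of i] by auto
    have "a $ rix (idx i - 1) = ?q * ?q ^ (?n - idx i)"
      by (simp only: a_def vec_lambda_beta idx_rix[OF i(1,2)] i(3) power_Suc)
    then have "?s * a $ i + ?K * a $ rix (idx i - 1) = (?s + ?K * ?q) * ?q ^ (?n - idx i)"
      by (simp add: a_def distrib_right)
    with False sq show ?thesis by simp
  qed
  then have "eigvec d \<alpha> k \<mu> a" unfolding eigvec_iff by blast
  with an show ?thesis using that by blast
qed

lemma Pk_root_exists:
  assumes "0 < n"
  obtains \<mu> :: complex where "Pk n d \<alpha> k (- \<mu>) = 0"
proof -
  let ?c = "- (of_real \<alpha> * (- of_nat (k\<^sup>2)) ^ (n - 1)) :: complex"
  have "\<exists>w :: complex. w ^ n = ?c"
  proof (cases "?c = 0")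
    case True
    have "(0 :: complex) ^ n = ?c" unfolding True using assms by simp
    then show ?thesis ..
  next
    case False
    then have "card {w :: complex. w ^ n = ?c} = n" by (intro card_nth_roots assms)
    with assms have "{w :: complex. w ^ n = ?c} \<noteq> {}" by (metis card.empty less_irrefl)
    then show ?thesis by blast
  qed
  then obtain w :: complex where "w ^ n = ?c" by blast
  then show ?thesis using that[of "of_real ((real k)\<^sup>2 * d) - w"] by (simp add: Pk_def)
qed

section \<open>Necessity\<close>

lemma sinc_sin_scaleR:
  fixes a :: "'a::euclidean_space"
  assumes "1 \<le> k"
  shows "sinc l (\<lambda>x. sin (real k * x) *\<^sub>R a) = (if l = k then (pi / 2) *\<^sub>R a else 0)"
proof (cases "l = 0")
  case False
  have "sinc l (\<lambda>x. sin (real k * x) *\<^sub>R a) = (LINT x|Om. (sin (real l * x) * sin (real k * x)) *\<^sub>R a)"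
    by (simp add: sinc_def)
  also have "\<dots> = (LINT x|Om. sin (real l * x) * sin (real k * x)) *\<^sub>R a"
    by (rule integral_scaleR_left) (intro leb_continuous continuous_intros)
  finally show ?thesis using False assms by (simp add: trig_orthogonal)
qed (use assms in simp)

lemma L2norm_sin_le: "L2norm Om (\<lambda>x. sin (real k * x)) \<le> sqrt pi"
  using L2norm_bounded[OF finite_leb L2_measurable[OF L2_sin[of k pi]], of 1] by (simp add: measure_leb_pi)

lemma norm_sinc_le:
  fixes f :: "real \<Rightarrow> 'a::euclidean_space"
  assumes "f \<in> L2 Om"
  shows "norm (sinc k f) \<le> sqrt pi * L2norm Om f"
proof -
  have "norm (sinc k f) \<le> L2norm Om (\<lambda>x. sin (real k * x)) * L2norm Om f"
    unfolding sinc_def by (rule L2_Cauchy_Schwarz_scaleR[OF L2_sin assms])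
  also have "\<dots> \<le> sqrt pi * L2norm Om f" by (intro mult_right_mono L2norm_sin_le L2norm_nonneg)
  finally show ?thesis .
qed

text \<open>Testing with \<open>sin (k x)\<close> times a unit vector. The modal equation is kept
  integrated in time: u is only square integrable, so the modes need not be differentiable at every
  time.\<close>

lemma weak_solution_mode:
  fixes y :: "real \<Rightarrow> real \<Rightarrow> real^('n::{finite,linorder})"
  assumes ws: "weak_solution T (matD d) (matA \<alpha>) vecB x0 y0 u y" and y0: "y0 \<in> L2 Om"
  shows "\<And>t. t \<in> {0..T} \<Longrightarrow> y t \<in> L2 Om"
    and "continuous_on {0..T} (\<lambda>t. sinc k (y t))"
    and "\<And>t. t \<in> {0..T} \<Longrightarrow> sinc k (y t) $ i - sinc k y0 $ i + (LINT s|leb t. (modeM d \<alpha> k *v sinc k (y s)) $ i)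
      = (LINT s|leb t. u s) * (sin (real k * x0) * vecB $ i)"
proof -
  show yL: "y t \<in> L2 Om" if "t \<in> {0..T}" for t using ws that by (auto simp: weak_solution_def)
  obtain z where z: "case_prod y \<in> L2 (leb T \<Otimes>\<^sub>M Om)" "case_prod z \<in> L2 (leb T \<Otimes>\<^sub>M Om)"
    "AE t in leb T. y t \<in> H10 \<and> weak_deriv (y t) (z t)" and
    id: "\<And>v v' t. v \<in> H10 \<Longrightarrow> weak_deriv v v' \<Longrightarrow> continuous_on {0..pi} v \<Longrightarrow> t \<in> {0..T} \<Longrightarrow>
              (LINT x|Om. y t x \<bullet> v x) - (LINT x|Om. y0 x \<bullet> v x)
              + (LINT s|leb t. LINT x|Om. (matD d *v z s x) \<bullet> v' x + (matA \<alpha> *v y s x) \<bullet> v x)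
              = (LINT s|leb t. u s * (vecB \<bullet> v x0))"
    using ws unfolding weak_solution_def by blast
  show cont: "continuous_on {0..T} (\<lambda>t. sinc k (y t))"
    unfolding continuous_on
  proof
    fix t assume t: "t \<in> {0..T}"
    have "((\<lambda>s. L2norm Om (\<lambda>x. y s x - y t x)) \<longlongrightarrow> 0) (at t within {0..T})"
      using ws t by (auto simp: weak_solution_def)
    from tendsto_mult_right_zero[OF this, of "sqrt pi"]
    show "((\<lambda>t. sinc k (y t)) \<longlongrightarrow> sinc k (y t)) (at t within {0..T})"
    proof (rule LIM_zero_cancel[OF Lim_null_comparison, rotated])
      have "norm (sinc k (y s) - sinc k (y t)) \<le> sqrt pi * L2norm Om (\<lambda>x. y s x - y t x)" if "s \<in> {0..T}" for s
        using norm_sinc_le[OF L2_diff[OF yL[OF that] yL[OF t]], of k] by (simp add: sinc_diff[OF yL[OF that] yL[OF t]])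
      then show "\<forall>\<^sub>F s in at t within {0..T}. norm (sinc k (y s) - sinc k (y t)) \<le> sqrt pi * L2norm Om (\<lambda>x. y s x - y t x)"
        by (auto simp: eventually_at_filter)
    qed
  qed
  fix t assume t: "t \<in> {0..T}"
  define v v' :: "real \<Rightarrow> (real, 'n) vec" where
    "v x = sin (real k * x) *\<^sub>R axis i 1" and "v' x = (real k * cos (real k * x)) *\<^sub>R axis i 1" for x
  have H: "H10_deriv v v'" unfolding v_def[abs_def] v'_def[abs_def] by (rule H10_deriv_sin)
  then have v: "v \<in> H10" by (auto simp: H10_iff)
  have vc: "continuous_on {0..pi} v" unfolding v_def by (intro continuous_intros)
  have test: "(LINT x|Om. f x \<bullet> v x) = sinc k f $ i" if "f \<in> L2 Om" for f :: "real \<Rightarrow> (real, 'n) vec"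
  proof -
    have "(LINT x|Om. (sin (real k * x) *\<^sub>R f x) \<bullet> axis i 1) = sinc k f \<bullet> axis i 1"
      unfolding sinc_def by (rule integral_inner_left) (rule L2_scaleR_integrable[OF L2_sin that])
    then show ?thesis by (simp add: v_def inner_axis)
  qed
  have test': "(LINT x|Om. f x \<bullet> v' x) = real k * cosc k f $ i" if "f \<in> L2 Om" for f :: "real \<Rightarrow> (real, 'n) vec"
  proof -
    have "(LINT x|Om. real k * ((cos (real k * x) *\<^sub>R f x) \<bullet> axis i 1)) = real k * (cosc k f \<bullet> axis i 1)"
      unfolding cosc_def integral_mult_right_zero
      by (subst integral_inner_left) (auto intro: L2_scaleR_integrable[OF L2_cos that])
    then show ?thesis by (simp add: v'_def inner_axis mult.assoc)
  qed
  let ?I = "\<lambda>s. LINT x|Om. (matD d *v z s x) \<bullet> v' x + (matA \<alpha> *v y s x) \<bullet> v x"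
  have inner: "?I s = (modeM d \<alpha> k *v sinc k (y s)) $ i" if s: "s \<in> {0..T}" "y s \<in> H10" "weak_deriv (y s) (z s)" for s
  proof -
    have Hy: "H10_deriv (y s) (z s)" by (rule H10_deriv_if_H10[OF s(2,3)])
    have L: "(\<lambda>x. matD d *v z s x) \<in> L2 Om" "(\<lambda>x. matA \<alpha> *v y s x) \<in> L2 Om"
      using H10_derivD[OF Hy] by (auto intro: L2_linear matrix_vector_mul_linear)
    have "?I s = (LINT x|Om. (matD d *v z s x) \<bullet> v' x) + (LINT x|Om. (matA \<alpha> *v y s x) \<bullet> v x)"
      by (intro Bochner_Integration.integral_add L2_inner_integrable L H10_derivD[OF H])
    also have "\<dots> = real k * cosc k (\<lambda>x. matD d *v z s x) $ i + sinc k (\<lambda>x. matA \<alpha> *v y s x) $ i"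
      by (simp only: test[OF L(2)] test'[OF L(1)])
    also have "cosc k (\<lambda>x. matD d *v z s x) = matD d *v (real k *\<^sub>R sinc k (y s))"
      by (simp only: cosc_linear[OF H10_derivD(3)[OF Hy] matrix_vector_mul_linear] cosc_H10_deriv[OF Hy])
    also have "sinc k (\<lambda>x. matA \<alpha> *v y s x) = matA \<alpha> *v sinc k (y s)"
      by (rule sinc_linear[OF H10_derivD(2)[OF Hy] matrix_vector_mul_linear])
    finally show ?thesis
      by (simp add: modeM_def matrix_vector_mult_add_rdistrib scaleR_matrix_vector_assoc[symmetric]
          matrix_vector_mult_scaleR power2_eq_square)
  qed
  \<comment> \<open>\<open>?I\<close> is identified with the modal expression only for almost every
    s, so comparing the integrals requires measurability in s; it comes from joint measurability of
    y and z.\<close>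
  have Im: "?I \<in> borel_measurable (leb t)"
  proof -
    have [measurable]: "case_prod y \<in> borel_measurable (leb T \<Otimes>\<^sub>M Om)" "case_prod z \<in> borel_measurable (leb T \<Otimes>\<^sub>M Om)"
      using z by (auto dest: L2_measurable)
    interpret Om: finite_measure Om by (rule finite_leb)
    have [measurable]: "v \<in> borel_measurable Om" "v' \<in> borel_measurable Om"
      using H10_derivD[OF H] by (auto dest: L2_measurable)
    have lin: "(\<lambda>p. (M :: ((real, 'n) vec, 'n) vec) *v f p) \<in> borel_measurable N" if "f \<in> borel_measurable N" for M f N
    proof -
      have "(\<lambda>w. M *v w) \<in> borel_measurable borel"
        by (intro borel_measurable_continuous_onI linear_continuous_on) (simp add: matrix_vector_mul_bounded_linear)
      with that show ?thesis by measurable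
    qed
    have "(\<lambda>p. (matD d *v case_prod z p) \<bullet> v' (snd p) + (matA \<alpha> *v case_prod y p) \<bullet> v (snd p)) \<in> borel_measurable (leb T \<Otimes>\<^sub>M Om)"
      by (intro borel_measurable_add borel_measurable_inner lin) measurable
    then have "(\<lambda>(s, x). (matD d *v z s x) \<bullet> v' x + (matA \<alpha> *v y s x) \<bullet> v x) \<in> borel_measurable (leb T \<Otimes>\<^sub>M Om)"
      by (simp add: case_prod_beta')
    from Om.borel_measurable_lebesgue_integral[OF this] have "?I \<in> borel_measurable (leb T)" by simp
    then have "?I \<in> borel_measurable (restrict_space (leb T) {0<..<t})" by (rule measurable_restrict_space1)
    moreover have "restrict_space (leb T) {0<..<t} = leb t"
      using t by (simp add: restrict_restrict_space Int_absorb1 Int_commute greaterThanLessThan_subseteq_greaterThanLessThan inf.absorb2 inf.absorb1)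
    ultimately show ?thesis by simp
  qed
  have Mc: "continuous_on {0..t} (\<lambda>s. (modeM d \<alpha> k *v sinc k (y s)) $ i)"
    by (intro continuous_intros linear_continuous_on_compose[OF _ matrix_vector_mul_linear] continuous_on_subset[OF cont]) (use t in auto)
  have "AE s in leb t. ?I s = (modeM d \<alpha> k *v sinc k (y s)) $ i"
    using z(3) t unfolding AE_leb_iff by (auto elim!: eventually_mono intro!: inner)
  then have "(LINT s|leb t. ?I s) = (LINT s|leb t. (modeM d \<alpha> k *v sinc k (y s)) $ i)"
    by (intro integral_cong_AE Im borel_measurable_integrable leb_continuous(1)[OF Mc])
  moreover have "(LINT s|leb t. u s * (vecB \<bullet> v x0)) = (LINT s|leb t. u s) * (sin (real k * x0) * vecB $ i)"
    by (simp add: v_def inner_axis)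
  ultimately show "sinc k (y t) $ i - sinc k y0 $ i + (LINT s|leb t. (modeM d \<alpha> k *v sinc k (y s)) $ i)
      = (LINT s|leb t. u s) * (sin (real k * x0) * vecB $ i)"
    using id[OF v H10_derivD(1)[OF H] vc t] test[OF yL[OF t]] test[OF y0] by simp
qed

lemma linear_ode_zero:
  fixes P :: "real \<Rightarrow> complex"
  assumes P: "\<And>t. t \<in> {0..T} \<Longrightarrow> (P has_vector_derivative - \<mu> * P t) (at t within {0..T})"
    and "P 0 = 0" "t \<in> {0..T}"
  shows "P t = 0"
proof -
  define E where "E t = exp (t *\<^sub>R \<mu>)" for t :: real
  have "((\<lambda>t. E t * P t) has_derivative (\<lambda>h. 0)) (at s within {0..T})" if "s \<in> {0..T}" for s
  proof -
    have "(E has_vector_derivative E s * \<mu>) (at s within {0..T})"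
      unfolding E_def by (rule exp_scaleR_has_vector_derivative_right)
    from has_vector_derivative_mult[OF this P[OF that]]
    show ?thesis by (simp add: has_vector_derivative_def algebra_simps)
  qed
  then obtain c where "\<And>s. s \<in> {0..T} \<Longrightarrow> E s * P s = c"
    using has_derivative_zero_constant[of "{0..T}" "\<lambda>t. E t * P t"] by (metis convex_real_interval(5))
  from this[of 0] this[of t] assms(2,3) have "E t * P t = 0" by simp
  then show ?thesis by (simp add: E_def)
qed

text \<open>
  The functional \<open>p = \<Sum> a\<^sub>k \<cdot> y\<^sub>k\<close> of the modes does not feel the control, and satisfies \<open>p' = - \<mu> p\<close>.
\<close>

lemma not_approx_controllable:
  fixes a :: "nat \<Rightarrow> complex^('n::{finite,linorder})"
  assumes T: "0 < T" and K: "finite K" "\<And>k. k \<in> K \<Longrightarrow> 1 \<le> k"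
    and a: "\<And>k. k \<in> K \<Longrightarrow> eigvec d \<alpha> k \<mu> (a k)"
    and ann: "(\<Sum>k\<in>K. of_real (sin (real k * x0)) * a k $ rix CARD('n)) = 0"
    and nz: "m \<in> K" "a m \<noteq> 0"
  shows "\<not> approx_controllable T (matD d) (matA \<alpha>) (vecB :: (real, 'n) vec) x0"
proof
  assume ctrl: "approx_controllable T (matD d) (matA \<alpha>) (vecB :: (real, 'n) vec) x0"
  define \<Lambda> :: "(real \<Rightarrow> (real, 'n) vec) \<Rightarrow> complex" where
    "\<Lambda> f = (\<Sum>k\<in>K. \<Sum>i\<in>UNIV. a k $ i * of_real (sinc k f $ i))" for f
  define L where "L = (\<Sum>k\<in>K. \<Sum>i\<in>UNIV. norm (a k $ i) * sqrt pi)"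
  have L: "norm (\<Lambda> f) \<le> L * L2norm Om f" if "f \<in> L2 Om" for f
  proof -
    have "norm (a k $ i * of_real (sinc k f $ i)) \<le> norm (a k $ i) * sqrt pi * L2norm Om f" for k i
    proof -
      have "\<bar>sinc k f $ i\<bar> \<le> sqrt pi * L2norm Om f"
        using component_le_norm_cart[of "sinc k f" i] norm_sinc_le[OF that, of k] by simp
      then show ?thesis by (simp add: norm_mult mult.assoc mult_left_mono)
    qed
    then show ?thesis unfolding \<Lambda>_def L_def sum_distrib_right
      by (intro order_trans[OF norm_sum] sum_mono)
  qed
  have L0: "0 \<le> L" unfolding L_def by (intro sum_nonneg mult_nonneg_nonneg) auto
  have \<Lambda>_diff: "\<Lambda> (\<lambda>x. f x - g x) = \<Lambda> f - \<Lambda> g" if "f \<in> L2 Om" "g \<in> L2 Om" for f g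
    by (simp add: \<Lambda>_def sinc_diff[OF that] right_diff_distrib sum_subtractf)
  have zero: "\<Lambda> (y T) = 0" if ws: "weak_solution T (matD d) (matA \<alpha>) vecB x0 (\<lambda>x. 0) u y" for u y
  proof -
    note mode = weak_solution_mode[OF ws L2_zero]
    have s0: "sinc k (\<lambda>x. 0) = (0 :: (real, 'n) vec)" for k by (simp add: sinc_def)
    \<comment> \<open>Primitives of the modes, differentiable although the modes are only known to
      be continuous. The functional P of the primitives has derivative
      \<open>\<Lambda> (y t)\<close>, and the integrated modal equations turn this into
      \<open>- \<mu> * P t\<close>, because \<open>ann\<close> cancels the control.\<close>
    define C where "C k j t = (LINT s|leb t. sinc k (y s) $ j)" for k j t
    define P where "P t = (\<Sum>k\<in>K. \<Sum>j\<in>UNIV. a k $ j * of_real (C k j t))" for t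
    have cont: "continuous_on {0..T} (\<lambda>s. sinc k (y s) $ j)" for k j
      by (intro continuous_intros mode)
    have C': "(C k j has_real_derivative sinc k (y t) $ j) (at t within {0..T})" if "t \<in> {0..T}" for k j t
    proof -
      have "C k j s = integral {0..s} (\<lambda>s. sinc k (y s) $ j)" if "s \<in> {0..T}" for s
        unfolding C_def by (rule leb_continuous(2)) (rule continuous_on_subset[OF cont], use that in auto)
      with integral_has_vector_derivative[OF cont that, of k j] that show ?thesis
        unfolding has_real_derivative_iff_has_vector_derivative by (auto intro: has_vector_derivative_transform)
    qed
    have P': "(P has_vector_derivative \<Lambda> (y t)) (at t within {0..T})" if "t \<in> {0..T}" for t
      unfolding P_def \<Lambda>_def
      by (intro has_vector_derivative_sum has_vector_derivative_mult_right has_vector_derivative_of_real C' that)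
    have eq: "\<Lambda> (y t) = - \<mu> * P t" if t: "t \<in> {0..T}" for t
    proof -
      let ?U = "LINT s|leb t. u s"
      have ci: "integrable (leb t) (\<lambda>s. sinc k (y s) $ j)" for k j
        by (rule leb_continuous(1)) (rule continuous_on_subset[OF cont], use t in auto)
      have "sinc k (y t) $ i + (\<Sum>j\<in>UNIV. modeM d \<alpha> k $ i $ j * C k j t) = ?U * (sin (real k * x0) * vecB $ i)" for k i
      proof -
        have "(LINT s|leb t. (modeM d \<alpha> k *v sinc k (y s)) $ i) = (\<Sum>j\<in>UNIV. modeM d \<alpha> k $ i $ j * C k j t)"
          unfolding C_def matrix_vector_mul_component inner_vec_def
          by (simp add: Bochner_Integration.integral_sum ci)
        with mode(3)[OF t, of k i] show ?thesis by (simp add: s0)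
      qed
      then have e: "a k $ i * of_real (sinc k (y t) $ i) + (\<Sum>j\<in>UNIV. of_real (modeM d \<alpha> k $ i $ j) * a k $ i * of_real (C k j t))
          = of_real ?U * (of_real (sin (real k * x0)) * (of_real (vecB $ i) * a k $ i))" for k i
      proof -
        have "a k $ i * of_real (sinc k (y t) $ i + (\<Sum>j\<in>UNIV. modeM d \<alpha> k $ i $ j * C k j t))
            = a k $ i * of_real (?U * (sin (real k * x0) * vecB $ i))"
          by (simp only: \<open>\<And>k i. sinc k (y t) $ i + (\<Sum>j\<in>UNIV. modeM d \<alpha> k $ i $ j * C k j t) = ?U * (sin (real k * x0) * vecB $ i)\<close>)
        then show ?thesis by (simp add: distrib_left sum_distrib_left mult.commute mult.left_commute)
      qed
      have B: "(\<Sum>i\<in>UNIV. of_real (vecB $ i) * a k $ i) = a k $ rix CARD('n)" for k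
      proof -
        have n1: "1 \<le> CARD('n)" by (simp add: Suc_le_eq)
        have "(\<Sum>i\<in>UNIV. of_real (vecB $ i) * a k $ i) = (\<Sum>i\<in>UNIV. if i = rix CARD('n) then a k $ i else 0)"
          using idx_eq_iff_rix[OF n1 order_refl] by (intro sum.cong) (auto simp: vecB_def)
        then show ?thesis by simp
      qed
      have M: "(\<Sum>i\<in>UNIV. \<Sum>j\<in>UNIV. of_real (modeM d \<alpha> k $ i $ j) * a k $ i * of_real (C k j t))
          = \<mu> * (\<Sum>j\<in>UNIV. a k $ j * of_real (C k j t))" if "k \<in> K" for k
      proof -
        have "(\<Sum>i\<in>UNIV. \<Sum>j\<in>UNIV. of_real (modeM d \<alpha> k $ i $ j) * a k $ i * of_real (C k j t))
            = (\<Sum>j\<in>UNIV. (\<Sum>i\<in>UNIV. of_real (modeM d \<alpha> k $ i $ j) * a k $ i) * of_real (C k j t))"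
          unfolding sum_distrib_right by (rule sum.swap)
        also have "\<dots> = (\<Sum>j\<in>UNIV. \<mu> * a k $ j * of_real (C k j t))"
          using a[OF that, unfolded eigvec_def] by simp
        finally show ?thesis by (simp add: sum_distrib_left mult.assoc)
      qed
      have "\<Lambda> (y t) + \<mu> * P t
          = (\<Sum>k\<in>K. \<Sum>i\<in>UNIV. a k $ i * of_real (sinc k (y t) $ i) + (\<Sum>j\<in>UNIV. of_real (modeM d \<alpha> k $ i $ j) * a k $ i * of_real (C k j t)))"
        unfolding \<Lambda>_def P_def by (simp add: sum.distrib M sum_distrib_left)
      also have "\<dots> = of_real ?U * (\<Sum>k\<in>K. of_real (sin (real k * x0)) * (\<Sum>i\<in>UNIV. of_real (vecB $ i) * a k $ i))"
        unfolding e sum_distrib_left ..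
      also have "\<dots> = 0" unfolding B ann by simp
      finally show ?thesis by (simp add: eq_neg_iff_add_eq_0)
    qed
    have "P 0 = 0" by (simp add: P_def C_def integral_restrict_space)
    then have "P T = 0" using linear_ode_zero[of T P \<mu> T] P' eq T by (metis atLeastAtMost_iff less_eq_real_def)
    with eq[of T] T show ?thesis by simp
  qed
  obtain i where i: "a m $ i \<noteq> 0" using nz(2) by (auto simp: vec_eq_iff)
  \<comment> \<open>A single sine mode outside the kernel of \<Lambda>, while all states reached
    from zero lie in it.\<close>
  define g :: "real \<Rightarrow> (real, 'n) vec" where "g x = sin (real m * x) *\<^sub>R axis i 1" for x
  have g: "g \<in> L2 Om" unfolding g_def by (intro L2_scaleR_left L2_sin)
  have "\<Lambda> g = (\<Sum>k\<in>K. if k = m then a m $ i * of_real (pi / 2) else 0)"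
    unfolding \<Lambda>_def
  proof (rule sum.cong[OF refl])
    fix k assume "k \<in> K"
    have "sinc k g = (if k = m then (pi / 2) *\<^sub>R axis i 1 else 0)"
      unfolding g_def[abs_def] by (rule sinc_sin_scaleR[OF K(2)[OF nz(1)]])
    then show "(\<Sum>i'\<in>UNIV. a k $ i' * of_real (sinc k g $ i')) = (if k = m then a m $ i * of_real (pi / 2) else 0)"
      by (auto simp: axis_def if_distrib[of "\<lambda>x. _ * of_real x"] if_distrib[of "(*) _"] cong: if_cong)
  qed
  then have \<Lambda>g: "\<Lambda> g = a m $ i * of_real (pi / 2)" using K(1) nz(1) by simp
  \<comment> \<open>An error \<epsilon> changes \<Lambda> by at most L \<epsilon>, hence by at most
    \<open>norm (a m $ i)\<close>, whereas the value at g has pi/2 times this modulus.\<close>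
  define \<epsilon> where "\<epsilon> = norm (a m $ i) / (L + 1)"
  have "0 < \<epsilon>" using i L0 by (simp add: \<epsilon>_def)
  then obtain u y where uy: "weak_solution T (matD d) (matA \<alpha>) vecB x0 (\<lambda>x. 0) u y" "L2norm Om (\<lambda>x. y T x - g x) \<le> \<epsilon>"
    using ctrl g L2_zero unfolding approx_controllable_def by blast
  have yT: "y T \<in> L2 Om" using weak_solution_mode(1)[OF uy(1) L2_zero] T by simp
  have "norm (a m $ i) * (pi / 2) = norm (\<Lambda> (\<lambda>x. y T x - g x))"
    unfolding \<Lambda>_diff[OF yT g] zero[OF uy(1)] \<Lambda>g by (simp add: norm_mult norm_divide)
  also have "\<dots> \<le> L * L2norm Om (\<lambda>x. y T x - g x)" by (rule L[OF L2_diff[OF yT g]])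
  also have "\<dots> \<le> L * \<epsilon>" by (rule mult_left_mono[OF uy(2) L0])
  also have "\<dots> \<le> norm (a m $ i)" using L0 by (simp add: \<epsilon>_def field_simps)
  finally have "pi / 2 \<le> 1" using i by simp
  with pi_gt3 show False by simp
qed

section \<open>The eigenspaces of the adjoint operator\<close>

lemma adjoint_component:
  fixes M :: "real^'n^'n"
  shows "(conj_transpose (of_real_matrix M) *v w) $ i = (\<Sum>j\<in>UNIV. of_real (M $ j $ i) * w $ j)"
  by (simp add: matrix_vector_mult_def conj_transpose_def of_real_matrix_def map_matrix_def)

text \<open>Linearity over the reals, which is what the coefficient lemmas for Euclidean spaces ask
  for: they see complex vectors as real ones.\<close>

lemma linear_complex_matrix: "linear (\<lambda>w. (M :: complex^'n^'m) *v w)"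
  by (rule linearI) (simp_all add: vec_eq_iff matrix_vector_mult_def scaleR_sum_right sum.distrib algebra_simps)

lemma linear_complex_scale: "linear (\<lambda>w :: complex^'n. c *s w)"
  by (rule linearI) (simp_all add: vec_eq_iff algebra_simps)

lemma eigvec_iff_adjoint:
  "eigvec d \<alpha> k \<mu> a \<longleftrightarrow> (real k)\<^sup>2 *\<^sub>R (conj_transpose (of_real_matrix (matD d)) *v a)
     + conj_transpose (of_real_matrix (matA \<alpha>)) *v a = \<mu> *s a"
  unfolding eigvec_def vec_eq_iff
  by (simp add: modeM_def adjoint_component distrib_right sum.distrib scaleR_conv_of_real[where 'a = complex] sum_distrib_left mult.assoc)

lemma eigvec_scale: "eigvec d \<alpha> k \<mu> a \<Longrightarrow> eigvec d \<alpha> k \<mu> (c *s a)"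
  unfolding eigvec_def by (simp add: mult.left_commute flip: sum_distrib_left)

lemma sinc_cong_AE:
  assumes "f \<in> L2 Om" "g \<in> L2 Om" "AE x in Om. f x = g x"
  shows "sinc k f = sinc k g"
  unfolding sinc_def using assms(3)
  by (intro integral_cong_AE borel_measurable_integrable L2_scaleR_integrable[OF L2_sin] assms(1,2)) auto

lemma sin_eigvec_in_ker:
  fixes a :: "complex^('n::{finite,linorder})"
  assumes "eigvec d \<alpha> k \<mu> a"
  shows "(\<lambda>x. sin (real k * x) *\<^sub>R a) \<in> ker_Lstar (matD d) (matA \<alpha>) \<mu>"
proof -
  let ?f = "\<lambda>x. sin (real k * x) *\<^sub>R a" and ?f1 = "\<lambda>x. (real k * cos (real k * x)) *\<^sub>R a"
    and ?f2 = "\<lambda>x. (- (real k)\<^sup>2 * sin (real k * x)) *\<^sub>R a"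
  have H: "H10_deriv ?f ?f1" by (rule H10_deriv_sin)
  have w: "weak_deriv ?f1 ?f2"
  proof (rule weak_deriv_C1)
    fix x
    have "((\<lambda>x. real k * cos (real k * x)) has_real_derivative - (real k)\<^sup>2 * sin (real k * x)) (at x)"
      by (auto intro!: derivative_eq_intros simp: power2_eq_square)
    from has_vector_derivative_scaleR[OF this has_vector_derivative_const[of a]]
    show "(?f1 has_vector_derivative ?f2 x) (at x)" by simp
  qed (intro continuous_intros)
  have "?f \<in> H2" "?f \<in> H10" using H w by (auto simp: H2_def H1_def H10_iff dest: H10_derivD(1))
  moreover have "(\<lambda>x. \<mu> *s ?f x) \<in> L2 Om" by (rule L2_linear[OF H10_derivD(2)[OF H] linear_complex_scale])
  moreover have "\<mu> *s ?f x = - (conj_transpose (of_real_matrix (matD d)) *v ?f2 x)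
      + conj_transpose (of_real_matrix (matA \<alpha>)) *v ?f x" for x
    unfolding linear_scale[OF linear_complex_matrix] linear_scale[OF linear_complex_scale]
      assms[unfolded eigvec_iff_adjoint, symmetric]
    by (simp add: scaleR_add_right mult.commute)
  ultimately show ?thesis using H10_derivD(1)[OF H] w unfolding ker_Lstar_def Lstar_def by blast
qed

text \<open>Sine coefficients turn the second derivative into - k^2; the boundary condition enters
  through \<open>cosc_H10_deriv\<close>.\<close>

lemma ker_sinc:
  fixes f :: "real \<Rightarrow> complex^('n::{finite,linorder})"
  assumes "f \<in> ker_Lstar (matD d) (matA \<alpha>) \<mu>"
  shows "f \<in> L2 Om" and "eigvec d \<alpha> k \<mu> (sinc k f)"
proof -
  let ?D = "conj_transpose (of_real_matrix (matD d)) :: ((complex, 'n) vec, 'n) vec"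
    and ?A = "conj_transpose (of_real_matrix (matA \<alpha>)) :: ((complex, 'n) vec, 'n) vec"
  obtain f1 f2 where f: "f \<in> H10" "weak_deriv f f1" "weak_deriv f1 f2"
    and eq: "AE x in Om. \<mu> *s f x = - (?D *v f2 x) + ?A *v f x"
    using assms by (auto simp: ker_Lstar_def Lstar_def)
  show fL: "f \<in> L2 Om" by (rule weak_derivD(1)[OF f(2)])
  have f2L: "f2 \<in> L2 Om" by (rule weak_derivD(2)[OF f(3)])
  have neg: "linear (\<lambda>w. - (?D *v w))" by (intro linear_compose_neg linear_complex_matrix)
  have "sinc k f2 = - (real k)\<^sup>2 *\<^sub>R sinc k f"
    by (simp add: sinc_weak_deriv[OF f(3)] cosc_H10_deriv[OF H10_deriv_if_H10[OF f(1,2)]] power2_eq_square)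
  note s2 = this
  have L: "(\<lambda>x. - (?D *v f2 x)) \<in> L2 Om" "(\<lambda>x. ?A *v f x) \<in> L2 Om" "(\<lambda>x. \<mu> *s f x) \<in> L2 Om"
    using L2_linear[OF f2L neg] L2_linear[OF fL linear_complex_matrix] L2_linear[OF fL linear_complex_scale] by auto
  have "\<mu> *s sinc k f = sinc k (\<lambda>x. \<mu> *s f x)" by (rule sinc_linear[OF fL linear_complex_scale, symmetric])
  also have "\<dots> = sinc k (\<lambda>x. - (?D *v f2 x) + ?A *v f x)"
    by (rule sinc_cong_AE[OF L(3) L2_add[OF L(1,2)] eq])
  also have "\<dots> = - (?D *v sinc k f2) + ?A *v sinc k f"
    by (simp only: sinc_add[OF L(1,2)] sinc_linear[OF f2L neg] sinc_linear[OF fL linear_complex_matrix])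
  also have "?D *v sinc k f2 = - ((real k)\<^sup>2 *\<^sub>R (?D *v sinc k f))"
    unfolding s2 linear_scale[OF linear_complex_matrix] by simp
  finally show "eigvec d \<alpha> k \<mu> (sinc k f)" by (simp add: eigvec_iff_adjoint)
qed

lemma scaled_sine_AE_zero:
  fixes a :: "'a::euclidean_space"
  assumes "1 \<le> k" "AE x in Om. sin (real k * x) *\<^sub>R a = 0"
  shows "a = 0"
proof -
  have "sinc k (\<lambda>x. sin (real k * x) *\<^sub>R a) = sinc k (\<lambda>x. 0)"
    by (intro sinc_cong_AE L2_scaleR_left L2_sin L2_zero assms(2))
  then show ?thesis by (simp add: sinc_sin_scaleR[OF assms(1)] sinc_def)
qed

section \<open>Geometric simplicity as disjointness of the modal spectra\<close>

definition disjoint_spectra :: "nat \<Rightarrow> real \<Rightarrow> real \<Rightarrow> bool" where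
  "disjoint_spectra n d \<alpha> \<longleftrightarrow> (\<forall>k m. \<forall>z :: complex. 1 \<le> k \<longrightarrow> 1 \<le> m \<longrightarrow> k \<noteq> m \<longrightarrow>
     Pk n d \<alpha> k z = 0 \<longrightarrow> Pk n d \<alpha> m z \<noteq> 0)"

text \<open>The eigenvalue belongs to a single frequency k, so every kernel element has at most one
  nonzero sine coefficient. That coefficient is an eigenvector of the k-th mode, and by
  \<open>eigvec_entries\<close> all of these are multiples of one vector.\<close>

lemma eigenvalues_simple_if_disjoint_spectra:
  fixes \<mu> :: complex
  assumes disj: "disjoint_spectra CARD('n::{finite,linorder}) d \<alpha>"
    and ev: "eigenvalue_Lstar (matD d :: ((real, 'n) vec, 'n) vec) (matA \<alpha>) \<mu>"
  shows "has_geometric_multiplicity (matD d :: ((real, 'n) vec, 'n) vec) (matA \<alpha>) \<mu> 1"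
proof -
  let ?V = "ker_Lstar (matD d :: ((real, 'n) vec, 'n) vec) (matA \<alpha>) \<mu>"
  obtain f where f: "f \<in> ?V" "\<not> (AE x in Om. f x = 0)" using ev by (auto simp: eigenvalue_Lstar_def)
  obtain k where "sinc k f \<noteq> 0" using sine_coefficients_zero[OF ker_sinc(1)[OF f(1)]] f(2) by blast
  moreover from this have k: "1 \<le> k" by (cases k) auto
  ultimately have root: "Pk CARD('n) d \<alpha> k (- \<mu>) = 0" using eigvec_root[OF k ker_sinc(2)[OF f(1)]] by blast
  obtain a :: "(complex, 'n) vec" where a: "eigvec d \<alpha> k \<mu> a" "a $ rix CARD('n) = 1"
    using eigvec_exists[OF k root] by blast
  have a0: "a \<noteq> 0" using a(2) by auto
  let ?b = "\<lambda>x. sin (real k * x) *\<^sub>R a"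
  have "\<exists>c. AE x in Om. g x = c *s ?b x" if g: "g \<in> ?V" for g
  proof -
    note gL = ker_sinc(1)[OF g] and ge = ker_sinc(2)[OF g]
    define c where "c = sinc k g $ rix CARD('n)"
    have "sinc k g $ i = (c *s a) $ i" for i
      using eigvec_entries[OF k ge, of i, folded c_def] eigvec_entries[OF k a(1), of i, unfolded a(2) mult_1_right]
      by (simp only: vector_smult_component mult.commute[of c])
    then have sk: "sinc k g = c *s a" by (simp add: vec_eq_iff)
    have "sinc l g = 0" if "l \<noteq> k" for l
    proof (cases "l = 0")
      case False
      then have "1 \<le> l" by simp
      show ?thesis
      proof (rule ccontr)
        assume "sinc l g \<noteq> 0"
        from eigvec_root[OF \<open>1 \<le> l\<close> ge this] root that \<open>1 \<le> l\<close> k disj show False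
          unfolding disjoint_spectra_def by blast
      qed
    qed simp
    then have "sinc l g = sinc l (\<lambda>x. sin (real k * x) *\<^sub>R ((2 / pi) *\<^sub>R (c *s a)))" for l
      unfolding sinc_sin_scaleR[OF k] using sk by simp
    then have ae: "AE x in Om. g x = sin (real k * x) *\<^sub>R ((2 / pi) *\<^sub>R (c *s a))"
      by (intro sine_coefficients_unique gL L2_scaleR_left L2_sin)
    have e: "sin (real k * x) *\<^sub>R ((2 / pi) *\<^sub>R (c *s a)) = (of_real (2 / pi) * c) *s ?b x" for x
      by (simp add: vec_eq_iff scaleR_conv_of_real[where 'a = complex])
    show ?thesis by (rule exI) (rule ae[unfolded e])
  qed
  note ex = this
  have zero: "c = 0" if "AE x in Om. c *s ?b x = 0" for c
  proof -
    have "AE x in Om. sin (real k * x) *\<^sub>R (c *s a) = 0"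
      using that by (simp only: linear_scale[OF linear_complex_scale])
    from scaled_sine_AE_zero[OF k this] have "(c *s a) $ rix CARD('n) = 0" by (simp only: zero_index)
    with a(2) show ?thesis by simp
  qed
  have single: "(\<Sum>i<(1::nat). h i) = h 0" for h :: "nat \<Rightarrow> (complex, 'n) vec" by simp
  show ?thesis
    unfolding has_geometric_multiplicity_def has_complex_dim_def
  proof (rule exI[of _ "\<lambda>_. ?b"], intro conjI allI impI ballI)
    show "?b \<in> ?V" by (rule sin_eigvec_in_ker[OF a(1)])
  next
    fix c :: "nat \<Rightarrow> complex" and i :: nat
    assume c: "AE x in Om. (\<Sum>i<1. c i *s ?b x) = 0" and "i < 1"
    from zero[OF c[unfolded single]] \<open>i < 1\<close> show "c i = 0" by simp
  next
    fix f assume "f \<in> ?V"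
    from ex[OF this] obtain c where "AE x in Om. f x = c *s ?b x" ..
    then show "\<exists>c. AE x in Om. f x = (\<Sum>i<(1::nat). c i *s ?b x)"
      unfolding single by (rule exI[of _ "\<lambda>_. c"])
  qed
qed

text \<open>A shared eigenvalue would yield eigenfunctions of two different frequencies. If both
  were multiples of one function e, cross-multiplying their factors would eliminate e and contradict
  orthogonality of the sines.\<close>

lemma disjoint_spectra_if_eigenvalues_simple:
  assumes gm: "\<And>\<mu>. eigenvalue_Lstar (matD d :: ((real, 'n::{finite,linorder}) vec, 'n) vec) (matA \<alpha>) \<mu> \<Longrightarrow>
    has_geometric_multiplicity (matD d :: ((real, 'n) vec, 'n) vec) (matA \<alpha>) \<mu> 1"
  shows "disjoint_spectra CARD('n) d \<alpha>"
  unfolding disjoint_spectra_def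
proof (intro allI impI notI)
  fix k m :: nat and z :: complex
  assume km: "1 \<le> k" "1 \<le> m" "k \<noteq> m" and "Pk CARD('n) d \<alpha> k z = 0" "Pk CARD('n) d \<alpha> m z = 0"
  define \<mu> where "\<mu> = - z"
  have root: "Pk CARD('n) d \<alpha> k (- \<mu>) = 0" "Pk CARD('n) d \<alpha> m (- \<mu>) = 0"
    using \<open>Pk CARD('n) d \<alpha> k z = 0\<close> \<open>Pk CARD('n) d \<alpha> m z = 0\<close> by (simp_all add: \<mu>_def)
  let ?V = "ker_Lstar (matD d :: ((real, 'n) vec, 'n) vec) (matA \<alpha>) \<mu>"
  obtain a :: "(complex, 'n) vec" where a: "eigvec d \<alpha> k \<mu> a" "a $ rix CARD('n) = 1"
    using eigvec_exists[OF km(1) root(1)] by blast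
  obtain b :: "(complex, 'n) vec" where b: "eigvec d \<alpha> m \<mu> b" "b $ rix CARD('n) = 1"
    using eigvec_exists[OF km(2) root(2)] by blast
  have ab: "a \<noteq> 0" "b \<noteq> 0" using a(2) b(2) by auto
  have na: "\<not> (AE x in Om. sin (real k * x) *\<^sub>R a = 0)" "\<not> (AE x in Om. sin (real m * x) *\<^sub>R b = 0)"
    using scaled_sine_AE_zero[OF km(1), of a] scaled_sine_AE_zero[OF km(2), of b] ab by blast+
  note V = sin_eigvec_in_ker[OF a(1)] sin_eigvec_in_ker[OF b(1)]
  have "eigenvalue_Lstar (matD d :: ((real, 'n) vec, 'n) vec) (matA \<alpha>) \<mu>"
    unfolding eigenvalue_Lstar_def by (rule bexI, rule na(1), rule V(1))
  from gm[OF this] obtain e :: "nat \<Rightarrow> real \<Rightarrow> (complex, 'n) vec"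
    where e: "\<forall>f\<in>?V. \<exists>c. AE x in Om. f x = (\<Sum>i<1. c i *s e i x)"
    unfolding has_geometric_multiplicity_def has_complex_dim_def by (elim exE conjE)
  have single: "(\<Sum>i<(1::nat). h i) = h 0" for h :: "nat \<Rightarrow> (complex, 'n) vec" by simp
  obtain c1 where c1: "AE x in Om. sin (real k * x) *\<^sub>R a = c1 (0::nat) *s e 0 x"
    using bspec[OF e V(1)] unfolding single ..
  obtain c2 where c2: "AE x in Om. sin (real m * x) *\<^sub>R b = c2 (0::nat) *s e 0 x"
    using bspec[OF e V(2)] unfolding single ..
  have "AE x in Om. sin (real k * x) *\<^sub>R (c2 0 *s a) = sin (real m * x) *\<^sub>R (c1 0 *s b)"
    using c1 c2
  proof eventually_elim
    case (elim x)
    have "sin (real k * x) *\<^sub>R (c2 0 *s a) = c2 0 *s (c1 0 *s e 0 x)"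
      by (simp only: elim(1)[symmetric] linear_scale[OF linear_complex_scale])
    also have "\<dots> = c1 0 *s (c2 0 *s e 0 x)" by (simp add: mult.commute)
    also have "\<dots> = sin (real m * x) *\<^sub>R (c1 0 *s b)"
      by (simp only: elim(2)[symmetric] linear_scale[OF linear_complex_scale])
    finally show ?case .
  qed
  then have "sinc k (\<lambda>x. sin (real k * x) *\<^sub>R (c2 0 *s a)) = sinc k (\<lambda>x. sin (real m * x) *\<^sub>R (c1 0 *s b))"
    by (intro sinc_cong_AE L2_scaleR_left L2_sin)
  then have "c2 0 *s a = 0" using km by (simp add: sinc_sin_scaleR)
  then have "(c2 0 *s a) $ rix CARD('n) = 0" by (simp only: zero_index)
  then have "c2 0 = 0" using a(2) by simp
  with c2 na(2) show False by simp
qed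

text \<open>Without coupling the only zero of \<open>Pk\<close> is - k^2 d, and these numbers differ
  from mode to mode.\<close>

lemma disjoint_spectra_uncoupled:
  assumes "0 < n" "0 < d"
  shows "disjoint_spectra n d 0"
  unfolding disjoint_spectra_def
proof (intro allI impI notI)
  fix k m :: nat and z :: complex
  assume "k \<noteq> m" "Pk n d 0 k z = 0" "Pk n d 0 m z = 0"
  then have "z + of_real ((real k)\<^sup>2 * d) = 0" "z + of_real ((real m)\<^sup>2 * d) = 0" using assms(1) by (simp_all add: Pk_def)
  then have "of_real ((real k)\<^sup>2 * d) = (of_real ((real m)\<^sup>2 * d) :: complex)" by (metis add_left_cancel)
  then have "(real k)\<^sup>2 * d = (real m)\<^sup>2 * d" by (simp only: of_real_eq_iff)
  with \<open>k \<noteq> m\<close> assms(2) show False by (simp add: power2_eq_iff)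
qed

section \<open>The controllability criterion\<close>

lemma sin_multiples_nonzero_iff:
  assumes "x0 \<in> {0<..<pi}"
  shows "(\<forall>k\<ge>1. sin (real k * x0) \<noteq> 0) \<longleftrightarrow> (\<forall>r\<in>\<rat> \<inter> {0<..<1}. x0 \<noteq> r * pi)"
proof (intro iffI ballI allI impI notI)
  fix r assume s: "\<forall>k\<ge>1. sin (real k * x0) \<noteq> 0" and "r \<in> \<rat> \<inter> {0<..<1}" and x0: "x0 = r * pi"
  then obtain p q :: int where q: "0 < q" "r = of_int p / of_int q"
    by (auto elim!: Rats_cases')
  then have "real (nat q) * x0 = of_int p * pi" by (simp add: x0)
  then have "sin (real (nat q) * x0) = 0" by (simp only: sin_zero_iff_int2) blast
  with s[rule_format, of "nat q"] q(1) show False by simp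
next
  fix k :: nat assume r: "\<forall>r\<in>\<rat> \<inter> {0<..<1}. x0 \<noteq> r * pi" and k: "1 \<le> k" and "sin (real k * x0) = 0"
  then obtain i :: int where i: "real k * x0 = of_int i * pi" by (auto simp: sin_zero_iff_int2)
  define r where "r = real_of_int i / real k"
  have x: "x0 = r * pi" using i k by (simp add: r_def field_simps)
  have "r \<in> \<rat>" by (simp add: r_def)
  moreover have "0 < r" "r < 1" using assms unfolding x by (auto simp: zero_less_mult_iff)
  ultimately show False using r x by auto
qed

text \<open>Over the complex numbers each mode has an eigenvector; if \<open>sin (k x0)\<close>
  vanishes, the corresponding eigenfunction does not feel the control.\<close>

lemma sin_nonzero_if_approx_controllable:
  assumes "0 < T" "1 \<le> k" and ctrl: "approx_controllable T (matD d) (matA \<alpha>) (vecB :: (real, 'n::{finite,linorder}) vec) x0"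
  shows "sin (real k * x0) \<noteq> 0"
proof
  assume s: "sin (real k * x0) = 0"
  obtain \<mu> :: complex where "Pk CARD('n) d \<alpha> k (- \<mu>) = 0" by (rule Pk_root_exists[of "CARD('n)" d \<alpha> k, OF zero_less_card_finite])
  then obtain a :: "(complex, 'n) vec" where a: "eigvec d \<alpha> k \<mu> a" "a $ rix CARD('n) = 1"
    by (rule eigvec_exists[OF assms(2)])
  then have "a \<noteq> 0" by auto
  with not_approx_controllable[OF assms(1), of "{k}" d \<alpha> \<mu> "\<lambda>_. a" x0 k] a assms(2) s ctrl show False by simp
qed

lemma disjoint_spectra_if_approx_controllable:
  assumes T: "0 < T" and ctrl: "approx_controllable T (matD d) (matA \<alpha>) (vecB :: (real, 'n::{finite,linorder}) vec) x0"
  shows "disjoint_spectra CARD('n) d \<alpha>"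
  unfolding disjoint_spectra_def
proof (intro allI impI notI)
  fix k m :: nat and z :: complex
  assume km: "1 \<le> k" "1 \<le> m" "k \<noteq> m" and root: "Pk CARD('n) d \<alpha> k z = 0" "Pk CARD('n) d \<alpha> m z = 0"
  define \<mu> where "\<mu> = - z"
  have z: "z = - \<mu>" by (simp add: \<mu>_def)
  obtain a :: "(complex, 'n) vec" where a: "eigvec d \<alpha> k \<mu> a" "a $ rix CARD('n) = 1"
    using root(1) unfolding z by (rule eigvec_exists[OF km(1)])
  obtain b :: "(complex, 'n) vec" where b: "eigvec d \<alpha> m \<mu> b" "b $ rix CARD('n) = 1"
    using root(2) unfolding z by (rule eigvec_exists[OF km(2)])
  have s: "sin (real m * x0) \<noteq> 0" by (rule sin_nonzero_if_approx_controllable[OF T km(2) ctrl])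
  \<comment> \<open>The two eigenvectors have last entry 1, so these weights make their
    contributions at x0 cancel; \<open>s\<close> keeps the first weight nonzero.\<close>
  define v where "v l = (if l = k then of_real (sin (real m * x0)) *s a else of_real (- sin (real k * x0)) *s b)" for l
  have v: "v k = of_real (sin (real m * x0)) *s a" "v m = of_real (- sin (real k * x0)) *s b"
    using km(3) by (simp_all add: v_def)
  have "eigvec d \<alpha> k \<mu> (v k)" "eigvec d \<alpha> m \<mu> (v m)"
    unfolding v by (rule eigvec_scale[OF a(1)], rule eigvec_scale[OF b(1)])
  then have "eigvec d \<alpha> l \<mu> (v l)" if "l \<in> {k, m}" for l
    using that by auto
  moreover have "(\<Sum>l\<in>{k, m}. of_real (sin (real l * x0)) * v l $ rix CARD('n)) = 0"
    using km(3) a(2) b(2) by (simp add: v)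
  moreover have "v k $ rix CARD('n) \<noteq> 0" using s a(2) by (simp add: v)
  then have "v k \<noteq> 0" by (metis zero_index)
  ultimately have "\<not> approx_controllable T (matD d) (matA \<alpha>) (vecB :: (real, 'n) vec) x0"
    using km(1,2) by (intro not_approx_controllable[OF T, where K = "{k, m}" and m = k]) auto
  with ctrl show False by blast
qed

lemma approx_controllable_iff:
  assumes "0 < T" "1 \<le> d" "x0 \<in> {0<..<pi}"
  shows "approx_controllable T (matD d) (matA \<alpha>) (vecB :: (real, 'n::{finite,linorder}) vec) x0 \<longleftrightarrow>
    disjoint_spectra CARD('n) d \<alpha> \<and> (\<forall>r\<in>\<rat> \<inter> {0<..<1}. x0 \<noteq> r * pi)"
  unfolding sin_multiples_nonzero_iff[OF assms(3), symmetric]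
proof
  assume "disjoint_spectra CARD('n) d \<alpha> \<and> (\<forall>k\<ge>1. sin (real k * x0) \<noteq> 0)"
  then show "approx_controllable T (matD d) (matA \<alpha>) (vecB :: (real, 'n) vec) x0"
    unfolding disjoint_spectra_def by (intro approx_controllable_if assms) auto
qed (intro conjI allI impI disjoint_spectra_if_approx_controllable[OF assms(1)]
    sin_nonzero_if_approx_controllable[OF assms(1)])

theorem theorem3p2:
  fixes T d \<alpha> x0 :: real
    and D A :: "real^('n::{finite,linorder})^('n::{finite,linorder})" and B :: "real^('n::{finite,linorder})"
  assumes "T > 0" and "CARD('n) \<ge> 2" and "d \<ge> 1"
    and "D = matD d" and "A = matA \<alpha>" and "B = vecB"
    and "\<alpha> > 0 \<longrightarrow> (\<exists>p\<ge>1. CARD('n) = 2 * p + 1)"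
    and "x0 \<in> {0<..<pi}"
  shows "(\<alpha> \<noteq> 0 \<longrightarrow>
            (approx_controllable T D A B x0 \<longleftrightarrow>
               (\<forall>\<mu>. eigenvalue_Lstar D A \<mu> \<longrightarrow> has_geometric_multiplicity D A \<mu> 1) \<and>
               (\<forall>r \<in> \<rat> \<inter> {0<..<1}. x0 \<noteq> r * pi))) \<and>
         (\<alpha> = 0 \<longrightarrow>
            (approx_controllable T D A B x0 \<longleftrightarrow>
               (\<forall>r \<in> \<rat> \<inter> {0<..<1}. x0 \<noteq> r * pi)))"
proof -
  have ctrl: "approx_controllable T D A B x0 \<longleftrightarrow>
      disjoint_spectra CARD('n) d \<alpha> \<and> (\<forall>r \<in> \<rat> \<inter> {0<..<1}. x0 \<noteq> r * pi)"
    unfolding assms(4,5,6) by (rule approx_controllable_iff[OF assms(1,3,8)])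
  have "(\<forall>\<mu>. eigenvalue_Lstar D A \<mu> \<longrightarrow> has_geometric_multiplicity D A \<mu> 1) \<longleftrightarrow> disjoint_spectra CARD('n) d \<alpha>"
    unfolding assms(4,5)
    using disjoint_spectra_if_eigenvalues_simple eigenvalues_simple_if_disjoint_spectra by metis
  moreover have "disjoint_spectra CARD('n) d \<alpha>" if "\<alpha> = 0"
    unfolding that using assms(3) by (intro disjoint_spectra_uncoupled) auto
  ultimately show ?thesis unfolding ctrl by blast
qed

end
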